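(* If $p=0$, then the ideal $\widetilde K_n\vartriangleleft\sigma\langle\widetilde X\rangle$ is generated by $\sigma_{n+1}(a)=0$ for $a\in\mathbb{F}\langle X\rangle$; in particular, $\widetilde K_n$ is finitely based. If $p>0$, then the ideal $\widetilde K_n\vartriangleleft\sigma\langle\widetilde X\rangle$ is not finitely based.
   Context: Let $\mathbb{F}$ be an infinite field of arbitrary characteristic $p\ge 0$ and $n>1$ an integer. Ideals are two-sided, $\mathbb{N}=\{1,2,\ldots\}$, $\mathbb{N}_0=\mathbb{N}\sqcup\{0\}$, $|\underline{t}|=t_1+\cdots+t_u$. A relation $f=h$ is identified with the element $f-h$. Matrices. $R=\mathbb{F}[x_{ij}(k)\mid 1\le i,j\le n,\ k\ge 1]$ and $X_k=(x_{ij}(k))_{1\le i,j\le n}$ are the generic matrices. For an $n\times n$ matrix $A$ define $\sigma_t(A)$ by $\det(\lambda E-A)=\sum_{t=0}^n(-1)^t\lambda^{n-t}\sigma_t(A)$. $R^{GL(n)}\subset R$ is the algebra of matrix $GL(n)$-invariants, i.e. the subalgebra generated by all $\sigma_t(A)$, $1\le t\le n$, $A$ a monomial in generic matrices. Words. $\langle X\rangle$ is the free semigroup (without unity) on letters $x_1,x_2,\ldots$; $\langle X\rangle^{\#}=\langle X\rangle\sqcup\{1\}$; $\mathbb{F}\langle X\rangle$ is the vector space with basis $\langle X\rangle$. $\phi_n$ is the multiplicative linear map on $\mathbb{F}\langle X\rangle$ with $x_k\mapsto X_k$. $\langle X\rangle$ carries the lexicographical linear order with $x_1>x_2>\cdots$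 and $ab>a$. Words $a,b$ are cyclic equivalent if $a=a_1a_2$, $b=a_2a_1$ for some $a_1,a_2\in\langle X\rangle^{\#}$. A word $a$ is primitive if $a\ne b^l$ for all $b\in\langle X\rangle$, $l>1$. $\langle\widetilde X\rangle$ is the set of maximal representatives of the cyclic equivalence classes of primitive words. $\mathrm{mdeg}(a)=(\deg_{x_1}(a),\deg_{x_2}(a),\ldots)$. Free algebras. $\sigma\langle X\rangle$ is the commutative polynomial ring over $\mathbb{F}$ freely generated by symbols $\sigma_t(a)$, where $t\ge1$ and $a\in\mathbb{F}\langle X\rangle$ has coefficient $1$ in its highest term; put $\sigma_t(\alpha a)=\alpha^t\sigma_t(a)$ for $\alpha\in\mathbb{F}$ and $\sigma_0(a)=1$. The large free algebra $\sigma\langle\widetilde X\rangle$ is the commutative polynomial ring over $\mathbb{F}$ freely generated by symbols $\sigma_t(e)$, $t>0$, $e\in\langle\widetilde X\rangle$. Special elements. For $\underline t\in\mathbb{N}_0^u$ let $\Omega(\underline t)$ be the set of multisets $\omega$ consisting of pairwise different $e_1,\ldots,e_q\in\langle\widetilde X\rangle$ ($q>0$) with multiplicities $k_1,\ldots,k_q\in\mathbb{N}$ such that $\sum_i k_i\,\mathrm{mdeg}(e_i)=\underline t$; put $\sigma(\omega)=(-1)^{k_1+\cdots+k_q}\sigma_{k_1}(e_1)\cdots\sigma_{k_q}(e_q)$ and $\sigma_{\underline t}(x_1,\ldots,x_u)=(-1)^{|\underline t|}\sum_{\omega\in\Omega(\underline t)}\sigma(\omega)\in\sigma\langle X\rangle$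 (equal to $1$ if $\Omega(\underline t)$ is empty). For $t>0$, $F_t(x_1,\ldots,x_u)=\sum\sigma_{\underline t}(x_1,\ldots,x_u)$ over $\underline t\in\mathbb{N}_0^u$ with $|\underline t|=t$. For $a_i\in\mathbb{F}\langle X\rangle$, $F_t(a_1,\ldots,a_u)$ is the result of the substitutions $x_i\to a_i$. For $t\ge1$, $l\ge2$ there is a unique polynomial $P_{t,l}$ in $tl$ variables with coefficients in the image of $\mathbb{Z}$ in $\mathbb{F}$ such that $\sigma_t(A^l)=P_{t,l}(\sigma_1(A),\ldots,\sigma_{tl}(A))$ for all $m\times m$ matrices $A$ over commutative $\mathbb{F}$-algebras with $m\ge tl$; $P_{t,l}(a)=P_{t,l}(\sigma_1(a),\ldots,\sigma_{tl}(a))\in\sigma\langle X\rangle$. The map $\widetilde\pi$. By a theorem of Donkin there is a surjective homomorphism $\widetilde\pi:\sigma\langle X\rangle\to\sigma\langle\widetilde X\rangle$ with $\widetilde\pi(\sigma_t(e))=\sigma_t(e)$ for $e\in\langle\widetilde X\rangle$, whose kernel is the ideal generated by $\sigma_t(a_1+\cdots+a_u)-F_t(a_1,\ldots,a_u)$, $\sigma_t(a^l)-P_{t,l}(a)$, $\sigma_t(ab)-\sigma_t(ba)$, where $t>0$, $l,u>1$, $a_i\in\mathbb{F}\langle X\rangle$, $a,b\in\langle X\rangle$. Elements of $\sigma\langle X\rangle$ are regarded as elements of $\sigma\langle\widetilde X\rangle$ via $\widetilde\pi$. $\widetilde K_n$ is the kernel of the surjective homomorphism $\widetilde\Phi_n:\sigma\langle\widetilde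 X\rangle\to R^{GL(n)}$ with $\sigma_t(e)\mapsto\sigma_t(\phi_n(e))$ for $1\le t\le n$ and $\sigma_t(e)\mapsto0$ for $t>n$. Finitely based. A substitution endomorphism of $\sigma\langle\widetilde X\rangle$ is the endomorphism $\varphi$ determined by substitutions $x_k\to a_k$, $a_k\in\mathbb{F}\langle X\rangle$, $k>0$, with $\varphi(\sigma_t(a))=\sigma_t(\varphi(a))$. The ideal $\widetilde K_n$ is stable under all of these (it is a T-ideal). It is finitely based if there are finitely many elements $f_1,\ldots,f_s$ such that it is generated as an ideal by all $\varphi(f_1),\ldots,\varphi(f_s)$ with $\varphi$ ranging over substitution endomorphisms. *)

theory Defs
  imports
    "HOL-Library.Poly_Mapping"
    "HOL-Library.Multiset"
    "Jordan_Normal_Form.Char_Poly"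
begin

section \<open>Polynomial rings\<close>

text \<open>
  The ring of commutative polynomials over \<open>'f\<close> in a set of variables \<open>'v\<close>, as the
  monoid algebra of the monoid of finitely supported exponent functions.
\<close>

type_synonym ('v, 'f) mpoly = "('v \<Rightarrow>\<^sub>0 nat) \<Rightarrow>\<^sub>0 'f"

text \<open>Scalars of a monoid algebra; used for polynomial rings and for the free algebra below.\<close>

definition Const :: "'f \<Rightarrow> ('k::zero \<Rightarrow>\<^sub>0 'f::zero)" where
  "Const c = Poly_Mapping.single 0 c"

definition Var :: "'v \<Rightarrow> ('v, 'f::zero_neq_one) mpoly" where
  "Var v = Poly_Mapping.single (Poly_Mapping.single v 1) 1"

definition peval :: "('v \<Rightarrow> ('w, 'f::comm_ring_1) mpoly) \<Rightarrow> ('v, 'f) mpoly \<Rightarrow> ('w, 'f) mpoly" where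
  "peval h f = (\<Sum>m\<in>Poly_Mapping.keys f. Const (Poly_Mapping.lookup f m) *
                  (\<Prod>v\<in>Poly_Mapping.keys m. h v ^ Poly_Mapping.lookup m v))"

definition alg_hom :: "(('v, 'f::comm_ring_1) mpoly \<Rightarrow> ('w, 'f) mpoly) \<Rightarrow> bool" where
  "alg_hom h \<longleftrightarrow> (\<forall>c. h (Const c) = Const c) \<and>
     (\<forall>f g. h (f + g) = h f + h g) \<and> (\<forall>f g. h (f * g) = h f * h g)"

text \<open>The ideal generated by a set: a commutative ring as a module over itself.\<close>

definition ideal_gen :: "'r::comm_ring_1 set \<Rightarrow> 'r set" where
  "ideal_gen S = module.span (*) S"


section \<open>Words\<close>

text \<open>
  The free monoid \<open>\<langle>X\<rangle>\<^sup>#\<close>, written additively because \<^theory>\<open>HOL-Library.Poly_Mapping\<close>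
  builds monoid algebras from additive monoids. The letter \<open>k::nat\<close> stands for
  \<open>x\<^bsub>k+1\<^esub>\<close>; the semigroup \<open>\<langle>X\<rangle>\<close> consists of the words \<open>w \<noteq> 0\<close>.
\<close>

datatype word = Word (letters: "nat list")

instantiation word :: monoid_add
begin

definition zero_word :: word where "zero_word = Word []"

definition plus_word :: "word \<Rightarrow> word \<Rightarrow> word" where
  "plus_word a b = Word (letters a @ letters b)"

instance
  by standard (auto simp: zero_word_def plus_word_def)

end

text \<open>
  Lexicographical order with \<open>x\<^sub>1 > x\<^sub>2 > \<dots>\<close> (a letter with a larger index is smaller)
  and \<open>ab > a\<close>.
\<close>

instantiation word :: linorder
begin

definition less_word :: "word \<Rightarrow> word \<Rightarrow> bool" where
  "less_word a b \<longleftrightarrow> (letters a, letters b) \<in> lexord {(i, j). j < i}"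

definition less_eq_word :: "word \<Rightarrow> word \<Rightarrow> bool" where
  "less_eq_word a b \<longleftrightarrow> a = b \<or> a < b"

instance
proof
  have irr: "\<not> a < a" for a :: word
    unfolding less_word_def by (rule lexord_irreflexive) auto
  have tr: "a < b \<Longrightarrow> b < c \<Longrightarrow> a < c" for a b c :: word
    unfolding less_word_def by (rule lexord_trans) (auto simp: trans_def)
  fix x y z :: word
  show "x < y \<longleftrightarrow> x \<le> y \<and> \<not> y \<le> x"
    unfolding less_eq_word_def using irr tr by metis
  show "x \<le> x" by (simp add: less_eq_word_def)
  show "x \<le> y \<Longrightarrow> y \<le> z \<Longrightarrow> x \<le> z"
    unfolding less_eq_word_def using tr by metis
  show "x \<le> y \<Longrightarrow> y \<le> x \<Longrightarrow> x = y"
    unfolding less_eq_word_def using irr tr by metis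
  have "(letters x, letters y) \<in> lexord {(i, j). j < i} \<or> letters x = letters y \<or>
        (letters y, letters x) \<in> lexord {(i, j). j < i}"
    by (rule lexord_linear) auto
  then show "x \<le> y \<or> y \<le> x"
    unfolding less_eq_word_def less_word_def by (auto intro: word.expand)
qed

end

definition cyc_equiv :: "word \<Rightarrow> word \<Rightarrow> bool" where
  "cyc_equiv a b \<longleftrightarrow> (\<exists>a1 a2. a = a1 + a2 \<and> b = a2 + a1)"

text \<open>In additive notation the power \<open>b\<^sup>l\<close> of a word is \<open>sum_list (replicate l b)\<close>.\<close>

definition primitive_word :: "word \<Rightarrow> bool" where
  "primitive_word a \<longleftrightarrow> (\<forall>b l. b \<noteq> 0 \<longrightarrow> l > 1 \<longrightarrow> a \<noteq> sum_list (replicate l b))"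

definition Xtilde :: "word set" where
  "Xtilde = {e. e \<noteq> 0 \<and> primitive_word e \<and> (\<forall>b. cyc_equiv e b \<longrightarrow> b \<le> e)}"

text \<open>
  Multidegrees in \<open>\<nat>\<^sub>0\<^sup>\<infinity>\<close>; the tuples \<open>t \<in> \<nat>\<^sub>0\<^sup>u\<close> are the multidegrees supported
  on the first \<open>u\<close> letters.
\<close>

definition mdeg :: "word \<Rightarrow> (nat \<Rightarrow>\<^sub>0 nat)" where
  "mdeg a = (\<Sum>k\<leftarrow>letters a. Poly_Mapping.single k 1)"

definition tdeg :: "(nat \<Rightarrow>\<^sub>0 nat) \<Rightarrow> nat" where
  "tdeg \<tau> = (\<Sum>k\<in>Poly_Mapping.keys \<tau>. Poly_Mapping.lookup \<tau> k)"

text \<open>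
  \<^typ>\<open>word \<Rightarrow>\<^sub>0 'f\<close> is the free associative algebra with unity; \<open>'f\<langle>X\<rangle>\<close> is its subspace of
  elements without constant term.
\<close>

definition FX :: "(word \<Rightarrow>\<^sub>0 'f::zero) set" where
  "FX = {a. Poly_Mapping.lookup a 0 = 0}"

definition mon :: "word \<Rightarrow> (word \<Rightarrow>\<^sub>0 'f::zero_neq_one)" where
  "mon w = Poly_Mapping.single w 1"

definition word_subst :: "(nat \<Rightarrow> (word \<Rightarrow>\<^sub>0 'f::comm_ring_1)) \<Rightarrow> word \<Rightarrow> (word \<Rightarrow>\<^sub>0 'f)" where
  "word_subst s w = prod_list (map s (letters w))"

definition FX_subst :: "(nat \<Rightarrow> (word \<Rightarrow>\<^sub>0 'f::comm_ring_1)) \<Rightarrow> (word \<Rightarrow>\<^sub>0 'f) \<Rightarrow> (word \<Rightarrow>\<^sub>0 'f)" where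
  "FX_subst s a = (\<Sum>w\<in>Poly_Mapping.keys a. Const (Poly_Mapping.lookup a w) * word_subst s w)"

definition lcoef :: "(word \<Rightarrow>\<^sub>0 'f::zero) \<Rightarrow> 'f" where
  "lcoef a = Poly_Mapping.lookup a (Max (Poly_Mapping.keys a))"


section \<open>The algebras \<open>\<sigma>\<langle>X\<rangle>\<close> and \<open>\<sigma>\<langle>X~\<rangle>\<close>\<close>

text \<open>The free generators \<open>\<sigma>\<^sub>t(a)\<close> of the two polynomial rings, as types.\<close>

typedef (overloaded) 'f sgen =
  "{(t, a). t \<ge> 1 \<and> a \<in> FX \<and> a \<noteq> 0 \<and> lcoef a = 1} :: (nat \<times> (word \<Rightarrow>\<^sub>0 'f::field)) set"
proof
  show "(1::nat, mon (Word [0])) \<in> {(t, a). t \<ge> 1 \<and> a \<in> FX \<and> a \<noteq> 0 \<and> lcoef (a :: word \<Rightarrow>\<^sub>0 'f) = 1}"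
    by (simp add: mon_def FX_def lcoef_def zero_word_def lookup_single poly_mapping_eq_iff fun_eq_iff when_def)
qed

typedef tgen = "{(t, e). t > 0 \<and> e \<in> Xtilde} :: (nat \<times> word) set"
proof
  have len: "length (letters (sum_list (replicate l b))) = l * length (letters b)" for l b
    by (induction l) (auto simp: zero_word_def plus_word_def)
  have "primitive_word (Word [0])"
    unfolding primitive_word_def
  proof (intro allI impI)
    fix b :: word and l :: nat
    assume "b \<noteq> 0" "l > 1"
    then have "length (letters b) \<noteq> 0" by (cases b) (auto simp: zero_word_def)
    then have "length (letters (sum_list (replicate l b))) \<noteq> 1" using \<open>l > 1\<close> len by simp
    then show "Word [0] \<noteq> sum_list (replicate l b)" by (metis length_Cons list.size(3) One_nat_def word.sel)
  qed
  moreover have "b \<le> Word [0]" if "cyc_equiv (Word [0]) b" for b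
    using that by (auto simp: cyc_equiv_def plus_word_def Cons_eq_append_conv)
  ultimately show "(1::nat, Word [0]) \<in> {(t, e). t > 0 \<and> e \<in> Xtilde}"
    by (auto simp: Xtilde_def zero_word_def)
qed

type_synonym 'f sX = "('f sgen, 'f) mpoly"
type_synonym 'f sXt = "(tgen, 'f) mpoly"

text \<open>
  \<open>\<sigma>\<^sub>t(b)\<close> for \<open>b \<in> 'f\<langle>X\<rangle>\<close> arbitrary, following \<open>\<sigma>\<^sub>t(\<alpha> a) = \<alpha>\<^sup>t \<sigma>\<^sub>t(a)\<close> and
  \<open>\<sigma>\<^sub>0(b) = 1\<close>. Only meaningful on \<^const>\<open>FX\<close>.
\<close>

definition sigma :: "nat \<Rightarrow> (word \<Rightarrow>\<^sub>0 'f::field) \<Rightarrow> 'f sX" where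
  "sigma t b =
     (if t = 0 then 1 else if b = 0 then 0
      else Const (lcoef b ^ t) * Var (Abs_sgen (t, Const (inverse (lcoef b)) * b)))"

text \<open>\<open>\<sigma>\<^sub>t(e)\<close> as a free generator of \<open>\<sigma>\<langle>X~\<rangle>\<close>; only meaningful for \<open>t > 0\<close>, \<open>e \<in> Xtilde\<close>.\<close>

definition sigma_t :: "nat \<Rightarrow> word \<Rightarrow> 'f::field sXt" where
  "sigma_t t e = Var (Abs_tgen (t, e))"

definition sX_subst :: "(nat \<Rightarrow> (word \<Rightarrow>\<^sub>0 'f::field)) \<Rightarrow> 'f sX \<Rightarrow> 'f sX" where
  "sX_subst s = peval (\<lambda>g. case Rep_sgen g of (t, a) \<Rightarrow> sigma t (FX_subst s a))"


section \<open>The elements \<open>F\<^sub>t\<close>\<close>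

definition Omega :: "(nat \<Rightarrow>\<^sub>0 nat) \<Rightarrow> word multiset set" where
  "Omega \<tau> = {\<omega>. \<omega> \<noteq> {#} \<and> set_mset \<omega> \<subseteq> Xtilde \<and> (\<Sum>e\<in>#\<omega>. mdeg e) = \<tau>}"

definition sigma_omega :: "word multiset \<Rightarrow> 'f::field sX" where
  "sigma_omega \<omega> = (-1) ^ size \<omega> * (\<Prod>e\<in>set_mset \<omega>. sigma (count \<omega> e) (mon e))"

definition sigma_multi :: "(nat \<Rightarrow>\<^sub>0 nat) \<Rightarrow> 'f::field sX" where
  "sigma_multi \<tau> =
     (if Omega \<tau> = {} then 1 else (-1) ^ tdeg \<tau> * (\<Sum>\<omega>\<in>Omega \<tau>. sigma_omega \<omega>))"

definition F_gen :: "nat \<Rightarrow> nat \<Rightarrow> 'f::field sX" where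
  "F_gen t u = (\<Sum>\<tau> | Poly_Mapping.keys \<tau> \<subseteq> {..<u} \<and> tdeg \<tau> = t. sigma_multi \<tau>)"

text \<open>
  \<open>F\<^sub>t(a\<^sub>1,\<dots>,a\<^sub>u)\<close>. The letters beyond the first \<open>u\<close> do not occur in \<^term>\<open>F_gen t u\<close>, so the
  value substituted for them is irrelevant.
\<close>

definition F_elem :: "nat \<Rightarrow> (word \<Rightarrow>\<^sub>0 'f::field) list \<Rightarrow> 'f sX" where
  "F_elem t as = sX_subst (\<lambda>k. if k < length as then as ! k else 0) (F_gen t (length as))"


section \<open>Generic matrices and \<open>P\<^bsub>t,l\<^esub>\<close>\<close>

text \<open>
  \<open>\<sigma>\<^sub>t(A)\<close> from \<open>det(\<lambda>E - A) = \<Sum>\<^sub>t (-1)\<^sup>t \<lambda>\<^bsup>m-t\<^esup> \<sigma>\<^sub>t(A)\<close> for an \<open>m \<times> m\<close> matrix and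
  \<open>t \<le> m\<close>.
\<close>

definition sigma_mat :: "nat \<Rightarrow> 'r::comm_ring_1 mat \<Rightarrow> 'r" where
  "sigma_mat t A = (-1) ^ t * coeff (char_poly A) (dim_row A - t)"

text \<open>
  The variable \<open>(i, j, k)\<close> is the \<open>(i, j)\<close> entry, counted from 0, of the generic matrix that
  is substituted for letter \<open>k\<close>. The indices \<open>i\<close>, \<open>j\<close> are not bounded in the type;
  \<open>n \<times> n\<close> generic matrices only involve the variables with \<open>i, j < n\<close>.
\<close>

type_synonym 'f matvars = "(nat \<times> nat \<times> nat, 'f) mpoly"

definition gen_mat :: "nat \<Rightarrow> nat \<Rightarrow> 'f::comm_ring_1 matvars mat" where
  "gen_mat n k = mat n n (\<lambda>(i, j). Var (i, j, k))"

definition phi :: "nat \<Rightarrow> word \<Rightarrow> 'f::comm_ring_1 matvars mat" where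
  "phi n w = foldr (\<lambda>k A. gen_mat n k * A) (letters w) (1\<^sub>m n)"

text \<open>
  \<open>P\<^bsub>t,l\<^esub>\<close>, a polynomial in the variables \<open>1,\<dots>,tl\<close>. The identity defining it is required
  for matrices over the polynomial ring \<^typ>\<open>'f matvars\<close>, since one cannot quantify over all commutative
  algebras inside a definition. This is no loss: every \<open>m \<times> m\<close> matrix over a commutative
  algebra is the image of the generic matrix \<^term>\<open>gen_mat m 0\<close> under an algebra homomorphism.
\<close>

definition P_poly :: "nat \<Rightarrow> nat \<Rightarrow> (nat, 'f::field) mpoly" where
  "P_poly t l = (THE P.
     (\<forall>m\<in>Poly_Mapping.keys P. Poly_Mapping.keys m \<subseteq> {1..t*l} \<and> Poly_Mapping.lookup P m \<in> \<int>) \<and>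
     (\<forall>m A. m \<ge> t * l \<longrightarrow> A \<in> carrier_mat m m \<longrightarrow>
        sigma_mat t (A ^\<^sub>m l) = peval (\<lambda>i. sigma_mat i (A :: 'f matvars mat)) P))"

definition P_elem :: "nat \<Rightarrow> nat \<Rightarrow> (word \<Rightarrow>\<^sub>0 'f::field) \<Rightarrow> 'f sX" where
  "P_elem t l a = peval (\<lambda>i. sigma i a) (P_poly t l)"


section \<open>The map \<open>\<pi>~\<close>\<close>

definition relations :: "'f::field sX set" where
  "relations =
     {sigma t (sum_list as) - F_elem t as | t as. t > 0 \<and> length as > 1 \<and> set as \<subseteq> FX} \<union>
     {sigma t (mon a ^ l) - P_elem t l (mon a) | t l a. t > 0 \<and> l > 1 \<and> a \<noteq> 0} \<union>
     {sigma t (mon (a + b)) - sigma t (mon (b + a)) | t a b. t > 0 \<and> a \<noteq> 0 \<and> b \<noteq> 0}"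

text \<open>
  The surjective homomorphism \<open>\<pi>~ : \<sigma>\<langle>X\<rangle> \<rightarrow> \<sigma>\<langle>X~\<rangle>\<close> of Donkin's theorem. It is uniquely
  determined by these properties, as the relations express every \<open>\<sigma>\<^sub>t(a)\<close> through the
  \<open>\<sigma>\<^sub>k(e)\<close>, \<open>e \<in> Xtilde\<close>.
\<close>

definition donkin_map :: "('f::field sX \<Rightarrow> 'f sXt) \<Rightarrow> bool" where
  "donkin_map \<pi> \<longleftrightarrow> alg_hom \<pi> \<and> surj \<pi> \<and>
     (\<forall>t>0. \<forall>e\<in>Xtilde. \<pi> (sigma t (mon e)) = sigma_t t e) \<and>
     {f. \<pi> f = 0} = ideal_gen relations"

definition pi_t :: "'f::field sX \<Rightarrow> 'f sXt" where
  "pi_t = (SOME \<pi>. donkin_map \<pi>)"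


section \<open>The ideal \<open>K~\<^sub>n\<close>\<close>

definition Phi_t :: "nat \<Rightarrow> 'f::field sXt \<Rightarrow> 'f matvars" where
  "Phi_t n = peval (\<lambda>g. case Rep_tgen g of (t, e) \<Rightarrow> if t \<le> n then sigma_mat t (phi n e) else 0)"

definition K_t :: "nat \<Rightarrow> 'f::field sXt set" where
  "K_t n = {f. Phi_t n f = 0}"

definition subst_endo :: "('f::field sXt \<Rightarrow> 'f sXt) \<Rightarrow> bool" where
  "subst_endo \<phi> \<longleftrightarrow> alg_hom \<phi> \<and>
     (\<exists>s. (\<forall>k. s k \<in> FX) \<and>
          (\<forall>t>0. \<forall>a\<in>FX. \<phi> (pi_t (sigma t a)) = pi_t (sigma t (FX_subst s a))))"

definition finitely_based :: "'f::field sXt set \<Rightarrow> bool" where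
  "finitely_based I \<longleftrightarrow>
     (\<exists>S. finite S \<and> I = ideal_gen {\<phi> f | \<phi> f. subst_endo \<phi> \<and> f \<in> S})"

end

theory Submission
  imports
    Defs
    "HOL-Algebra.Algebraic_Closure_Type"
    "HOL-Combinatorics.Permutations"
begin

hide_const (open) up_ring.monom up_ring.coeff Module.smult Polynomials.degree Module.module Divisibility.prime

text \<open>
  An element of \<open>\<sigma>\<langle>X~\<rangle>\<close> is identified with the function that it defines on families of square
  matrices of all sizes over the algebraic closure, via \<open>\<sigma>\<^sub>t(e) \<mapsto> \<sigma>\<^sub>t(e(A))\<close>. Direct sums of weighted
  cycles labelled by the words \<open>e\<close> show that this is faithful. Eliminating letters in
  \<open>det(1 - x - b) = det(1 - x) det(1 - (1 - x)\<^sup>-\<^sup>1 b)\<close> shows that every \<open>\<sigma>\<^sub>t(a)\<close> is represented in this way,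
  which gives \<open>\<pi>~\<close>; its kernel is read off from Amitsur's formula, checked on labelled cycles.
  \<open>K~\<^sub>n\<close> consists of the elements that vanish on all families of \<open>n \<times> n\<close> matrices.

  If \<open>p > 0\<close>, let \<open>q > n\<close> be a power of \<open>p\<close> larger than all \<open>t\<close> that occur in a finite set of elements of
  \<open>K~\<^sub>n\<close>. As \<open>\<sigma>\<^sub>t(c E)\<close> vanishes for scalar \<open>q \<times> q\<close> matrices and \<open>0 < t < q\<close>, all consequences of these elements vanish
  at \<open>x\<^sub>1 = E\<close>, \<open>x\<^sub>k = 0\<close> for \<open>k > 1\<close>, but \<open>\<sigma>\<^sub>q(x\<^sub>1) \<in> K~\<^sub>n\<close> does not.

  If \<open>p = 0\<close>, an element is a combination of products of traces along permutations \<open>\<tau>\<close>. If it vanishes on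
  \<open>n \<times> n\<close> matrices, evaluating at sums of matrix units gives linear relations between its (symmetrized)
  coefficients. Let \<open>\<sigma>\<close> be the lexicographically largest permutation that occurs. If \<open>\<sigma>\<close> has no decreasing
  subsequence of length \<open>n + 1\<close>, its positions are covered by \<open>n\<close> increasing ones, and one of the relations says that the
  coefficient of \<open>\<sigma>\<close> is zero. Otherwise an antisymmetrized trace with leading term \<open>\<sigma>\<close> is subtracted; it
  lies in the ideal generated by the \<open>\<sigma>\<^bsub>n+1\<^esub>(a)\<close>, by polarization.
\<close>

subsection \<open>Polynomial evaluation\<close>

text \<open>\<open>pi_t\<close> is an arbitrary choice among the maps with the required properties,
  so nothing can be said about it until one such map is exhibited; this is why Donkin's theorem is
  proved on the way. Working with functions avoids questions of well-definedness: elements of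
  \<sigma>\<langle>X~\<rangle> with equal values are equal, so a homomorphism may be given by
  choosing representatives, and relations become identities between determinants. The sizes of the
  matrices must be unbounded, since \<open>sg t\<close> vanishes on matrices smaller than
  \<open>t\<close>. The algebraic closure enters because prescribed values of \<sigma>_t are
  realized by splitting 1 - s_1 z + s_2 z^2 - ... into linear factors, one labelled cycle for each.
  The two characteristics part at t!: division by it turns \<sigma>_t into traces and permits
  averaging over renumbered positions, whereas for a power q of p the identity (1 - z)^q = 1 - z^q
  shows that nonzero q x q scalar matrices are detected by \<sigma>_q alone. Straightening can be
  iterated because antisymmetrized traces on n + 1 positions satisfy the linear relations that n x n
  matrices impose.\<close>

lemma poly_mapping_sum_single: "f = (\<Sum>k\<in>Poly_Mapping.keys f. Poly_Mapping.single k (Poly_Mapping.lookup f k))"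
proof (rule poly_mapping_eqI)
  fix k
  show "Poly_Mapping.lookup f k = Poly_Mapping.lookup (\<Sum>k\<in>Poly_Mapping.keys f. Poly_Mapping.single k (Poly_Mapping.lookup f k)) k"
    by (auto simp: lookup_sum lookup_single when_def in_keys_iff)
qed

lemma poly_mapping_add_induct:
  assumes s: "\<And>k v. P (Poly_Mapping.single k v)" and a: "\<And>f g. P f \<Longrightarrow> P g \<Longrightarrow> P (f + g)"
  shows "P (f :: 'k \<Rightarrow>\<^sub>0 'a::comm_monoid_add)"
proof -
  have "finite A \<Longrightarrow> P (\<Sum>k\<in>A. Poly_Mapping.single k (Poly_Mapping.lookup f k))" for A
  proof (induction A rule: finite_induct)
    case empty
    show ?case using s[of undefined 0] by simp
  next
    case (insert x A)
    then show ?case using a s by simp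
  qed
  from this[OF finite_keys[of f]] show ?thesis using poly_mapping_sum_single[of f] by simp
qed

text \<open>The additive extension of \<open>g\<close> from single terms. The coefficient is an
  argument of \<open>g\<close> rather than a factor, so that it may pass through a ring homomorphism
  or multiply a matrix entry.\<close>

definition lext :: "('a::zero \<Rightarrow> 'k \<Rightarrow> 'r::comm_monoid_add) \<Rightarrow> ('k \<Rightarrow>\<^sub>0 'a) \<Rightarrow> 'r" where
  "lext g f = (\<Sum>k\<in>Poly_Mapping.keys f. g (Poly_Mapping.lookup f k) k)"

lemma lext_add:
  assumes "\<And>k. g 0 k = 0" "\<And>a b k. g (a + b) k = g a k + g b k"
  shows "lext g (f + f') = lext g f + lext g f'"
  unfolding lext_def by (rule setsum_keys_plus_distrib) (use assms in auto)

lemma lext_single: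
  assumes "\<And>k. g 0 k = 0"
  shows "lext g (Poly_Mapping.single k a) = g a k"
  unfolding lext_def using assms by (cases "a = 0") auto

lemma lext_zero [simp]: "lext g 0 = 0"
  by (simp add: lext_def)

lemma lext_superset:
  assumes "\<And>k. g 0 k = 0" "finite A" "Poly_Mapping.keys f \<subseteq> A"
  shows "lext g f = (\<Sum>k\<in>A. g (Poly_Mapping.lookup f k) k)"
  unfolding lext_def using assms by (intro sum.mono_neutral_left) (auto simp: in_keys_iff)

text \<open>In contrast to \<open>peval\<close>, the values lie in another ring: coefficients travel
  along \<open>c\<close>, in most uses the embedding \<open>to_ac\<close> of the field into its
  algebraic closure.\<close>

definition meval :: "('f::zero \<Rightarrow> 'r::comm_ring_1) \<Rightarrow> ('v \<Rightarrow> 'r) \<Rightarrow> ('v, 'f) mpoly \<Rightarrow> 'r" where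
  "meval c h f = (\<Sum>m\<in>Poly_Mapping.keys f. c (Poly_Mapping.lookup f m) *
                  (\<Prod>v\<in>Poly_Mapping.keys m. h v ^ Poly_Mapping.lookup m v))"

definition mono_eval :: "('v \<Rightarrow> 'r::comm_ring_1) \<Rightarrow> ('v \<Rightarrow>\<^sub>0 nat) \<Rightarrow> 'r" where
  "mono_eval h m = (\<Prod>v\<in>Poly_Mapping.keys m. h v ^ Poly_Mapping.lookup m v)"

lemma mono_eval_superset:
  assumes "finite A" "Poly_Mapping.keys m \<subseteq> A"
  shows "mono_eval h m = (\<Prod>v\<in>A. h v ^ Poly_Mapping.lookup m v)"
  unfolding mono_eval_def using assms by (intro prod.mono_neutral_left) (auto simp: in_keys_iff)

lemma mono_eval_add: "mono_eval h (m + m') = mono_eval h m * mono_eval h m'"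
proof -
  let ?A = "Poly_Mapping.keys m \<union> Poly_Mapping.keys m'"
  have "Poly_Mapping.keys (m + m') \<subseteq> ?A" by (rule keys_add)
  then show ?thesis
    by (subst (1 2 3) mono_eval_superset[of ?A]) (auto simp: lookup_add power_add prod.distrib)
qed

lemma mono_eval_zero [simp]: "mono_eval h 0 = 1"
  by (simp add: mono_eval_def)

lemma mono_eval_single [simp]: "mono_eval h (Poly_Mapping.single v n) = h v ^ n"
  by (cases "n = 0") (auto simp: mono_eval_def)

lemma meval_lext: "meval c h = lext (\<lambda>a m. c a * mono_eval h m)"
  by (simp add: fun_eq_iff meval_def lext_def mono_eval_def)

lemma peval_meval: "peval h f = meval Const h f"
  by (simp add: peval_def meval_def)

lemma mult_single_bilinear_induct:
  fixes F :: "('k::monoid_add \<Rightarrow>\<^sub>0 'a::semiring_0) \<Rightarrow> 'r"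
  assumes "\<And>f g. F (f + g) = padd (F f) (F g)"
    and "\<And>x y z. pmul (padd x y) z = padd (pmul x z) (pmul y z)"
    and "\<And>x y z. pmul x (padd y z) = padd (pmul x y) (pmul x z)"
    and "\<And>k a l b. F (Poly_Mapping.single (k + l) (a * b)) = pmul (F (Poly_Mapping.single k a)) (F (Poly_Mapping.single l b))"
  shows "F (f * g) = pmul (F f) (F g)"
proof (induction f rule: poly_mapping_add_induct)
  case (1 k a)
  show ?case
    by (induction g rule: poly_mapping_add_induct) (auto simp: mult_single assms distrib_left)
next
  case (2 f f')
  then show ?case by (simp add: assms distrib_right)
qed

context
  fixes c :: "'f::comm_ring_1 \<Rightarrow> 'r::comm_ring_1"
  assumes c: "comm_ring_hom c"
begin

interpretation c: comm_ring_hom c by (rule c)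

lemma meval_add: "meval c h (f + g) = meval c h f + meval c h g"
  unfolding meval_lext by (rule lext_add) (auto simp: c.hom_add distrib_right)

lemma meval_single: "meval c h (Poly_Mapping.single m a) = c a * mono_eval h m"
  unfolding meval_lext by (subst lext_single) auto

lemma meval_mult: "meval c h (f * g) = meval c h f * meval c h g"
  by (rule mult_single_bilinear_induct[where padd = "(+)"])
     (auto simp: meval_add meval_single mono_eval_add c.hom_mult algebra_simps)

lemma meval_Const [simp]: "meval c h (Const a) = c a"
  by (simp add: Const_def meval_single)

lemma meval_Var [simp]: "meval c h (Var v) = h v"
  by (simp add: Var_def meval_single)

lemma comm_ring_hom_meval: "comm_ring_hom (meval c h)"
proof
  show "meval c h 1 = 1" using meval_single[of h 0 1] by simp
  show "meval c h 0 = 0" by (simp add: meval_lext)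
qed (simp_all add: meval_add meval_mult)

lemma meval_superset:
  assumes "finite A" "Poly_Mapping.keys f \<subseteq> A"
  shows "meval c h f = (\<Sum>m\<in>A. c (Poly_Mapping.lookup f m) * mono_eval h m)"
  unfolding meval_lext by (rule lext_superset) (use assms in auto)

end

lemma mpoly_induct [case_names Const Var add mult]:
  fixes f :: "('v, 'f::comm_ring_1) mpoly"
  assumes "\<And>a. P (Const a)" "\<And>v. P (Var v)"
    "\<And>f g. P f \<Longrightarrow> P g \<Longrightarrow> P (f + g)" "\<And>f g. P f \<Longrightarrow> P g \<Longrightarrow> P (f * g)"
  shows "P f"
proof (induction f rule: poly_mapping_add_induct)
  case (1 m a)
  have pow: "P (Poly_Mapping.single (Poly_Mapping.single v n) 1)" for v n
  proof (induction n)
    case 0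
    then show ?case using assms(1)[of 1] by (simp add: Const_def)
  next
    case (Suc n)
    have "Poly_Mapping.single (Poly_Mapping.single v (Suc n)) 1 = Var v * Poly_Mapping.single (Poly_Mapping.single v n) (1::'f)"
      by (simp add: Var_def mult_single flip: single_add)
    with Suc assms show ?case by metis
  qed
  have "P (Poly_Mapping.single m 1)"
  proof (induction m rule: poly_mapping_add_induct)
    case (1 v n)
    then show ?case by (rule pow)
  next
    case (2 m m')
    have "Poly_Mapping.single (m + m') 1 = Poly_Mapping.single m 1 * Poly_Mapping.single m' (1::'f)"
      by (simp add: mult_single)
    with 2 assms show ?case by metis
  qed
  moreover have "Poly_Mapping.single m a = Const a * Poly_Mapping.single m 1"
    by (simp add: Const_def mult_single)
  ultimately show ?case using assms by metis
next
  case (2 f g)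
  then show ?case using assms by blast
qed

lemma comm_ring_hom_Const: "comm_ring_hom (Const :: 'f::comm_ring_1 \<Rightarrow> ('v, 'f) mpoly)"
  by standard (auto simp: Const_def single_add mult_single)

lemma comm_ring_hom_mpoly_eqI:
  fixes f :: "('v, 'f::comm_ring_1) mpoly"
  assumes "comm_ring_hom F" "comm_ring_hom G"
    and "\<And>a. F (Const a) = G (Const a)" "\<And>v. F (Var v) = G (Var v)"
  shows "F f = G f"
proof -
  interpret F: comm_ring_hom F by fact
  interpret G: comm_ring_hom G by fact
  show ?thesis
    by (induction f rule: mpoly_induct) (auto simp: assms F.hom_add F.hom_mult G.hom_add G.hom_mult)
qed

lemma alg_hom_peval: "alg_hom (peval h)"
  unfolding alg_hom_def peval_meval[abs_def]
  by (simp add: meval_add meval_mult comm_ring_hom_Const)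

lemma alg_hom_comm_ring_hom: assumes "alg_hom F" shows "comm_ring_hom F"
proof -
  have C: "Const 0 = 0" "Const 1 = 1" by (simp_all add: Const_def)
  show ?thesis
  proof
    show "F 0 = 0" "F 1 = 1" using assms C by (metis alg_hom_def)+
  qed (use assms in \<open>auto simp: alg_hom_def\<close>)
qed

lemma comm_ring_hom_comp:
  assumes "comm_ring_hom F" "comm_ring_hom G"
  shows "comm_ring_hom (\<lambda>x. F (G x))"
proof -
  interpret F: comm_ring_hom F by fact
  interpret G: comm_ring_hom G by fact
  show ?thesis by standard (auto simp: F.hom_add F.hom_mult G.hom_add G.hom_mult)
qed

definition mvars :: "('v, 'f::zero) mpoly \<Rightarrow> 'v set" where
  "mvars f = (\<Union>m\<in>Poly_Mapping.keys f. Poly_Mapping.keys m)"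

lemma finite_mvars: "finite (mvars f)"
  by (simp add: mvars_def)

lemma meval_cong:
  assumes "\<And>v. v \<in> mvars f \<Longrightarrow> h v = h' v"
  shows "meval c h f = meval c h' f"
  unfolding meval_def using assms
  by (intro sum.cong prod.cong arg_cong2[where f = "(*)"] arg_cong2[where f = "(^)"]) (auto simp: mvars_def)

text \<open>Induction on the variables. Collecting the powers of one variable \<open>v\<close> gives
  coefficients \<open>q i\<close> in the others; for fixed values of these, a univariate polynomial
  with infinitely many roots arises, so every \<open>q i\<close> vanishes everywhere as well. The
  points may lie in a larger domain than the coefficients, as long as \<open>c\<close> is
  injective.\<close>

lemma mpoly_zero_if_vanishing:
  fixes c :: "'f::comm_ring_1 \<Rightarrow> 'r::idom" and f :: "('v, 'f) mpoly"
  assumes c: "comm_ring_hom c" "inj c" and inf: "infinite (UNIV :: 'r set)"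
    and van: "\<And>h. meval c h f = 0"
  shows "f = 0"
proof -
  interpret c: comm_ring_hom c by fact
  have "finite V \<Longrightarrow> mvars f \<subseteq> V \<Longrightarrow> (\<And>h. meval c h f = 0) \<Longrightarrow> f = 0" for V and f :: "('v, 'f) mpoly"
  proof (induction V arbitrary: f rule: finite_induct)
    case empty
    then have k: "Poly_Mapping.keys f \<subseteq> {0}"
      by (auto simp: mvars_def)
    have "c (Poly_Mapping.lookup f 0) = 0"
      using empty(2) meval_superset[OF c(1) _ k, of undefined] by simp
    then have "Poly_Mapping.lookup f 0 = 0"
      using c(2) by (metis c.hom_zero injD)
    with k show ?case by (metis in_keys_iff keys_eq_empty singletonD subset_singletonD insertI1)
  next
    case (insert v V)
    define q where "q i = (\<Sum>m\<in>{m\<in>Poly_Mapping.keys f. Poly_Mapping.lookup m v = i}.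
        Poly_Mapping.single (m - Poly_Mapping.single v i) (Poly_Mapping.lookup f m))" for i
    define I where "I = (\<lambda>m. Poly_Mapping.lookup m v) ` Poly_Mapping.keys f"
    have fI: "finite I" by (simp add: I_def)
    \<comment> \<open>Subtraction of exponents is truncated; it is exact here because precisely the
      exponent of \<open>v\<close> in \<open>m\<close> is removed.\<close>
    have split: "m = (m - Poly_Mapping.single v (Poly_Mapping.lookup m v)) + Poly_Mapping.single v (Poly_Mapping.lookup m v)" for m :: "'v \<Rightarrow>\<^sub>0 nat"
      by (rule poly_mapping_eqI) (auto simp: lookup_add lookup_minus lookup_single when_def)
    have f_eq: "f = (\<Sum>i\<in>I. q i * Poly_Mapping.single (Poly_Mapping.single v i) 1)"
    proof -
      have "(\<Sum>i\<in>I. q i * Poly_Mapping.single (Poly_Mapping.single v i) 1) =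
        (\<Sum>i\<in>I. \<Sum>m\<in>{m\<in>Poly_Mapping.keys f. Poly_Mapping.lookup m v = i}. Poly_Mapping.single m (Poly_Mapping.lookup f m))"
        unfolding q_def sum_distrib_right
        by (intro sum.cong refl) (use split in \<open>auto simp: mult_single\<close>)
      also have "\<dots> = (\<Sum>m\<in>Poly_Mapping.keys f. Poly_Mapping.single m (Poly_Mapping.lookup f m))"
        unfolding I_def by (rule sum.image_gen[symmetric]) simp
      finally show ?thesis using poly_mapping_sum_single[of f] by simp
    qed
    have q_vars: "mvars (q i) \<subseteq> V" for i
    proof
      fix w assume "w \<in> mvars (q i)"
      then obtain m where m: "m \<in> Poly_Mapping.keys (q i)" "w \<in> Poly_Mapping.keys m" by (auto simp: mvars_def)
      from m(1) obtain m' where m': "m' \<in> Poly_Mapping.keys f" "Poly_Mapping.lookup m' v = i"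
        "m = m' - Poly_Mapping.single v i"
        unfolding q_def using keys_sum[of "\<lambda>m. Poly_Mapping.single (m - Poly_Mapping.single v i) (Poly_Mapping.lookup f m)"]
        by (fastforce split: if_splits)
      from m(2) m' have "w \<noteq> v" "w \<in> Poly_Mapping.keys m'"
        by (auto simp: in_keys_iff lookup_minus lookup_single when_def split: if_splits)
      then show "w \<in> V" using m'(1) insert.prems(1) by (auto simp: mvars_def)
    qed
    have "meval c h (q i) = 0" if "i \<in> I" for h i
    proof -
      define p where "p = (\<Sum>i\<in>I. monom (meval c h (q i)) i)"
      have "poly p x = 0" for x
      proof -
        interpret e: comm_ring_hom "meval c (h(v := x))" by (rule comm_ring_hom_meval[OF c(1)])
        have "0 = meval c (h(v := x)) f" using insert.prems(2) by simp
        also have "\<dots> = (\<Sum>i\<in>I. meval c (h(v := x)) (q i) * x ^ i)"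
          by (subst f_eq) (simp add: e.hom_sum e.hom_mult meval_single[OF c(1)])
        also have "\<dots> = (\<Sum>i\<in>I. meval c h (q i) * x ^ i)"
          using q_vars insert.hyps(2) by (intro sum.cong refl arg_cong2[where f = "(*)"] meval_cong) auto
        also have "\<dots> = poly p x" by (simp add: p_def poly_sum poly_monom)
        finally show ?thesis by simp
      qed
      then have "p = 0" using poly_roots_finite[of p] inf by auto
      then have "coeff p i = 0" by simp
      then show ?thesis using that fI by (simp add: p_def coeff_sum if_distrib[of "\<lambda>x. x = _"] cong: if_cong)
    qed
    then have "q i = 0" if "i \<in> I" for i using insert.IH[OF q_vars] that by blast
    then show ?case using f_eq by simp
  qed
  from this[OF finite_mvars subset_refl van] show ?thesis .
qed

subsection \<open>Coefficients of the characteristic polynomial\<close>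

text \<open>The sum of the principal t x t minors. It agrees with \<open>sigma_mat\<close> for
  \<open>t\<close> up to the size and is 0 beyond, whereas there the truncated difference in
  \<open>sigma_mat\<close> would return, up to sign, the constant coefficient of the characteristic
  polynomial.\<close>

definition sg :: "nat \<Rightarrow> 'r::comm_ring_1 mat \<Rightarrow> 'r" where
  "sg t A = (\<Sum>I | I \<subseteq> {0..<dim_row A} \<and> card I = t.
     \<Sum>p | p permutes I. signof p * (\<Prod>i\<in>I. A $$ (i, p i)))"

lemma finite_subsets_card: "finite {I. I \<subseteq> {0..<n::nat} \<and> card I = t}"
  by (rule finite_subset[of _ "Pow {0..<n}"]) auto

lemma sg_gt: "dim_row A < t \<Longrightarrow> sg t A = 0"
proof -
  assume t: "dim_row A < t"
  have "card I \<noteq> t" if "I \<subseteq> {0..<dim_row A}" for I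
    using card_mono[OF _ that] t by auto
  then have "{I. I \<subseteq> {0..<dim_row A} \<and> card I = t} = {}" by blast
  then show "sg t A = 0" unfolding sg_def by (simp only: sum.empty)
qed

lemma sg_0 [simp]: "sg 0 A = 1"
proof -
  have "{I. I \<subseteq> {0..<dim_row A} \<and> card I = 0} = {{}}" by (auto dest: finite_subset)
  then show ?thesis by (simp add: sg_def sign_id)
qed

text \<open>Multiply out each product of the Leibniz formula, \<open>I\<close> being the set of rows
  that contribute an entry of yA. In the other rows the identity matrix forces the permutation to
  fix the index, so only permutations of \<open>I\<close> survive. The two scalars cover both the
  characteristic polynomial and \<open>dpoly\<close>.\<close>

lemma det_scalar_add:
  assumes A: "A \<in> carrier_mat n n"
  shows "det (x \<cdot>\<^sub>m 1\<^sub>m n + y \<cdot>\<^sub>m A) = (\<Sum>t\<le>n. x ^ (n - t) * y ^ t * sg t A)"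
proof -
  let ?N = "{0..<n}"
  let ?d = "\<lambda>p i. if i = (p i :: nat) then 1 else (0::'a)"
  have fixes_iff: "(p permutes ?N \<and> (\<forall>i\<in>?N - I. p i = i)) = (p permutes I)" if "I \<subseteq> ?N" for p I
  proof -
    have "p permutes ?N" if "p permutes I" using that \<open>I \<subseteq> ?N\<close> by (rule permutes_subset)
    moreover have "p permutes I" if "p permutes ?N" "\<forall>i\<in>?N - I. p i = i"
      using permutes_superset[OF that(1), of I] that(2) by blast
    moreover have "\<forall>i\<in>?N - I. p i = i" if "p permutes I"
      using that by (simp add: permutes_not_in)
    ultimately show ?thesis by blast
  qed
  have dprod: "(\<Prod>i\<in>?N - I. x * ?d p i) = (if \<forall>i\<in>?N - I. p i = i then x ^ (n - card I) else 0)" if I: "I \<subseteq> ?N" for p I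
  proof (cases "\<forall>i\<in>?N - I. p i = i")
    case True
    have "(\<Prod>i\<in>?N - I. x * ?d p i) = (\<Prod>i\<in>?N - I. x)" using True by (intro prod.cong) auto
    also have "\<dots> = x ^ (n - card I)" using I by (simp add: card_Diff_subset finite_subset[OF I])
    finally show ?thesis using True by simp
  next
    case False
    then obtain i where "i \<in> ?N - I" "p i \<noteq> i" by auto
    then have "(\<Prod>i\<in>?N - I. x * ?d p i) = 0" by (intro prod_zero bexI[of _ i]) auto
    then show ?thesis unfolding if_not_P[OF False] .
  qed
  have "det (x \<cdot>\<^sub>m 1\<^sub>m n + y \<cdot>\<^sub>m A) =
    (\<Sum>p | p permutes ?N. signof p * (\<Prod>i\<in>?N. y * A $$ (i, p i) + x * ?d p i))"
    using A by (subst det_def'[of _ n]) (auto intro!: sum.cong prod.cong arg_cong2[where f = "(*)"] simp: permutes_in_image)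
  also have "\<dots> = (\<Sum>p | p permutes ?N. \<Sum>I\<in>Pow ?N. signof p * ((\<Prod>i\<in>I. y * A $$ (i, p i)) * (\<Prod>i\<in>?N - I. x * ?d p i)))"
    by (simp add: prod_add sum_distrib_left)
  also have "\<dots> = (\<Sum>I\<in>Pow ?N. \<Sum>p | p permutes ?N. signof p * ((\<Prod>i\<in>I. y * A $$ (i, p i)) * (\<Prod>i\<in>?N - I. x * ?d p i)))"
    by (rule sum.swap)
  also have "\<dots> = (\<Sum>I\<in>Pow ?N. x ^ (n - card I) * y ^ card I * (\<Sum>p | p permutes I. signof p * (\<Prod>i\<in>I. A $$ (i, p i))))"
  proof (rule sum.cong[OF refl])
    fix I assume "I \<in> Pow ?N"
    then have I: "I \<subseteq> ?N" by simp
    have "(\<Sum>p | p permutes ?N. signof p * ((\<Prod>i\<in>I. y * A $$ (i, p i)) * (\<Prod>i\<in>?N - I. x * ?d p i))) =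
      (\<Sum>p | p permutes ?N. if \<forall>i\<in>?N - I. p i = i then signof p * (\<Prod>i\<in>I. y * A $$ (i, p i)) * x ^ (n - card I) else 0)"
      using dprod[OF I] by (intro sum.cong refl) auto
    also have "\<dots> = (\<Sum>p | p permutes I. signof p * (\<Prod>i\<in>I. y * A $$ (i, p i)) * x ^ (n - card I))"
      using fixes_iff[OF I]
      by (subst sum.inter_filter[symmetric]) (auto simp: finite_permutations intro!: sum.cong)
    also have "\<dots> = x ^ (n - card I) * y ^ card I * (\<Sum>p | p permutes I. signof p * (\<Prod>i\<in>I. A $$ (i, p i)))"
      by (simp add: prod.distrib sum_distrib_left mult_ac)
    finally show "(\<Sum>p | p permutes ?N. signof p * ((\<Prod>i\<in>I. y * A $$ (i, p i)) * (\<Prod>i\<in>?N - I. x * ?d p i))) =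
      x ^ (n - card I) * y ^ card I * (\<Sum>p | p permutes I. signof p * (\<Prod>i\<in>I. A $$ (i, p i)))" .
  qed
  also have "\<dots> = (\<Sum>t\<in>card ` Pow ?N. \<Sum>I\<in>{I\<in>Pow ?N. card I = t}. x ^ (n - card I) * y ^ card I * (\<Sum>p | p permutes I. signof p * (\<Prod>i\<in>I. A $$ (i, p i))))"
    by (rule sum.image_gen) simp
  also have "\<dots> = (\<Sum>t\<in>card ` Pow ?N. x ^ (n - t) * y ^ t * sg t A)"
    using A by (auto simp: sg_def sum_distrib_left intro!: sum.cong)
  also have "card ` Pow ?N = {..n}"
  proof
    show "card ` Pow ?N \<subseteq> {..n}" using card_mono[of ?N] by auto
    show "{..n} \<subseteq> card ` Pow ?N"
    proof
      fix t assume "t \<in> {..n}"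
      then have "card {0..<t} = t" "{0..<t} \<in> Pow ?N" by auto
      then show "t \<in> card ` Pow ?N" by (metis image_eqI)
    qed
  qed
  finally show ?thesis .
qed

lemma (in comm_ring_hom) sg_hom: "A \<in> carrier_mat n n \<Longrightarrow> sg t (map_mat hom A) = hom (sg t A)"
  unfolding sg_def
  by (auto simp: hom_distribs intro!: sum.cong prod.cong arg_cong2[where f = "(*)"])
     (subst index_map_mat(1), auto simp: permutes_in_image subset_eq dest: permutes_in_image[THEN iffD2])

lemma comm_ring_hom_pCons: "comm_ring_hom (\<lambda>a::'r::comm_ring_1. [:a:])"
  by standard auto

lemma sg_eq_sigma_mat:
  assumes A: "A \<in> carrier_mat n n" and t: "t \<le> n"
  shows "sigma_mat t A = sg t A"
proof -
  interpret C: comm_ring_hom "\<lambda>a::'a. [:a:]" by (rule comm_ring_hom_pCons)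
  have "char_poly_matrix A = [:0, 1:] \<cdot>\<^sub>m 1\<^sub>m n + (-1) \<cdot>\<^sub>m map_mat (\<lambda>a. [:a:]) A"
    using A by (auto simp: char_poly_matrix_def intro!: eq_matI)
  then have "char_poly A = (\<Sum>t\<le>n. [:0, 1:] ^ (n - t) * (-1) ^ t * [:sg t A:])"
    unfolding char_poly_def using A by (simp add: det_scalar_add C.sg_hom[of A n])
  also have "\<dots> = (\<Sum>t\<le>n. monom ((-1) ^ t * sg t A) (n - t))"
  proof (rule sum.cong[OF refl])
    fix t
    show "[:0, 1:] ^ (n - t) * (-1) ^ t * [:sg t A:] = monom ((-1) ^ t * sg t A) (n - t)"
      by (cases "even t") (simp_all add: monom_altdef)
  qed
  finally have cp: "char_poly A = (\<Sum>t\<le>n. monom ((-1) ^ t * sg t A) (n - t))" .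
  have "coeff (char_poly A) (n - t) = (\<Sum>s\<le>n. if s = t then (-1) ^ s * sg s A else 0)"
    unfolding cp coeff_sum coeff_monom by (rule sum.cong[OF refl]) (use t in auto)
  also have "\<dots> = (-1) ^ t * sg t A" using t by simp
  finally have "sigma_mat t A = (-1) ^ t * ((-1) ^ t * sg t A)"
    using A by (simp add: sigma_mat_def)
  also have "\<dots> = sg t A" by (simp flip: mult.assoc power_add)
  finally show ?thesis .
qed

text \<open>The reciprocal characteristic polynomial det(1 - zA). The coefficient of z^t belongs to
  \<open>sg t\<close> whatever the size of the matrix, so matrices of different sizes can be
  compared, and direct sums give products.\<close>

definition dpoly :: "'r::comm_ring_1 mat \<Rightarrow> 'r poly" where
  "dpoly A = det (1\<^sub>m (dim_row A) + (- [:0, 1:]) \<cdot>\<^sub>m map_mat (\<lambda>a. [:a:]) A)"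

lemma dpoly_eq:
  assumes A: "A \<in> carrier_mat n n"
  shows "dpoly A = (\<Sum>t\<le>n. monom ((-1) ^ t * sg t A) t)"
proof -
  interpret C: comm_ring_hom "\<lambda>a::'a. [:a:]" by (rule comm_ring_hom_pCons)
  have "dpoly A = det (1 \<cdot>\<^sub>m 1\<^sub>m n + (- [:0, 1:]) \<cdot>\<^sub>m map_mat (\<lambda>a. [:a:]) A)"
    unfolding dpoly_def using A by (intro arg_cong[where f = det] eq_matI) auto
  also have "\<dots> = (\<Sum>t\<le>n. (- [:0, 1:]) ^ t * [:sg t A:])"
    using A by (subst det_scalar_add) (auto simp: C.sg_hom[of A n])
  also have "\<dots> = (\<Sum>t\<le>n. monom ((-1) ^ t * sg t A) t)"
  proof (rule sum.cong[OF refl])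
    fix t
    have "(- [:0, 1:]) ^ t = [:0, 1:] ^ t * [:(-1::'a) ^ t:]"
      by (subst power_minus) (cases "even t"; auto)
    then show "(- [:0, 1:]) ^ t * [:sg t A:] = monom ((-1) ^ t * sg t A) t"
      by (simp add: monom_altdef mult.commute)
  qed
  finally show ?thesis .
qed

lemma coeff_dpoly: "A \<in> carrier_mat n n \<Longrightarrow> coeff (dpoly A) t = (-1) ^ t * sg t A"
  by (simp add: dpoly_eq coeff_sum sg_gt if_distrib[of "\<lambda>x. x = _"] sum.delta)

lemma sg_coeff_dpoly: "A \<in> carrier_mat n n \<Longrightarrow> sg t A = (-1) ^ t * coeff (dpoly A) t"
  by (simp add: coeff_dpoly flip: mult.assoc power_add)

lemma sg_eqI_dpoly: "A \<in> carrier_mat n n \<Longrightarrow> B \<in> carrier_mat m m \<Longrightarrow> dpoly A = dpoly B \<Longrightarrow> sg t A = sg t B"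
  by (simp add: sg_coeff_dpoly)

lemma det_one_add:
  assumes A: "A \<in> carrier_mat n n"
  shows "det (1\<^sub>m n + y \<cdot>\<^sub>m A) = (\<Sum>t\<le>n. y ^ t * sg t A)"
proof -
  have "1\<^sub>m n + y \<cdot>\<^sub>m A = 1 \<cdot>\<^sub>m 1\<^sub>m n + y \<cdot>\<^sub>m A"
    using A by (intro eq_matI) auto
  then show ?thesis using det_scalar_add[OF A, of 1 y] by simp
qed

lemma poly_dpoly:
  assumes A: "A \<in> carrier_mat n n"
  shows "poly (dpoly A) x = det (1\<^sub>m n + (- x) \<cdot>\<^sub>m A)"
  unfolding det_one_add[OF A] dpoly_eq[OF A] poly_sum poly_monom
  by (intro sum.cong refl) (simp add: power_minus[of x])

section \<open>Polynomials in one matrix\<close>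

definition mp :: "'r::comm_ring_1 mat \<Rightarrow> 'r poly \<Rightarrow> 'r mat" where
  "mp W p = mat (dim_row W) (dim_row W) (\<lambda>(i, j). \<Sum>k\<le>degree p. coeff p k * (W ^\<^sub>m k) $$ (i, j))"

lemma mp_carrier [simp]: "W \<in> carrier_mat n n \<Longrightarrow> mp W p \<in> carrier_mat n n"
  by (simp add: mp_def)

lemma mp_dim [simp]: "dim_row (mp W p) = dim_row W" "dim_col (mp W p) = dim_row W"
  by (simp_all add: mp_def)

lemma mp_index:
  assumes "W \<in> carrier_mat n n" "i < n" "j < n" "degree p \<le> N"
  shows "mp W p $$ (i, j) = (\<Sum>k\<le>N. coeff p k * (W ^\<^sub>m k) $$ (i, j))"
proof -
  have "mp W p $$ (i, j) = (\<Sum>k\<le>degree p. coeff p k * (W ^\<^sub>m k) $$ (i, j))"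
    using assms by (simp add: mp_def)
  also have "\<dots> = (\<Sum>k\<le>N. coeff p k * (W ^\<^sub>m k) $$ (i, j))"
    using assms(4) by (intro sum.mono_neutral_left) (auto simp: coeff_eq_0)
  finally show ?thesis .
qed

lemma mp_one: "W \<in> carrier_mat n n \<Longrightarrow> mp W 1 = 1\<^sub>m n"
  by (intro eq_matI) (auto simp: mp_index[of W n _ _ 1 0] dest: mp_carrier[of W n 1])

text \<open>Products of polynomials in a matrix are always formed by one factor 1 + cz at a time:
  these are the factors of 1 - z^l, and the last factor of the geometric sum.\<close>

lemma mp_mult_linear:
  fixes W :: "'r::comm_ring_1 mat"
  assumes W: "W \<in> carrier_mat n n"
  shows "mp W (p * [:1, c:]) = mp W p * (1\<^sub>m n + c \<cdot>\<^sub>m W)"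
proof (rule eq_matI)
  fix i j assume "i < dim_row (mp W p * (1\<^sub>m n + c \<cdot>\<^sub>m W))" "j < dim_col (mp W p * (1\<^sub>m n + c \<cdot>\<^sub>m W))"
  then have ij: "i < n" "j < n" using W mp_carrier[OF W, of p] by auto
  let ?N = "degree p"
  have Wk: "W ^\<^sub>m k \<in> carrier_mat n n" for k using W by simp
  have "degree (p * [:1, c:]) \<le> Suc ?N"
    using degree_mult_le[of p "[:1, c:]"] degree_pCons_le[of 1 "[:c:]"] by simp
  moreover have cf: "coeff (p * [:1, c:]) k = coeff p k + c * coeff (pCons 0 p) k" for k
    by (simp add: coeff_pCons split: nat.split)
  ultimately have "mp W (p * [:1, c:]) $$ (i, j) = (\<Sum>k\<le>Suc ?N. (coeff p k + c * coeff (pCons 0 p) k) * (W ^\<^sub>m k) $$ (i, j))"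
    using mp_index[OF W ij, of "p * [:1, c:]" "Suc ?N"] by (simp only: cf)
  also have "\<dots> = (\<Sum>k\<le>Suc ?N. coeff p k * (W ^\<^sub>m k) $$ (i, j)) + c * (\<Sum>k\<le>Suc ?N. coeff (pCons 0 p) k * (W ^\<^sub>m k) $$ (i, j))"
    by (simp add: algebra_simps sum.distrib sum_distrib_left del: sum.atMost_Suc)
  also have "(\<Sum>k\<le>Suc ?N. coeff p k * (W ^\<^sub>m k) $$ (i, j)) = mp W p $$ (i, j)"
    by (rule mp_index[symmetric]) (use ij W in auto)
  also have "(\<Sum>k\<le>Suc ?N. coeff (pCons 0 p) k * (W ^\<^sub>m k) $$ (i, j)) = (\<Sum>k\<le>?N. coeff p k * (W ^\<^sub>m Suc k) $$ (i, j))"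
    by (subst sum.atMost_Suc_shift) simp
  also have "\<dots> = (\<Sum>k\<le>?N. \<Sum>m = 0..<n. coeff p k * ((W ^\<^sub>m k) $$ (i, m) * W $$ (m, j)))"
    using ij W Wk by (auto simp: scalar_prod_def sum_distrib_left simp del: assoc_mult_mat)
  also have "\<dots> = (\<Sum>m = 0..<n. mp W p $$ (i, m) * W $$ (m, j))"
    using ij W by (subst sum.swap) (simp add: mp_index[OF W _ _ order_refl] sum_distrib_right mult.assoc)
  finally have "mp W (p * [:1, c:]) $$ (i, j) = mp W p $$ (i, j) + c * (\<Sum>m = 0..<n. mp W p $$ (i, m) * W $$ (m, j))" .
  also have "\<dots> = (mp W p + c \<cdot>\<^sub>m (mp W p * W)) $$ (i, j)"
    using ij W mp_carrier[OF W, of p] by (simp add: scalar_prod_def)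
  also have "mp W p + c \<cdot>\<^sub>m (mp W p * W) = mp W p * (1\<^sub>m n + c \<cdot>\<^sub>m W)"
    using W mp_carrier[OF W, of p]
    by (subst mult_add_distrib_mat[of _ n n _ n]) (auto simp: mult_smult_distrib[of _ n n _ n] right_mult_one_mat[of _ n n])
  finally show "mp W (p * [:1, c:]) $$ (i, j) = (mp W p * (1\<^sub>m n + c \<cdot>\<^sub>m W)) $$ (i, j)" .
qed (use W mp_carrier[OF W] in auto)

lemma det_mp_prod:
  assumes W: "W \<in> carrier_mat n n"
  shows "det (mp W (\<Prod>c\<leftarrow>cs. [:1, c:])) = (\<Prod>c\<leftarrow>cs. det (1\<^sub>m n + c \<cdot>\<^sub>m W))"
proof (induction cs)
  case Nil
  then show ?case by (simp add: mp_one[OF W])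
next
  case (Cons c cs)
  have "(\<Prod>c\<leftarrow>c # cs. [:1, c:]) = (\<Prod>c\<leftarrow>cs. [:1, c:]) * [:1, c:]" by (simp only: list.map prod_list.Cons mult.commute)
  then have "det (mp W (\<Prod>c\<leftarrow>c # cs. [:1, c:])) = det (mp W (\<Prod>c\<leftarrow>cs. [:1, c:])) * det (1\<^sub>m n + c \<cdot>\<^sub>m W)"
    using W by (simp only: mp_mult_linear[OF W]) (rule det_mult[of _ n], auto)
  then show ?case using Cons by simp
qed

lemma mp_one_add_monom:
  assumes W: "W \<in> carrier_mat n n" and l: "l > 0"
  shows "mp W (1 + monom c l) = 1\<^sub>m n + c \<cdot>\<^sub>m (W ^\<^sub>m l)"
proof (rule eq_matI)
  fix i j assume "i < dim_row (1\<^sub>m n + c \<cdot>\<^sub>m (W ^\<^sub>m l))" "j < dim_col (1\<^sub>m n + c \<cdot>\<^sub>m (W ^\<^sub>m l))"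
  then have ij: "i < n" "j < n" using W l by auto
  have "degree (1 + monom c l) \<le> l" by (rule degree_add_le) (auto simp: degree_monom_le)
  then have "mp W (1 + monom c l) $$ (i, j) = (\<Sum>k\<le>l. ((if k = 0 then 1 else 0) + (if k = l then c else 0)) * (W ^\<^sub>m k) $$ (i, j))"
    using ij W by (subst mp_index) (auto simp: coeff_monom intro!: sum.cong)
  also have "\<dots> = (\<Sum>k\<le>l. (if k = 0 then (W ^\<^sub>m 0) $$ (i, j) else 0) + (if k = l then c * (W ^\<^sub>m l) $$ (i, j) else 0))"
    using l by (intro sum.cong) auto
  also have "\<dots> = (W ^\<^sub>m 0) $$ (i, j) + c * (W ^\<^sub>m l) $$ (i, j)"
    by (simp add: sum.distrib)
  finally show "mp W (1 + monom c l) $$ (i, j) = (1\<^sub>m n + c \<cdot>\<^sub>m (W ^\<^sub>m l)) $$ (i, j)"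
    using ij W by simp
qed (use W mp_carrier[OF W] in auto)

lemma geometric_mat:
  fixes W :: "'r::comm_ring_1 mat"
  assumes W: "W \<in> carrier_mat n n" and N: "N > 0"
  shows "mp W (\<Sum>k<N. monom 1 k) * (1\<^sub>m n + (-1) \<cdot>\<^sub>m W) = 1\<^sub>m n + (-1) \<cdot>\<^sub>m (W ^\<^sub>m N)"
proof -
  have "(\<Sum>k<N. monom 1 k) * [:1, -1:] = 1 + monom (-1::'r) N"
  proof (induction N)
    case (Suc N)
    have "(\<Sum>k<Suc N. monom 1 k) * [:1, -1::'r:] = 1 + monom (-1) N + monom 1 N * [:1, -1:]"
      using Suc by (simp only: sum.lessThan_Suc distrib_right)
    also have "\<dots> = 1 + monom (-1) (Suc N)"
      by (simp add: monom_Suc minus_monom poly_eq_iff coeff_monom)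
    finally show ?case .
  qed (simp add: one_pCons monom_0)
  then show ?thesis
    using mp_mult_linear[OF W, of "\<Sum>k<N. monom 1 k" "-1"] mp_one_add_monom[OF W N] by simp
qed

text \<open>For W = zA over the polynomial ring, W^N = 0 turns the geometric sum into an inverse of
  1 - W. Hence det(1 - zA) is a unit, that is a constant, and its value at z = 0 is 1.\<close>

lemma dpoly_nilpotent:
  fixes A :: "'r::idom mat"
  assumes A: "A \<in> carrier_mat n n" and N: "A ^\<^sub>m N = 0\<^sub>m n n"
  shows "dpoly A = 1"
proof (cases "N = 0")
  case True
  then have "1\<^sub>m n = (0\<^sub>m n n :: 'r mat)" using N A by simp
  from arg_cong[OF this, of "\<lambda>M. M $$ (0, 0)"] have "n = 0" by (cases n) auto
  then show ?thesis using dpoly_eq[OF A] by (simp add: monom_0)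
next
  case False
  interpret C: comm_ring_hom "\<lambda>a::'r. [:a:]" by (rule comm_ring_hom_pCons)
  define W where "W = [:0, 1:] \<cdot>\<^sub>m map_mat (\<lambda>a. [:a:]) A"
  have W: "W \<in> carrier_mat n n" using A by (simp add: W_def)
  have "W ^\<^sub>m k = [:0, 1:] ^ k \<cdot>\<^sub>m map_mat (\<lambda>a. [:a:]) (A ^\<^sub>m k)" for k
  proof (induction k)
    case 0
    then show ?case using A by (auto simp: W_def intro!: eq_matI)
  next
    case (Suc k)
    have "W ^\<^sub>m Suc k = ([:0, 1:] ^ k \<cdot>\<^sub>m map_mat (\<lambda>a. [:a:]) (A ^\<^sub>m k)) * W" using Suc by simp
    also have "\<dots> = ([:0, 1:] ^ k * [:0, 1:]) \<cdot>\<^sub>m (map_mat (\<lambda>a. [:a:]) (A ^\<^sub>m k) * map_mat (\<lambda>a. [:a:]) A)"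
      unfolding W_def using A
      by (subst mult_smult_assoc_mat[of _ n n _ n], simp, simp, subst mult_smult_distrib[of _ n n _ n])
         (auto intro!: eq_matI)
    also have "map_mat (\<lambda>a. [:a:]) (A ^\<^sub>m k) * map_mat (\<lambda>a. [:a:]) A = map_mat (\<lambda>a. [:a:]) (A ^\<^sub>m Suc k)"
      using A by (simp add: C.mat_hom_mult[of _ n n _ n])
    finally show ?case by (simp only: power_Suc2)
  qed
  then have "W ^\<^sub>m N = 0\<^sub>m n n" using N by (auto intro!: eq_matI)
  then have "mp W (\<Sum>k<N. monom 1 k) * (1\<^sub>m n + (-1) \<cdot>\<^sub>m W) = 1\<^sub>m n"
    using geometric_mat[OF W, of N] False by (auto intro!: eq_matI)
  then have "det (mp W (\<Sum>k<N. monom 1 k)) * det (1\<^sub>m n + (-1) \<cdot>\<^sub>m W) = 1"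
    using W det_mult[of "mp W (\<Sum>k<N. monom 1 k)" n "1\<^sub>m n + (-1) \<cdot>\<^sub>m W"] by simp
  moreover have "1\<^sub>m n + (-1) \<cdot>\<^sub>m W = 1\<^sub>m (dim_row A) + (- [:0, 1:]) \<cdot>\<^sub>m map_mat (\<lambda>a. [:a:]) A"
    using A by (auto simp: W_def intro!: eq_matI)
  ultimately have "dpoly A dvd 1" unfolding dpoly_def by (metis dvd_triv_right)
  then have "degree (dpoly A) = 0" by (rule poly_dvd_1[THEN iffD1, THEN conjunct1])
  moreover have "coeff (dpoly A) 0 = 1" using coeff_dpoly[OF A, of 0] by simp
  ultimately show ?thesis by (metis coeff_pCons_0 degree_eq_zeroE one_pCons)
qed

text \<open>Sylvester's identity. Multiplying the block matrix \<open>?M\<close> by the unipotent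
  \<open>?U\<close> from the right and from the left makes it triangular, with 1 + AB and 1 + BA
  respectively as the only diagonal block different from 1; both products have the same
  determinant.\<close>

lemma det_one_add_mult_commute:
  fixes A B :: "'r::idom mat"
  assumes A: "A \<in> carrier_mat n n" and B: "B \<in> carrier_mat n n"
  shows "det (1\<^sub>m n + A * B) = det (1\<^sub>m n + B * A)"
proof -
  let ?M = "four_block_mat (1\<^sub>m n) (- A) B (1\<^sub>m n)"
  let ?U = "four_block_mat (1\<^sub>m n) (0\<^sub>m n n) (- B) (1\<^sub>m n)"
  have M: "?M \<in> carrier_mat (n + n) (n + n)" and U: "?U \<in> carrier_mat (n + n) (n + n)"
    using A B by auto
  have dU: "det ?U = 1" using B by (subst det_four_block_mat_upper_right_zero[of _ n _ n]) auto
  have "?M * ?U = four_block_mat (1\<^sub>m n + A * B) (- A) (0\<^sub>m n n) (1\<^sub>m n)"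
    using A B by (subst mult_four_block_mat[of _ n n _ n _ n _ _ n _ n]) (auto intro!: cong_four_block_mat)
  then have "det (?M * ?U) = det (1\<^sub>m n + A * B)"
    using A B det_four_block_mat_lower_left_zero[of "1\<^sub>m n + A * B" n "- A" n "0\<^sub>m n n" "1\<^sub>m n"] by auto
  moreover have "?U * ?M = four_block_mat (1\<^sub>m n) (- A) (0\<^sub>m n n) (1\<^sub>m n + B * A)"
    using A B by (subst mult_four_block_mat[of _ n n _ n _ n _ _ n _ n]) (auto intro!: cong_four_block_mat comm_add_mat[of _ n n])
  then have "det (?U * ?M) = det (1\<^sub>m n + B * A)"
    using A B det_four_block_mat_lower_left_zero[of "1\<^sub>m n" n "- A" n "0\<^sub>m n n" "1\<^sub>m n + B * A"] by auto
  ultimately show ?thesis using det_mult[OF M U] det_mult[OF U M] dU by simp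
qed

lemma dpoly_mult_commute:
  fixes A B :: "'r::idom mat"
  assumes A: "A \<in> carrier_mat n n" and B: "B \<in> carrier_mat n n"
  shows "dpoly (A * B) = dpoly (B * A)"
proof -
  interpret C: comm_ring_hom "\<lambda>a::'r. [:a:]" by (rule comm_ring_hom_pCons)
  let ?h = "map_mat (\<lambda>a::'r. [:a:])"
  let ?z = "- [:0, 1:] :: 'r poly"
  have "1\<^sub>m n + ?z \<cdot>\<^sub>m ?h (A * B) = 1\<^sub>m n + (?z \<cdot>\<^sub>m ?h A) * ?h B"
    using A B by (simp add: C.mat_hom_mult[of _ n n _ n] mult_smult_assoc_mat[of _ n n _ n])
  moreover have "1\<^sub>m n + ?z \<cdot>\<^sub>m ?h (B * A) = 1\<^sub>m n + ?h B * (?z \<cdot>\<^sub>m ?h A)"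
    using A B by (simp add: C.mat_hom_mult[of _ n n _ n] mult_smult_distrib[of _ n n _ n])
  ultimately show ?thesis
    unfolding dpoly_def using A B det_one_add_mult_commute[of "?z \<cdot>\<^sub>m ?h A" n "?h B"] by simp
qed

lemma sg_mult_commute:
  fixes A B :: "'r::idom mat"
  assumes "A \<in> carrier_mat n n" "B \<in> carrier_mat n n"
  shows "sg t (A * B) = sg t (B * A)"
  using assms by (intro sg_eqI_dpoly[of _ n _ n] dpoly_mult_commute) auto

abbreviation dsum :: "'r::zero mat \<Rightarrow> 'r mat \<Rightarrow> 'r mat" where
  "dsum A B \<equiv> four_block_mat A (0\<^sub>m (dim_row A) (dim_col B)) (0\<^sub>m (dim_row B) (dim_col A)) B"

lemma dpoly_dsum:
  fixes A B :: "'r::idom mat"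
  assumes A: "A \<in> carrier_mat n n" and B: "B \<in> carrier_mat m m"
  shows "dpoly (dsum A B) = dpoly A * dpoly B"
proof -
  let ?h = "map_mat (\<lambda>a::'r. [:a:])"
  let ?z = "- [:0, 1:] :: 'r poly"
  have "1\<^sub>m (n + m) + ?z \<cdot>\<^sub>m ?h (dsum A B) =
    four_block_mat (1\<^sub>m n + ?z \<cdot>\<^sub>m ?h A) (0\<^sub>m n m) (0\<^sub>m m n) (1\<^sub>m m + ?z \<cdot>\<^sub>m ?h B)"
    using A B by (auto intro!: eq_matI)
  then show ?thesis
    unfolding dpoly_def using A B
      det_four_block_mat_lower_left_zero[of "1\<^sub>m n + ?z \<cdot>\<^sub>m ?h A" n "0\<^sub>m n m" m "0\<^sub>m m n" "1\<^sub>m m + ?z \<cdot>\<^sub>m ?h B"]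
    by simp
qed

text \<open>Over an algebraically closed field a polynomial is a constant times a product of factors
  z - x. As its value at 0 is 1, no root is 0, and each factor can be rescaled to 1 - z/x; the
  scalars multiply to 1.\<close>

lemma split_monic_at_0:
  fixes p :: "'k::alg_closed_field poly"
  assumes "coeff p 0 = 1"
  shows "\<exists>cs. p = (\<Prod>c\<leftarrow>cs. [:1, c:])"
proof -
  have "p \<noteq> 0" using assms by auto
  from alg_closed_imp_factorization[OF this] obtain A where A: "p = smult (coeff p (degree p)) (\<Prod>x\<in>#A. [:-x, 1:])" by blast
  obtain xs where xs: "mset xs = A" by (rule ex_mset[THEN exE])
  have p: "p = smult (coeff p (degree p)) (\<Prod>x\<leftarrow>xs. [:-x, 1:])" using A xs by (metis mset_map prod_mset_prod_list)
  have c0: "coeff (\<Prod>x\<leftarrow>xs. [:-x, 1:]) 0 = (\<Prod>x\<leftarrow>xs. - x)"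
    by (induction xs) (auto simp: coeff_mult_0)
  with assms p have one: "coeff p (degree p) * (\<Prod>x\<leftarrow>xs. - x) = 1" by (metis coeff_smult)
  then have nz: "(\<Prod>x\<leftarrow>xs. - x) \<noteq> 0" by (metis mult_zero_right zero_neq_one)
  have "(\<Prod>x\<leftarrow>xs. - x) \<noteq> 0 \<Longrightarrow> (\<Prod>x\<leftarrow>xs. [:-x, 1:]) = smult (\<Prod>x\<leftarrow>xs. - x) (\<Prod>x\<leftarrow>xs. [:1, - inverse x:])" for xs :: "'k list"
  proof (induction xs)
    case (Cons x xs)
    then have "x \<noteq> 0" by auto
    then have x: "[:-x, 1:] = smult (-x) [:1, - inverse x:]" by simp
    have "(\<Prod>x\<leftarrow>xs. - x) \<noteq> 0" using Cons.prems by simp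
    note IH = Cons.IH[OF this]
    show ?case
      by (simp only: list.map prod_list.Cons x IH mult_smult_left mult_smult_right smult_smult mult.commute[of "- x"])
  qed simp
  from p[unfolded this[OF nz] smult_smult one] have "p = (\<Prod>c\<leftarrow>map (\<lambda>x. - inverse x) xs. [:1, c:])"
    by (simp add: comp_def)
  then show ?thesis by blast
qed

section \<open>Congruence modulo z^(N+1), and the characteristic polynomial of a power\<close>

definition cut :: "nat \<Rightarrow> 'r::comm_ring_1 poly \<Rightarrow> 'r poly \<Rightarrow> bool" where
  "cut N p q \<longleftrightarrow> (\<forall>i\<le>N. coeff p i = coeff q i)"

lemma cut_refl [simp]: "cut N p p" by (simp add: cut_def)
lemma cut_mult: "cut N p q \<Longrightarrow> cut N p' q' \<Longrightarrow> cut N (p * p') (q * q')"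
  by (auto simp: cut_def coeff_mult intro!: sum.cong)
lemma cut_sum: "(\<And>x. x \<in> S \<Longrightarrow> cut N (f x) (g x)) \<Longrightarrow> cut N (sum f S) (sum g S)"
  by (auto simp: cut_def coeff_sum intro!: sum.cong)
lemma cut_prod: "(\<And>x. x \<in> S \<Longrightarrow> cut N (f x) (g x)) \<Longrightarrow> cut N (prod f S) (prod g S)"
  by (induction S rule: infinite_finite_induct) (auto intro: cut_mult)
lemma cut_prod_list: "(\<And>x. x \<in> set xs \<Longrightarrow> cut N (f x) (g x)) \<Longrightarrow> cut N (\<Prod>x\<leftarrow>xs. f x) (\<Prod>x\<leftarrow>xs. g x)"
  by (induction xs) (auto intro: cut_mult)

lemma cut_det:
  assumes A: "A \<in> carrier_mat n n" and B: "B \<in> carrier_mat n n"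
    and "\<And>i j. i < n \<Longrightarrow> j < n \<Longrightarrow> cut N (A $$ (i, j)) (B $$ (i, j))"
  shows "cut N (det A) (det B)"
  unfolding det_def'[OF A] det_def'[OF B] using assms(3)
  by (intro cut_sum cut_mult cut_prod) (auto simp: permutes_in_image)

text \<open>The factors 1 + cz of 1 - z^l, evaluated at xA, write 1 - x^l A^l as a product of
  matrices 1 + cxA, whose determinants are the values of \<open>dpoly A\<close> at -cx. Equality at
  all points of an infinite domain is equality of polynomials.\<close>

lemma dpoly_pow:
  fixes A :: "'k::idom mat"
  assumes A: "A \<in> carrier_mat n n" and l: "l > 0" and inf: "infinite (UNIV :: 'k set)"
    and cs: "1 + monom (-1) l = (\<Prod>c\<leftarrow>cs. [:1, c:])"
  shows "pcompose (dpoly (A ^\<^sub>m l)) (monom 1 l) = (\<Prod>c\<leftarrow>cs. pcompose (dpoly A) [:0, - c:])" (is "?L = ?R")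
proof -
  have "poly (?L - ?R) x = 0" for x
  proof -
    define W where "W = x \<cdot>\<^sub>m A"
    have W: "W \<in> carrier_mat n n" using A by (simp add: W_def)
    have Wl: "W ^\<^sub>m k = x ^ k \<cdot>\<^sub>m (A ^\<^sub>m k)" for k
    proof (induction k)
      case (Suc k)
      then have "W ^\<^sub>m Suc k = (x ^ k \<cdot>\<^sub>m (A ^\<^sub>m k)) * (x \<cdot>\<^sub>m A)" by (simp add: W_def)
      also have "\<dots> = x ^ Suc k \<cdot>\<^sub>m (A ^\<^sub>m Suc k)"
        using A by (auto simp: mult_smult_assoc_mat[of _ n n _ n] mult_smult_distrib[of _ n n _ n] intro!: eq_matI)
      finally show ?case .
    qed (use A in \<open>auto simp: W_def intro!: eq_matI\<close>)
    have "poly ?L x = poly (dpoly (A ^\<^sub>m l)) (x ^ l)" by (simp add: poly_pcompose poly_monom)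
    also have "\<dots> = det (1\<^sub>m n + (-1) \<cdot>\<^sub>m (W ^\<^sub>m l))"
      using A by (subst poly_dpoly[of _ n]) (auto simp: Wl intro!: arg_cong[where f = det] eq_matI)
    also have "\<dots> = (\<Prod>c\<leftarrow>cs. det (1\<^sub>m n + c \<cdot>\<^sub>m W))"
      using det_mp_prod[OF W, of cs] mp_one_add_monom[OF W l, of "-1"] cs by simp
    also have "\<dots> = (\<Prod>c\<leftarrow>cs. poly (dpoly A) (- (c * x)))"
      using A by (subst poly_dpoly[of _ n]) (auto simp: W_def intro!: arg_cong[where f = prod_list] arg_cong[where f = det] eq_matI)
    also have "\<dots> = poly ?R x"
      by (simp add: poly_prod_list comp_def poly_pcompose mult.commute)
    finally show ?thesis by simp
  qed
  then have "?L - ?R = 0" using poly_roots_finite[of "?L - ?R"] inf by auto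
  then show ?thesis by simp
qed

lemma coeff_pcompose_monom_mult:
  fixes p :: "'r::comm_ring_1 poly"
  assumes "l > 0"
  shows "coeff (pcompose p (monom 1 l)) (l * t) = coeff p t"
proof (induction p arbitrary: t)
  case (pCons a p)
  show ?case
  proof (cases t)
    case 0
    then show ?thesis using assms by (simp add: pcompose_pCons coeff_monom_mult coeff_mult_0)
  next
    case (Suc s)
    then have "l * t = l * s + l" by simp
    moreover have "coeff [:a:] (l * t) = 0" using Suc assms by (cases "l * t") auto
    ultimately show ?thesis using Suc pCons.IH[of s]
      by (simp add: pcompose_pCons coeff_monom_mult)
  qed
qed simp

text \<open>By \<open>dpoly_pow\<close>, \<sigma>_t of the l-th power of \<open>A\<close> is, up to
  sign, the coefficient of z^(tl) in a product of rescaled copies of \<open>dpoly A\<close>, hence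
  determined by the coefficients of \<open>dpoly A\<close> up to tl. This replaces the theory of
  symmetric functions in the construction of P_{t,l} and holds across different sizes.\<close>

lemma sg_pow_cong:
  fixes A B :: "'k::alg_closed_field mat"
  assumes A: "A \<in> carrier_mat n n" and B: "B \<in> carrier_mat m m" and l: "l > 0"
    and inf: "infinite (UNIV :: 'k set)"
    and eq: "\<And>i. i \<le> t * l \<Longrightarrow> sg i A = sg i B"
  shows "sg t (A ^\<^sub>m l) = sg t (B ^\<^sub>m l)"
proof -
  have "coeff (1 + monom (-1 :: 'k) l) 0 = 1" using l by simp
  from split_monic_at_0[OF this] obtain cs where cs: "1 + monom (-1 :: 'k) l = (\<Prod>c\<leftarrow>cs. [:1, c:])" by blast
  have "cut (t * l) (\<Prod>c\<leftarrow>cs. pcompose (dpoly A) [:0, - c:]) (\<Prod>c\<leftarrow>cs. pcompose (dpoly B) [:0, - c:])"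
    by (rule cut_prod_list) (use eq in \<open>auto simp: cut_def coeff_pcompose_linear coeff_dpoly[OF A] coeff_dpoly[OF B]\<close>)
  then have "cut (t * l) (pcompose (dpoly (A ^\<^sub>m l)) (monom 1 l)) (pcompose (dpoly (B ^\<^sub>m l)) (monom 1 l))"
    using dpoly_pow[OF A l inf cs] dpoly_pow[OF B l inf cs] by simp
  then have "coeff (pcompose (dpoly (A ^\<^sub>m l)) (monom 1 l)) (l * t) = coeff (pcompose (dpoly (B ^\<^sub>m l)) (monom 1 l)) (l * t)"
    by (simp add: cut_def mult.commute)
  then show ?thesis
    using A B sg_coeff_dpoly[of "A ^\<^sub>m l" n t] sg_coeff_dpoly[of "B ^\<^sub>m l" m t]
    by (simp add: coeff_pcompose_monom_mult[OF l])
qed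

subsection \<open>The polynomials \<open>P\<^bsub>t,l\<^esub>\<close>\<close>

text \<open>The shape of 1 - zC for the companion matrices \<open>C\<close> below: apart from an
  arbitrary first column, upper bidiagonal with unit diagonal.\<close>

definition tmat :: "nat \<Rightarrow> (nat \<Rightarrow> 'r::comm_ring_1) \<Rightarrow> (nat \<Rightarrow> 'r) \<Rightarrow> 'r mat" where
  "tmat N x c = mat N N (\<lambda>(i, j). (if j = 0 then x i else if i = j then 1 else 0) + (if j = Suc i then c i else 0))"

lemma tmat_carrier [simp]: "tmat N x c \<in> carrier_mat N N"
  by (simp add: tmat_def)

lemma det_tmat: "N > 0 \<Longrightarrow> det (tmat N x c) = (\<Sum>i<N. x i * (\<Prod>j<i. - c j))"
proof (induction N)
  case (Suc m)
  show ?case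
  proof (cases "m = 0")
    case True
    then show ?thesis by (simp add: tmat_def det_single)
  next
    case False
    let ?T = "tmat (Suc m) x c"
    have del_m: "mat_delete ?T m m = tmat m x c"
      by (auto simp: mat_delete_def tmat_def intro!: eq_matI)
    have del_0: "mat_delete ?T m 0 = mat m m (\<lambda>(i, j). (if i = Suc j then 1 else 0) + (if j = i then c i else 0))"
      by (auto simp: mat_delete_def tmat_def intro!: eq_matI)
    have "det (mat_delete ?T m 0) = prod_list (diag_mat (mat_delete ?T m 0))"
      by (rule det_lower_triangular[where n = m]) (auto simp: del_0)
    also have "\<dots> = (\<Prod>j<m. c j)"
      by (auto simp: del_0 diag_mat_def prod.list_conv_set_nth atLeast0LessThan intro!: prod.cong)
    finally have d0: "det (mat_delete ?T m 0) = (\<Prod>j<m. c j)" .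
    have "det ?T = (\<Sum>j<Suc m. ?T $$ (m, j) * cofactor ?T m j)"
      by (rule laplace_expansion_row) auto
    also have "\<dots> = (\<Sum>j\<in>{0, m}. ?T $$ (m, j) * cofactor ?T m j)"
      by (rule sum.mono_neutral_right) (auto simp: tmat_def)
    also have "\<dots> = x m * ((-1) ^ m * (\<Prod>j<m. c j)) + det (tmat m x c)"
      using False by (simp add: cofactor_def d0 del_m) (simp add: tmat_def)
    also have "(-1) ^ m * (\<Prod>j<m. c j) = (\<Prod>j<m. - c j)"
      by (subst prod_uminus) simp
    finally show ?thesis using Suc False by simp
  qed
qed simp

text \<open>The weights \<open>c\<close> on the superdiagonal are kept general because labelled
  cycles also lead to matrices of this form, with weight 0 where an edge is deleted.\<close>

definition companion :: "nat \<Rightarrow> (nat \<Rightarrow> 'r::comm_ring_1) \<Rightarrow> (nat \<Rightarrow> 'r) \<Rightarrow> 'r mat" where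
  "companion N a c = mat N N (\<lambda>(i, j). (if j = 0 then a i else 0) + (if j = Suc i then c i else 0))"

lemma companion_carrier [simp]: "companion N a c \<in> carrier_mat N N"
  by (simp add: companion_def)

lemma dpoly_companion:
  assumes "N > 0"
  shows "dpoly (companion N a c) = 1 - (\<Sum>i<N. monom (a i * (\<Prod>j<i. c j)) (Suc i))"
proof -
  have "1\<^sub>m N + (- [:0, 1:]) \<cdot>\<^sub>m map_mat (\<lambda>a. [:a:]) (companion N a c) =
    tmat N (\<lambda>i. (if i = 0 then 1 else 0) - monom (a i) 1) (\<lambda>i. - monom (c i) 1)"
    by (auto simp: companion_def tmat_def monom_altdef intro!: eq_matI)
  then have "dpoly (companion N a c) = (\<Sum>i<N. ((if i = 0 then 1 else 0) - monom (a i) 1) * (\<Prod>j<i. monom (c j) 1))"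
    unfolding dpoly_def using assms by (simp add: det_tmat carrier_matD[OF companion_carrier])
  also have "\<dots> = (\<Sum>i<N. (if i = 0 then 1 else 0) - monom (a i * (\<Prod>j<i. c j)) (Suc i))"
  proof (rule sum.cong[OF refl])
    fix i
    have "(\<Prod>j<i. monom (c j) 1) = monom (\<Prod>j<i. c j) i"
      by (induction i) (auto simp: mult_monom mult.commute monom_0 one_pCons)
    then show "((if i = 0 then 1 else 0) - monom (a i) 1) * (\<Prod>j<i. monom (c j) 1) =
      (if i = 0 then 1 else 0) - monom (a i * (\<Prod>j<i. c j)) (Suc i)"
      by (auto simp: left_diff_distrib mult_monom monom_0 one_pCons)
  qed
  also have "\<dots> = 1 - (\<Sum>i<N. monom (a i * (\<Prod>j<i. c j)) (Suc i))"
    using assms by (simp add: sum_subtractf)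
  finally show ?thesis .
qed

text \<open>The alternating signs in the first column cancel those of \<open>dpoly\<close>. So every
  sequence of values occurs as \<open>sg 1\<close>, ..., \<open>sg N\<close> of a matrix whose
  entries are 0 and 1 and, up to sign, these values.\<close>

lemma sg_companion:
  assumes "N > 0" "1 \<le> i" "i \<le> N"
  shows "sg i (companion N (\<lambda>j. (-1) ^ j * s (Suc j)) (\<lambda>_. 1)) = s i"
proof -
  obtain j where j: "i = Suc j" "j < N" using assms by (cases i) auto
  have "coeff (dpoly (companion N (\<lambda>j. (-1) ^ j * s (Suc j)) (\<lambda>_. 1))) i = - ((-1) ^ j * s i)"
    unfolding dpoly_companion[OF assms(1)] using j
    by (simp add: coeff_sum)
  then show ?thesis
    by (subst sg_coeff_dpoly[of _ N]) (use j in \<open>auto simp flip: mult.assoc power_add\<close>)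
qed

lemma infinite_alg_closure: "infinite (UNIV :: 'f::field set) \<Longrightarrow> infinite (UNIV :: 'f alg_closure set)"
  using inj_to_ac[where ?'a = 'f] by (metis finite_imageD finite_subset subset_UNIV)

lemma comm_ring_hom_to_ac: "comm_ring_hom (to_ac :: 'f::field \<Rightarrow> _)"
  by standard auto

section \<open>Polynomials with coefficients in the image of the integers\<close>

definition int_polys :: "'v set \<Rightarrow> ('v, 'f::comm_ring_1) mpoly set" where
  "int_polys V = {P. \<forall>m\<in>Poly_Mapping.keys P. Poly_Mapping.keys m \<subseteq> V \<and> Poly_Mapping.lookup P m \<in> \<int>}"

lemma int_polys_lookup: "P \<in> int_polys V \<Longrightarrow> Poly_Mapping.lookup P m \<in> \<int>"
  by (cases "m \<in> Poly_Mapping.keys P") (auto simp: int_polys_def in_keys_iff)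

lemma int_polys_add:
  assumes P: "P \<in> int_polys V" and Q: "Q \<in> int_polys V"
  shows "P + Q \<in> int_polys V"
  unfolding int_polys_def
proof (intro CollectI ballI conjI)
  fix m assume "m \<in> Poly_Mapping.keys (P + Q)"
  then have "m \<in> Poly_Mapping.keys P \<union> Poly_Mapping.keys Q" using keys_add[of P Q] by blast
  then show "Poly_Mapping.keys m \<subseteq> V" using P Q by (auto simp: int_polys_def)
  show "Poly_Mapping.lookup (P + Q) m \<in> \<int>"
    unfolding lookup_add by (intro Ints_add int_polys_lookup[OF P] int_polys_lookup[OF Q])
qed

lemma int_polys_zero: "0 \<in> int_polys V"
  by (simp add: int_polys_def)

lemma int_polys_sum: "(\<And>x. x \<in> S \<Longrightarrow> f x \<in> int_polys V) \<Longrightarrow> sum f S \<in> int_polys V"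
  by (induction S rule: infinite_finite_induct) (auto intro: int_polys_add int_polys_zero)

lemma int_polys_single: "Poly_Mapping.keys m \<subseteq> V \<Longrightarrow> a \<in> \<int> \<Longrightarrow> Poly_Mapping.single m a \<in> int_polys V"
  by (auto simp: int_polys_def)

lemma int_polys_mult:
  assumes "P \<in> int_polys V" "Q \<in> int_polys V"
  shows "P * Q \<in> int_polys V"
proof -
  have "P * Q = (\<Sum>m\<in>Poly_Mapping.keys P. \<Sum>m'\<in>Poly_Mapping.keys Q.
      Poly_Mapping.single (m + m') (Poly_Mapping.lookup P m * Poly_Mapping.lookup Q m'))"
    by (subst poly_mapping_sum_single[of P], subst poly_mapping_sum_single[of Q])
       (simp add: sum_product mult_single)
  also have "\<dots> \<in> int_polys V"
  proof (intro int_polys_sum int_polys_single)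
    fix m m' assume "m \<in> Poly_Mapping.keys P" "m' \<in> Poly_Mapping.keys Q"
    then have "Poly_Mapping.keys m \<union> Poly_Mapping.keys m' \<subseteq> V"
      using assms by (auto simp: int_polys_def)
    with keys_add[of m m'] show "Poly_Mapping.keys (m + m') \<subseteq> V" by (rule subset_trans)
  qed (use assms in \<open>auto intro: Ints_mult int_polys_lookup\<close>)
  finally show ?thesis .
qed

lemma int_polys_prod: "(\<And>x. x \<in> S \<Longrightarrow> f x \<in> int_polys V) \<Longrightarrow> prod f S \<in> int_polys V"
  by (induction S rule: infinite_finite_induct)
     (auto intro: int_polys_mult int_polys_single[of 0 V 1, simplified])

lemma int_polys_of_int: "of_int k \<in> int_polys V"
  using int_polys_single[of 0 V "of_int k"] by (simp flip: single_of_int)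

lemma int_polys_Var: "v \<in> V \<Longrightarrow> Var v \<in> int_polys V"
  unfolding Var_def by (rule int_polys_single) auto

lemma int_polys_sg:
  assumes "A \<in> carrier_mat n n" "\<And>i j. i < n \<Longrightarrow> j < n \<Longrightarrow> A $$ (i, j) \<in> int_polys V"
  shows "sg t A \<in> int_polys V"
  unfolding sg_def using assms
  by (intro int_polys_sum int_polys_mult int_polys_prod int_polys_of_int) (auto simp: permutes_in_image subset_eq)

lemma int_polys_pow_mat:
  assumes A: "A \<in> carrier_mat n n" "\<And>i j. i < n \<Longrightarrow> j < n \<Longrightarrow> A $$ (i, j) \<in> int_polys V"
  shows "i < n \<Longrightarrow> j < n \<Longrightarrow> (A ^\<^sub>m k) $$ (i, j) \<in> int_polys V"
proof (induction k arbitrary: i j)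
  case 0
  then show ?case using A int_polys_of_int[of 0 V] int_polys_of_int[of 1 V] by auto
next
  case (Suc k)
  have "A ^\<^sub>m k \<in> carrier_mat n n" using A by simp
  with Suc A show ?case by (auto simp: scalar_prod_def intro!: int_polys_sum int_polys_mult)
qed

lemma (in comm_ring_hom) mat_hom_sg_pow:
  assumes "A \<in> carrier_mat n n"
  shows "hom (sg t (A ^\<^sub>m l)) = sg t (map_mat hom A ^\<^sub>m l)"
  using assms by (subst sg_hom[symmetric, of _ n]) (auto simp: mat_hom_pow[OF assms])

text \<open>\<sigma>_t of the l-th power of a generic companion matrix of size tl. In this form the
  coefficients are visibly integral; the variable \<open>i\<close> stands for \<sigma>_i.\<close>

definition P_companion :: "nat \<Rightarrow> nat \<Rightarrow> (nat, 'f::field) mpoly" where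
  "P_companion t l = sg t (companion (t * l) (\<lambda>j. (-1) ^ j * Var (Suc j)) (\<lambda>_. 1) ^\<^sub>m l)"

lemma P_companion_in: "P_companion t l \<in> int_polys {1..t * l}"
proof -
  have "(- 1) ^ i \<in> int_polys {1..t * l}" for i
    using int_polys_of_int[of "(-1) ^ i"] by simp
  then show ?thesis
    unfolding P_companion_def
    by (intro int_polys_sg[of _ "t * l"] int_polys_pow_mat[of _ "t * l"])
       (use int_polys_of_int[of 0 "{1..t * l}"] int_polys_of_int[of 1 "{1..t * l}"] in
         \<open>auto simp: companion_def intro!: int_polys_add int_polys_mult int_polys_Var\<close>)
qed

text \<open>After substitution the companion matrix and \<open>A\<close> have the same
  \<open>sg i\<close> for i up to tl, hence by \<open>sg_pow_cong\<close> the same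
  \<open>sg t\<close> of their l-th powers. The size \<open>m\<close> is arbitrary, also below
  tl.\<close>

lemma meval_P_companion:
  fixes c :: "'f::field \<Rightarrow> 'k::alg_closed_field"
  assumes c: "comm_ring_hom c" and inf: "infinite (UNIV :: 'k set)"
    and A: "A \<in> carrier_mat m m" and t: "t > 0" and l: "l > 0"
  shows "meval c (\<lambda>i. sg i A) (P_companion t l) = sg t (A ^\<^sub>m l)"
proof -
  interpret e: comm_ring_hom "meval c (\<lambda>i. sg i A) :: (nat, 'f) mpoly \<Rightarrow> _" by (rule comm_ring_hom_meval[OF c])
  have N: "t * l > 0" using t l by simp
  let ?C = "companion (t * l) (\<lambda>j. (-1) ^ j * sg (Suc j) A) (\<lambda>_. 1)"
  have "map_mat (meval c (\<lambda>i. sg i A)) (companion (t * l) (\<lambda>j. (-1) ^ j * Var (Suc j)) (\<lambda>_. 1)) = ?C"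
    by (auto simp: companion_def e.hom_add e.hom_mult e.hom_power e.hom_uminus meval_Var[OF c] intro!: eq_matI)
  then have "meval c (\<lambda>i. sg i A) (P_companion t l) = sg t (?C ^\<^sub>m l)"
    unfolding P_companion_def by (subst e.mat_hom_sg_pow[of _ "t * l"]) auto
  also have "\<dots> = sg t (A ^\<^sub>m l)"
  proof (rule sg_pow_cong[OF companion_carrier A l inf])
    fix i assume "i \<le> t * l"
    then show "sg i ?C = sg i A"
      using sg_companion[OF N, of i "\<lambda>j. sg j A"] by (cases "i = 0") auto
  qed
  finally show ?thesis .
qed

lemma mpoly_eq_if_meval_eq:
  fixes f g :: "('v, 'f::field) mpoly"
  assumes "infinite (UNIV :: 'f set)" "\<And>h. meval to_ac h f = meval to_ac h g"
  shows "f = g"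
proof -
  have "f - g = 0"
  proof (rule mpoly_zero_if_vanishing[OF comm_ring_hom_to_ac inj_to_ac infinite_alg_closure[OF assms(1)]])
    fix h :: "'v \<Rightarrow> 'f alg_closure"
    interpret e: comm_ring_hom "meval to_ac h :: ('v, 'f) mpoly \<Rightarrow> _" by (rule comm_ring_hom_meval[OF comm_ring_hom_to_ac])
    show "meval to_ac h (f - g) = 0" by (simp add: e.hom_minus assms(2))
  qed
  then show ?thesis by simp
qed

lemma meval_peval:
  assumes c: "comm_ring_hom (c :: 'f::comm_ring_1 \<Rightarrow> 'r::comm_ring_1)"
  shows "meval c h (peval g f) = meval c (\<lambda>v. meval c h (g v)) f"
  unfolding peval_meval
proof (rule comm_ring_hom_mpoly_eqI[where F = "\<lambda>f. meval c h (meval Const g f)"])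
  show "comm_ring_hom (\<lambda>f. meval c h (meval Const g f))"
    by (rule comm_ring_hom_comp[OF comm_ring_hom_meval[OF c] comm_ring_hom_meval[OF comm_ring_hom_Const]])
  show "comm_ring_hom (meval c (\<lambda>v. meval c h (g v)))" by (rule comm_ring_hom_meval[OF c])
qed (simp_all add: meval_Const[OF comm_ring_hom_Const] meval_Const[OF c] meval_Var[OF c] meval_Var[OF comm_ring_hom_Const])

text \<open>Resolves the definite description. For uniqueness, a companion matrix on which
  \<sigma>_1, ..., \<sigma>_{tl} are independent variables lets the defining identity recover the
  polynomial.\<close>

lemma P_poly_eq:
  assumes inf: "infinite (UNIV :: 'f::field set)" and t: "t > 0" and l: "l > 0"
  shows "(P_poly t l :: (nat, 'f) mpoly) = P_companion t l"
  unfolding P_poly_def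
proof (rule the_equality)
  have "sigma_mat t (A ^\<^sub>m l) = peval (\<lambda>i. sigma_mat i A) (P_companion t l)"
    if m: "m \<ge> t * l" and A: "(A :: 'f matvars mat) \<in> carrier_mat m m" for m A
  proof (rule mpoly_eq_if_meval_eq[OF inf])
    fix h :: "nat \<times> nat \<times> nat \<Rightarrow> 'f alg_closure"
    interpret e: comm_ring_hom "meval to_ac h :: 'f matvars \<Rightarrow> _" by (rule comm_ring_hom_meval[OF comm_ring_hom_to_ac])
    have tm: "t \<le> m" using m l by (metis le_trans mult_le_mono2 nat_mult_1_right Suc_leI One_nat_def)
    have "meval to_ac h (sigma_mat t (A ^\<^sub>m l)) = sg t (map_mat (meval to_ac h) A ^\<^sub>m l)"
      using A tm by (simp add: sg_eq_sigma_mat[of _ m] e.mat_hom_sg_pow[of _ m])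
    also have "\<dots> = meval to_ac (\<lambda>i. sg i (map_mat (meval to_ac h) A)) (P_companion t l)"
      using A by (intro meval_P_companion[symmetric, of _ _ m] comm_ring_hom_to_ac infinite_alg_closure inf t l) auto
    also have "\<dots> = meval to_ac (\<lambda>i. meval to_ac h (sigma_mat i A)) (P_companion t l)"
    proof (rule meval_cong)
      fix i assume "i \<in> mvars (P_companion t l :: (nat, 'f) mpoly)"
      then have "i \<in> {1..t * l}" using P_companion_in[of t l, where ?'a = 'f] unfolding mvars_def int_polys_def by blast
      then have "i \<le> m" using m by simp
      then show "sg i (map_mat (meval to_ac h) A) = meval to_ac h (sigma_mat i A)"
        using A by (simp add: sg_eq_sigma_mat[of _ m] e.sg_hom[of _ m])
    qed
    also have "\<dots> = meval to_ac h (peval (\<lambda>i. sigma_mat i A) (P_companion t l))"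
      by (rule meval_peval[OF comm_ring_hom_to_ac, symmetric])
    finally show "meval to_ac h (sigma_mat t (A ^\<^sub>m l)) = \<dots>" .
  qed
  then show "(\<forall>m\<in>Poly_Mapping.keys (P_companion t l :: (nat, 'f) mpoly). Poly_Mapping.keys m \<subseteq> {1..t * l} \<and> Poly_Mapping.lookup (P_companion t l :: (nat, 'f) mpoly) m \<in> \<int>) \<and>
     (\<forall>m A. m \<ge> t * l \<longrightarrow> A \<in> carrier_mat m m \<longrightarrow>
        sigma_mat t (A ^\<^sub>m l) = peval (\<lambda>i. sigma_mat i (A :: 'f matvars mat)) (P_companion t l))"
    using P_companion_in[of t l, where ?'a = 'f] by (auto simp: int_polys_def)
next
  fix P :: "(nat, 'f) mpoly"
  assume P: "(\<forall>m\<in>Poly_Mapping.keys P. Poly_Mapping.keys m \<subseteq> {1..t * l} \<and> Poly_Mapping.lookup P m \<in> \<int>) \<and>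
     (\<forall>m A. m \<ge> t * l \<longrightarrow> A \<in> carrier_mat m m \<longrightarrow>
        sigma_mat t (A ^\<^sub>m l) = peval (\<lambda>i. sigma_mat i (A :: 'f matvars mat)) P)"
  have N: "t * l > 0" using t l by simp
  show "P = P_companion t l"
  proof (rule mpoly_eq_if_meval_eq[OF inf])
    fix h :: "nat \<Rightarrow> 'f alg_closure"
    \<comment> \<open>The identity is required over the ring \<open>'f matvars\<close>; its
      variables \<open>(i, 0, 0)\<close> serve as independent values of \<sigma>_i, and
      \<open>g\<close> specializes them to \<open>h i\<close>.\<close>
    define A :: "'f matvars mat" where "A = companion (t * l) (\<lambda>j. (-1) ^ j * Var (Suc j, 0, 0)) (\<lambda>_. 1)"
    define g where "g = (\<lambda>(i, _ :: nat \<times> nat). h i)"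
    interpret e: comm_ring_hom "meval to_ac g :: 'f matvars \<Rightarrow> _" by (rule comm_ring_hom_meval[OF comm_ring_hom_to_ac])
    have A: "A \<in> carrier_mat (t * l) (t * l)" by (simp add: A_def)
    have vals: "meval to_ac g (sigma_mat i A) = h i" if "1 \<le> i" "i \<le> t * l" for i
      using that sg_companion[OF N that, of "\<lambda>j. Var (j, 0, 0) :: 'f matvars"] sg_eq_sigma_mat[OF A, of i]
      by (simp add: A_def g_def meval_Var[OF comm_ring_hom_to_ac])
    have vars: "mvars P \<subseteq> {1..t * l}" "mvars (P_companion t l :: (nat, 'f) mpoly) \<subseteq> {1..t * l}"
      using P P_companion_in[of t l, where ?'a = 'f] by (auto simp: mvars_def int_polys_def)
    have ev: "meval to_ac g (peval (\<lambda>i. sigma_mat i A) Q) = meval to_ac h Q" if "mvars Q \<subseteq> {1..t * l}" for Q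
      unfolding meval_peval[OF comm_ring_hom_to_ac] using that vals by (intro meval_cong) auto
    have tm: "t \<le> t * l" using l by simp
    have "meval to_ac g (sigma_mat t (A ^\<^sub>m l)) = meval to_ac (\<lambda>i. sg i (map_mat (meval to_ac g) A)) (P_companion t l)"
      using A tm
      by (simp add: sg_eq_sigma_mat[of _ "t * l"] e.mat_hom_sg_pow[of _ "t * l"]
        meval_P_companion[of _ _ "t * l"] comm_ring_hom_to_ac infinite_alg_closure inf t l)
    also have "\<dots> = meval to_ac h (P_companion t l)"
      using vars(2) vals A by (intro meval_cong) (auto simp: sg_eq_sigma_mat[of _ "t * l"] e.sg_hom[of _ "t * l"])
    finally have "meval to_ac h (P_companion t l) = meval to_ac g (peval (\<lambda>i. sigma_mat i A) P)"
      unfolding P[THEN conjunct2, rule_format, OF order_refl A, symmetric] by simp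
    also have "\<dots> = meval to_ac h P" by (rule ev[OF vars(1)])
    finally show "meval to_ac h P = meval to_ac h (P_companion t l)" by simp
  qed
qed

subsection \<open>Words\<close>

lemma letters_zero [simp]: "letters 0 = []"
  by (simp add: zero_word_def)

lemma letters_plus [simp]: "letters (a + b) = letters a @ letters b"
  by (simp add: plus_word_def)

lemma word_eq_iff: "a = b \<longleftrightarrow> letters a = letters b"
  by (metis word.expand)

lemma letters_eq_Nil [simp]: "letters w = [] \<longleftrightarrow> w = 0"
  by (simp add: word_eq_iff)

section \<open>Powers, primitive words and rotations\<close>

definition wpow :: "nat \<Rightarrow> word \<Rightarrow> word" where
  "wpow l b = sum_list (replicate l b)"

lemma wpow_0 [simp]: "wpow 0 b = 0" and wpow_Suc [simp]: "wpow (Suc l) b = b + wpow l b"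
  by (simp_all add: wpow_def)

lemma wpow_add: "wpow (k + l) b = wpow k b + wpow l b"
  by (induction k) (auto simp: add.assoc)

lemma wpow_Suc2: "wpow (Suc l) b = wpow l b + b"
  using wpow_add[of l 1 b] by simp

lemma wpow_mult: "wpow (k * l) b = wpow k (wpow l b)"
  by (induction k) (auto simp: wpow_add)

lemma length_wpow [simp]: "length (letters (wpow l b)) = l * length (letters b)"
  by (induction l) auto

lemma letters_wpow: "letters (wpow l b) = concat (replicate l (letters b))"
  by (induction l) auto

lemma primitive_word_wpow: "primitive_word a \<longleftrightarrow> (\<forall>b l. b \<noteq> 0 \<longrightarrow> l > 1 \<longrightarrow> a \<noteq> wpow l b)"
  by (simp add: primitive_word_def wpow_def)

lemma ex_primitive_root:
  assumes "w \<noteq> 0"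
  shows "\<exists>v l. w = wpow l v \<and> l > 0 \<and> v \<noteq> 0 \<and> primitive_word v"
  using assms
proof (induction "length (letters w)" arbitrary: w rule: less_induct)
  case less
  show ?case
  proof (cases "primitive_word w")
    case True
    then show ?thesis using less.prems by (intro exI[of _ w] exI[of _ 1]) auto
  next
    case False
    then obtain b l where b: "b \<noteq> 0" "l > 1" "w = wpow l b" by (auto simp: primitive_word_wpow)
    then have "length (letters b) < length (letters w)" by simp
    from less.hyps[OF this b(1)] obtain v k where "b = wpow k v" "k > 0" "v \<noteq> 0" "primitive_word v" by blast
    then show ?thesis using b by (intro exI[of _ v] exI[of _ "l * k"]) (auto simp: wpow_mult)
  qed
qed

lemma wpow_rotate: "a + wpow l (b + a) = wpow l (a + b) + a"
  by (induction l) (auto simp: add.assoc)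

lemma word_append_eq:
  fixes a b c d :: word
  assumes "a + b = c + d" "length (letters a) = length (letters c)"
  shows "a = c" "b = d"
  using assms by (auto simp: word_eq_iff)

text \<open>If b + a is a power of \<open>c\<close>, the cut between \<open>b\<close> and
  \<open>a\<close> falls inside or in front of some copy of c = d + e, unless it lies at the very
  end. Then b = c^k d and a = e c^j, so that a + b is a power of e + d with the same
  exponent.\<close>

lemma primitive_rotate:
  assumes "primitive_word (a + b)"
  shows "primitive_word (b + a)"
  unfolding primitive_word_wpow
proof (intro allI impI notI)
  fix c :: word and l :: nat
  assume c: "c \<noteq> 0" "l > 1" "b + a = wpow l c"
  show False
  proof (cases "b = 0")
    case True
    then show False using assms c by (auto simp: primitive_word_wpow)
  next
    case False
    define n where "n = length (letters c)"
    have n: "n > 0" using c by (simp add: n_def)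
    define k where "k = length (letters b) div n"
    define d where "d = Word (take (length (letters b) mod n) (letters c))"
    define e where "e = Word (drop (length (letters b) mod n) (letters c))"
    have de: "c = d + e" by (simp add: d_def e_def word_eq_iff)
    have len: "length (letters b) + length (letters a) = l * n"
      using arg_cong[OF c(3), of "\<lambda>w. length (letters w)"] by (simp add: n_def)
    have ld: "length (letters d) = length (letters b) mod n"
      using n by (simp add: d_def n_def[symmetric] min_def) (metis mod_le_divisor leD le_less_linear mod_less_divisor less_imp_le)
    have "length (letters b) \<le> l * n" using len by simp
    then have kl: "k \<le> l" unfolding k_def using n by (metis div_le_mono nonzero_mult_div_cancel_right less_not_refl)
    show False
    proof (cases "k = l")
      case True
      then have "length (letters b) \<ge> l * n" unfolding k_def by (metis div_times_less_eq_dividend)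
      then have "length (letters a) = 0" using len by linarith
      then have "a = 0" by simp
      then show False using assms c by (auto simp: primitive_word_wpow)
    next
      case False
      then obtain j where j: "l = k + Suc j" using kl by (metis add_Suc_right le_neq_implies_less less_imp_Suc_add)
      have "b + a = wpow k c + (c + wpow j c)" by (simp only: c(3) j wpow_add wpow_Suc)
      also have "\<dots> = (wpow k c + d) + (e + wpow j c)" by (subst (2) de) (simp add: add.assoc)
      finally have "b + a = (wpow k c + d) + (e + wpow j c)" .
      moreover have "length (letters b) = length (letters (wpow k c + d))"
        using ld by (simp add: k_def n_def[symmetric])
      ultimately have ab: "b = wpow k c + d" "a = e + wpow j c" by (rule word_append_eq)+
      have "a + b = e + wpow j (d + e) + wpow k (d + e) + d"
        by (simp add: ab add.assoc flip: de)
      also have "\<dots> = e + wpow (j + k) (d + e) + d" by (simp add: wpow_add add.assoc)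
      also have "\<dots> = wpow l (e + d)" by (simp add: wpow_rotate j add.assoc add.commute[of j] flip: wpow_Suc2)
      finally have "a + b = wpow l (e + d)" .
      moreover have "length (letters (e + d)) = n" unfolding n_def by (subst de) simp
      then have "e + d \<noteq> 0" using n by (metis letters_zero list.size(3) less_irrefl)
      ultimately show False using assms c(2) by (auto simp: primitive_word_wpow)
    qed
  qed
qed

lemma cyc_equiv_rotate: "cyc_equiv a b \<longleftrightarrow> (\<exists>k. letters b = rotate k (letters a))"
proof
  assume "cyc_equiv a b"
  then obtain a1 a2 where "a = a1 + a2" "b = a2 + a1" by (auto simp: cyc_equiv_def)
  then show "\<exists>k. letters b = rotate k (letters a)"
    by (intro exI[of _ "length (letters a1)"]) (simp add: rotate_append)
next
  assume "\<exists>k. letters b = rotate k (letters a)"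
  then obtain k where k: "letters b = rotate k (letters a)" by blast
  let ?m = "k mod length (letters a)"
  have "a = Word (take ?m (letters a)) + Word (drop ?m (letters a))"
    "b = Word (drop ?m (letters a)) + Word (take ?m (letters a))"
    using k by (simp_all add: word_eq_iff rotate_drop_take)
  then show "cyc_equiv a b" unfolding cyc_equiv_def by blast
qed

lemma primitive_cyc_equiv: "cyc_equiv a b \<Longrightarrow> primitive_word a \<Longrightarrow> primitive_word b"
  by (auto simp: cyc_equiv_def primitive_rotate)

lemma cyc_equiv_sym: "cyc_equiv a b \<Longrightarrow> cyc_equiv b a"
  by (auto simp: cyc_equiv_def)

lemma cyc_equiv_trans: "cyc_equiv a b \<Longrightarrow> cyc_equiv b c \<Longrightarrow> cyc_equiv a c"
  by (auto simp: cyc_equiv_rotate rotate_rotate)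

lemma cyc_equiv_length: "cyc_equiv a b \<Longrightarrow> length (letters b) = length (letters a)"
  by (auto simp: cyc_equiv_rotate)

lemma ex_Xtilde_rep:
  assumes "v \<noteq> 0" "primitive_word v"
  shows "\<exists>e\<in>Xtilde. cyc_equiv v e"
proof -
  let ?S = "{b. cyc_equiv v b}"
  have "?S = (\<lambda>k. Word (rotate k (letters v))) ` {..<length (letters v)}"
  proof safe
    fix b assume "cyc_equiv v b"
    then obtain k where "letters b = rotate k (letters v)" by (auto simp: cyc_equiv_rotate)
    then have "b = Word (rotate (k mod length (letters v)) (letters v))" by (simp add: word_eq_iff flip: rotate_conv_mod)
    then show "b \<in> (\<lambda>k. Word (rotate k (letters v))) ` {..<length (letters v)}" using assms by auto
  qed (auto simp: cyc_equiv_rotate)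
  then have fin: "finite ?S" by simp
  have ne: "v \<in> ?S" by (auto simp: cyc_equiv_rotate intro: exI[of _ 0])
  define e where "e = Max ?S"
  have e: "cyc_equiv v e" using Max_in[OF fin] ne unfolding e_def by blast
  have "e \<noteq> 0" using cyc_equiv_length[OF e] assms by (metis length_0_conv letters_eq_Nil)
  moreover have "b \<le> e" if "cyc_equiv e b" for b
    unfolding e_def using cyc_equiv_trans[OF e that] fin by (intro Max_ge) auto
  ultimately show ?thesis using primitive_cyc_equiv[OF e assms(2)] e by (auto simp: Xtilde_def)
qed

lemma Xtilde_cyc_equiv_eq: "e \<in> Xtilde \<Longrightarrow> e' \<in> Xtilde \<Longrightarrow> cyc_equiv e e' \<Longrightarrow> e = e'"
  by (auto simp: Xtilde_def intro: antisym dest: cyc_equiv_sym)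

text \<open>Bezout in the natural numbers: a multiple of \<open>a\<close> equals a multiple of
  \<open>b\<close> plus the gcd, so forward shifts are enough.\<close>

lemma periodic_gcd:
  fixes f :: "nat \<Rightarrow> 'a" and a b :: nat
  assumes a: "\<And>p. f (p + a) = f p" and b: "\<And>p. f (p + b) = f p" and "a > 0"
  shows "f (p + gcd a b) = f p"
proof -
  have A: "f (p + x * a) = f p" for p x by (induction x) (auto simp: add.assoc[symmetric] a add.commute[of a])
  have B: "f (p + x * b) = f p" for p x by (induction x) (auto simp: add.assoc[symmetric] b add.commute[of b])
  obtain x y where xy: "a * x = b * y + gcd a b" using bezout_nat[of a b] assms(3) by auto
  have "f (p + gcd a b) = f (p + gcd a b + y * b)" by (simp only: B)
  also have "p + gcd a b + y * b = p + x * a" using xy by (simp add: mult.commute)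
  also have "f \<dots> = f p" by (rule A)
  finally show ?thesis .
qed

text \<open>\<open>f\<close> is the periodic continuation of the word. A period \<open>g\<close>
  that divides the length cuts the word into equal blocks, and primitivity leaves a single
  block.\<close>

lemma primitive_period:
  assumes "primitive_word w" "w \<noteq> 0" "g > 0" "g dvd length (letters w)"
    and "\<And>i. i < length (letters w) \<Longrightarrow> letters w ! i = f i" and "\<And>p. f (p + g) = f p"
  shows "g = length (letters w)"
proof (rule ccontr)
  assume ne: "g \<noteq> length (letters w)"
  obtain l where l: "length (letters w) = l * g" using assms(4) by (metis dvd_def mult.commute)
  let ?b = "Word (map f [0..<g])"
  have per: "f (q * g + r) = f r" for q r by (induction q) (auto simp: assms(6) add.assoc[symmetric] add.commute[of g] add.commute[of _ r] add.left_commute)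
  have nthc: "i < k * g \<Longrightarrow> concat (replicate k (map f [0..<g])) ! i = f i" for k i
  proof (induction k arbitrary: i)
    case (Suc k)
    show ?case
    proof (cases "i < g")
      case False
      then have "concat (replicate (Suc k) (map f [0..<g])) ! i = f (i - g)"
        using Suc by (simp add: nth_append)
      then show ?thesis using assms(6)[of "i - g"] False by simp
    qed (simp add: nth_append)
  qed simp
  have "w = wpow l ?b"
    by (auto simp: word_eq_iff letters_wpow l length_concat sum_list_replicate nthc assms(5) intro!: nth_equalityI)
  moreover have "l > 1" using ne l assms(2) by (cases l; cases "l - 1") auto
  moreover have "?b \<noteq> 0" using assms(3) by (simp add: word_eq_iff)
  ultimately show False using assms(1) by (auto simp: primitive_word_wpow)
qed

text \<open>The common infinite sequence has both lengths as periods, hence also their gcd, which by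
  primitivity equals each of the two lengths.\<close>

lemma primitive_eq_if_same_sequence:
  assumes w: "primitive_word w" "w \<noteq> 0" and r: "primitive_word r" "r \<noteq> 0"
    and eq: "\<And>p. letters w ! (p mod length (letters w)) = letters r ! (p mod length (letters r))"
  shows "w = r"
proof -
  let ?a = "length (letters w)" and ?b = "length (letters r)"
  define f where "f p = letters w ! (p mod ?a)" for p
  have a: "?a > 0" and b: "?b > 0" using w r by auto
  have f2: "f p = letters r ! (p mod ?b)" for p by (simp add: f_def eq)
  have per: "f (p + gcd ?a ?b) = f p" for p
    by (rule periodic_gcd) (use a in \<open>auto simp: f2, auto simp: f_def simp flip: f2\<close>)
  have g: "gcd ?a ?b > 0" using a by simp
  have "gcd ?a ?b = ?a" by (rule primitive_period[OF w g, of f]) (use per in \<open>auto simp: f_def\<close>)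
  moreover have "gcd ?a ?b = ?b" by (rule primitive_period[OF r g, of f]) (use per in \<open>auto simp: f2\<close>)
  ultimately have "?a = ?b" by simp
  moreover have "letters w ! i = letters r ! i" if "i < ?a" for i
    using eq[of i] that \<open>?a = ?b\<close> by simp
  ultimately show ?thesis by (auto simp: word_eq_iff intro: nth_equalityI)
qed

section \<open>Values of words at families of matrices\<close>

definition wmat :: "nat \<Rightarrow> (nat \<Rightarrow> 'r::comm_ring_1 mat) \<Rightarrow> word \<Rightarrow> 'r mat" where
  "wmat m A w = foldr (\<lambda>k M. A k * M) (letters w) (1\<^sub>m m)"

lemma phi_wmat: "phi n w = wmat n (gen_mat n) w"
  by (simp add: phi_def wmat_def)

lemma wmat_zero [simp]: "wmat m A 0 = 1\<^sub>m m"
  by (simp add: wmat_def)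

lemma wmat_Cons: "wmat m A (Word (k # ks)) = A k * wmat m A (Word ks)"
  by (simp add: wmat_def)

lemma word_induct [case_names zero Cons]:
  assumes "P 0" "\<And>k ks. P (Word ks) \<Longrightarrow> P (Word (k # ks))"
  shows "P w"
proof -
  have "P (Word ks)" for ks using assms by (induction ks) (auto simp: zero_word_def)
  from this[of "letters w"] show ?thesis by simp
qed

locale mat_family =
  fixes m :: nat and A :: "nat \<Rightarrow> 'r::comm_ring_1 mat"
  assumes fam [simp]: "A k \<in> carrier_mat m m"
begin

lemma wmat_carrier [simp]: "wmat m A w \<in> carrier_mat m m"
proof (induction w rule: word_induct)
  case (Cons k ks)
  then show ?case using fam[of k] by (simp only: wmat_Cons mult_carrier_mat[of _ m m])
qed simp

lemma wmat_dim [simp]: "dim_row (wmat m A w) = m" "dim_col (wmat m A w) = m"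
  using wmat_carrier by (auto simp del: wmat_carrier)

lemma wmat_letter: "wmat m A (Word [k]) = A k"
  unfolding wmat_def using fam[of k] by (simp add: right_mult_one_mat[of _ m m])

lemma wmat_plus: "wmat m A (a + b) = wmat m A a * wmat m A b"
proof (induction a rule: word_induct)
  case zero
  then show ?case by (simp add: left_mult_one_mat[of _ m m])
next
  case (Cons k ks)
  have "Word (k # ks) + b = Word (k # letters (Word ks + b))" by (simp add: word_eq_iff)
  then have "wmat m A (Word (k # ks) + b) = A k * wmat m A (Word ks + b)"
    by (simp only: wmat_Cons word.collapse)
  also have "\<dots> = A k * wmat m A (Word ks) * wmat m A b"
    unfolding Cons by (simp add: assoc_mult_mat[of _ m m _ m _ m])
  finally show ?case by (simp only: wmat_Cons)
qed

lemma wmat_wpow: "wmat m A (wpow l b) = wmat m A b ^\<^sub>m l"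
proof (induction l)
  case (Suc l)
  then show ?case by (simp only: wpow_Suc2 wmat_plus pow_mat.simps)
qed simp

end

lemma mat_family_hom:
  assumes "mat_family m A" "comm_ring_hom c"
  shows "map_mat c (wmat m A w) = wmat m (\<lambda>k. map_mat c (A k)) w" "mat_family m (\<lambda>k. map_mat c (A k))"
proof -
  interpret mat_family m A by fact
  interpret c: comm_ring_hom c by fact
  show "map_mat c (wmat m A w) = wmat m (\<lambda>k. map_mat c (A k)) w"
  proof (induction w rule: word_induct)
    case (Cons k ks)
    then show ?case unfolding wmat_Cons by (simp add: c.mat_hom_mult[of _ m m _ m])
  qed (simp add: c.mat_hom_one)
  show "mat_family m (\<lambda>k. map_mat c (A k))" by standard simp
qed

subsection \<open>Evaluation of noncommutative polynomials\<close>

text \<open>Given entry by entry, so that \<open>lext\<close> applies with values in the ring of the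
  entries.\<close>

definition fmat :: "('f::zero \<Rightarrow> 'r::comm_ring_1) \<Rightarrow> nat \<Rightarrow> (nat \<Rightarrow> 'r mat) \<Rightarrow> (word \<Rightarrow>\<^sub>0 'f) \<Rightarrow> 'r mat" where
  "fmat c m A a = mat m m (\<lambda>(i, j). lext (\<lambda>x w. c x * wmat m A w $$ (i, j)) a)"

lemma fmat_carrier [simp]: "fmat c m A a \<in> carrier_mat m m"
  by (simp add: fmat_def)

lemma fmat_dim [simp]: "dim_row (fmat c m A a) = m" "dim_col (fmat c m A a) = m"
  by (simp_all add: fmat_def)

locale mat_family_hom = mat_family m A + c: comm_ring_hom c
  for m and A :: "nat \<Rightarrow> 'r::comm_ring_1 mat" and c :: "'f::comm_ring_1 \<Rightarrow> 'r"
begin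

lemma fmat_add: "fmat c m A (a + b) = fmat c m A a + fmat c m A b"
  by (intro eq_matI) (auto simp: fmat_def c.hom_add distrib_right intro!: lext_add)

lemma fmat_single: "fmat c m A (Poly_Mapping.single w x) = c x \<cdot>\<^sub>m wmat m A w"
  by (intro eq_matI) (auto simp: fmat_def lext_single)

lemma fmat_zero: "fmat c m A 0 = 0\<^sub>m m m"
  by (intro eq_matI) (auto simp: fmat_def)

lemma fmat_mon: "fmat c m A (mon w) = wmat m A w"
  unfolding mon_def fmat_single by (intro eq_matI) auto

lemma fmat_mult: "fmat c m A (a * b) = fmat c m A a * fmat c m A b"
proof (induction a rule: poly_mapping_add_induct)
  case (1 k x)
  show ?case
  proof (induction b rule: poly_mapping_add_induct)
    case (1 l y)
    have "fmat c m A (Poly_Mapping.single k x * Poly_Mapping.single l y) = (c x * c y) \<cdot>\<^sub>m (wmat m A k * wmat m A l)"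
      by (simp add: mult_single fmat_single c.hom_mult wmat_plus)
    also have "\<dots> = (c x \<cdot>\<^sub>m wmat m A k) * (c y \<cdot>\<^sub>m wmat m A l)"
      by (subst mult_smult_assoc_mat[of _ m m _ m], simp, simp, subst mult_smult_distrib[of _ m m _ m])
         (auto intro!: eq_matI)
    finally show ?case by (simp only: fmat_single)
  next
    case (2 f g)
    then show ?case by (simp add: distrib_left fmat_add mult_add_distrib_mat[of _ m m _ m])
  qed
next
  case (2 f g)
  then show ?case by (simp add: distrib_right fmat_add add_mult_distrib_mat[of _ m m _ _ m])
qed

lemma fmat_Const: "fmat c m A (Const x) = c x \<cdot>\<^sub>m 1\<^sub>m m"
  by (simp add: Const_def fmat_single)

lemma fmat_one: "fmat c m A 1 = 1\<^sub>m m"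
  using fmat_single[of 0 1] by (auto intro!: eq_matI)

lemma fmat_power: "fmat c m A (a ^ l) = fmat c m A a ^\<^sub>m l"
  by (induction l) (simp_all only: power_Suc2 fmat_mult pow_mat.simps power_0 fmat_one fmat_dim)

lemma fmat_Const_mult: "fmat c m A (Const x * b) = c x \<cdot>\<^sub>m fmat c m A b"
  unfolding fmat_mult fmat_Const
  by (subst mult_smult_assoc_mat[of _ m m _ m]) (auto simp: left_mult_one_mat[of _ m m])

lemma fmat_word_subst: "fmat c m A (word_subst s w) = wmat m (\<lambda>k. fmat c m A (s k)) w"
proof (induction w rule: word_induct)
  case zero
  then show ?case by (simp add: word_subst_def fmat_one)
next
  case (Cons k ks)
  have "word_subst s (Word (k # ks)) = s k * word_subst s (Word ks)" by (simp add: word_subst_def)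
  with Cons show ?case by (simp only: fmat_mult wmat_Cons)
qed

lemma fmat_FX_subst: "fmat c m A (FX_subst s a) = fmat c m (\<lambda>k. fmat c m A (s k)) a"
proof -
  interpret s: mat_family_hom m "\<lambda>k. fmat c m A (s k)" c by standard simp
  have FX: "FX_subst s a = lext (\<lambda>x w. Const x * word_subst s w) a" for a
    by (simp add: FX_subst_def lext_def)
  have add: "FX_subst s (a + b) = FX_subst s a + FX_subst s b" for a b
    unfolding FX by (rule lext_add) (auto simp: Const_def single_add distrib_right)
  show ?thesis
  proof (induction a rule: poly_mapping_add_induct)
    case (1 k v)
    have "FX_subst s (Poly_Mapping.single k v) = Const v * word_subst s k"
      unfolding FX by (rule lext_single) (simp add: Const_def)
    then show ?case by (simp only: fmat_Const_mult fmat_word_subst s.fmat_single)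
  next
    case (2 f g)
    then show ?case by (simp only: add fmat_add s.fmat_add)
  qed
qed

end

subsection \<open>Evaluation of \<open>\<sigma>\<langle>X~\<rangle>\<close>\<close>

definition ev :: "nat \<Rightarrow> (nat \<Rightarrow> 'f::field alg_closure mat) \<Rightarrow> 'f sXt \<Rightarrow> 'f alg_closure" where
  "ev m A = meval to_ac (\<lambda>g. case Rep_tgen g of (t, e) \<Rightarrow> sg t (wmat m A e))"

interpretation ev: comm_ring_hom "ev m A"
  unfolding ev_def by (rule comm_ring_hom_meval[OF comm_ring_hom_to_ac])

lemma ev_Const [simp]: "ev m A (Const a) = to_ac a"
  by (simp add: ev_def meval_Const[OF comm_ring_hom_to_ac])

lemma ev_sigma_t: "t > 0 \<Longrightarrow> e \<in> Xtilde \<Longrightarrow> ev m A (sigma_t t e) = sg t (wmat m A e)"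
  by (simp add: ev_def sigma_t_def meval_Var[OF comm_ring_hom_to_ac] Abs_tgen_inverse)

lemma tgen_cases: obtains t e where "t > 0" "e \<in> Xtilde" "g = Abs_tgen (t, e)" "Rep_tgen g = (t, e)"
proof -
  obtain t e where te: "Rep_tgen g = (t, e)" by fastforce
  then show ?thesis using Rep_tgen[of g] Rep_tgen_inverse[of g] by (intro that[of t e]) auto
qed

text \<open>The test \<open>t \<le> n\<close> in \<open>Phi_t\<close> disappears, because
  \<open>sg t\<close> vanishes on matrices of size below \<open>t\<close>.\<close>

lemma meval_Phi_t:
  fixes f :: "'f::field sXt"
  shows "meval to_ac h (Phi_t n f) = ev n (\<lambda>k. mat n n (\<lambda>(i, j). h (i, j, k))) f"
proof -
  interpret h: comm_ring_hom "meval to_ac h :: 'f matvars \<Rightarrow> _" by (rule comm_ring_hom_meval[OF comm_ring_hom_to_ac])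
  interpret G: mat_family n "gen_mat n :: nat \<Rightarrow> 'f matvars mat" by standard (simp add: gen_mat_def)
  let ?A = "\<lambda>k. mat n n (\<lambda>(i, j). h (i, j, k))"
  interpret A: mat_family n ?A by standard simp
  have gen: "map_mat (meval to_ac h) (gen_mat n k) = ?A k" for k
    by (auto simp: gen_mat_def meval_Var[OF comm_ring_hom_to_ac] intro!: eq_matI)
  have w: "map_mat (meval to_ac h) (phi n e) = wmat n ?A e" for e
    unfolding phi_wmat by (subst mat_family_hom(1)[OF G.mat_family_axioms h.comm_ring_hom_axioms]) (simp only: gen)
  have c: "(phi n e :: 'f matvars mat) \<in> carrier_mat n n" for e by (simp add: phi_wmat)
  show ?thesis
    unfolding Phi_t_def ev_def meval_peval[OF comm_ring_hom_to_ac]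
    by (intro meval_cong) (auto simp: sg_eq_sigma_mat[OF c] sg_gt h.sg_hom[OF c, symmetric] w split: prod.split)
qed

text \<open>Every family of n x n matrices over the closure is a specialization of the generic one,
  and a polynomial is 0 when all its specializations to an infinite field are.\<close>

lemma K_t_iff:
  fixes f :: "'f::field sXt"
  assumes "infinite (UNIV :: 'f set)"
  shows "f \<in> K_t n \<longleftrightarrow> (\<forall>A. mat_family n A \<longrightarrow> ev n A f = 0)"
proof
  assume f: "f \<in> K_t n"
  show "\<forall>A. mat_family n A \<longrightarrow> ev n A f = 0"
  proof (intro allI impI)
    fix A :: "nat \<Rightarrow> 'f alg_closure mat" assume "mat_family n A"
    then interpret mat_family n A .
    let ?h = "\<lambda>(i, j, k). A k $$ (i, j)"
    have "(\<lambda>k. mat n n (\<lambda>(i, j). ?h (i, j, k))) = A" using carrier_matD[OF fam] by (intro ext eq_matI) auto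
    then have "ev n A f = meval to_ac ?h (Phi_t n f)" by (simp add: meval_Phi_t)
    then show "ev n A f = 0" using f by (simp add: K_t_def meval_lext)
  qed
next
  assume van: "\<forall>A. mat_family n A \<longrightarrow> ev n A f = 0"
  have "Phi_t n f = 0"
  proof (rule mpoly_zero_if_vanishing[OF comm_ring_hom_to_ac inj_to_ac infinite_alg_closure[OF assms]])
    fix h :: "nat \<times> nat \<times> nat \<Rightarrow> 'f alg_closure"
    show "meval to_ac h (Phi_t n f) = 0" unfolding meval_Phi_t
      by (rule van[rule_format]) (standard, simp)
  qed
  then show "f \<in> K_t n" by (simp add: K_t_def)
qed

subsection \<open>Labelled cycles\<close>

text \<open>The letters of \<open>e\<close> label the edges of a directed cycle, whose last edge has weight \<open>y\<close>.\<close>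

definition cyc :: "word \<Rightarrow> 'r::comm_ring_1 \<Rightarrow> nat \<Rightarrow> 'r mat" where
  "cyc e y k = (let l = length (letters e) in mat l l (\<lambda>(i, j).
     if letters e ! i = k \<and> j = Suc i mod l then (if Suc i = l then y else 1) else 0))"

lemma mat_family_cyc: "mat_family (length (letters e)) (cyc e y)"
  by standard (simp add: cyc_def Let_def)

lemma cyc_index:
  assumes "i < length (letters e)" "j < length (letters e)"
  shows "cyc e y k $$ (i, j) = (if letters e ! i = k \<and> j = Suc i mod length (letters e)
    then (if Suc i = length (letters e) then y else 1) else 0)"
  using assms by (simp add: cyc_def Let_def)

lemma cyc_mult_index:
  assumes "i < length (letters e)" "j < length (letters e)" "M \<in> carrier_mat (length (letters e)) (length (letters e))"
  shows "(cyc e y k * M) $$ (i, j) = (if letters e ! i = k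
    then (if Suc i = length (letters e) then y else 1) * M $$ (Suc i mod length (letters e), j) else 0)"
proof -
  let ?l = "length (letters e)"
  interpret mat_family ?l "cyc e y" by (rule mat_family_cyc)
  have "(cyc e y k * M) $$ (i, j) = (\<Sum>r = 0..<?l. cyc e y k $$ (i, r) * M $$ (r, j))"
    using assms carrier_matD[OF fam[of k]] by (simp add: scalar_prod_def)
  also have "\<dots> = (\<Sum>r = 0..<?l. if r = Suc i mod ?l then (if letters e ! i = k
    then (if Suc i = ?l then y else 1) * M $$ (Suc i mod ?l, j) else 0) else 0)"
    using assms by (intro sum.cong refl) (auto simp: cyc_index)
  also have "\<dots> = (if letters e ! i = k
    then (if Suc i = ?l then y else 1) * M $$ (Suc i mod ?l, j) else 0)"
    using assms by (subst sum.delta) auto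
  finally show ?thesis .
qed

text \<open>Each letter moves one step forward along an edge with that label. A nonzero entry (i, j)
  therefore says that \<open>w\<close> is spelled by a walk from \<open>i\<close> to
  \<open>j\<close>, possibly winding around the cycle several times.\<close>

lemma wmat_cyc_nonzero:
  assumes "i < length (letters e)" "j < length (letters e)"
    and "wmat (length (letters e)) (cyc e y) w $$ (i, j) \<noteq> 0"
  shows "j = (i + length (letters w)) mod length (letters e) \<and>
    (\<forall>p<length (letters w). letters w ! p = letters e ! ((i + p) mod length (letters e)))"
  using assms
proof (induction w arbitrary: i rule: word_induct)
  case zero
  then show ?case by (auto split: if_splits)
next
  case (Cons k ks)
  let ?l = "length (letters e)"
  interpret mat_family ?l "cyc e y" by (rule mat_family_cyc)
  have "wmat ?l (cyc e y) (Word (k # ks)) $$ (i, j) = (if letters e ! i = k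
    then (if Suc i = ?l then y else 1) * wmat ?l (cyc e y) (Word ks) $$ (Suc i mod ?l, j) else 0)"
    unfolding wmat_Cons using Cons.prems by (intro cyc_mult_index) auto
  with Cons.prems(3) have k: "letters e ! i = k" and nz: "wmat ?l (cyc e y) (Word ks) $$ (Suc i mod ?l, j) \<noteq> 0"
    by (auto split: if_splits)
  have "Suc i mod ?l < ?l" by (rule mod_less_divisor) (use Cons.prems in linarith)
  from Cons.IH[OF this Cons.prems(2) nz]
  have j: "j = (Suc i mod ?l + length ks) mod ?l"
    and ks: "\<And>p. p < length ks \<Longrightarrow> ks ! p = letters e ! ((Suc i mod ?l + p) mod ?l)" by auto
  have "letters (Word (k # ks)) ! p = letters e ! ((i + p) mod ?l)" if "p < length (k # ks)" for p
  proof (cases p)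
    case 0
    then show ?thesis using k Cons.prems by simp
  next
    case (Suc q)
    then have "ks ! q = letters e ! ((Suc i + q) mod ?l)" using ks[of q] that by (simp add: mod_add_left_eq)
    then show ?thesis using Suc by simp
  qed
  moreover have "j = (i + length (letters (Word (k # ks)))) mod ?l"
    using j by (simp add: mod_add_left_eq)
  ultimately show ?case by simp
qed

text \<open>A walk that spells sufficiently many copies of \<open>w\<close> makes the periodic
  sequence of \<open>w\<close> equal to that of a rotation of \<open>e\<close>. Then
  \<open>w\<close> is this rotation and, both words being maximal, equal to \<open>e\<close>. So the
  value of any other \<open>w\<close> is nilpotent.\<close>

lemma dpoly_cyc_other:
  fixes y :: "'r::idom"
  assumes e: "e \<in> Xtilde" and w: "w \<in> Xtilde" "w \<noteq> e"
  shows "dpoly (wmat (length (letters e)) (cyc e y) w) = 1"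
proof -
  let ?l = "length (letters e)" and ?a = "length (letters w)"
  interpret mat_family ?l "cyc e y" by (rule mat_family_cyc)
  have pos: "?l > 0" "?a > 0" and ne: "e \<noteq> 0" "w \<noteq> 0" and prim: "primitive_word e" "primitive_word w"
    using e w by (auto simp: Xtilde_def)
  \<comment> \<open>The exponent is the length of \<open>e\<close>, so that a walk covers a common
    multiple of the lengths of \<open>e\<close> and \<open>w\<close>.\<close>
  have "wmat ?l (cyc e y) (wpow ?l w) = 0\<^sub>m ?l ?l"
  proof (rule eq_matI)
    fix i j assume "i < dim_row (0\<^sub>m ?l ?l :: 'r mat)" "j < dim_col (0\<^sub>m ?l ?l :: 'r mat)"
    then have ij: "i < ?l" "j < ?l" by auto
    show "wmat ?l (cyc e y) (wpow ?l w) $$ (i, j) = 0\<^sub>m ?l ?l $$ (i, j)"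
    proof (rule ccontr)
      assume "\<not> ?thesis"
      then have "wmat ?l (cyc e y) (wpow ?l w) $$ (i, j) \<noteq> 0" using ij by simp
      from wmat_cyc_nonzero[OF ij this] have path: "\<And>p. p < ?l * ?a \<Longrightarrow>
        letters (wpow ?l w) ! p = letters e ! ((i + p) mod ?l)" by simp
      have nthc: "p < k * ?a \<Longrightarrow> letters (wpow k w) ! p = letters w ! (p mod ?a)" for k p
      proof (induction k arbitrary: p)
        case (Suc k)
        then show ?case using pos
          by (cases "p < ?a") (auto simp: nth_append le_mod_geq)
      qed simp
      define r where "r = Word (rotate i (letters e))"
      have cr: "cyc_equiv e r" unfolding cyc_equiv_rotate r_def by auto
      have lr: "length (letters r) = ?l" by (simp add: r_def)
      have rn: "letters r ! q = letters e ! ((i + q) mod ?l)" if "q < ?l" for q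
        using that by (simp add: r_def nth_rotate)
      have "w = r"
      proof (rule primitive_eq_if_same_sequence[OF prim(2) ne(2)])
        show "primitive_word r" by (rule primitive_cyc_equiv[OF cr prim(1)])
        show "r \<noteq> 0" using lr pos by auto
        fix p
        define p' where "p' = p mod (?l * ?a)"
        have p': "p' < ?l * ?a" using pos by (simp add: p'_def)
        have m: "p' mod ?a = p mod ?a" "p' mod ?l = p mod ?l"
          unfolding p'_def by (simp_all add: mod_mod_cancel)
        have "letters w ! (p mod ?a) = letters e ! ((i + p') mod ?l)"
          using path[OF p'] nthc[OF p'] m by simp
        also have "\<dots> = letters e ! ((i + p mod ?l) mod ?l)" by (metis m(2) mod_add_right_eq)
        also have "\<dots> = letters r ! (p mod length (letters r))" using rn[of "p mod ?l"] pos lr by simp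
        finally show "letters w ! (p mod ?a) = letters r ! (p mod length (letters r))" .
      qed
      then show False using cr Xtilde_cyc_equiv_eq[OF e w(1)] w(2) by auto
    qed
  qed auto
  then show ?thesis
    by (intro dpoly_nilpotent[where N = ?l and n = ?l]) (auto simp: wmat_wpow)
qed

text \<open>Since \<open>e\<close> is primitive, it can be read around the cycle from vertex 0 only.
  Its value is the matrix with the single entry \<open>y\<close> at (0, 0).\<close>

lemma dpoly_cyc_same:
  fixes y :: "'r::idom"
  assumes e: "e \<in> Xtilde"
  shows "dpoly (wmat (length (letters e)) (cyc e y) e) = 1 - monom y 1"
proof -
  let ?l = "length (letters e)"
  interpret mat_family ?l "cyc e y" by (rule mat_family_cyc)
  have pos: "?l > 0" and ne: "e \<noteq> 0" and prim: "primitive_word e" using e by (auto simp: Xtilde_def)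
  \<comment> \<open>Reading the suffix of \<open>e\<close> that starts at vertex \<open>q\<close>
    ends at vertex 0 and passes the weighted edge exactly once.\<close>
  have drop: "q < ?l \<Longrightarrow> wmat ?l (cyc e y) (Word (drop q (letters e))) $$ (q, 0) = y" for q
  proof (induction "?l - q" arbitrary: q)
    case (Suc d)
    have "drop q (letters e) = letters e ! q # drop (Suc q) (letters e)"
      using Suc.prems by (simp add: Cons_nth_drop_Suc)
    then have eq: "wmat ?l (cyc e y) (Word (drop q (letters e))) $$ (q, 0) =
       (if Suc q = ?l then y else 1) * wmat ?l (cyc e y) (Word (drop (Suc q) (letters e))) $$ (Suc q mod ?l, 0)"
      using Suc.prems pos by (simp add: wmat_Cons cyc_mult_index)
    show ?case
    proof (cases "Suc q = ?l")
      case True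
      then have "Word (drop (Suc q) (letters e)) = 0" by (simp add: word_eq_iff)
      then show ?thesis using eq True pos by simp
    next
      case False
      then show ?thesis using eq Suc.hyps Suc.prems by simp
    qed
  qed simp
  have "wmat ?l (cyc e y) e = companion ?l (\<lambda>i. if i = 0 then y else 0) (\<lambda>_. 0)"
  proof (rule eq_matI)
    fix i j assume "i < dim_row (companion ?l (\<lambda>i. if i = 0 then y else 0) (\<lambda>_. 0))"
      "j < dim_col (companion ?l (\<lambda>i. if i = 0 then y else 0) (\<lambda>_. 0))"
    then have ij: "i < ?l" "j < ?l" by (auto simp: companion_def)
    show "wmat ?l (cyc e y) e $$ (i, j) = companion ?l (\<lambda>i. if i = 0 then y else 0) (\<lambda>_. 0) $$ (i, j)"
    proof (cases "wmat ?l (cyc e y) e $$ (i, j) = 0")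
      case False
      from wmat_cyc_nonzero[OF ij this] have j: "j = i" and
        path: "\<And>p. p < ?l \<Longrightarrow> letters e ! p = letters e ! ((i + p) mod ?l)" using ij by auto
      have "i = 0"
      proof (rule ccontr)
        assume i0: "i \<noteq> 0"
        define f where "f p = letters e ! (p mod ?l)" for p
        have "f (p + i) = f p" for p
          using path[of "p mod ?l"] pos by (simp add: f_def mod_add_right_eq add.commute)
        moreover have "f (p + ?l) = f p" for p by (simp add: f_def)
        ultimately have per: "f (p + gcd i ?l) = f p" for p using periodic_gcd[of f i ?l p] i0 by auto
        have "gcd i ?l = ?l" using i0
          by (intro primitive_period[OF prim ne, of _ f] per) (auto simp: f_def)
        then show False using i0 ij by (metis gcd_le1_nat leD)
      qed
      then show ?thesis using j drop[of 0] pos by (simp add: companion_def)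
    next
      case True
      have "i \<noteq> 0 \<or> j \<noteq> 0 \<or> y = 0" using True drop[of 0] pos by (cases "i = 0"; cases "j = 0") auto
      then show ?thesis using True ij by (cases "i = 0"; cases "j = 0") (auto simp: companion_def)
    qed
  qed (auto simp: companion_def)
  then have "dpoly (wmat ?l (cyc e y) e) = 1 - (\<Sum>i<?l. monom ((if i = 0 then y else 0) * (\<Prod>j<i. 0)) (Suc i))"
    by (simp only: dpoly_companion[OF pos])
  also have "(\<Sum>i<?l. monom ((if i = 0 then y else 0) * (\<Prod>j<i. 0)) (Suc i)) = (\<Sum>i<?l. if i = 0 then monom y 1 else 0)"
    by (intro sum.cong) auto
  finally show ?thesis using pos by simp
qed

definition msum :: "nat \<Rightarrow> nat \<Rightarrow> (nat \<Rightarrow> 'r::comm_ring_1 mat) \<Rightarrow> 'r mat" where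
  "msum m u A = mat m m (\<lambda>(i, j). \<Sum>k<u. A k $$ (i, j))"

lemma msum_carrier [simp]: "msum m u A \<in> carrier_mat m m"
  by (simp add: msum_def)

text \<open>Summing over the letters below \<open>u\<close> deletes the edges with other labels. If
  an edge is missing, no closed walk remains; otherwise the determinant sees only the full turn, of
  weight \<open>y\<close>.\<close>

lemma dpoly_cyc_msum:
  fixes y :: "'r::idom"
  assumes e: "e \<in> Xtilde"
  shows "dpoly (msum (length (letters e)) u (cyc e y)) =
    (if set (letters e) \<subseteq> {..<u} then 1 - monom y (length (letters e)) else 1)"
proof -
  let ?l = "length (letters e)"
  let ?d = "\<lambda>i. if letters e ! i < u then 1 else (0::'r)"
  let ?a = "\<lambda>i. if Suc i = ?l then ?d i * y else 0"
  have pos: "?l > 0" using e by (auto simp: Xtilde_def)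
  have "msum ?l u (cyc e y) = companion ?l ?a ?d"
  proof (rule eq_matI)
    fix i j assume "i < dim_row (companion ?l ?a ?d)" "j < dim_col (companion ?l ?a ?d)"
    then have ij: "i < ?l" "j < ?l" by (auto simp: companion_def)
    have "msum ?l u (cyc e y) $$ (i, j) = (\<Sum>k<u. if letters e ! i = k then
      (if j = Suc i mod ?l then (if Suc i = ?l then y else 1) else 0) else 0)"
      using ij by (auto simp: msum_def cyc_index intro!: sum.cong)
    also have "\<dots> = ?d i * (if j = Suc i mod ?l then (if Suc i = ?l then y else 1) else 0)"
      by simp
    also have "\<dots> = companion ?l ?a ?d $$ (i, j)"
    proof (cases "Suc i = ?l")
      case False
      then have "Suc i < ?l" using ij by simp
      then show ?thesis using ij by (auto simp: companion_def)
    qed (use ij in \<open>auto simp: companion_def\<close>)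
    finally show "msum ?l u (cyc e y) $$ (i, j) = companion ?l ?a ?d $$ (i, j)" .
  qed (auto simp: msum_def companion_def)
  then have "dpoly (msum ?l u (cyc e y)) = 1 - (\<Sum>i<?l. monom (?a i * (\<Prod>j<i. ?d j)) (Suc i))"
    by (simp only: dpoly_companion[OF pos])
  also have "(\<Sum>i<?l. monom (?a i * (\<Prod>j<i. ?d j)) (Suc i)) =
    (\<Sum>i<?l. if i = ?l - 1 then monom (y * (\<Prod>j<?l. ?d j)) ?l else 0)"
  proof (rule sum.cong[OF refl])
    fix i assume "i \<in> {..<?l}"
    show "monom (?a i * (\<Prod>j<i. ?d j)) (Suc i) = (if i = ?l - 1 then monom (y * (\<Prod>j<?l. ?d j)) ?l else 0)"
    proof (cases "Suc i = ?l")
      case True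
      have "(\<Prod>j<?l. ?d j) = ?d i * (\<Prod>j<i. ?d j)" unfolding True[symmetric] by (simp add: mult.commute)
      then show ?thesis using True by (simp add: mult_ac)
    qed (use pos in auto)
  qed
  also have "\<dots> = monom (y * (\<Prod>j<?l. ?d j)) ?l" using pos by simp
  also have "(\<Prod>j<?l. ?d j) = (if set (letters e) \<subseteq> {..<u} then 1 else 0)"
  proof (cases "set (letters e) \<subseteq> {..<u}")
    case False
    then obtain j where "j < ?l" "\<not> letters e ! j < u" by (metis in_set_conv_nth lessThan_iff subsetI)
    then have "(\<Prod>j<?l. ?d j) = 0" by (intro prod_zero) auto
    then show ?thesis using False by simp
  qed (auto intro!: prod.neutral simp: subset_eq)
  finally show ?thesis by auto
qed

section \<open>Direct sums of labelled cycles\<close>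

fun tdim :: "(word \<times> 'r) list \<Rightarrow> nat" where
  "tdim [] = 0"
| "tdim ((e, y) # bs) = length (letters e) + tdim bs"

fun tfam :: "(word \<times> 'r::comm_ring_1) list \<Rightarrow> nat \<Rightarrow> 'r mat" where
  "tfam [] k = 1\<^sub>m 0"
| "tfam ((e, y) # bs) k = dsum (cyc e y k) (tfam bs k)"

lemma mat_family_tfam: "mat_family (tdim bs) (tfam bs)"
proof (induction bs rule: tdim.induct)
  case (2 e y bs)
  interpret c: mat_family "length (letters e)" "cyc e y" by (rule mat_family_cyc)
  interpret t: mat_family "tdim bs" "tfam bs" by (rule 2)
  show ?case by standard (simp add: four_block_carrier_mat[OF c.fam t.fam])
qed (standard, simp)

lemma wmat_dsum:
  assumes "mat_family m A" "mat_family m' B"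
  shows "wmat (m + m') (\<lambda>k. dsum (A k) (B k)) w = dsum (wmat m A w) (wmat m' B w)"
proof -
  interpret A: mat_family m A by fact
  interpret B: mat_family m' B by fact
  note dims = carrier_matD[OF A.fam] carrier_matD[OF B.fam]
  show ?thesis
  proof (induction w rule: word_induct)
    case zero
    then show ?case by (auto intro!: eq_matI)
  next
    case (Cons k ks)
    have "wmat (m + m') (\<lambda>k. dsum (A k) (B k)) (Word (k # ks)) = dsum (A k) (B k) * dsum (wmat m A (Word ks)) (wmat m' B (Word ks))"
      by (simp only: wmat_Cons Cons)
    also have "\<dots> = dsum (A k * wmat m A (Word ks)) (B k * wmat m' B (Word ks))"
      by (subst mult_four_block_mat[of _ m m _ m' _ m' _ _ m _ m'])
         (auto simp: dims intro!: cong_four_block_mat)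
    finally show ?case by (simp only: wmat_Cons)
  qed
qed

lemma dpoly_empty: "A \<in> carrier_mat 0 0 \<Longrightarrow> dpoly A = 1"
  using dpoly_eq[of A 0] by (simp add: monom_0 one_pCons)

lemma dpoly_tfam:
  fixes bs :: "(word \<times> 'r::idom) list"
  assumes "w \<in> Xtilde" "fst ` set bs \<subseteq> Xtilde"
  shows "dpoly (wmat (tdim bs) (tfam bs) w) = (\<Prod>(e, y)\<leftarrow>bs. if e = w then 1 - monom y 1 else 1)"
  using assms(2)
proof (induction bs rule: tdim.induct)
  case 1
  interpret mat_family 0 "tfam []" using mat_family_tfam[of "[]"] by simp
  show ?case using dpoly_empty[OF wmat_carrier, of w] by (simp del: tfam.simps)
next
  case (2 e y bs)
  interpret c: mat_family "length (letters e)" "cyc e y" by (rule mat_family_cyc)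
  interpret t: mat_family "tdim bs" "tfam bs" by (rule mat_family_tfam)
  have "wmat (tdim ((e, y) # bs)) (tfam ((e, y) # bs)) w = dsum (wmat (length (letters e)) (cyc e y) w) (wmat (tdim bs) (tfam bs) w)"
    using wmat_dsum[OF c.mat_family_axioms t.mat_family_axioms, of w] by (simp only: tdim.simps tfam.simps[abs_def])
  then have "dpoly (wmat (tdim ((e, y) # bs)) (tfam ((e, y) # bs)) w) =
    dpoly (wmat (length (letters e)) (cyc e y) w) * dpoly (wmat (tdim bs) (tfam bs) w)"
    by (simp only: dpoly_dsum[OF c.wmat_carrier t.wmat_carrier])
  also have "dpoly (wmat (length (letters e)) (cyc e y) w) = (if e = w then 1 - monom y 1 else 1)"
    using 2(2) assms(1) dpoly_cyc_same[of e y] dpoly_cyc_other[of e w y] by auto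
  finally show ?case using 2 by simp
qed

lemma msum_dsum:
  assumes "mat_family m A" "mat_family m' B"
  shows "msum (m + m') u (\<lambda>k. dsum (A k) (B k)) = dsum (msum m u A) (msum m' u B)"
proof -
  interpret A: mat_family m A by fact
  interpret B: mat_family m' B by fact
  note dims = carrier_matD[OF A.fam] carrier_matD[OF B.fam]
  show ?thesis by (auto simp: msum_def dims intro!: eq_matI)
qed

lemma dpoly_msum_tfam:
  fixes bs :: "(word \<times> 'r::idom) list"
  assumes "fst ` set bs \<subseteq> Xtilde"
  shows "dpoly (msum (tdim bs) u (tfam bs)) =
    (\<Prod>(e, y)\<leftarrow>bs. if set (letters e) \<subseteq> {..<u} then 1 - monom y (length (letters e)) else 1)"
  using assms
proof (induction bs rule: tdim.induct)
  case 1
  show ?case by (simp add: dpoly_empty)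
next
  case (2 e y bs)
  interpret c: mat_family "length (letters e)" "cyc e y" by (rule mat_family_cyc)
  interpret t: mat_family "tdim bs" "tfam bs" by (rule mat_family_tfam)
  have "msum (tdim ((e, y) # bs)) u (tfam ((e, y) # bs)) = dsum (msum (length (letters e)) u (cyc e y)) (msum (tdim bs) u (tfam bs))"
    using msum_dsum[OF c.mat_family_axioms t.mat_family_axioms, of u] by (simp only: tdim.simps tfam.simps[abs_def])
  then have "dpoly (msum (tdim ((e, y) # bs)) u (tfam ((e, y) # bs))) =
    dpoly (msum (length (letters e)) u (cyc e y)) * dpoly (msum (tdim bs) u (tfam bs))"
    by (simp only: dpoly_dsum[OF msum_carrier msum_carrier])
  then show ?case using 2 dpoly_cyc_msum[of e u y] by (simp del: tfam.simps)
qed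

lemma pcompose_prod_list: "pcompose (\<Prod>x\<leftarrow>xs. f x) q = (\<Prod>x\<leftarrow>xs. pcompose (f x) (q :: 'r::comm_ring_1 poly))"
  by (induction xs) (auto simp: pcompose_mult pcompose_1)

lemma prod_prod_list: "finite S \<Longrightarrow> (\<Prod>a\<in>S. \<Prod>x\<leftarrow>xs. f a x) = (\<Prod>x\<leftarrow>xs. \<Prod>a\<in>S. f a x :: 'r::comm_monoid_mult)"
  by (induction xs) (auto simp: prod.distrib)

text \<open>Amitsur's formula on direct sums of labelled cycles. A cycle labelled \<open>e\<close>
  of weight \<open>y\<close> contributes 1 - y z^l, with l the length of \<open>e\<close>, to the
  left side if its letters are below \<open>u\<close>, and on the right side to the factor of
  \<open>e\<close> alone. Cycles of length above \<open>t\<close> are invisible modulo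
  z^(t+1).\<close>

lemma cut_dpoly_msum_tfam:
  fixes bs :: "(word \<times> 'r::idom) list"
  assumes bs: "fst ` set bs \<subseteq> Xtilde" and fin: "finite L"
    and L: "L = {e \<in> Xtilde. set (letters e) \<subseteq> {..<u} \<and> length (letters e) \<le> t}"
  shows "cut t (dpoly (msum (tdim bs) u (tfam bs)))
    (\<Prod>e\<in>L. pcompose (dpoly (wmat (tdim bs) (tfam bs) e)) (monom 1 (length (letters e))))"
proof -
  have pc: "pcompose (1 - monom y 1) (monom 1 l) = 1 - monom y l" for y :: 'r and l
    by (simp add: pcompose_diff pcompose_1 monom_Suc monom_0 pcompose_pCons smult_monom)
  have "(\<Prod>e\<in>L. pcompose (dpoly (wmat (tdim bs) (tfam bs) e)) (monom 1 (length (letters e)))) =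
    (\<Prod>e\<in>L. \<Prod>b\<leftarrow>bs. if fst b = e then 1 - monom (snd b) (length (letters e)) else 1)"
    using L bs
    by (intro prod.cong refl) (auto simp: dpoly_tfam pcompose_prod_list case_prod_unfold pc[simplified] pcompose_1 intro!: arg_cong[where f = prod_list])
  also have "\<dots> = (\<Prod>b\<leftarrow>bs. \<Prod>e\<in>L. if fst b = e then 1 - monom (snd b) (length (letters e)) else 1)"
    by (rule prod_prod_list[OF fin])
  also have "\<dots> = (\<Prod>b\<leftarrow>bs. if fst b \<in> L then 1 - monom (snd b) (length (letters (fst b))) else 1)"
    using fin by (simp add: prod.delta')
  finally have eq: "(\<Prod>e\<in>L. pcompose (dpoly (wmat (tdim bs) (tfam bs) e)) (monom 1 (length (letters e)))) =
    (\<Prod>b\<leftarrow>bs. if fst b \<in> L then 1 - monom (snd b) (length (letters (fst b))) else 1)" .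
  show ?thesis
    unfolding eq dpoly_msum_tfam[OF bs] case_prod_unfold
    by (rule cut_prod_list) (use bs in \<open>auto simp: L cut_def\<close>)
qed

text \<open>The desired reciprocal characteristic polynomial of each word \<open>e\<close> splits
  into factors 1 + cz. One cycle labelled \<open>e\<close> of weight -c is taken for each factor;
  cycles for different words do not interfere.\<close>

lemma ex_tfam:
  fixes h :: "nat \<Rightarrow> word \<Rightarrow> 'k::alg_closed_field"
  assumes "finite E" "E \<subseteq> Xtilde"
  shows "\<exists>bs. fst ` set bs \<subseteq> Xtilde \<and> (\<forall>e\<in>E. \<forall>t. 1 \<le> t \<and> t \<le> N \<longrightarrow> sg t (wmat (tdim bs) (tfam bs) e) = h t e)"
proof -
  have "\<exists>bs. fst ` set bs \<subseteq> E \<and> (\<forall>e\<in>E. (\<Prod>(e', y)\<leftarrow>bs. if e' = e then 1 - monom y 1 else 1) =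
      1 + (\<Sum>t=1..N. monom ((-1) ^ t * h t e) t))"
    using assms(1)
  proof (induction E rule: finite_induct)
    case (insert e E)
    then obtain bs where bs: "fst ` set bs \<subseteq> E" "\<And>e. e \<in> E \<Longrightarrow> (\<Prod>(e', y)\<leftarrow>bs. if e' = e then 1 - monom y 1 else 1) =
      1 + (\<Sum>t=1..N. monom ((-1) ^ t * h t e) t)" by blast
    let ?p = "1 + (\<Sum>t=1..N. monom ((-1) ^ t * h t e) t)"
    have "coeff ?p 0 = 1" by (simp add: coeff_sum)
    from split_monic_at_0[OF this] obtain cs where cs: "?p = (\<Prod>c\<leftarrow>cs. [:1, c:])" by blast
    have mon: "1 - monom (- c) 1 = [:1, c:]" for c :: 'k by (simp add: monom_Suc monom_0 one_pCons)
    define bs' where "bs' = map (\<lambda>c. (e, - c)) cs @ bs"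
    have "(\<Prod>(e', y)\<leftarrow>bs'. if e' = e1 then 1 - monom y 1 else 1) = 1 + (\<Sum>t=1..N. monom ((-1) ^ t * h t e1) t)"
      if "e1 \<in> insert e E" for e1
    proof (cases "e1 = e")
      case True
      have "(\<Prod>(e', y)\<leftarrow>bs. if e' = e then 1 - monom y 1 else 1) = 1"
        using bs(1) insert(2) by (induction bs) auto
      then show ?thesis using True cs by (simp add: bs'_def comp_def mon[simplified] case_prod_unfold)
    next
      case False
      then show ?thesis using that bs(2)[of e1] by (simp add: bs'_def comp_def case_prod_unfold map_replicate_const prod_list_replicate)
    qed
    moreover have "fst ` set bs' \<subseteq> insert e E" using bs(1) by (auto simp: bs'_def)
    ultimately show ?case by blast
  qed simp
  then obtain bs where bs1: "fst ` set bs \<subseteq> E" and bs2: "\<forall>e\<in>E. (\<Prod>(e', y)\<leftarrow>bs. if e' = e then 1 - monom y 1 else 1) =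
      1 + (\<Sum>t=1..N. monom ((-1) ^ t * h t e) t)" by (elim exE conjE)
  note bs = bs1 bs2[rule_format]
  interpret t: mat_family "tdim bs" "tfam bs" by (rule mat_family_tfam)
  have "sg t (wmat (tdim bs) (tfam bs) e) = h t e" if "e \<in> E" "1 \<le> t" "t \<le> N" for e t
  proof -
    have "coeff (dpoly (wmat (tdim bs) (tfam bs) e)) t = (-1) ^ t * h t e"
      using that bs assms(2) by (subst dpoly_tfam) (auto simp: coeff_sum)
    then show ?thesis unfolding sg_coeff_dpoly[OF t.wmat_carrier] by (simp flip: mult.assoc power_add)
  qed
  then show ?thesis using bs(1) assms(2) by blast
qed

text \<open>Only finitely many generators occur in \<open>f\<close> and \<open>g\<close>, and by
  \<open>ex_tfam\<close> these take arbitrary values on direct sums of cycles.\<close>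

lemma sXt_eqI:
  fixes f g :: "'f::field sXt"
  assumes inf: "infinite (UNIV :: 'f set)"
    and eq: "\<And>bs. fst ` set bs \<subseteq> Xtilde \<Longrightarrow> ev (tdim bs) (tfam bs) f = ev (tdim bs) (tfam bs) g"
  shows "f = g"
proof (rule mpoly_eq_if_meval_eq[OF inf])
  fix h :: "tgen \<Rightarrow> 'f alg_closure"
  define S where "S = Rep_tgen ` (mvars f \<union> mvars g)"
  have fin: "finite S" by (simp add: S_def finite_mvars)
  define N where "N = Max (insert 0 (fst ` S))"
  have N: "t \<le> N" if "(t, e) \<in> S" for t e
    unfolding N_def using fin that by (intro Max_ge) force+
  have "snd (Rep_tgen v) \<in> Xtilde" for v by (cases v rule: tgen_cases) simp
  then have "snd ` S \<subseteq> Xtilde" by (auto simp: S_def)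
  from ex_tfam[OF _ this, of N "\<lambda>t e. h (Abs_tgen (t, e))"] fin
  obtain bs where bs: "fst ` set bs \<subseteq> Xtilde" and
    v: "\<And>e t. e \<in> snd ` S \<Longrightarrow> 1 \<le> t \<Longrightarrow> t \<le> N \<Longrightarrow> sg t (wmat (tdim bs) (tfam bs) e) = h (Abs_tgen (t, e))" by blast
  have val: "(case Rep_tgen v of (t, e) \<Rightarrow> sg t (wmat (tdim bs) (tfam bs) e)) = h v" if "v \<in> mvars f \<union> mvars g" for v
  proof (cases v rule: tgen_cases)
    case (1 t e)
    then have "(t, e) \<in> S" using that unfolding S_def by (metis image_eqI)
    then have "e \<in> snd ` S" "t \<le> N" using N by force+
    then show ?thesis using v[of e t] 1 by simp
  qed
  have "meval to_ac h f = ev (tdim bs) (tfam bs) f"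
    unfolding ev_def by (rule meval_cong) (use val in auto)
  also have "\<dots> = ev (tdim bs) (tfam bs) g" by (rule eq[OF bs])
  also have "\<dots> = meval to_ac h g"
    unfolding ev_def by (rule meval_cong) (use val in auto)
  finally show "meval to_ac h f = meval to_ac h g" .
qed

lemma sXt_eqI':
  fixes f g :: "'f::field sXt"
  assumes "infinite (UNIV :: 'f set)"
    and "\<And>m A. mat_family m A \<Longrightarrow> ev m A f = ev m A g"
  shows "f = g"
  using assms mat_family_tfam by (intro sXt_eqI) auto

section \<open>Matrix functions that come from \<sigma>\<langle>X~\<rangle>\<close>

definition represents :: "'f::field sXt \<Rightarrow> (nat \<Rightarrow> (nat \<Rightarrow> 'f alg_closure mat) \<Rightarrow> 'f alg_closure) \<Rightarrow> bool" where
  "represents g F \<longleftrightarrow> (\<forall>m A. mat_family m A \<longrightarrow> ev m A g = F m A)"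

text \<open>Over an infinite field the representing element is unique, by
  \<open>sXt_eqI'\<close>.\<close>

definition represented :: "(nat \<Rightarrow> (nat \<Rightarrow> 'f::field alg_closure mat) \<Rightarrow> 'f alg_closure) \<Rightarrow> bool" where
  "represented F \<longleftrightarrow> (\<exists>g. represents g F)"

lemma represented_cong:
  "represented F \<Longrightarrow> (\<And>m A. mat_family m A \<Longrightarrow> G m A = F m A) \<Longrightarrow> represented G"
  by (auto simp: represented_def represents_def)

lemma represented_const: "represented (\<lambda>m A. to_ac a)"
  unfolding represented_def represents_def by (intro exI[of _ "Const a"]) simp

lemma represented_0: "represented (\<lambda>m A. 0)" and represented_1: "represented (\<lambda>m A. 1)"
  using represented_const[of 0] represented_const[of 1] by simp_all

lemma represented_add: "represented F \<Longrightarrow> represented G \<Longrightarrow> represented (\<lambda>m A. F m A + G m A)"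
  unfolding represented_def represents_def by (metis ev.hom_add)

lemma represented_mult: "represented F \<Longrightarrow> represented G \<Longrightarrow> represented (\<lambda>m A. F m A * G m A)"
  unfolding represented_def represents_def by (metis ev.hom_mult)

lemma represented_sum: "(\<And>x. x \<in> S \<Longrightarrow> represented (F x)) \<Longrightarrow> represented (\<lambda>m A. \<Sum>x\<in>S. F x m A)"
  by (induction S rule: infinite_finite_induct) (auto intro: represented_add represented_0)

lemma represented_prod: "(\<And>x. x \<in> S \<Longrightarrow> represented (F x)) \<Longrightarrow> represented (\<lambda>m A. \<Prod>x\<in>S. F x m A)"
  by (induction S rule: infinite_finite_induct) (auto intro: represented_mult represented_1)

lemma represented_power: "represented F \<Longrightarrow> represented (\<lambda>m A. F m A ^ k)"
  by (induction k) (auto intro: represented_mult represented_1)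

lemma represented_meval:
  assumes "\<And>v. v \<in> mvars P \<Longrightarrow> represented (F v)"
  shows "represented (\<lambda>m A. meval to_ac (\<lambda>v. F v m A) P)"
  unfolding meval_def
  by (intro represented_sum represented_mult represented_const represented_prod represented_power assms)
     (auto simp: mvars_def)

text \<open>A word is a power of a primitive word, which is a rotation of some \<open>e\<close> in
  \<open>Xtilde\<close>. Rotations do not change \<open>sg\<close>, and powers are handled by
  \<open>P_companion\<close>.\<close>

lemma represented_sg_word:
  assumes inf: "infinite (UNIV :: 'f::field set)" and w: "w \<noteq> 0"
  shows "represented (\<lambda>m (A :: nat \<Rightarrow> 'f alg_closure mat). sg t (wmat m A w))"
proof (cases "t = 0")
  case True
  then show ?thesis by (simp add: represented_1)
next
  case t: False
  have prim: "represented (\<lambda>m (A :: nat \<Rightarrow> 'f alg_closure mat). sg i (wmat m A v))"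
    if v: "v \<noteq> 0" "primitive_word v" for v i
  proof (cases "i = 0")
    case True
    then show ?thesis by (simp add: represented_1)
  next
    case False
    obtain e where e: "e \<in> Xtilde" "cyc_equiv v e" using ex_Xtilde_rep[OF v] by blast
    then obtain a b where ab: "v = a + b" "e = b + a" by (auto simp: cyc_equiv_def)
    have "represents (sigma_t i e) (\<lambda>m (A :: nat \<Rightarrow> 'f alg_closure mat). sg i (wmat m A v))"
      unfolding represents_def
    proof (intro allI impI)
      fix m and A :: "nat \<Rightarrow> 'f alg_closure mat" assume "mat_family m A"
      then interpret mat_family m A .
      show "ev m A (sigma_t i e) = sg i (wmat m A v)"
        using False e sg_mult_commute[OF wmat_carrier wmat_carrier, of i b a] by (simp add: ev_sigma_t ab wmat_plus)
    qed
    then show ?thesis by (auto simp: represented_def)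
  qed
  from ex_primitive_root[OF w] obtain v l where v: "w = wpow l v" "l > 0" "v \<noteq> 0" "primitive_word v" by blast
  have "represented (\<lambda>m (A :: nat \<Rightarrow> 'f alg_closure mat). meval to_ac (\<lambda>i. sg i (wmat m A v)) (P_companion t l))"
    by (rule represented_meval) (rule prim[OF v(3,4)])
  then show ?thesis
  proof (rule represented_cong)
    fix m and A :: "nat \<Rightarrow> 'f alg_closure mat" assume "mat_family m A"
    then interpret mat_family m A .
    show "sg t (wmat m A w) = meval to_ac (\<lambda>i. sg i (wmat m A v)) (P_companion t l)"
      using meval_P_companion[OF comm_ring_hom_to_ac infinite_alg_closure[OF inf] wmat_carrier _ v(2), of t v] t
      by (simp add: v(1) wmat_wpow)
  qed
qed

subsection \<open>Elimination\<close>

text \<open>Words carry coefficients in a polynomial ring in one variable z; the condition is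
  divisibility by z^d.\<close>

definition low :: "nat \<Rightarrow> (word \<Rightarrow>\<^sub>0 'f::comm_ring_1 poly) \<Rightarrow> bool" where
  "low d S \<longleftrightarrow> (\<forall>w. \<forall>i<d. coeff (Poly_Mapping.lookup S w) i = 0)"

lemma low_0: "low 0 S" by (simp add: low_def)
lemma low_mono: "low d S \<Longrightarrow> d' \<le> d \<Longrightarrow> low d' S" by (simp add: low_def)
lemma low_diff: "low d S \<Longrightarrow> low d T \<Longrightarrow> low d (S - T)" by (simp add: low_def lookup_minus)
lemma low_sum: "(\<And>x. x \<in> I \<Longrightarrow> low d (f x)) \<Longrightarrow> low d (sum f I)"
  by (simp add: low_def lookup_sum coeff_sum)
lemma low_single: "(\<And>i. i < d \<Longrightarrow> coeff p i = 0) \<Longrightarrow> low d (Poly_Mapping.single w p)"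
  by (simp add: low_def lookup_single when_def)

lemma low_mult:
  assumes "low d S" "low d' T"
  shows "low (d + d') (S * T)"
proof -
  have "S * T = (\<Sum>w\<in>Poly_Mapping.keys S. \<Sum>w'\<in>Poly_Mapping.keys T.
      Poly_Mapping.single (w + w') (Poly_Mapping.lookup S w * Poly_Mapping.lookup T w'))"
    by (subst poly_mapping_sum_single[of S], subst poly_mapping_sum_single[of T])
       (simp add: sum_product mult_single)
  also have "low (d + d') \<dots>"
  proof (intro low_sum low_single)
    fix w w' i assume i: "i < d + d'"
    show "coeff (Poly_Mapping.lookup S w * Poly_Mapping.lookup T w') i = 0"
      unfolding coeff_mult
    proof (rule sum.neutral, rule ballI)
      fix j assume "j \<in> {..i}"
      then have "j < d \<or> i - j < d'" using i by auto
      then show "coeff (Poly_Mapping.lookup S w) j * coeff (Poly_Mapping.lookup T w') (i - j) = 0"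
        using assms by (auto simp: low_def)
    qed
  qed
  finally show ?thesis .
qed

lemma low_power: "low 1 S \<Longrightarrow> low k (S ^ k)"
proof (induction k)
  case (Suc k)
  then show ?case using low_mult[of 1 S k "S ^ k"] by simp
qed (rule low_0)

lemma word_add_eq_0_iff [simp]: "u + v = 0 \<longleftrightarrow> u = 0 \<and> v = 0" for u v :: word
  by (cases u; cases v) (auto simp: zero_word_def plus_word_def)

lemma FX_mult: "a \<in> FX \<Longrightarrow> a * b \<in> FX" for a b :: "word \<Rightarrow>\<^sub>0 'f::semiring_0"
proof -
  assume a: "a \<in> FX"
  have "0 \<notin> Poly_Mapping.keys (a * b)"
  proof
    assume "0 \<in> Poly_Mapping.keys (a * b)"
    then obtain u v where "0 = u + v" "u \<in> Poly_Mapping.keys a" using keys_mult[of a b] by blast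
    then have "u = 0" by (metis word_add_eq_0_iff)
    then show False using a \<open>u \<in> Poly_Mapping.keys a\<close> by (auto simp: FX_def)
  qed
  then show "a * b \<in> FX" by (auto simp: FX_def in_keys_iff)
qed

lemma FX_add: "a \<in> FX \<Longrightarrow> b \<in> FX \<Longrightarrow> a + b \<in> FX" for a b :: "word \<Rightarrow>\<^sub>0 'f::monoid_add"
  by (simp add: FX_def lookup_add)

definition pmats :: "(nat \<Rightarrow> 'r::comm_ring_1 mat) \<Rightarrow> nat \<Rightarrow> 'r poly mat" where
  "pmats A k = map_mat (\<lambda>a. [:a:]) (A k)"

definition fm :: "nat \<Rightarrow> (nat \<Rightarrow> 'f::field alg_closure mat) \<Rightarrow> (word \<Rightarrow>\<^sub>0 'f poly) \<Rightarrow> 'f alg_closure poly mat" where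
  "fm m A = fmat (map_poly to_ac) m (pmats A)"

text \<open>det(1 - S) at the matrices \<open>A\<close>, as a polynomial in z. For S = za this is
  \<open>dpoly\<close> of the value of \<open>a\<close>.\<close>

definition dfm :: "nat \<Rightarrow> (nat \<Rightarrow> 'f::field alg_closure mat) \<Rightarrow> (word \<Rightarrow>\<^sub>0 'f poly) \<Rightarrow> 'f alg_closure poly" where
  "dfm m A S = det (fm m A (1 - S))"

lemma comm_ring_hom_map_poly_to_ac: "comm_ring_hom (map_poly (to_ac :: 'f::field \<Rightarrow> _))"
proof -
  interpret b: map_poly_comm_ring_hom "to_ac :: 'f \<Rightarrow> _"
    by (intro map_poly_comm_ring_hom.intro comm_ring_hom_to_ac)
  show ?thesis by unfold_locales
qed

lemma fm_family:
  assumes "mat_family m (A :: nat \<Rightarrow> 'f::field alg_closure mat)"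
  shows "mat_family_hom m (pmats A) (map_poly (to_ac :: 'f \<Rightarrow> _))"
    and "wmat m (pmats A) w = map_mat (\<lambda>a. [:a:]) (wmat m A w)"
proof -
  have 1: "mat_family m (pmats A)" "wmat m (pmats A) w = map_mat (\<lambda>a. [:a:]) (wmat m A w)" for w
    using mat_family_hom[OF assms comm_ring_hom_pCons] by (simp_all add: pmats_def[abs_def])
  show "mat_family_hom m (pmats A) (map_poly (to_ac :: 'f \<Rightarrow> _))"
    by (intro mat_family_hom.intro 1 comm_ring_hom_map_poly_to_ac)
  show "wmat m (pmats A) w = map_mat (\<lambda>a. [:a:]) (wmat m A w)" by (rule 1)
qed

text \<open>Changes of order above \<open>N\<close> in z do not reach the coefficients up to
  \<open>N\<close>; this permits truncating power series.\<close>

lemma dfm_cong: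
  assumes mf: "mat_family m A" and low: "low (Suc N) (T - S)"
  shows "cut N (dfm m A S) (dfm m A T)"
  unfolding dfm_def
proof (rule cut_det[of _ m])
  interpret mat_family m A by (rule mf)
  interpret P: mat_family_hom m "pmats A" "map_poly to_ac" by (rule fm_family[OF mf])
  fix i j assume ij: "i < m" "j < m"
  have "fm m A (1 - S) = fm m A (T - S) + fm m A (1 - T)"
    unfolding fm_def P.fmat_add[symmetric] by simp
  then have "fm m A (1 - S) $$ (i, j) = fm m A (T - S) $$ (i, j) + fm m A (1 - T) $$ (i, j)"
    using ij by (simp add: fm_def)
  moreover have "coeff (fm m A (T - S) $$ (i, j)) r = 0" if "r \<le> N" for r
    using ij low that
    by (auto simp: fm_def fmat_def lext_def coeff_sum fm_family(2)[OF mf] coeff_map_poly low_def intro!: sum.neutral)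
  ultimately show "cut N (fm m A (1 - S) $$ (i, j)) (fm m A (1 - T) $$ (i, j))"
    by (simp add: cut_def)
qed (auto simp: fm_def)

lemma geometric_ring: "(\<Sum>k<N. x ^ k) * (1 - x) = 1 - x ^ N" for x :: "'r::ring_1"
proof (induction N)
  case (Suc N)
  have "(\<Sum>k<Suc N. x ^ k) * (1 - x) = 1 - x ^ N + x ^ N * (1 - x)"
    unfolding sum.lessThan_Suc distrib_right Suc ..
  then show ?case by (simp add: right_diff_distrib power_Suc2 del: power_Suc)
qed simp

lemma dfm_single:
  assumes mf: "mat_family m A" and d: "d > 0"
  shows "coeff (dfm m A (Poly_Mapping.single w (monom a d))) i =
    (if d dvd i then (- to_ac a) ^ (i div d) * sg (i div d) (wmat m A w) else 0)"
proof -
  interpret mat_family m A by (rule mf)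
  interpret P: mat_family_hom m "pmats A" "map_poly to_ac" by (rule fm_family[OF mf])
  interpret C: comm_ring_hom "\<lambda>a::'a alg_closure. [:a:]" by (rule comm_ring_hom_pCons)
  have "fm m A (1 - Poly_Mapping.single w (monom a d)) = fm m A (1 + Poly_Mapping.single w (monom (- a) d))"
    by (simp add: single_uminus minus_monom[symmetric])
  also have "\<dots> = 1\<^sub>m m + monom (- to_ac a) d \<cdot>\<^sub>m map_mat (\<lambda>a. [:a:]) (wmat m A w)"
    unfolding fm_def P.fmat_add P.fmat_one P.fmat_single fm_family(2)[OF mf] by (simp add: map_poly_monom)
  finally have "dfm m A (Poly_Mapping.single w (monom a d)) = (\<Sum>t\<le>m. monom (- to_ac a) d ^ t * [:sg t (wmat m A w):])"
    unfolding dfm_def by (simp add: det_one_add[of _ m] C.sg_hom[of _ m])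
  also have "\<dots> = (\<Sum>t\<le>m. monom ((- to_ac a) ^ t * sg t (wmat m A w)) (d * t))"
    by (intro sum.cong refl) (simp add: monom_power smult_monom mult.commute)
  finally have "coeff (dfm m A (Poly_Mapping.single w (monom a d))) i =
    (\<Sum>t\<le>m. if d * t = i then (- to_ac a) ^ t * sg t (wmat m A w) else 0)"
    by (simp add: coeff_sum)
  also have "\<dots> = (if d dvd i then (- to_ac a) ^ (i div d) * sg (i div d) (wmat m A w) else 0)"
  proof (cases "d dvd i")
    case True
    then have "(d * t = i) = (t = i div d)" for t using d by auto
    then show ?thesis using True by (simp add: sg_gt)
  next
    case False
    then show ?thesis by (auto intro!: sum.neutral)
  qed
  finally show ?thesis .
qed

text \<open>An outer induction raises the order \<open>d\<close> of \<open>S\<close> in z up to N +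
  1, where only the constant 1 is left; an inner one counts the words whose coefficient at z^d is
  nonzero. Eliminating one such term \<open>x\<close> replaces the rest \<open>s\<close> by s(1 -
  x)^-1, which agrees with \<open>s\<close> up to z^d because \<open>x\<close> has order at least 1.
  So at order d the word of \<open>x\<close> is gone, no other word has entered, and the count
  drops.\<close>

lemma represented_dfm:
  fixes S :: "word \<Rightarrow>\<^sub>0 'f::field poly"
  assumes inf: "infinite (UNIV :: 'f set)"
  shows "1 \<le> d \<Longrightarrow> d \<le> Suc N \<Longrightarrow> S \<in> FX \<Longrightarrow> low d S \<Longrightarrow> i \<le> N \<Longrightarrow>
    represented (\<lambda>m A. coeff (dfm m A S) i)"
proof (induction "Suc N - d" arbitrary: d S i)
  case 0
  then have low: "low (Suc N) (0 - S)" using low_diff[of "Suc N" 0 S] by (simp add: low_def)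
  have "represented (\<lambda>m A. if i = 0 then 1 else 0)" by (simp add: represented_0 represented_1)
  then show ?case
  proof (rule represented_cong)
    fix m and A :: "nat \<Rightarrow> 'f alg_closure mat" assume mf: "mat_family m A"
    interpret P: mat_family_hom m "pmats A" "map_poly to_ac" by (rule fm_family[OF mf])
    have "dfm m A 0 = 1" by (simp add: dfm_def fm_def P.fmat_one)
    then show "coeff (dfm m A S) i = (if i = 0 then 1 else 0)"
      using dfm_cong[OF mf low] \<open>i \<le> N\<close> by (simp add: cut_def)
  qed
next
  case (Suc r)
  have IH: "represented (\<lambda>m A. coeff (dfm m A S) i)" if "S \<in> FX" "low (Suc d) S" "i \<le> N"
    for S :: "word \<Rightarrow>\<^sub>0 'f poly" and i
    by (rule Suc.hyps(1)[OF _ _ _ that]) (use Suc.hyps(2) in auto)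
  define cnt where "cnt S = {w. coeff (Poly_Mapping.lookup S w) d \<noteq> 0}" for S :: "word \<Rightarrow>\<^sub>0 'f poly"
  have fin: "finite (cnt S)" for S
    by (rule finite_subset[of _ "Poly_Mapping.keys S"]) (auto simp: cnt_def in_keys_iff)
  have "S \<in> FX \<Longrightarrow> low d S \<Longrightarrow> i \<le> N \<Longrightarrow> represented (\<lambda>m A. coeff (dfm m A S) i)"
    for S :: "word \<Rightarrow>\<^sub>0 'f poly" and i
  proof (induction "card (cnt S)" arbitrary: S i)
    case 0
    then have "cnt S = {}" using fin by simp
    then have "low (Suc d) S" using 0 by (auto simp: low_def cnt_def less_Suc_eq)
    then show ?case using IH 0 by blast
  next
    case (Suc k)
    then obtain w where w: "w \<in> cnt S" by (metis card.empty equals0I nat.distinct(1))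
    define x where "x = Poly_Mapping.single w (monom (coeff (Poly_Mapping.lookup S w) d) d)"
    define s where "s = S - x"
    \<comment> \<open>The geometric series for the inverse of 1 - x, cut off so that the error s
      x^(N+1) is invisible in the coefficients up to \<open>N\<close>.\<close>
    define G where "G = (\<Sum>k<Suc N. x ^ k)"
    have w0: "w \<noteq> 0" using w Suc.prems(1) by (auto simp: cnt_def FX_def)
    have lowx: "low d x" unfolding x_def by (rule low_single) simp
    have lows: "low d s" unfolding s_def by (rule low_diff[OF Suc.prems(2) lowx])
    have sFX: "s \<in> FX" using Suc.prems(1) w0 by (simp add: s_def x_def FX_def lookup_minus lookup_single)
    have x1: "low 1 x" using lowx \<open>1 \<le> d\<close> by (rule low_mono)
    have "G - 1 = (\<Sum>k<N. x ^ Suc k)" unfolding G_def by (subst sum.lessThan_Suc_shift) simp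
    also have "low 1 \<dots>" by (intro low_sum low_mono[OF low_power[OF x1]]) simp
    finally have "low (Suc d) (s * (G - 1))" using low_mult[OF lows, of 1] by simp
    then have cf: "coeff (Poly_Mapping.lookup (s * G) v) j = coeff (Poly_Mapping.lookup s v) j" if "j \<le> d" for v j
    proof -
      have "s * G = s * (G - 1) + s" by (simp add: algebra_simps)
      then show ?thesis using \<open>low (Suc d) (s * (G - 1))\<close> that by (simp add: lookup_add low_def)
    qed
    have lowsG: "low d (s * G)" using cf lows by (simp add: low_def)
    have "coeff (Poly_Mapping.lookup s v) d = (if v = w then 0 else coeff (Poly_Mapping.lookup S v) d)" for v
      by (simp add: s_def x_def lookup_minus lookup_single when_def)
    then have "cnt (s * G) = cnt S - {w}"
      by (auto simp: cnt_def cf[OF order_refl] split: if_splits)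
    then have "k = card (cnt (s * G))" using Suc.hyps(2) w fin by simp
    from Suc.hyps(1)[OF this FX_mult[OF sFX] lowsG]
    have rep: "represented (\<lambda>m A. coeff (dfm m A (s * G)) j)" if "j \<le> N" for j using that .
    have repx: "represented (\<lambda>m (A :: nat \<Rightarrow> 'f alg_closure mat). coeff (dfm m A x) j)" for j
    proof (rule represented_cong)
      show "represented (\<lambda>m A. if d dvd j then (to_ac (- coeff (Poly_Mapping.lookup S w) d)) ^ (j div d) * sg (j div d) (wmat m A w) else 0)"
        by (cases "d dvd j") (auto intro!: represented_mult represented_0 represented_power represented_const represented_sg_word inf w0 simp del: to_ac_minus)
    qed (use \<open>1 \<le> d\<close> in \<open>simp add: x_def dfm_single\<close>)
    have "represented (\<lambda>m A. \<Sum>j\<le>i. coeff (dfm m A (s * G)) j * coeff (dfm m A x) (i - j))"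
      using Suc.prems(3) by (intro represented_sum represented_mult rep repx) auto
    then show ?case
    proof (rule represented_cong)
      fix m and A :: "nat \<Rightarrow> 'f alg_closure mat" assume mf: "mat_family m A"
      interpret P: mat_family_hom m "pmats A" "map_poly to_ac" by (rule fm_family[OF mf])
      have "(1 - s * G) * (1 - x) = 1 - x - s * (G * (1 - x))" by (simp add: algebra_simps)
      also have "\<dots> = 1 - (S - s * x ^ Suc N)"
        unfolding G_def geometric_ring s_def by (simp add: algebra_simps)
      finally have "dfm m A (S - s * x ^ Suc N) = dfm m A (s * G) * dfm m A x"
        unfolding dfm_def fm_def by (simp only: P.fmat_mult[symmetric] det_mult[OF fmat_carrier fmat_carrier, symmetric])
      moreover have "low (Suc N) (S - (S - s * x ^ Suc N))"
        using low_mult[OF low_0[of s] low_power[OF x1, of "Suc N"]] by simp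
      from dfm_cong[OF mf this] have "coeff (dfm m A (S - s * x ^ Suc N)) i = coeff (dfm m A S) i"
        using Suc.prems(3) by (simp add: cut_def)
      ultimately show "coeff (dfm m A S) i = (\<Sum>j\<le>i. coeff (dfm m A (s * G)) j * coeff (dfm m A x) (i - j))"
        by (simp add: coeff_mult)
    qed
  qed
  then show ?case using Suc.prems by blast
qed

text \<open>With S = za, which has order 1 in z, \<sigma>_t(a) is up to sign the coefficient of z^t
  in det(1 - S).\<close>

lemma represented_sg_fmat:
  fixes a :: "word \<Rightarrow>\<^sub>0 'f::field"
  assumes inf: "infinite (UNIV :: 'f set)" and a: "a \<in> FX"
  shows "represented (\<lambda>m A. sg t (fmat to_ac m A a))"
proof -
  define S where "S = Poly_Mapping.map (\<lambda>c. monom c 1) a"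
  have lS: "Poly_Mapping.lookup S w = monom (Poly_Mapping.lookup a w) 1" for w
    by (simp add: S_def Poly_Mapping.map.rep_eq when_def)
  have "S \<in> FX" using a by (simp add: FX_def lS)
  moreover have "low 1 S" by (simp add: low_def lS)
  ultimately have "represented (\<lambda>m A. (-1) ^ t * coeff (dfm m A S) t)"
    using represented_dfm[OF inf, of 1 t S t] represented_const[of "(-1) ^ t"]
    by (intro represented_mult) simp_all
  then show ?thesis
  proof (rule represented_cong)
    fix m and A :: "nat \<Rightarrow> 'f alg_closure mat" assume mf: "mat_family m A"
    interpret mat_family m A by (rule mf)
    interpret P: mat_family_hom m "pmats A" "map_poly to_ac" by (rule fm_family[OF mf])
    have keys: "Poly_Mapping.keys S = Poly_Mapping.keys a"
      by (auto simp: in_keys_iff lS)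
    have "1 - S = 1 + Poly_Mapping.map (\<lambda>c. monom (- c) 1) a"
      by (rule poly_mapping_eqI) (simp add: lookup_add lookup_minus lS Poly_Mapping.map.rep_eq when_def minus_monom)
    have "fm m A (1 - S) + fm m A S = 1\<^sub>m m"
      unfolding fm_def P.fmat_add[symmetric] by (simp add: P.fmat_one)
    moreover have "fm m A S = [:0, 1:] \<cdot>\<^sub>m map_mat (\<lambda>a. [:a:]) (fmat to_ac m A a)"
    proof (rule eq_matI)
      fix i j assume "i < dim_row ([:0, 1:] \<cdot>\<^sub>m map_mat (\<lambda>a. [:a:]) (fmat to_ac m A a))"
        "j < dim_col ([:0, 1:] \<cdot>\<^sub>m map_mat (\<lambda>a. [:a:]) (fmat to_ac m A a))"
      then have ij: "i < m" "j < m" by auto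
      interpret C: comm_ring_hom "\<lambda>a::'f alg_closure. [:a:]" by (rule comm_ring_hom_pCons)
      have "fm m A S $$ (i, j) = (\<Sum>w\<in>Poly_Mapping.keys a. monom (to_ac (Poly_Mapping.lookup a w)) 1 * [:wmat m A w $$ (i, j):])"
        using ij by (simp add: fm_def fmat_def lext_def keys lS map_poly_monom fm_family(2)[OF mf])
      also have "\<dots> = (\<Sum>w\<in>Poly_Mapping.keys a. [:0, 1:] * [:to_ac (Poly_Mapping.lookup a w) * wmat m A w $$ (i, j):])"
        by (intro sum.cong refl) (simp add: monom_Suc monom_0)
      also have "\<dots> = [:0, 1:] * [:\<Sum>w\<in>Poly_Mapping.keys a. to_ac (Poly_Mapping.lookup a w) * wmat m A w $$ (i, j):]"
        by (simp only: sum_distrib_left[symmetric] C.hom_sum)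
      finally show "fm m A S $$ (i, j) = ([:0, 1:] \<cdot>\<^sub>m map_mat (\<lambda>a. [:a:]) (fmat to_ac m A a)) $$ (i, j)"
        using ij by (simp add: fmat_def lext_def)
    qed (auto simp: fm_def)
    ultimately have "fm m A (1 - S) = 1\<^sub>m m + (- [:0, 1:]) \<cdot>\<^sub>m map_mat (\<lambda>a. [:a:]) (fmat to_ac m A a)"
      (is "?L = ?R")
    proof (intro eq_matI)
      fix i j assume sum: "fm m A (1 - S) + fm m A S = 1\<^sub>m m"
        and S: "fm m A S = [:0, 1:] \<cdot>\<^sub>m map_mat (\<lambda>a. [:a:]) (fmat to_ac m A a)"
        and "i < dim_row ?R" "j < dim_col ?R"
      then have ij: "i < m" "j < m" by auto
      have "?L $$ (i, j) + fm m A S $$ (i, j) = 1\<^sub>m m $$ (i, j)"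
        using arg_cong[OF sum, of "\<lambda>M. M $$ (i, j)"] ij by (simp add: fm_def)
      then have "?L $$ (i, j) = 1\<^sub>m m $$ (i, j) - fm m A S $$ (i, j)" by (simp only: eq_diff_eq)
      then show "?L $$ (i, j) = ?R $$ (i, j)" using ij by (simp add: S)
    qed (auto simp: fm_def)
    then have "dfm m A S = dpoly (fmat to_ac m A a)" by (simp add: dfm_def dpoly_def)
    then show "sg t (fmat to_ac m A a) = (-1) ^ t * coeff (dfm m A S) t"
      using sg_coeff_dpoly[OF fmat_carrier] by simp
  qed
qed

section \<open>Values of the generators of \<sigma>\<langle>X\<rangle>\<close>

lemma sg_smult:
  assumes "A \<in> carrier_mat n n"
  shows "sg t (c \<cdot>\<^sub>m A) = c ^ t * sg t A"
  unfolding sg_def sum_distrib_left using assms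
proof (intro sum.cong refl)
  show "{I. I \<subseteq> {0..<dim_row (c \<cdot>\<^sub>m A)} \<and> card I = t} = {I. I \<subseteq> {0..<dim_row A} \<and> card I = t}" by simp
  fix I p assume I: "I \<in> {I. I \<subseteq> {0..<dim_row A} \<and> card I = t}" and p: "p \<in> {p. p permutes I}"
  have "(\<Prod>i\<in>I. (c \<cdot>\<^sub>m A) $$ (i, p i)) = (\<Prod>i\<in>I. c * A $$ (i, p i))"
  proof (rule prod.cong[OF refl])
    fix i assume "i \<in> I"
    then have "i < n" "p i < n" using I p assms permutes_in_image[of p I i] by auto
    then show "(c \<cdot>\<^sub>m A) $$ (i, p i) = c * A $$ (i, p i)" using assms by simp
  qed
  also have "\<dots> = c ^ t * (\<Prod>i\<in>I. A $$ (i, p i))" using I by (simp add: prod.distrib)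
  finally show "signof p * (\<Prod>i\<in>I. (c \<cdot>\<^sub>m A) $$ (i, p i)) = c ^ t * (signof p * (\<Prod>i\<in>I. A $$ (i, p i)))"
    by simp
qed

lemma sg_zero_mat:
  assumes "t > 0"
  shows "sg t (0\<^sub>m n n) = (0 :: 'r::comm_ring_1)"
proof -
  have "0\<^sub>m n n = (0 :: 'r) \<cdot>\<^sub>m 0\<^sub>m n n" by (auto intro!: eq_matI)
  then have "sg t (0\<^sub>m n n :: 'r mat) = 0 ^ t * sg t (0\<^sub>m n n)" using sg_smult[of "0\<^sub>m n n :: 'r mat" n t 0] by simp
  also have "\<dots> = 0" using assms by (simp add: zero_power)
  finally show ?thesis .
qed

lemma lookup_Const_mult: "Poly_Mapping.lookup (Const x * b) w = x * Poly_Mapping.lookup b w"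
  for b :: "'k::monoid_add \<Rightarrow>\<^sub>0 'f::semiring_0"
proof (induction b rule: poly_mapping_add_induct)
  case (1 k v)
  then show ?case by (simp add: Const_def mult_single lookup_single when_def)
qed (simp add: distrib_left lookup_add)

lemma lcoef_nz:
  assumes "b \<noteq> 0"
  shows "lcoef b \<noteq> 0"
proof -
  have "Max (Poly_Mapping.keys b) \<in> Poly_Mapping.keys b" using assms by (intro Max_in) auto
  then show ?thesis by (simp add: lcoef_def in_keys_iff)
qed

lemma Const_mult_keys: "x \<noteq> 0 \<Longrightarrow> Poly_Mapping.keys (Const x * b) = Poly_Mapping.keys b"
  for b :: "word \<Rightarrow>\<^sub>0 'f::field"
  by (auto simp: in_keys_iff lookup_Const_mult)

lemma normalized:
  fixes b :: "word \<Rightarrow>\<^sub>0 'f::field"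
  assumes "b \<noteq> 0" "b \<in> FX"
  defines "b' \<equiv> Const (inverse (lcoef b)) * b"
  shows "b' \<in> FX" "b' \<noteq> 0" "lcoef b' = 1" "Const (lcoef b) * b' = b"
proof -
  have nz: "lcoef b \<noteq> 0" by (rule lcoef_nz) fact
  have k: "Poly_Mapping.keys b' = Poly_Mapping.keys b" unfolding b'_def using nz by (intro Const_mult_keys) simp
  show "b' \<in> FX" using assms(2) by (simp add: b'_def FX_def lookup_Const_mult)
  show "b' \<noteq> 0" using k assms(1) by (metis keys_eq_empty)
  show "lcoef b' = 1" using nz unfolding lcoef_def k by (simp add: b'_def lookup_Const_mult lcoef_def)
  show "Const (lcoef b) * b' = b" using nz by (intro poly_mapping_eqI) (simp add: b'_def lookup_Const_mult)
qed

lemma Rep_sgen_normalized: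
  fixes b :: "word \<Rightarrow>\<^sub>0 'f::field"
  assumes "b \<noteq> 0" "b \<in> FX" "t > 0"
  shows "Rep_sgen (Abs_sgen (t, Const (inverse (lcoef b)) * b)) = (t, Const (inverse (lcoef b)) * b)"
  using normalized[OF assms(1,2)] assms(3) by (intro Abs_sgen_inverse) auto

lemma sgen_cases: obtains t a where "t > 0" "a \<in> FX" "a \<noteq> 0" "lcoef a = 1" "g = Abs_sgen (t, a)" "Rep_sgen g = (t, a)"
proof -
  obtain t a where ta: "Rep_sgen g = (t, a)" by fastforce
  then show ?thesis using Rep_sgen[of g] Rep_sgen_inverse[of g] by (intro that[of t a]) auto
qed

definition evs :: "nat \<Rightarrow> (nat \<Rightarrow> 'f::field alg_closure mat) \<Rightarrow> 'f sX \<Rightarrow> 'f alg_closure" where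
  "evs m A = meval to_ac (\<lambda>g. case Rep_sgen g of (t, a) \<Rightarrow> sg t (fmat to_ac m A a))"

interpretation evs: comm_ring_hom "evs m A"
  unfolding evs_def by (rule comm_ring_hom_meval[OF comm_ring_hom_to_ac])

lemma fam_hom: "mat_family m A \<Longrightarrow> mat_family_hom m A (to_ac :: 'f::field \<Rightarrow> _)"
  by (intro mat_family_hom.intro comm_ring_hom_to_ac)

text \<open>The normalization by the leading coefficient in \<open>sigma\<close> is undone by the
  homogeneity of \<open>sg\<close>.\<close>

lemma evs_sigma:
  fixes b :: "word \<Rightarrow>\<^sub>0 'f::field"
  assumes mf: "mat_family m A" and b: "b \<in> FX"
  shows "evs m A (sigma t b) = sg t (fmat to_ac m A b)"
proof -
  interpret mat_family_hom m A "to_ac :: 'f \<Rightarrow> _" by (rule fam_hom[OF mf])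
  consider "t = 0" | "t > 0" "b = 0" | "t > 0" "b \<noteq> 0" by auto
  then show ?thesis
  proof cases
    case 3
    let ?b = "Const (inverse (lcoef b)) * b"
    have "evs m A (sigma t b) = to_ac (lcoef b) ^ t * sg t (fmat to_ac m A ?b)"
      unfolding sigma_def evs_def using 3 b
      by (simp add: meval_mult[OF comm_ring_hom_to_ac] meval_Const[OF comm_ring_hom_to_ac]
          meval_Var[OF comm_ring_hom_to_ac] Rep_sgen_normalized)
    also have "\<dots> = sg t (fmat to_ac m A (Const (lcoef b) * ?b))"
      unfolding fmat_Const_mult by (simp add: sg_smult[of _ m])
    finally show ?thesis using normalized[OF 3(2) b] by simp
  qed (simp_all add: sigma_def fmat_zero sg_zero_mat)
qed

lemma FX_Const_mult: "a \<in> FX \<Longrightarrow> Const x * a \<in> FX" for a :: "word \<Rightarrow>\<^sub>0 'f::semiring_0"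
  by (simp add: FX_def lookup_Const_mult)

lemma FX_sum: "(\<And>x. x \<in> S \<Longrightarrow> f x \<in> FX) \<Longrightarrow> sum f S \<in> FX" for f :: "_ \<Rightarrow> word \<Rightarrow>\<^sub>0 'f::comm_monoid_add"
  by (simp add: FX_def lookup_sum)

lemma FX_zero: "0 \<in> FX" by (simp add: FX_def)

lemma FX_mon: "w \<noteq> 0 \<Longrightarrow> mon w \<in> FX"
  by (simp add: FX_def mon_def lookup_single)

lemma FX_sum_list: "set as \<subseteq> FX \<Longrightarrow> sum_list as \<in> FX" for as :: "(word \<Rightarrow>\<^sub>0 'f::monoid_add) list"
  by (induction as) (auto intro: FX_add FX_zero[THEN subsetD[rotated]] simp: FX_zero)

lemma FX_word_subst:
  fixes s :: "nat \<Rightarrow> (word \<Rightarrow>\<^sub>0 'f::comm_ring_1)"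
  assumes "w \<noteq> 0" "\<And>k. s k \<in> FX"
  shows "word_subst s w \<in> FX"
  using assms(1) by (cases "letters w") (auto simp: word_subst_def intro!: FX_mult assms)

lemma FX_FX_subst:
  assumes "a \<in> FX" "\<And>k. s k \<in> FX"
  shows "FX_subst s a \<in> FX"
  unfolding FX_subst_def using assms
  by (intro FX_sum FX_Const_mult FX_word_subst) (auto simp: FX_def)

lemma evs_sX_subst:
  fixes f :: "'f::field sX"
  assumes mf: "mat_family m A" and s: "\<And>k. s k \<in> FX"
  shows "evs m A (sX_subst s f) = evs m (\<lambda>k. fmat to_ac m A (s k)) f"
proof -
  interpret mat_family_hom m A "to_ac :: 'f \<Rightarrow> _" by (rule fam_hom[OF mf])
  have "evs m A (sX_subst s f) = meval to_ac (\<lambda>g. evs m A (case Rep_sgen g of (t, a) \<Rightarrow> sigma t (FX_subst s a))) f"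
    unfolding evs_def sX_subst_def by (rule meval_peval[OF comm_ring_hom_to_ac])
  also have "\<dots> = evs m (\<lambda>k. fmat to_ac m A (s k)) f"
    unfolding evs_def[of m "\<lambda>k. fmat to_ac m A (s k)"]
  proof (rule meval_cong)
    fix g :: "'f sgen"
    show "evs m A (case Rep_sgen g of (t, a) \<Rightarrow> sigma t (FX_subst s a)) =
      (case Rep_sgen g of (t, a) \<Rightarrow> sg t (fmat to_ac m (\<lambda>k. fmat to_ac m A (s k)) a))"
      by (cases g rule: sgen_cases) (simp add: evs_sigma[OF mf] FX_FX_subst s fmat_FX_subst)
  qed
  finally show ?thesis .
qed

subsection \<open>The coefficients of \<open>\<Prod>\<^sub>e p\<^sub>e(z\<^bsup>l(e)\<^esup>)\<close>\<close>

definition wmsets :: "('e \<Rightarrow> nat) \<Rightarrow> 'e set \<Rightarrow> nat \<Rightarrow> 'e multiset set" where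
  "wmsets l L t = {\<omega>. set_mset \<omega> \<subseteq> L \<and> (\<Sum>e\<in>#\<omega>. l e) = t}"

lemma wmsets_insert:
  assumes "e \<notin> L"
  shows "bij_betw (\<lambda>(k, \<omega>). replicate_mset k e + \<omega>) (SIGMA k:{k. k * l e \<le> t}. wmsets l L (t - k * l e)) (wmsets l (insert e L) t)"
proof (rule bij_betwI')
  fix x y assume "x \<in> (SIGMA k:{k. k * l e \<le> t}. wmsets l L (t - k * l e))" "y \<in> (SIGMA k:{k. k * l e \<le> t}. wmsets l L (t - k * l e))"
  then obtain k \<omega> k' \<omega>' where xy: "x = (k, \<omega>)" "y = (k', \<omega>')" "set_mset \<omega> \<subseteq> L" "set_mset \<omega>' \<subseteq> L"
    by (auto simp: wmsets_def)
  have "k = k'" if "replicate_mset k e + \<omega> = replicate_mset k' e + \<omega>'"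
  proof -
    have "e \<notin># \<omega>" "e \<notin># \<omega>'" using xy assms by auto
    then show ?thesis using arg_cong[OF that, of "\<lambda>M. count M e"] by (simp add: not_in_iff)
  qed
  then show "((case x of (k, \<omega>) \<Rightarrow> replicate_mset k e + \<omega>) = (case y of (k, \<omega>) \<Rightarrow> replicate_mset k e + \<omega>)) = (x = y)"
    using xy by auto
next
  fix x assume "x \<in> (SIGMA k:{k. k * l e \<le> t}. wmsets l L (t - k * l e))"
  then show "(case x of (k, \<omega>) \<Rightarrow> replicate_mset k e + \<omega>) \<in> wmsets l (insert e L) t"
    by (auto simp: wmsets_def split: if_splits)
next
  fix \<omega> assume w: "\<omega> \<in> wmsets l (insert e L) t"
  define \<omega>' where "\<omega>' = filter_mset (\<lambda>x. x \<noteq> e) \<omega>"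
  have eq: "\<omega> = replicate_mset (count \<omega> e) e + \<omega>'"
    by (simp add: \<omega>'_def multiset_eq_iff)
  have "(\<Sum>x\<in>#\<omega>. l x) = count \<omega> e * l e + (\<Sum>x\<in>#\<omega>'. l x)"
    by (subst eq) simp
  then have "(count \<omega> e, \<omega>') \<in> (SIGMA k:{k. k * l e \<le> t}. wmsets l L (t - k * l e))"
    using w by (auto simp: wmsets_def \<omega>'_def)
  then show "\<exists>x\<in>SIGMA k:{k. k * l e \<le> t}. wmsets l L (t - k * l e). \<omega> = (case x of (k, \<omega>) \<Rightarrow> replicate_mset k e + \<omega>)"
    using eq by (intro bexI[of _ "(count \<omega> e, \<omega>')"]) auto
qed

lemma wmsets_empty: "wmsets l {} t = (if t = 0 then {{#}} else {})"
  by (auto simp: wmsets_def)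

lemma finite_wmsets:
  assumes "finite L" "\<And>e. e \<in> L \<Longrightarrow> l e > 0"
  shows "finite (wmsets l L t)"
  using assms
proof (induction L arbitrary: t rule: finite_induct)
  case (insert e L)
  have "finite {k. k * l e \<le> t}"
    by (rule finite_subset[of _ "{..t}"]) (use insert.prems[of e] in \<open>auto intro: le_trans[rotated]\<close>)
  then have "finite (SIGMA k:{k. k * l e \<le> t}. wmsets l L (t - k * l e))" using insert by auto
  then show ?case using bij_betw_finite[OF wmsets_insert[OF insert.hyps(2)]] by blast
qed (simp add: wmsets_empty)

lemma coeff_pcompose_monom:
  fixes p :: "'r::comm_ring_1 poly"
  assumes l: "l > 0"
  shows "coeff (pcompose p (monom 1 l)) i = (if l dvd i then coeff p (i div l) else 0)"
proof (induction p arbitrary: i)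
  case (pCons a p)
  have c0: "coeff [:a:] i = (if i = 0 then a else 0)" by (cases i) auto
  have "coeff (pcompose (pCons a p) (monom 1 l)) i = coeff [:a:] i + (if l \<le> i then coeff (pcompose p (monom 1 l)) (i - l) else 0)"
    by (simp add: pcompose_pCons coeff_monom_mult)
  also have "\<dots> = (if l dvd i then coeff (pCons a p) (i div l) else 0)"
  proof (cases "l \<le> i")
    case True
    then have "i div l = Suc ((i - l) div l)" "l dvd (i - l) \<longleftrightarrow> l dvd i"
      using l by (simp_all add: le_div_geq dvd_minus_self)
    then show ?thesis using True l pCons.IH[of "i - l"] c0 by simp
  next
    case False
    then show ?thesis using c0 l by (auto dest: dvd_imp_le)
  qed
  finally show ?case .
qed simp

text \<open>Choosing a term of degree k l(e) in the factor of each \<open>e\<close> amounts to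
  choosing multiplicities k; positive weights keep the number of choices finite.\<close>

lemma coeff_prod_pcompose_monom:
  fixes p :: "'e \<Rightarrow> 'r::comm_ring_1 poly"
  assumes "finite L" "\<And>e. e \<in> L \<Longrightarrow> l e > 0"
  shows "coeff (\<Prod>e\<in>L. pcompose (p e) (monom 1 (l e))) t = (\<Sum>\<omega>\<in>wmsets l L t. \<Prod>e\<in>L. coeff (p e) (count \<omega> e))"
  using assms
proof (induction L arbitrary: t rule: finite_induct)
  case (insert e L)
  have le: "l e > 0" using insert.prems by simp
  let ?K = "{k. k * l e \<le> t}"
  have finK: "finite ?K"
    by (rule finite_subset[of _ "{..t}"]) (use le in \<open>auto intro: le_trans[rotated]\<close>)
  let ?Q = "\<Prod>e\<in>L. pcompose (p e) (monom 1 (l e))"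
  have "coeff (\<Prod>e\<in>insert e L. pcompose (p e) (monom 1 (l e))) t = (\<Sum>i\<le>t. coeff (pcompose (p e) (monom 1 (l e))) i * coeff ?Q (t - i))"
    using insert.hyps by (simp add: coeff_mult)
  also have "\<dots> = (\<Sum>i\<in>(\<lambda>k. k * l e) ` ?K. coeff (pcompose (p e) (monom 1 (l e))) i * coeff ?Q (t - i))"
  proof (rule sum.mono_neutral_right)
    show "\<forall>i\<in>{..t} - (\<lambda>k. k * l e) ` ?K. coeff (pcompose (p e) (monom 1 (l e))) i * coeff ?Q (t - i) = 0"
    proof
      fix i assume i: "i \<in> {..t} - (\<lambda>k. k * l e) ` ?K"
      have "\<not> l e dvd i"
      proof
        assume "l e dvd i"
        then obtain k where "i = k * l e" by (metis dvd_def mult.commute)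
        then show False using i by auto
      qed
      then show "coeff (pcompose (p e) (monom 1 (l e))) i * coeff ?Q (t - i) = 0"
        by (simp add: coeff_pcompose_monom[OF le])
    qed
  qed auto
  also have "\<dots> = (\<Sum>k\<in>?K. coeff (p e) k * coeff ?Q (t - k * l e))"
    using le by (subst sum.reindex) (auto simp: inj_on_def coeff_pcompose_monom)
  also have "\<dots> = (\<Sum>k\<in>?K. \<Sum>\<omega>\<in>wmsets l L (t - k * l e). coeff (p e) k * (\<Prod>e\<in>L. coeff (p e) (count \<omega> e)))"
    using insert by (simp add: sum_distrib_left)
  also have "\<dots> = (\<Sum>(k, \<omega>)\<in>(SIGMA k:?K. wmsets l L (t - k * l e)). coeff (p e) k * (\<Prod>e\<in>L. coeff (p e) (count \<omega> e)))"
    using finK insert by (intro sum.Sigma) (auto intro: finite_wmsets)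
  also have "\<dots> = (\<Sum>x\<in>(SIGMA k:?K. wmsets l L (t - k * l e)). \<Prod>e'\<in>insert e L. coeff (p e') (count (case x of (k, \<omega>) \<Rightarrow> replicate_mset k e + \<omega>) e'))"
  proof (rule sum.cong[OF refl])
    fix x assume "x \<in> (SIGMA k:?K. wmsets l L (t - k * l e))"
    then obtain k \<omega> where x: "x = (k, \<omega>)" "set_mset \<omega> \<subseteq> L" by (auto simp: wmsets_def)
    then have "count \<omega> e = 0" using insert.hyps by (meson not_in_iff subsetD)
    then have c1: "count (replicate_mset k e + \<omega>) e = k" by simp
    have c2: "(\<Prod>e'\<in>L. coeff (p e') (count (replicate_mset k e + \<omega>) e')) = (\<Prod>e'\<in>L. coeff (p e') (count \<omega> e'))"
      by (intro prod.cong refl) (use insert.hyps in auto)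
    show "(case x of (k, \<omega>) \<Rightarrow> coeff (p e) k * (\<Prod>e\<in>L. coeff (p e) (count \<omega> e))) =
      (\<Prod>e'\<in>insert e L. coeff (p e') (count (case x of (k, \<omega>) \<Rightarrow> replicate_mset k e + \<omega>) e'))"
      unfolding x(1) prod.case prod.insert[OF insert.hyps] c1 c2 ..
  qed
  also have "\<dots> = (\<Sum>\<omega>\<in>wmsets l (insert e L) t. \<Prod>e\<in>insert e L. coeff (p e) (count \<omega> e))"
    by (rule sum.reindex_bij_betw[OF wmsets_insert[OF insert.hyps(2)]])
  finally show ?case .
qed (auto simp: wmsets_empty)

subsection \<open>Amitsur's formula\<close>

lemma tdeg_add: "tdeg (a + b) = tdeg a + tdeg b"
proof -
  have "tdeg \<tau> = lext (\<lambda>x k. x) \<tau>" for \<tau> by (simp add: tdeg_def lext_def)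
  note eq = this
  show ?thesis unfolding eq by (rule lext_add) simp_all
qed

lemma tdeg_0 [simp]: "tdeg 0 = 0" by (simp add: tdeg_def)
lemma tdeg_single [simp]: "tdeg (Poly_Mapping.single k x) = x" by (cases "x = 0") (simp_all add: tdeg_def)

lemma keys_add_nat: "Poly_Mapping.keys (a + b) = Poly_Mapping.keys a \<union> Poly_Mapping.keys (b :: 'k \<Rightarrow>\<^sub>0 nat)"
  by (auto simp: in_keys_iff lookup_add)

lemma mdeg_simps: "mdeg 0 = 0" "mdeg (Word (k # ks)) = Poly_Mapping.single k 1 + mdeg (Word ks)"
  by (simp_all add: mdeg_def)

lemma tdeg_mdeg: "tdeg (mdeg e) = length (letters e)"
  by (induction e rule: word_induct) (simp_all add: mdeg_simps tdeg_add)

lemma keys_mdeg: "Poly_Mapping.keys (mdeg e) = set (letters e)"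
  by (induction e rule: word_induct) (simp_all add: mdeg_simps keys_add_nat)

lemma tdeg_sum_mset: "tdeg (\<Sum>e\<in>#\<omega>. mdeg e) = (\<Sum>e\<in>#\<omega>. length (letters e))"
  by (induction \<omega>) (simp_all add: tdeg_add tdeg_mdeg)

lemma keys_sum_mset: "Poly_Mapping.keys (\<Sum>e\<in>#\<omega>. mdeg e) = (\<Union>e\<in>set_mset \<omega>. set (letters e))"
  by (induction \<omega>) (simp_all add: keys_add_nat keys_mdeg)

text \<open>As maximal rotations take the place of minimal ones, these are the Lyndon words for the
  reversed order of the letters; the bound on the length makes the set finite.\<close>

definition Lyn :: "nat \<Rightarrow> nat \<Rightarrow> word set" where
  "Lyn u t = {e \<in> Xtilde. set (letters e) \<subseteq> {..<u} \<and> length (letters e) \<le> t}"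

lemma finite_Lyn: "finite (Lyn u t)"
proof -
  have "letters ` Lyn u t \<subseteq> {xs. set xs \<subseteq> {..<u} \<and> length xs \<le> t}" by (auto simp: Lyn_def)
  then have "finite (letters ` Lyn u t)" by (rule finite_subset) (rule finite_lists_length_le, simp)
  then show ?thesis by (rule finite_imageD) (auto simp: inj_on_def intro: word.expand)
qed

lemma Xtilde_letter: "Word [k] \<in> Xtilde"
proof -
  have "primitive_word (Word [k])"
    unfolding primitive_word_wpow
  proof (intro allI impI notI)
    fix b l assume b: "b \<noteq> 0" "l > (1::nat)" "Word [k] = wpow l b"
    from arg_cong[OF b(3), of "\<lambda>w. length (letters w)"] have "l * length (letters b) = 1" by simp
    then show False using b by simp
  qed
  moreover have "b \<le> Word [k]" if "cyc_equiv (Word [k]) b" for b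
    using that by (auto simp: cyc_equiv_def plus_word_def Cons_eq_append_conv)
  ultimately show ?thesis by (simp add: Xtilde_def zero_word_def)
qed

text \<open>Letters belong to \<open>Xtilde\<close>, so every nonzero multidegree is reached. This
  excludes the default value 1 of \<open>sigma_multi\<close>.\<close>

lemma Omega_nonempty:
  assumes "\<tau> \<noteq> 0"
  shows "Omega \<tau> \<noteq> {}"
proof -
  have "\<exists>\<omega>. set_mset \<omega> \<subseteq> Xtilde \<and> (\<Sum>e\<in>#\<omega>. mdeg e) = \<tau>" for \<tau>
  proof (induction \<tau> rule: poly_mapping_add_induct)
    case (1 k n)
    have "(\<Sum>e\<in>#replicate_mset n (Word [k]). mdeg e) = Poly_Mapping.single k n"
      by (induction n) (simp_all add: mdeg_def flip: single_add)
    then show ?case using Xtilde_letter by (intro exI[of _ "replicate_mset n (Word [k])"]) auto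
  next
    case (2 f g)
    then obtain \<omega> \<omega>' where "set_mset \<omega> \<subseteq> Xtilde" "(\<Sum>e\<in>#\<omega>. mdeg e) = f" "set_mset \<omega>' \<subseteq> Xtilde" "(\<Sum>e\<in>#\<omega>'. mdeg e) = g"
      by blast
    then show ?case by (intro exI[of _ "\<omega> + \<omega>'"]) auto
  qed
  then obtain \<omega> where \<omega>: "set_mset \<omega> \<subseteq> Xtilde" "(\<Sum>e\<in>#\<omega>. mdeg e) = \<tau>" by blast
  then have "\<omega> \<noteq> {#}" using assms by auto
  then show ?thesis using \<omega> by (auto simp: Omega_def)
qed

text \<open>The sum over multidegrees of total degree \<open>t\<close> and the sums over multisets
  of a given multidegree merge into one sum over multisets of total length \<open>t\<close>.\<close>

lemma F_gen_eq:
  assumes t: "t > 0"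
  shows "F_gen t u = (-1) ^ t * (\<Sum>\<omega>\<in>wmsets (\<lambda>e. length (letters e)) (Lyn u t) t. sigma_omega \<omega>)"
proof -
  let ?W = "wmsets (\<lambda>e. length (letters e)) (Lyn u t) t"
  let ?T = "{\<tau>. Poly_Mapping.keys \<tau> \<subseteq> {..<u} \<and> tdeg \<tau> = t}"
  have lpos: "length (letters e) > 0" if "e \<in> Lyn u t" for e using that by (auto simp: Lyn_def Xtilde_def)
  have finW: "finite ?W" by (rule finite_wmsets[OF finite_Lyn lpos])
  have WT: "\<omega> \<in> ?W \<longleftrightarrow> (\<exists>\<tau>\<in>?T. \<omega> \<in> Omega \<tau>)" for \<omega>
  proof
    assume "\<omega> \<in> ?W"
    then have w: "set_mset \<omega> \<subseteq> Lyn u t" "(\<Sum>e\<in>#\<omega>. length (letters e)) = t" by (auto simp: wmsets_def)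
    then have "\<omega> \<in> Omega (\<Sum>e\<in>#\<omega>. mdeg e)" using t by (auto simp: Omega_def Lyn_def)
    moreover have "(\<Sum>e\<in>#\<omega>. mdeg e) \<in> ?T" using w by (auto simp: tdeg_sum_mset keys_sum_mset Lyn_def)
    ultimately show "\<exists>\<tau>\<in>?T. \<omega> \<in> Omega \<tau>" by blast
  next
    assume "\<exists>\<tau>\<in>?T. \<omega> \<in> Omega \<tau>"
    then have w: "set_mset \<omega> \<subseteq> Xtilde" "Poly_Mapping.keys (\<Sum>e\<in>#\<omega>. mdeg e) \<subseteq> {..<u}" "tdeg (\<Sum>e\<in>#\<omega>. mdeg e) = t"
      by (auto simp: Omega_def)
    have "length (letters e) \<le> t" if "e \<in># \<omega>" for e
      using w(3) that by (auto simp: tdeg_sum_mset dest!: multi_member_split)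
    then show "\<omega> \<in> ?W" using w by (auto simp: wmsets_def Lyn_def tdeg_sum_mset keys_sum_mset)
  qed
  have Omega_mdeg: "\<omega> \<in> Omega \<tau> \<Longrightarrow> (\<Sum>e\<in>#\<omega>. mdeg e) = \<tau>" for \<omega> \<tau> by (simp add: Omega_def)
  have T: "?T = (\<lambda>\<omega>. \<Sum>e\<in>#\<omega>. mdeg e) ` ?W"
  proof (rule equalityI; rule subsetI)
    fix \<tau> assume \<tau>: "\<tau> \<in> ?T"
    then have "\<tau> \<noteq> 0" using t by auto
    from Omega_nonempty[OF this] obtain \<omega> where "\<omega> \<in> Omega \<tau>" by blast
    then show "\<tau> \<in> (\<lambda>\<omega>. \<Sum>e\<in>#\<omega>. mdeg e) ` ?W" using \<tau> WT Omega_mdeg by blast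
  next
    fix \<tau> assume "\<tau> \<in> (\<lambda>\<omega>. \<Sum>e\<in>#\<omega>. mdeg e) ` ?W"
    then obtain \<omega> where \<omega>: "\<omega> \<in> ?W" "\<tau> = (\<Sum>e\<in>#\<omega>. mdeg e)" by blast
    then obtain \<tau>' where "\<tau>' \<in> ?T" "\<omega> \<in> Omega \<tau>'" using WT by blast
    then show "\<tau> \<in> ?T" using \<omega> Omega_mdeg by simp
  qed
  have "F_gen t u = (\<Sum>\<tau>\<in>?T. (-1) ^ t * (\<Sum>\<omega>\<in>Omega \<tau>. sigma_omega \<omega>))"
    unfolding F_gen_def
  proof (rule sum.cong[OF refl])
    fix \<tau> assume "\<tau> \<in> ?T"
    then have "\<tau> \<noteq> 0" "tdeg \<tau> = t" using t by auto
    then show "sigma_multi \<tau> = (-1) ^ t * (\<Sum>\<omega>\<in>Omega \<tau>. sigma_omega \<omega>)"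
      using Omega_nonempty[of \<tau>] by (simp add: sigma_multi_def)
  qed
  also have "\<dots> = (-1) ^ t * (\<Sum>\<tau>\<in>?T. \<Sum>\<omega>\<in>{\<omega>\<in>?W. (\<Sum>e\<in>#\<omega>. mdeg e) = \<tau>}. sigma_omega \<omega>)"
    unfolding sum_distrib_left[symmetric]
  proof (intro arg_cong2[where f = "(*)"] sum.cong refl)
    fix \<tau> assume "\<tau> \<in> ?T"
    then have "\<omega> \<in> Omega \<tau> \<longleftrightarrow> \<omega> \<in> ?W \<and> (\<Sum>e\<in>#\<omega>. mdeg e) = \<tau>" for \<omega> using WT[of \<omega>] Omega_mdeg by blast
    then show "Omega \<tau> = {\<omega>\<in>?W. (\<Sum>e\<in>#\<omega>. mdeg e) = \<tau>}" by blast
  qed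
  also have "(\<Sum>\<tau>\<in>?T. \<Sum>\<omega>\<in>{\<omega>\<in>?W. (\<Sum>e\<in>#\<omega>. mdeg e) = \<tau>}. sigma_omega \<omega>) = (\<Sum>\<omega>\<in>?W. (sigma_omega \<omega> :: 'a sX))"
    unfolding T by (rule sum.image_gen[OF finW, symmetric])
  finally show ?thesis .
qed

section \<open>Construction of the map on generators\<close>

definition rep_sigma :: "nat \<Rightarrow> (word \<Rightarrow>\<^sub>0 'f::field) \<Rightarrow> 'f sXt" where
  "rep_sigma t a = (SOME g. represents g (\<lambda>m A. sg t (fmat to_ac m A a)))"

definition dpi :: "'f::field sX \<Rightarrow> 'f sXt" where
  "dpi = peval (\<lambda>g. case Rep_sgen g of (t, a) \<Rightarrow> rep_sigma t a)"

lemma ev_rep_sigma: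
  assumes "infinite (UNIV :: 'f::field set)" "(a :: word \<Rightarrow>\<^sub>0 'f) \<in> FX" "mat_family m A"
  shows "ev m A (rep_sigma t a) = sg t (fmat to_ac m A a)"
proof -
  have "represents (rep_sigma t a) (\<lambda>m A. sg t (fmat to_ac m A a))"
    unfolding rep_sigma_def using represented_sg_fmat[OF assms(1,2)] unfolding represented_def by (rule someI_ex)
  then show ?thesis using assms(3) by (simp add: represents_def)
qed

lemma ev_dpi:
  fixes f :: "'f::field sX"
  assumes "infinite (UNIV :: 'f set)" "mat_family m A"
  shows "ev m A (dpi f) = evs m A f"
proof -
  have "ev m A (dpi f) = meval to_ac (\<lambda>g. ev m A (case Rep_sgen g of (t, a) \<Rightarrow> rep_sigma t a)) f"
    unfolding ev_def dpi_def by (rule meval_peval[OF comm_ring_hom_to_ac])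
  also have "\<dots> = evs m A f"
    unfolding evs_def
  proof (rule meval_cong)
    fix g :: "'f sgen"
    show "ev m A (case Rep_sgen g of (t, a) \<Rightarrow> rep_sigma t a) = (case Rep_sgen g of (t, a) \<Rightarrow> sg t (fmat to_ac m A a))"
      by (cases g rule: sgen_cases) (simp add: ev_rep_sigma assms)
  qed
  finally show ?thesis .
qed

text \<open>The sign in \<open>sigma_omega\<close> turns each \<open>sg\<close> into a coefficient
  of \<open>dpoly\<close>. Words of multiplicity 0 contribute the constant coefficient 1, so the
  product may run over all of \<open>L\<close>.\<close>

lemma evs_sigma_omega:
  fixes A :: "nat \<Rightarrow> 'f::field alg_closure mat"
  assumes mf: "mat_family m A" and L: "finite L" "set_mset \<omega> \<subseteq> L" "L \<subseteq> Xtilde"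
  shows "evs m A (sigma_omega \<omega>) = (\<Prod>e\<in>L. coeff (dpoly (wmat m A e)) (count \<omega> e))"
proof -
  interpret mat_family_hom m A "to_ac :: 'f \<Rightarrow> _" by (rule fam_hom[OF mf])
  have "evs m A (sigma_omega \<omega>) = (-1) ^ size \<omega> * (\<Prod>e\<in>set_mset \<omega>. sg (count \<omega> e) (wmat m A e))"
    unfolding sigma_omega_def using L(2,3)
    by (auto simp: evs.hom_mult evs.hom_power evs.hom_prod evs.hom_uminus evs_sigma[OF mf] fmat_mon Xtilde_def
        intro!: prod.cong arg_cong2[where f = "(*)"] FX_mon) (subst evs_sigma[OF mf]; auto simp: fmat_mon intro!: FX_mon)?
  also have "size \<omega> = (\<Sum>e\<in>set_mset \<omega>. count \<omega> e)" by (simp add: size_multiset_overloaded_eq)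
  also have "(-1) ^ (\<Sum>e\<in>set_mset \<omega>. count \<omega> e) * (\<Prod>e\<in>set_mset \<omega>. sg (count \<omega> e) (wmat m A e)) =
    (\<Prod>e\<in>set_mset \<omega>. coeff (dpoly (wmat m A e)) (count \<omega> e))"
    by (simp add: power_sum prod.distrib coeff_dpoly[OF wmat_carrier])
  also have "\<dots> = (\<Prod>e\<in>L. coeff (dpoly (wmat m A e)) (count \<omega> e))"
    using L by (intro prod.mono_neutral_left) (auto simp: coeff_dpoly[OF wmat_carrier] not_in_iff)
  finally show ?thesis .
qed

text \<open>Amitsur's formula for arbitrary families. It is computed on direct sums of labelled
  cycles only; since these separate the elements of \<sigma>\<langle>X~\<rangle>, the element
  \<open>dpi (F_gen t u)\<close> equals the representative of \<sigma>_t of the sum of letters, and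
  evaluation at any family gives the claim.\<close>

lemma evs_F_gen:
  fixes A :: "nat \<Rightarrow> 'f::field alg_closure mat"
  assumes inf: "infinite (UNIV :: 'f set)" and t: "t > 0" and mf: "mat_family m A"
  shows "evs m A (F_gen t u) = sg t (msum m u A)"
proof -
  define s :: "word \<Rightarrow>\<^sub>0 'f" where "s = (\<Sum>k<u. mon (Word [k]))"
  have sFX: "s \<in> FX" unfolding s_def by (intro FX_sum FX_mon) (simp add: zero_word_def)
  have fs: "fmat to_ac m A s = msum m u A" if "mat_family m A" for m and A :: "nat \<Rightarrow> 'f alg_closure mat"
  proof -
    interpret mat_family_hom m A "to_ac :: 'f \<Rightarrow> _" by (rule fam_hom[OF that])
    have "fmat to_ac m A (\<Sum>k<u. mon (Word [k])) = msum m u A"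
    proof (induction u)
      case (Suc u)
      then show ?case using carrier_matD[OF fam[of u]]
        by (simp add: fmat_add fmat_mon wmat_letter) (auto simp: msum_def intro!: eq_matI)
    qed (auto simp: fmat_zero msum_def intro!: eq_matI)
    then show ?thesis by (simp add: s_def)
  qed
  have "dpi (F_gen t u) = rep_sigma t s"
  proof (rule sXt_eqI[OF inf])
    fix bs :: "(word \<times> 'f alg_closure) list" assume bs: "fst ` set bs \<subseteq> Xtilde"
    let ?m = "tdim bs" and ?A = "tfam bs"
    have mf: "mat_family ?m ?A" by (rule mat_family_tfam)
    have LX: "Lyn u t \<subseteq> Xtilde" by (auto simp: Lyn_def)
    have "ev ?m ?A (dpi (F_gen t u)) = (-1) ^ t * (\<Sum>\<omega>\<in>wmsets (\<lambda>e. length (letters e)) (Lyn u t) t. evs ?m ?A (sigma_omega \<omega>))"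
      unfolding ev_dpi[OF inf mf] F_gen_eq[OF t] by (simp add: evs.hom_mult evs.hom_power evs.hom_uminus evs.hom_sum)
    also have "\<dots> = (-1) ^ t * (\<Sum>\<omega>\<in>wmsets (\<lambda>e. length (letters e)) (Lyn u t) t. \<Prod>e\<in>Lyn u t. coeff (dpoly (wmat ?m ?A e)) (count \<omega> e))"
      by (intro arg_cong2[where f = "(*)"] sum.cong refl evs_sigma_omega[OF mf finite_Lyn _ LX]) (auto simp: wmsets_def)
    also have "\<dots> = (-1) ^ t * coeff (\<Prod>e\<in>Lyn u t. pcompose (dpoly (wmat ?m ?A e)) (monom 1 (length (letters e)))) t"
      by (subst coeff_prod_pcompose_monom[OF finite_Lyn]) (auto simp: Lyn_def Xtilde_def)
    also have "\<dots> = (-1) ^ t * coeff (dpoly (msum ?m u ?A)) t"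
      using cut_dpoly_msum_tfam[OF bs finite_Lyn Lyn_def[of u t]] by (simp add: cut_def)
    also have "\<dots> = sg t (msum ?m u ?A)" by (rule sg_coeff_dpoly[OF msum_carrier, symmetric])
    also have "\<dots> = ev ?m ?A (rep_sigma t s)" by (simp add: ev_rep_sigma[OF inf sFX mf] fs[OF mf])
    finally show "ev ?m ?A (dpi (F_gen t u)) = ev ?m ?A (rep_sigma t s)" .
  qed
  then show ?thesis using ev_dpi[OF inf mf, of "F_gen t u"] by (simp add: ev_rep_sigma[OF inf sFX mf] fs[OF mf])
qed

subsection \<open>Ideals\<close>

lemma module_self: "module ((*) :: 'r::comm_ring_1 \<Rightarrow> 'r \<Rightarrow> 'r)"
  by standard (auto simp: algebra_simps)

lemma ideal_gen_base: "x \<in> S \<Longrightarrow> x \<in> ideal_gen S"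
  unfolding ideal_gen_def by (rule module.span_base[OF module_self])
lemma ideal_gen_zero: "0 \<in> ideal_gen S"
  unfolding ideal_gen_def by (rule module.span_zero[OF module_self])
lemma ideal_gen_add: "x \<in> ideal_gen S \<Longrightarrow> y \<in> ideal_gen S \<Longrightarrow> x + y \<in> ideal_gen S"
  unfolding ideal_gen_def by (rule module.span_add[OF module_self])
lemma ideal_gen_mult: "x \<in> ideal_gen S \<Longrightarrow> r * x \<in> ideal_gen S"
  unfolding ideal_gen_def by (rule module.span_scale[OF module_self])
lemma ideal_gen_sum: "(\<And>x. x \<in> I \<Longrightarrow> f x \<in> ideal_gen S) \<Longrightarrow> sum f I \<in> ideal_gen S"
  unfolding ideal_gen_def by (rule module.span_sum[OF module_self])
lemma ideal_gen_subset_kernel: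
  assumes "comm_ring_hom F" "\<And>x. x \<in> S \<Longrightarrow> F x = 0" "x \<in> ideal_gen S"
  shows "F x = 0"
proof -
  interpret F: comm_ring_hom F by fact
  have "module.span (*) S \<subseteq> {x. F x = 0}"
    by (rule module.span_minimal[OF module_self])
       (auto simp: assms(2) F.hom_add F.hom_mult intro!: module.subspaceI[OF module_self])
  then show ?thesis using assms(3) by (auto simp: ideal_gen_def)
qed

subsection \<open>Donkin's homomorphism\<close>

lemma sigma_Const_mult: "sigma t (Const c * b) = Const (c ^ t) * sigma t (b :: word \<Rightarrow>\<^sub>0 'f::field)"
proof -
  consider "t = 0" | "t > 0" "c = 0 \<or> b = 0" | "t > 0" "c \<noteq> 0" "b \<noteq> 0" by auto
  then show ?thesis
  proof cases
    case 1
    then show ?thesis by (simp add: sigma_def Const_def)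
  next
    case 2
    then have "Const c * b = 0" by (auto simp: Const_def)
    then show ?thesis using 2 by (auto simp: sigma_def Const_def zero_power)
  next
    case 3
    have "Const c * b \<noteq> 0" using 3 Const_mult_keys[of c b] by (metis keys_eq_empty)
    moreover have lc: "lcoef (Const c * b) = c * lcoef b"
      using 3 by (simp add: lcoef_def Const_mult_keys lookup_Const_mult)
    moreover have "Const (inverse (c * lcoef b)) * (Const c * b) = Const (inverse (lcoef b)) * b"
      using 3 by (intro poly_mapping_eqI) (simp add: lookup_Const_mult field_simps)
    ultimately show ?thesis using 3
      by (simp add: sigma_def Const_def mult_single power_mult_distrib mult.assoc flip: mult.assoc)
  qed
qed

lemma sX_subst_hom: "comm_ring_hom (sX_subst s :: 'f::field sX \<Rightarrow> _)"
  unfolding sX_subst_def by (rule alg_hom_comm_ring_hom[OF alg_hom_peval])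

lemma peval_Const [simp]: "peval h (Const c) = Const c"
  by (simp add: peval_meval meval_Const[OF comm_ring_hom_Const])

lemma peval_Var [simp]: "peval h (Var v) = h v"
  by (simp add: peval_meval meval_Var[OF comm_ring_hom_Const])

lemma FX_subst_Const_mult: "FX_subst s (Const c * a) = Const c * FX_subst s a"
proof -
  have FX: "FX_subst s a = lext (\<lambda>x w. Const x * word_subst s w) a" for a
    by (simp add: FX_subst_def lext_def)
  have sing: "FX_subst s (Poly_Mapping.single w x) = Const x * word_subst s w" for w x
    unfolding FX by (rule lext_single) (simp add: Const_def)
  show ?thesis
  proof (induction a rule: poly_mapping_add_induct)
    case (1 k v)
    have "Const c * Poly_Mapping.single k v = Poly_Mapping.single k (c * v)" by (simp add: Const_def mult_single)
    moreover have "Const (c * v) = Const c * (Const v :: word \<Rightarrow>\<^sub>0 'a)" by (simp add: Const_def mult_single)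
    ultimately show ?case by (simp only: sing mult.assoc)
  next
    case (2 f g)
    have "FX_subst s (f + g) = FX_subst s f + FX_subst s g" for f g
      unfolding FX by (rule lext_add) (auto simp: Const_def single_add distrib_right)
    then show ?case using 2 by (simp only: distrib_left)
  qed
qed

lemma FX_subst_mon: "FX_subst s (mon w) = word_subst s w"
  by (simp add: FX_subst_def mon_def Const_def)

lemma sX_subst_sigma:
  fixes b :: "word \<Rightarrow>\<^sub>0 'f::field"
  assumes "b \<in> FX"
  shows "sX_subst s (sigma t b) = sigma t (FX_subst s b)"
proof -
  interpret s: comm_ring_hom "sX_subst s :: 'f sX \<Rightarrow> _" by (rule sX_subst_hom)
  consider "t = 0" | "t > 0" "b = 0" | "t > 0" "b \<noteq> 0" by auto
  then show ?thesis
  proof cases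
    case 2
    then show ?thesis by (simp add: sigma_def FX_subst_def)
  next
    case 3
    let ?b = "Const (inverse (lcoef b)) * b"
    have "sX_subst s (Var (Abs_sgen (t, ?b))) = sigma t (FX_subst s ?b)"
      by (simp only: sX_subst_def peval_Var Rep_sgen_normalized[OF 3(2) assms 3(1)] prod.case)
    moreover have "sX_subst s (Const x) = Const x" for x by (simp only: sX_subst_def peval_Const)
    moreover have "sigma t b = Const (lcoef b ^ t) * Var (Abs_sgen (t, ?b))" using 3 by (simp add: sigma_def)
    ultimately have "sX_subst s (sigma t b) = Const (lcoef b ^ t) * sigma t (FX_subst s ?b)"
      by (simp only: s.hom_mult)
    also have "\<dots> = sigma t (FX_subst s (Const (lcoef b) * ?b))"
      unfolding FX_subst_Const_mult[of s "lcoef b"] sigma_Const_mult ..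
    finally show ?thesis using normalized[OF 3(2) assms] by simp
  qed (simp add: sigma_def)
qed

text \<open>Substituting monomials for the letters turns words into monomials, so that
  \<open>F_elem\<close> at monomials involves only \<sigma>_k of monomials. Nonempty
  \<open>v k\<close> keep the words nonempty, while coefficients may be 0.\<close>

lemma word_subst_single:
  fixes c :: "nat \<Rightarrow> 'f::comm_ring_1"
  assumes "\<And>k. v k \<noteq> 0"
  shows "\<exists>w' c'. word_subst (\<lambda>k. Poly_Mapping.single (v k) (c k)) w = Poly_Mapping.single w' c' \<and> (w \<noteq> 0 \<longrightarrow> w' \<noteq> 0)"
proof (induction w rule: word_induct)
  case zero
  show ?case by (intro exI[of _ 0] exI[of _ 1]) (simp add: word_subst_def)
next
  case (Cons k ks)
  then obtain w' c' where "word_subst (\<lambda>k. Poly_Mapping.single (v k) (c k)) (Word ks) = Poly_Mapping.single w' c'" by blast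
  then have "word_subst (\<lambda>k. Poly_Mapping.single (v k) (c k)) (Word (k # ks)) = Poly_Mapping.single (v k + w') (c k * c')"
    by (simp add: word_subst_def mult_single)
  then show ?case using assms[of k] by (metis word_add_eq_0_iff)
qed

section \<open>Reduction modulo the relations\<close>

definition lift_sX :: "'f::field sXt \<Rightarrow> 'f sX" where
  "lift_sX = peval (\<lambda>g. case Rep_tgen g of (t, e) \<Rightarrow> sigma t (mon e))"

lemma lift_hom: "comm_ring_hom (lift_sX :: 'f::field sXt \<Rightarrow> _)"
  unfolding lift_sX_def by (rule alg_hom_comm_ring_hom[OF alg_hom_peval])

lemma lift_sigma_t: "t > 0 \<Longrightarrow> e \<in> Xtilde \<Longrightarrow> lift_sX (sigma_t t e) = sigma t (mon e)"
  by (simp add: lift_sX_def sigma_t_def Abs_tgen_inverse)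

lemma lift_Const [simp]: "lift_sX (Const c) = Const c"
  by (simp add: lift_sX_def)

text \<open>The elements that the relations reduce to \<open>\<sigma>\<langle>X~\<rangle>\<close>.\<close>

definition reducible_sX :: "'f::field sX set" where
  "reducible_sX = {f. \<exists>h. f - lift_sX h \<in> ideal_gen relations}"

lemma reducible_cong:
  assumes "g \<in> reducible_sX" "f - g \<in> ideal_gen relations"
  shows "f \<in> reducible_sX"
proof -
  obtain h where "g - lift_sX h \<in> ideal_gen relations" using assms(1) by (auto simp: reducible_sX_def)
  from ideal_gen_add[OF assms(2) this] have "f - lift_sX h \<in> ideal_gen relations" by simp
  then show ?thesis by (auto simp: reducible_sX_def)
qed

lemma reducible_Const: "Const c \<in> reducible_sX"
  unfolding reducible_sX_def using ideal_gen_zero by (auto intro!: exI[of _ "Const c"])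

lemma reducible_one: "1 \<in> reducible_sX"
  using reducible_Const[of 1] by (simp add: Const_def)

lemma reducible_add:
  assumes "f \<in> reducible_sX" "g \<in> reducible_sX"
  shows "f + g \<in> reducible_sX"
proof -
  interpret l: comm_ring_hom "lift_sX :: 'a sXt \<Rightarrow> _" by (rule lift_hom)
  obtain h h' where "f - lift_sX h \<in> ideal_gen relations" "g - lift_sX h' \<in> ideal_gen relations"
    using assms by (auto simp: reducible_sX_def)
  from ideal_gen_add[OF this] have "f + g - lift_sX (h + h') \<in> ideal_gen relations"
    by (simp add: l.hom_add algebra_simps)
  then show ?thesis by (auto simp: reducible_sX_def)
qed

lemma reducible_mult:
  assumes "f \<in> reducible_sX" "g \<in> reducible_sX"
  shows "f * g \<in> reducible_sX"
proof -
  interpret l: comm_ring_hom "lift_sX :: 'a sXt \<Rightarrow> _" by (rule lift_hom)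
  obtain h h' where "f - lift_sX h \<in> ideal_gen relations" "g - lift_sX h' \<in> ideal_gen relations"
    using assms by (auto simp: reducible_sX_def)
  from ideal_gen_add[OF ideal_gen_mult[OF this(2), of f] ideal_gen_mult[OF this(1), of "lift_sX h'"]]
  have "f * g - lift_sX (h * h') \<in> ideal_gen relations"
    by (simp add: l.hom_mult algebra_simps)
  then show ?thesis by (auto simp: reducible_sX_def)
qed

lemma reducible_sum: "(\<And>x. x \<in> S \<Longrightarrow> f x \<in> reducible_sX) \<Longrightarrow> sum f S \<in> reducible_sX"
  using reducible_Const[of 0]
  by (induction S rule: infinite_finite_induct) (auto intro: reducible_add simp: Const_def)

lemma reducible_prod: "(\<And>x. x \<in> S \<Longrightarrow> f x \<in> reducible_sX) \<Longrightarrow> prod f S \<in> reducible_sX"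
  by (induction S rule: infinite_finite_induct) (auto intro: reducible_mult reducible_one)

lemma reducible_power: "f \<in> reducible_sX \<Longrightarrow> f ^ k \<in> reducible_sX"
  by (induction k) (auto intro: reducible_mult reducible_one)

lemma reducible_peval: "(\<And>v. h v \<in> reducible_sX) \<Longrightarrow> peval h P \<in> reducible_sX"
  unfolding peval_def by (intro reducible_sum reducible_mult reducible_prod reducible_power reducible_Const)

lemma mon_plus: "mon (a + b) = mon a * (mon b :: word \<Rightarrow>\<^sub>0 'f::comm_ring_1)"
  by (simp add: mon_def mult_single)

lemma mon_wpow: "mon (wpow l v) = (mon v :: word \<Rightarrow>\<^sub>0 'f::comm_ring_1) ^ l"
  by (induction l) (simp_all add: mon_plus, simp add: mon_def)

lemma sigma_0 [simp]: "sigma 0 b = 1" by (simp add: sigma_def)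

text \<open>The power relation leads to a primitive word, the cyclic relation from there to the
  representative in \<open>Xtilde\<close>.\<close>

lemma reducible_sigma_word:
  assumes "w \<noteq> 0"
  shows "sigma t (mon w) \<in> (reducible_sX :: 'f::field sX set)"
proof -
  have prim: "sigma i (mon v) \<in> (reducible_sX :: 'f sX set)" if v: "v \<noteq> 0" "primitive_word v" for v i
  proof (cases "i = 0")
    case False
    obtain e where e: "e \<in> Xtilde" "cyc_equiv v e" using ex_Xtilde_rep[OF v] by blast
    then obtain a b where ab: "v = a + b" "e = b + a" by (auto simp: cyc_equiv_def)
    have "sigma i (mon e) \<in> (reducible_sX :: 'f sX set)"
      unfolding reducible_sX_def using False
      by (intro CollectI exI[of _ "sigma_t i e"]) (simp add: lift_sigma_t[OF _ e(1)] ideal_gen_zero)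
    then show ?thesis
    proof (rule reducible_cong)
      show "sigma i (mon v) - sigma i (mon e) \<in> ideal_gen (relations :: 'f sX set)"
      \<comment> \<open>The cyclic relation is available for nonempty \<open>a\<close> and
        \<open>b\<close>; otherwise the two words coincide.\<close>
      proof (cases "a = 0 \<or> b = 0")
        case True
        then show ?thesis using ab ideal_gen_zero by auto
      next
        case nz: False
        then have "sigma i (mon v) - sigma i (mon e) \<in> (relations :: 'f sX set)"
          unfolding relations_def ab using False by blast
        then show ?thesis by (rule ideal_gen_base)
      qed
    qed
  qed (simp add: reducible_one)
  from ex_primitive_root[OF assms] obtain v l where v: "w = wpow l v" "l > 0" "v \<noteq> 0" "primitive_word v" by blast
  consider "t = 0" | "l = 1" | "t > 0" "l > 1" using v(2) by linarith
  then show ?thesis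
  proof cases
    case 1
    then show ?thesis by (simp add: reducible_one)
  next
    case 2
    then show ?thesis using v prim[of v t] by simp
  next
    case 3
    have "P_elem t l (mon v) \<in> (reducible_sX :: 'f sX set)"
      unfolding P_elem_def by (intro reducible_peval prim v)
    moreover have "sigma t (mon w) - P_elem t l (mon v) \<in> (relations :: 'f sX set)"
      unfolding v(1) mon_wpow relations_def using 3 v(3) by blast
    ultimately show ?thesis by (rule reducible_cong[OF _ ideal_gen_base])
  qed
qed

lemma reducible_sigma_single:
  assumes "w \<noteq> 0"
  shows "sigma t (Poly_Mapping.single w c) \<in> (reducible_sX :: 'f::field sX set)"
proof -
  have "Poly_Mapping.single w c = Const c * mon w" by (simp add: Const_def mon_def mult_single)
  then show ?thesis using reducible_sigma_word[OF assms]
    by (simp only: sigma_Const_mult) (intro reducible_mult reducible_Const)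
qed

text \<open>Apply the sum relation to the terms of \<open>a\<close>: what it produces involves only
  \<sigma>_k of monomials.\<close>

lemma reducible_sigma:
  fixes a :: "word \<Rightarrow>\<^sub>0 'f::field"
  assumes a: "a \<in> FX"
  shows "sigma t a \<in> reducible_sX"
proof (cases "t = 0")
  case False
  from finite_distinct_list[OF finite_keys[of a]]
  obtain ws where ws: "set ws = Poly_Mapping.keys a" "distinct ws" by (elim exE conjE)
  \<comment> \<open>The two zeros make the list longer than 1, as the sum relation demands, even if
    \<open>a\<close> has fewer than two terms.\<close>
  define as where "as = map (\<lambda>w. Poly_Mapping.single w (Poly_Mapping.lookup a w)) ws @ [0, 0]"
  let ?s = "\<lambda>k. if k < length as then as ! k else 0"
  \<comment> \<open>Surplus letters are replaced by 0, written as a nonempty word with coefficient 0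
    so that \<open>word_subst_single\<close> applies.\<close>
  let ?v = "\<lambda>k. if k < length ws then ws ! k else Word [0]"
  let ?c = "\<lambda>k. if k < length ws then Poly_Mapping.lookup a (ws ! k) else 0"
  have nz: "w \<noteq> 0" if "w \<in> set ws" for w using that a ws(1) by (auto simp: FX_def)
  have s: "?s = (\<lambda>k. Poly_Mapping.single (?v k) (?c k))"
    by (auto simp: as_def nth_append fun_eq_iff nth_Cons split: nat.splits)
  have v: "?v k \<noteq> 0" for k using nz by (auto simp: zero_word_def)
  have sum: "sum_list as = a"
    using poly_mapping_sum_single[of a] ws by (simp add: as_def sum_list_distinct_conv_sum_set)
  have "set as \<subseteq> FX" using nz by (auto simp: as_def FX_def lookup_single)
  moreover have "length as > 1" by (simp add: as_def)
  ultimately have rel: "sigma t a - F_elem t as \<in> relations"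
    unfolding relations_def using False sum by blast
  interpret s: comm_ring_hom "sX_subst ?s :: 'f sX \<Rightarrow> _" by (rule sX_subst_hom)
  have "sX_subst ?s (sigma_omega \<omega>) \<in> reducible_sX" if "set_mset \<omega> \<subseteq> Xtilde" for \<omega>
  proof -
    have "sX_subst ?s (sigma k (mon e)) \<in> reducible_sX" if "e \<in> Xtilde" for k e
    proof -
      have e: "e \<noteq> 0" using that by (simp add: Xtilde_def)
      from word_subst_single[of ?v ?c e, OF v] e obtain w' c'
        where "word_subst ?s e = Poly_Mapping.single w' c'" "w' \<noteq> 0" unfolding s by blast
      then show ?thesis using e by (simp add: sX_subst_sigma FX_mon FX_subst_mon reducible_sigma_single)
    qed
    moreover have "sX_subst ?s ((-1) ^ size \<omega>) \<in> reducible_sX"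
      using reducible_power[OF reducible_Const[of "-1"], of "size \<omega>"] by (simp add: s.hom_power s.hom_uminus Const_def single_uminus)
    ultimately show ?thesis unfolding sigma_omega_def s.hom_mult s.hom_prod using that
      by (intro reducible_mult reducible_prod) auto
  qed
  moreover have "sX_subst ?s ((-1) ^ t) \<in> reducible_sX"
    using reducible_power[OF reducible_Const[of "-1"], of t] by (simp add: s.hom_power s.hom_uminus Const_def single_uminus)
  ultimately have "F_elem t as \<in> reducible_sX"
    using False unfolding F_elem_def
    by (simp only: F_gen_eq s.hom_mult s.hom_sum neq0_conv)
       (intro reducible_mult reducible_sum, auto simp: wmsets_def Lyn_def)
  then show ?thesis by (rule reducible_cong[OF _ ideal_gen_base[OF rel]])
qed (simp add: reducible_one)

lemma all_reducible: "f \<in> (reducible_sX :: 'f::field sX set)"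
proof (induction f rule: mpoly_induct)
  case (Var g)
  show ?case
  proof (cases g rule: sgen_cases)
    case (1 t a)
    have "sigma t a = Var g" using 1 by (simp add: sigma_def Const_def)
    then show ?thesis using reducible_sigma[OF 1(2), of t] by simp
  qed
qed (auto intro: reducible_Const reducible_add reducible_mult)

section \<open>Donkin's theorem\<close>

lemma dpi_hom: "comm_ring_hom (dpi :: 'f::field sX \<Rightarrow> _)"
  unfolding dpi_def by (rule alg_hom_comm_ring_hom[OF alg_hom_peval])

lemma fmat_sum:
  assumes "mat_family m A"
  shows "fmat to_ac m A (\<Sum>k<u. f k) = msum m u (\<lambda>k. fmat to_ac m A (f k :: word \<Rightarrow>\<^sub>0 'f::field))"
proof -
  interpret mat_family_hom m A "to_ac :: 'f \<Rightarrow> _" by (rule fam_hom[OF assms])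
  show ?thesis
  proof (induction u)
    case (Suc u)
    then show ?case by (simp add: fmat_add) (auto simp: msum_def intro!: eq_matI)
  qed (auto simp: fmat_zero msum_def intro!: eq_matI)
qed

text \<open>Under evaluation the three kinds of relations become Amitsur's formula, the defining
  property of P_{t,l} and the cyclic invariance of \<open>sg\<close>.\<close>

lemma dpi_relations:
  assumes inf: "infinite (UNIV :: 'f::field set)" and r: "r \<in> (relations :: 'f sX set)"
  shows "dpi r = 0"
proof (rule sXt_eqI'[OF inf])
  fix m and A :: "nat \<Rightarrow> 'f alg_closure mat" assume mf: "mat_family m A"
  interpret mat_family_hom m A "to_ac :: 'f \<Rightarrow> _" by (rule fam_hom[OF mf])
  from r consider
    (sum) t as where "r = sigma t (sum_list as) - F_elem t as" "t > 0" "length as > 1" "set as \<subseteq> FX"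
    | (pow) t l a where "r = sigma t (mon a ^ l) - P_elem t l (mon a)" "t > 0" "l > 1" "a \<noteq> 0"
    | (cyc) t a b where "r = sigma t (mon (a + b)) - sigma t (mon (b + a))" "t > 0" "a \<noteq> 0" "b \<noteq> 0"
    unfolding relations_def by blast
  then have "evs m A r = 0"
  proof cases
    case sum
    let ?s = "\<lambda>k. if k < length as then as ! k else 0"
    have sFX: "?s k \<in> FX" for k using sum(4) by (auto simp: FX_zero)
    have "sum_list as = (\<Sum>k<length as. ?s k)" by (simp add: sum_list_sum_nth atLeast0LessThan)
    then have "fmat to_ac m A (sum_list as) = msum m (length as) (\<lambda>k. fmat to_ac m A (?s k))"
      by (simp only: fmat_sum[OF mf])
    moreover have "evs m A (F_elem t as) = sg t (msum m (length as) (\<lambda>k. fmat to_ac m A (?s k)))"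
      unfolding F_elem_def evs_sX_subst[OF mf sFX] by (intro evs_F_gen[OF inf sum(2)]) (standard, simp)
    ultimately show ?thesis using FX_sum_list[OF sum(4)] by (simp add: sum(1) evs.hom_minus evs_sigma[OF mf])
  next
    case pow
    have "mon a ^ l \<in> (FX :: (word \<Rightarrow>\<^sub>0 'f) set)" using pow FX_mult[OF FX_mon[OF pow(4)]] by (cases l) auto
    then have "evs m A (sigma t (mon a ^ l)) = sg t (wmat m A a ^\<^sub>m l)"
      by (simp add: evs_sigma[OF mf] fmat_power fmat_mon)
    moreover have "evs m A (P_elem t l (mon a)) = meval to_ac (\<lambda>i. evs m A (sigma i (mon a))) (P_poly t l)"
      unfolding evs_def P_elem_def by (rule meval_peval[OF comm_ring_hom_to_ac])
    ultimately show ?thesis using pow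
      by (simp add: evs.hom_minus evs_sigma[OF mf] fmat_mon FX_mon P_poly_eq[OF inf]
          meval_P_companion[OF comm_ring_hom_to_ac infinite_alg_closure[OF inf] wmat_carrier])
  next
    case cyc
    then show ?thesis using sg_mult_commute[OF wmat_carrier wmat_carrier, of t a b]
      by (simp add: evs.hom_minus evs_sigma[OF mf] fmat_mon FX_mon wmat_plus)
  qed
  then show "ev m A (dpi r) = ev m A 0" by (simp add: ev_dpi[OF inf mf])
qed

lemma dpi_sigma_word:
  assumes inf: "infinite (UNIV :: 'f::field set)" and "t > 0" "e \<in> Xtilde"
  shows "dpi (sigma t (mon e)) = (sigma_t t e :: 'f sXt)"
proof (rule sXt_eqI'[OF inf])
  fix m and A :: "nat \<Rightarrow> 'f alg_closure mat" assume mf: "mat_family m A"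
  interpret mat_family_hom m A "to_ac :: 'f \<Rightarrow> _" by (rule fam_hom[OF mf])
  show "ev m A (dpi (sigma t (mon e))) = ev m A (sigma_t t e)"
    using assms by (simp add: ev_dpi[OF inf mf] evs_sigma[OF mf] FX_mon Xtilde_def fmat_mon ev_sigma_t)
qed

text \<open>Such a homomorphism inverts \<open>lift_sX\<close> on the generators, hence
  everywhere.\<close>

lemma Const_preserving_lift:
  fixes F :: "'f::field sX \<Rightarrow> 'f sXt"
  assumes "alg_hom F" "\<And>t e. t > 0 \<Longrightarrow> e \<in> Xtilde \<Longrightarrow> F (sigma t (mon e)) = sigma_t t e"
  shows "F (lift_sX h) = h"
proof (rule comm_ring_hom_mpoly_eqI[where F = "\<lambda>h. F (lift_sX h)" and G = "\<lambda>h. h"])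
  show "comm_ring_hom (\<lambda>h. F (lift_sX h))"
    by (rule comm_ring_hom_comp[OF alg_hom_comm_ring_hom[OF assms(1)] lift_hom])
  show "comm_ring_hom (\<lambda>h :: 'f sXt. h)" by standard auto
  show "F (lift_sX (Const a)) = Const a" for a using assms(1) by (simp add: alg_hom_def)
  show "F (lift_sX (Var g)) = Var g" for g
  proof (cases g rule: tgen_cases)
    case (1 t e)
    then have "Var g = (sigma_t t e :: 'f sXt)" by (simp add: sigma_t_def)
    then show ?thesis using 1 assms(2) by (simp add: lift_sigma_t)
  qed
qed

text \<open>An element of the kernel is congruent to some \<open>lift_sX h\<close> modulo the
  relations, and applying \<open>dpi\<close> gives h = 0. Surjectivity comes from the section
  \<open>lift_sX\<close>.\<close>

lemma donkin_map_dpi: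
  assumes inf: "infinite (UNIV :: 'f::field set)"
  shows "donkin_map (dpi :: 'f sX \<Rightarrow> _)"
proof -
  interpret d: comm_ring_hom "dpi :: 'f sX \<Rightarrow> _" by (rule dpi_hom)
  have alg: "alg_hom (dpi :: 'f sX \<Rightarrow> _)" unfolding dpi_def by (rule alg_hom_peval)
  have lift: "dpi (lift_sX h) = h" for h :: "'f sXt"
    by (rule Const_preserving_lift[OF alg dpi_sigma_word[OF inf]])
  have ker: "dpi f = 0" if "f \<in> ideal_gen relations" for f :: "'f sX"
    using ideal_gen_subset_kernel[OF dpi_hom dpi_relations[OF inf] that] .
  have "f \<in> ideal_gen relations" if "dpi f = 0" for f :: "'f sX"
  proof -
    obtain h where h: "f - lift_sX h \<in> ideal_gen relations" using all_reducible[of f] by (auto simp: reducible_sX_def)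
    from ker[OF h] have "h = 0" using that lift[of h] by (simp add: d.hom_minus)
    interpret l: comm_ring_hom "lift_sX :: 'f sXt \<Rightarrow> _" by (rule lift_hom)
    show ?thesis using h \<open>h = 0\<close> by simp
  qed
  with ker have "{f :: 'f sX. dpi f = 0} = ideal_gen relations" by blast
  moreover have "surj (dpi :: 'f sX \<Rightarrow> _)" using lift by (metis surjI)
  ultimately show ?thesis using alg dpi_sigma_word[OF inf] by (simp add: donkin_map_def)
qed

text \<open>Whatever map is chosen, it shares with \<open>dpi\<close> the kernel and the section
  \<open>lift_sX\<close>. Such maps are equal, because \<open>f - lift_sX (dpi f)\<close> lies in
  the common kernel.\<close>

lemma pi_t_eq_dpi:
  assumes inf: "infinite (UNIV :: 'f::field set)"
  shows "pi_t = (dpi :: 'f sX \<Rightarrow> _)"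
proof
  fix f :: "'f sX"
  have D: "donkin_map (pi_t :: 'f sX \<Rightarrow> _)"
    unfolding pi_t_def by (rule someI[where P = donkin_map, OF donkin_map_dpi[OF inf]])
  then have alg: "alg_hom (pi_t :: 'f sX \<Rightarrow> _)" by (simp add: donkin_map_def)
  interpret p: comm_ring_hom "pi_t :: 'f sX \<Rightarrow> _" by (rule alg_hom_comm_ring_hom[OF alg])
  interpret d: comm_ring_hom "dpi :: 'f sX \<Rightarrow> _" by (rule dpi_hom)
  have ps: "pi_t (sigma t (mon e)) = (sigma_t t e :: 'f sXt)" if "t > 0" "e \<in> Xtilde" for t e
    using D that unfolding donkin_map_def by blast
  have dalg: "alg_hom (dpi :: 'f sX \<Rightarrow> _)" unfolding dpi_def by (rule alg_hom_peval)
  note lift = Const_preserving_lift[OF alg ps] Const_preserving_lift[OF dalg dpi_sigma_word[OF inf]]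
  have "dpi (f - lift_sX (dpi f)) = 0" by (simp add: d.hom_minus lift)
  moreover have "{f :: 'f sX. pi_t f = 0} = ideal_gen relations"
    using D unfolding donkin_map_def by (elim conjE)
  moreover have "{f :: 'f sX. dpi f = 0} = ideal_gen relations"
    using donkin_map_dpi[OF inf] unfolding donkin_map_def by (elim conjE)
  ultimately have "pi_t (f - lift_sX (dpi f)) = 0" by blast
  then show "pi_t f = dpi f" by (simp add: p.hom_minus lift)
qed

lemma ev_pi_t_sigma:
  fixes a :: "word \<Rightarrow>\<^sub>0 'f::field"
  assumes inf: "infinite (UNIV :: 'f set)" and "mat_family m A" "a \<in> FX"
  shows "ev m A (pi_t (sigma t a)) = sg t (fmat to_ac m A a)"
  using assms by (simp add: pi_t_eq_dpi ev_dpi evs_sigma)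

section \<open>Substitution endomorphisms\<close>

lemma alg_hom_id: "alg_hom (\<lambda>x. x)"
  by (simp add: alg_hom_def)

text \<open>Substitution for the letters becomes substitution of matrices. Both sides are
  homomorphisms in \<open>f\<close>, so the comparison on generators is enough.\<close>

lemma subst_endo_ev:
  fixes \<phi> :: "'f::field sXt \<Rightarrow> 'f sXt"
  assumes inf: "infinite (UNIV :: 'f set)" and "alg_hom \<phi>" and sFX: "\<And>k. s k \<in> FX"
    and \<phi>: "\<And>t a. t > 0 \<Longrightarrow> a \<in> FX \<Longrightarrow> \<phi> (pi_t (sigma t a)) = pi_t (sigma t (FX_subst s a))"
    and mf: "mat_family m A"
  shows "ev m A (\<phi> f) = ev m (\<lambda>k. fmat to_ac m A (s k)) f"
proof (rule comm_ring_hom_mpoly_eqI[where F = "\<lambda>f. ev m A (\<phi> f)"])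
  interpret mat_family_hom m A "to_ac :: 'f \<Rightarrow> _" by (rule fam_hom[OF mf])
  have mf': "mat_family m (\<lambda>k. fmat to_ac m A (s k))" by standard simp
  then interpret s: mat_family_hom m "\<lambda>k. fmat to_ac m A (s k)" "to_ac :: 'f \<Rightarrow> _" by (rule fam_hom)
  show "comm_ring_hom (\<lambda>f. ev m A (\<phi> f))"
    by (rule comm_ring_hom_comp[OF ev.comm_ring_hom_axioms alg_hom_comm_ring_hom[OF assms(2)]])
  show "comm_ring_hom (ev m (\<lambda>k. fmat to_ac m A (s k)))" by (rule ev.comm_ring_hom_axioms)
  show "ev m A (\<phi> (Const a)) = ev m (\<lambda>k. fmat to_ac m A (s k)) (Const a)" for a
    using assms(2) by (simp add: alg_hom_def)
  show "ev m A (\<phi> (Var g)) = ev m (\<lambda>k. fmat to_ac m A (s k)) (Var g)" for g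
  proof (cases g rule: tgen_cases)
    case (1 t e)
    then have e: "mon e \<in> (FX :: (word \<Rightarrow>\<^sub>0 'f) set)" by (intro FX_mon) (simp add: Xtilde_def)
    have "Var g = (sigma_t t e :: 'f sXt)" using 1 by (simp add: sigma_t_def)
    also have "\<dots> = pi_t (sigma t (mon e))" using 1 by (simp add: pi_t_eq_dpi[OF inf] dpi_sigma_word[OF inf])
    finally have g: "Var g = (pi_t (sigma t (mon e)) :: 'f sXt)" .
    show ?thesis
      unfolding g \<phi>[OF 1(1) e] ev_pi_t_sigma[OF inf mf' e] ev_pi_t_sigma[OF inf mf FX_FX_subst[OF e sFX]] fmat_FX_subst ..
  qed
qed

text \<open>The images of the generators are prescribed; that the property then holds for all
  \<open>a\<close>, beyond the words in \<open>Xtilde\<close>, is seen by evaluation.\<close>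

lemma ex_subst_endo:
  fixes s :: "nat \<Rightarrow> (word \<Rightarrow>\<^sub>0 'f::field)"
  assumes inf: "infinite (UNIV :: 'f set)" and sFX: "\<And>k. s k \<in> FX"
  shows "\<exists>\<phi>. alg_hom \<phi> \<and> (\<forall>t>0. \<forall>a\<in>FX. \<phi> (pi_t (sigma t a)) = pi_t (sigma t (FX_subst s a)))"
proof -
  define \<phi> :: "'f sXt \<Rightarrow> 'f sXt" where
    "\<phi> = peval (\<lambda>g. case Rep_tgen g of (t, e) \<Rightarrow> pi_t (sigma t (FX_subst s (mon e))))"
  have alg: "alg_hom \<phi>" unfolding \<phi>_def by (rule alg_hom_peval)
  have ev\<phi>: "ev m A (\<phi> f) = ev m (\<lambda>k. fmat to_ac m A (s k)) f" if mf: "mat_family m A" for m A f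
  proof -
    interpret mat_family_hom m A "to_ac :: 'f \<Rightarrow> _" by (rule fam_hom[OF mf])
    have "ev m A (\<phi> f) = meval to_ac (\<lambda>g. ev m A (case Rep_tgen g of (t, e) \<Rightarrow> pi_t (sigma t (FX_subst s (mon e))))) f"
      unfolding ev_def \<phi>_def by (rule meval_peval[OF comm_ring_hom_to_ac])
    also have "\<dots> = ev m (\<lambda>k. fmat to_ac m A (s k)) f"
      unfolding ev_def[of m "\<lambda>k. fmat to_ac m A (s k)"]
    proof (rule meval_cong)
      fix g
      show "ev m A (case Rep_tgen g of (t, e) \<Rightarrow> pi_t (sigma t (FX_subst s (mon e)))) =
        (case Rep_tgen g of (t, e) \<Rightarrow> sg t (wmat m (\<lambda>k. fmat to_ac m A (s k)) e))"
      proof (cases g rule: tgen_cases)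
        case (1 t e)
        then have "mon e \<in> (FX :: (word \<Rightarrow>\<^sub>0 'f) set)" by (intro FX_mon) (simp add: Xtilde_def)
        from FX_FX_subst[OF this sFX] show ?thesis using 1
          by (simp add: ev_pi_t_sigma[OF inf mf]) (simp add: FX_subst_mon fmat_word_subst)
      qed
    qed
    finally show ?thesis .
  qed
  have "\<phi> (pi_t (sigma t a)) = pi_t (sigma t (FX_subst s a))" if a: "a \<in> FX" for t a
  proof (rule sXt_eqI'[OF inf])
    fix m and A :: "nat \<Rightarrow> 'f alg_closure mat" assume mf: "mat_family m A"
    interpret mat_family_hom m A "to_ac :: 'f \<Rightarrow> _" by (rule fam_hom[OF mf])
    have mf': "mat_family m (\<lambda>k. fmat to_ac m A (s k))" by standard simp
    show "ev m A (\<phi> (pi_t (sigma t a))) = ev m A (pi_t (sigma t (FX_subst s a)))"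
      by (simp add: ev\<phi>[OF mf] ev_pi_t_sigma[OF inf mf' a] ev_pi_t_sigma[OF inf mf FX_FX_subst[OF a sFX]] fmat_FX_subst)
  qed
  then show ?thesis using alg by blast
qed

subsection \<open>Positive characteristic\<close>

lemma fmat_scalar:
  assumes "\<And>k. \<exists>c. A k = c \<cdot>\<^sub>m 1\<^sub>m m"
  shows "\<exists>c. wmat m A w = c \<cdot>\<^sub>m (1\<^sub>m m :: 'r::comm_ring_1 mat)"
proof (induction w rule: word_induct)
  case zero
  show ?case by (intro exI[of _ 1]) (auto intro!: eq_matI)
next
  case (Cons k ks)
  then obtain c where c: "wmat m A (Word ks) = c \<cdot>\<^sub>m 1\<^sub>m m" by blast
  obtain d where d: "A k = d \<cdot>\<^sub>m 1\<^sub>m m" using assms by blast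
  have "A k * wmat m A (Word ks) = (d * c) \<cdot>\<^sub>m 1\<^sub>m m"
    unfolding c d by (subst mult_smult_assoc_mat[of _ m m _ m], simp, simp, subst mult_smult_distrib[of _ m m _ m])
      (auto intro!: eq_matI simp: left_mult_one_mat[of _ m m])
  then show ?case unfolding wmat_Cons by blast
qed

lemma fmat_scalar':
  assumes "\<And>k. \<exists>c. A k = c \<cdot>\<^sub>m 1\<^sub>m m"
  shows "\<exists>c. fmat h m A a = c \<cdot>\<^sub>m (1\<^sub>m m :: 'r::comm_ring_1 mat)"
proof -
  have "\<forall>w. \<exists>c. wmat m A w = c \<cdot>\<^sub>m 1\<^sub>m m" using fmat_scalar[OF assms] by simp
  from choice[OF this] obtain c where c: "\<forall>w. wmat m A w = c w \<cdot>\<^sub>m 1\<^sub>m m" by (elim exE)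
  have "fmat h m A a = (\<Sum>w\<in>Poly_Mapping.keys a. h (Poly_Mapping.lookup a w) * c w) \<cdot>\<^sub>m 1\<^sub>m m"
    by (rule eq_matI) (auto simp: fmat_def lext_def c[rule_format] sum_distrib_right intro!: sum.neutral)
  then show ?thesis by blast
qed

text \<open>In characteristic p, with q a power of p, det(1 - zE) = (1 - z)^q has only the terms of
  degree 0 and q.\<close>

lemma sg_scalar_mat:
  fixes c :: "'k::field"
  assumes p: "prime CHAR('k)" and q: "q = CHAR('k) ^ r" and "0 < t" "t < q"
  shows "sg t (c \<cdot>\<^sub>m (1\<^sub>m q)) = 0"
proof -
  have "dpoly (1\<^sub>m q :: 'k mat) = (1 - [:0, 1:]) ^ q"
  proof -
    have "1\<^sub>m q + (- [:0, 1:]) \<cdot>\<^sub>m map_mat (\<lambda>a. [:a:]) (1\<^sub>m q :: 'k mat) = (1 - [:0, 1:]) \<cdot>\<^sub>m 1\<^sub>m q"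
      by (auto intro!: eq_matI simp: one_pCons)
    then show ?thesis unfolding dpoly_def by simp
  qed
  also have "(1 - [:0, 1:]) ^ q = (1 + - [:0, 1:] :: 'k poly) ^ q" by (simp only: diff_conv_add_uminus)
  also have "\<dots> = 1 ^ q + (- [:0, 1:]) ^ q"
    unfolding q by (rule freshmans_dream'[where n = r]) (use p in auto)
  also have "\<dots> = 1 + monom ((-1) ^ q) q"
    by (subst power_minus) (cases "even q"; simp add: monom_altdef)
  finally have "coeff (dpoly (1\<^sub>m q :: 'k mat)) t = 0" using assms(3,4) by simp
  then have "sg t (1\<^sub>m q :: 'k mat) = 0" by (simp add: sg_coeff_dpoly[of _ q])
  then show ?thesis by (simp add: sg_smult[of _ q])
qed

lemma sg_full_one: "sg q (1\<^sub>m q) = (1 :: 'k::comm_ring_1)"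
proof -
  have I: "{I. I \<subseteq> {0..<q} \<and> card I = q} = {{0..<q}}"
    using card_subset_eq[of "{0..<q}"] by auto
  have "sg q (1\<^sub>m q :: 'k mat) = det (1\<^sub>m q)" unfolding sg_def det_def by (simp add: I)
  then show ?thesis by simp
qed

lemma K_t_not_finitely_based:
  assumes inf: "infinite (UNIV :: 'f::field set)" and p: "CHAR('f) > 0"
  shows "\<not> finitely_based (K_t n :: 'f sXt set)"
proof
  assume "finitely_based (K_t n :: 'f sXt set)"
  then obtain S where S: "finite S" and K: "K_t n = ideal_gen {\<phi> f | \<phi> f. subst_endo \<phi> \<and> f \<in> (S :: 'f sXt set)}"
    by (auto simp: finitely_based_def)
  have prime: "prime CHAR('f)" using p by (rule prime_CHAR_semidom)
  \<comment> \<open>A bound for \<open>n\<close> and for the degrees \<open>t\<close> of all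
    generators in \<open>S\<close>; the power \<open>q\<close> of p below exceeds it.\<close>
  define N where "N = Max (insert n (fst ` Rep_tgen ` (\<Union>f\<in>S. mvars f)))"
  have fin: "finite (insert n (fst ` Rep_tgen ` (\<Union>f\<in>S. mvars f)))" using S by (simp add: finite_mvars)
  have N: "fst (Rep_tgen v) \<le> N" if "f \<in> S" "v \<in> mvars f" for f v
    unfolding N_def using that by (intro Max_ge fin) auto
  have nN: "n \<le> N" unfolding N_def by (intro Max_ge fin) simp
  define q where "q = CHAR('f) ^ Suc N"
  have "N < Suc N" by simp
  also have "\<dots> < 2 ^ Suc N" by (rule less_exp)
  also have "\<dots> \<le> q" unfolding q_def by (intro power_mono) (use prime prime_ge_2_nat in auto)
  finally have Nq: "N < q" .
  \<comment> \<open>All letters are evaluated at the identity matrix, and scalar matrices stay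
    scalar under every substitution.\<close>
  define A :: "nat \<Rightarrow> 'f alg_closure mat" where "A = (\<lambda>_. 1\<^sub>m q)"
  have mf: "mat_family q A" by standard (simp add: A_def)
  interpret mat_family_hom q A "to_ac :: 'f \<Rightarrow> _" by (rule fam_hom[OF mf])
  have sFX: "mon (Word [k]) \<in> (FX :: (word \<Rightarrow>\<^sub>0 'f) set)" for k by (intro FX_mon) (simp add: zero_word_def)
  have Ascal: "\<exists>c. A k = c \<cdot>\<^sub>m 1\<^sub>m q" for k by (intro exI[of _ 1]) (auto simp: A_def intro!: eq_matI)
  \<comment> \<open>The identity is a substitution endomorphism, so the ideal contains
    \<open>S\<close> itself.\<close>
  have SK: "f \<in> K_t n" if "f \<in> S" for f
  proof -
    have "FX_subst (\<lambda>k. mon (Word [k])) a = a" for a :: "word \<Rightarrow>\<^sub>0 'f"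
    proof -
      have "word_subst (\<lambda>k. mon (Word [k])) w = (mon w :: word \<Rightarrow>\<^sub>0 'f)" for w
      proof (induction w rule: word_induct)
        case (Cons k ks)
        have "word_subst (\<lambda>k. mon (Word [k])) (Word (k # ks)) = mon (Word [k]) * word_subst (\<lambda>k. mon (Word [k])) (Word ks)"
          by (simp add: word_subst_def)
        also have "\<dots> = mon (Word [k]) * (mon (Word ks) :: word \<Rightarrow>\<^sub>0 'f)" by (simp only: Cons)
        also have "\<dots> = mon (Word (k # ks))" by (simp add: plus_word_def flip: mon_plus)
        finally show ?case .
      qed (simp add: word_subst_def mon_def)
      then show ?thesis
        using poly_mapping_sum_single[of a] by (simp add: FX_subst_def Const_def mon_def mult_single)
    qed
    then have "subst_endo (\<lambda>x :: 'f sXt. x)"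
      unfolding subst_endo_def using sFX by (intro conjI alg_hom_id exI[of _ "\<lambda>k. mon (Word [k])"]) auto
    with that show ?thesis unfolding K
      by (intro ideal_gen_base CollectI exI[of _ "\<lambda>x. x"] exI[of _ f]) simp
  qed
  \<comment> \<open>A constant term would survive at scalar matrices. It is excluded by evaluation
    at n x n zero matrices, where the element vanishes and so do all generators.\<close>
  have const: "to_ac (Poly_Mapping.lookup f 0) = 0" if "f \<in> S" for f
  proof -
    define Z :: "nat \<Rightarrow> 'f alg_closure mat" where "Z = (\<lambda>_. 0\<^sub>m n n)"
    have mfZ: "mat_family n Z" by standard (simp add: Z_def)
    then interpret Z: mat_family n Z .
    have "ev n Z f = 0" using SK[OF that] mfZ K_t_iff[OF inf] by blast
    moreover have "ev n Z f = (\<Sum>m\<in>Poly_Mapping.keys f. if m = 0 then to_ac (Poly_Mapping.lookup f 0) else 0)"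
      unfolding ev_def meval_lext lext_def
    proof (rule sum.cong[OF refl])
      fix m assume "m \<in> Poly_Mapping.keys f"
      let ?h = "\<lambda>g. case Rep_tgen g of (t, e) \<Rightarrow> sg t (wmat n Z e)"
      show "to_ac (Poly_Mapping.lookup f m) * mono_eval ?h m = (if m = 0 then to_ac (Poly_Mapping.lookup f 0) else 0)"
      proof (cases "m = 0")
        case False
        then obtain v where v: "v \<in> Poly_Mapping.keys m" by (metis keys_eq_empty ex_in_conv)
        have "?h v = 0"
        proof (cases v rule: tgen_cases)
          case (1 t e)
          then have "letters e \<noteq> []" by (simp add: Xtilde_def)
          then obtain k ks where "letters e = k # ks" by (cases "letters e") auto
          then have e: "e = Word (k # ks)" by (metis word.collapse)
          have "wmat n Z e = 0\<^sub>m n n" unfolding e wmat_Cons by (simp add: Z_def) (use Z.wmat_carrier in \<open>simp add: Z_def left_mult_zero_mat[of _ n n]\<close>)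
          then show ?thesis using 1 by (simp add: sg_zero_mat)
        qed
        then have "mono_eval ?h m = 0" unfolding mono_eval_def using v
          by (intro prod_zero bexI[of _ v]) (auto simp: in_keys_iff zero_power)
        then show ?thesis using False by simp
      qed simp
    qed
    ultimately show ?thesis by (cases "0 \<in> Poly_Mapping.keys f") (auto simp: in_keys_iff)
  qed
  have van: "ev q A (\<phi> f) = 0" if \<phi>: "subst_endo \<phi>" and f: "f \<in> S" for \<phi> f
  proof -
    obtain s where alg: "alg_hom \<phi>" and s: "\<And>k. s k \<in> FX"
      and \<phi>s: "\<And>t a. t > 0 \<Longrightarrow> a \<in> FX \<Longrightarrow> \<phi> (pi_t (sigma t a)) = pi_t (sigma t (FX_subst s a))"
      using \<phi> unfolding subst_endo_def by blast
    let ?B = "\<lambda>k. fmat to_ac q A (s k)"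
    have "ev q A (\<phi> f) = ev q ?B f" by (rule subst_endo_ev[OF inf alg s \<phi>s mf])
    also have "\<dots> = (\<Sum>m\<in>Poly_Mapping.keys f. 0)"
      unfolding ev_def meval_lext lext_def
    proof (rule sum.cong[OF refl])
      fix m assume m: "m \<in> Poly_Mapping.keys f"
      let ?h = "\<lambda>g. case Rep_tgen g of (t, e) \<Rightarrow> sg t (wmat q ?B e)"
      show "to_ac (Poly_Mapping.lookup f m) * mono_eval ?h m = 0"
      proof (cases "m = 0")
        case True
        then show ?thesis using const[OF f] by simp
      next
        case False
        then obtain v where v: "v \<in> Poly_Mapping.keys m" by (metis keys_eq_empty ex_in_conv)
        have "?h v = 0"
        proof (cases v rule: tgen_cases)
          case (1 t e)
          have "t \<le> N" using N[OF f, of v] m v 1 by (auto simp: mvars_def)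
          obtain c where "wmat q ?B e = c \<cdot>\<^sub>m 1\<^sub>m q"
            using fmat_scalar[of ?B q e] fmat_scalar'[of A q to_ac, OF Ascal] by blast
          then show ?thesis using 1 sg_scalar_mat[of q "Suc N" t c] prime \<open>t \<le> N\<close> Nq by (simp add: q_def)
        qed
        then have "mono_eval ?h m = 0" unfolding mono_eval_def using v
          by (intro prod_zero bexI[of _ v]) (auto simp: in_keys_iff zero_power)
        then show ?thesis by simp
      qed
    qed
    finally show ?thesis by simp
  qed
  have "ev q A f = 0" if "f \<in> K_t n" for f
    using that unfolding K by (rule ideal_gen_subset_kernel[OF ev.comm_ring_hom_axioms, rotated]) (use van in blast)
  moreover have "sigma_t q (Word [0]) \<in> (K_t n :: 'f sXt set)"
    unfolding K_t_iff[OF inf]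
  proof (intro allI impI)
    fix B :: "nat \<Rightarrow> 'f alg_closure mat" assume "mat_family n B"
    then interpret B: mat_family n B .
    show "ev n B (sigma_t q (Word [0])) = 0" using nN Nq by (simp add: ev_sigma_t Xtilde_letter sg_gt)
  qed
  ultimately have "ev q A (sigma_t q (Word [0])) = 0" by blast
  moreover have "ev q A (sigma_t q (Word [0])) = 1" using Nq by (simp add: ev_sigma_t Xtilde_letter wmat_letter) (simp add: A_def sg_full_one)
  ultimately show False by simp
qed

subsection \<open>Traces along permutations\<close>

text \<open>The involution p \<mapsto> (a b) p reverses the sign and keeps \<open>g\<close>, so the
  sum equals its own negative.\<close>

lemma sum_signed_cancel:
  fixes g :: "(nat \<Rightarrow> nat) \<Rightarrow> 'r::idom"
  assumes two: "(2 :: 'r) \<noteq> 0" and fin: "finite I" and ab: "a \<in> I" "b \<in> I" "a \<noteq> b"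
    and g: "\<And>p. p permutes I \<Longrightarrow> g (transpose a b \<circ> p) = g p"
  shows "(\<Sum>p | p permutes I. signof p * g p) = 0"
proof -
  let ?t = "transpose a b"
  have t: "?t permutes I" using ab by (intro permutes_swap_id)
  have bij: "bij_betw (\<lambda>p. ?t \<circ> p) {p. p permutes I} {p. p permutes I}"
    by (rule bij_betw_byWitness[where f' = "\<lambda>p. ?t \<circ> p"])
       (auto simp: t permutes_compose[OF _ t] fun_eq_iff)
  have perm: "permutation p" if "p permutes I" for p using that fin by (auto simp: permutation_permutes)
  have sgn: "signof (?t \<circ> p) = - (signof p :: 'r)" if "p permutes I" for p
    using sign_compose[OF perm[OF t] perm[OF that]] ab by (simp add: sign_swap_id)
  have "(\<Sum>p | p permutes I. signof p * g p) = (\<Sum>p | p permutes I. signof (?t \<circ> p) * g (?t \<circ> p))"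
    by (rule sum.reindex_bij_betw[OF bij, symmetric])
  also have "\<dots> = (\<Sum>p | p permutes I. - (signof p * g p))"
    by (intro sum.cong refl) (simp only: mem_Collect_eq sgn g minus_mult_left)
  also have "\<dots> = - (\<Sum>p | p permutes I. signof p * g p)" by (rule sum_negf)
  finally have "2 * (\<Sum>p | p permutes I. signof p * g p) = 0" by simp
  then show ?thesis using two by simp
qed

lemma bij_betw_map_permutation:
  assumes f: "bij_betw f A B"
  shows "bij_betw (map_permutation A f) {p. p permutes A} {p. p permutes B}"
proof (rule bij_betw_byWitness[where f' = "map_permutation B (inv_into A f)"])
  have inv: "bij_betw (inv_into A f) B A" by (rule bij_betw_inv_into[OF f])
  show "\<forall>p\<in>{p. p permutes A}. map_permutation B (inv_into A f) (map_permutation A f p) = p"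
    using f by (auto intro!: map_permutation_compose_inv simp: bij_betw_inv_into_left)
  show "\<forall>p\<in>{p. p permutes B}. map_permutation A f (map_permutation B (inv_into A f) p) = p"
    using f by (auto intro!: map_permutation_compose_inv[OF inv] simp: bij_betw_inv_into_right)
  show "map_permutation A f ` {p. p permutes A} \<subseteq> {p. p permutes B}"
    using map_permutation_permutes[OF f] by blast
  show "map_permutation B (inv_into A f) ` {p. p permutes B} \<subseteq> {p. p permutes A}"
    using map_permutation_permutes[OF inv] by blast
qed

text \<open>For a permutation \<tau> of \<open>D\<close>, the product over its cycles of the traces
  of the matrix products M_k M_{\<tau> k} ... along the cycle. As a sum over index functions it
  avoids any decomposition into cycles and is visibly multilinear in the matrices.\<close>

definition Tr :: "nat \<Rightarrow> nat set \<Rightarrow> (nat \<Rightarrow> nat) \<Rightarrow> (nat \<Rightarrow> 'r::comm_ring_1 mat) \<Rightarrow> 'r" where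
  "Tr m D \<tau> M = (\<Sum>i\<in>D \<rightarrow>\<^sub>E {..<m}. \<Prod>k\<in>D. M k $$ (i k, i (\<tau> k)))"

lemma Tr_cong: "(\<And>k. k \<in> D \<Longrightarrow> M k = M' k) \<Longrightarrow> (\<And>k. k \<in> D \<Longrightarrow> \<tau> k = \<tau>' k) \<Longrightarrow> Tr m D \<tau> M = Tr m D \<tau>' M'"
  unfolding Tr_def by (intro sum.cong prod.cong refl) auto

lemma Tr_reindex:
  assumes f: "bij_betw f D E" and \<tau>: "\<tau> permutes D"
  shows "Tr m E (map_permutation D f \<tau>) M = Tr m D \<tau> (\<lambda>k. M (f k))"
proof -
  have inj: "inj_on f D" and im: "f ` D = E" using f by (auto simp: bij_betw_def)
  have \<tau>D: "\<tau> k \<in> D \<longleftrightarrow> k \<in> D" for k using permutes_in_image[OF \<tau>] .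
  have mp: "map_permutation D f \<tau> (f k) = f (\<tau> k)" if "k \<in> D" for k
    using map_permutation_apply[OF inj that] .
  show ?thesis
    unfolding Tr_def
  proof (rule sum.reindex_bij_witness[where i = "\<lambda>g. restrict (\<lambda>e. g (inv_into D f e)) E" and j = "\<lambda>i. restrict (\<lambda>k. i (f k)) D"])
    fix i assume i: "i \<in> E \<rightarrow>\<^sub>E {..<m}"
    show "restrict (\<lambda>e. restrict (\<lambda>k. i (f k)) D (inv_into D f e)) E = i"
      using i f by (auto simp: fun_eq_iff restrict_def bij_betw_inv_into_right[OF f] im inv_into_into dest: PiE_arb)
    show "restrict (\<lambda>k. i (f k)) D \<in> D \<rightarrow>\<^sub>E {..<m}" using i im by auto
    have "(\<Prod>k\<in>E. M k $$ (i k, i (map_permutation D f \<tau> k))) = (\<Prod>k\<in>D. M (f k) $$ (i (f k), i (map_permutation D f \<tau> (f k))))"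
      by (rule prod.reindex_bij_betw[OF f, symmetric])
    also have "\<dots> = (\<Prod>k\<in>D. M (f k) $$ (restrict (\<lambda>k. i (f k)) D k, restrict (\<lambda>k. i (f k)) D (\<tau> k)))"
      by (intro prod.cong refl) (simp add: mp \<tau>D)
    finally show "(\<Prod>k\<in>D. M (f k) $$ (restrict (\<lambda>k. i (f k)) D k, restrict (\<lambda>k. i (f k)) D (\<tau> k))) =
      (\<Prod>k\<in>E. M k $$ (i k, i (map_permutation D f \<tau> k)))" by simp
  next
    fix g assume g: "g \<in> D \<rightarrow>\<^sub>E {..<m}"
    show "restrict (\<lambda>k. restrict (\<lambda>e. g (inv_into D f e)) E (f k)) D = g"
    proof
      fix x
      show "restrict (\<lambda>k. restrict (\<lambda>e. g (inv_into D f e)) E (f k)) D x = g x"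
      proof (cases "x \<in> D")
        case True
        then have "f x \<in> E" using im by blast
        then show ?thesis using True by (simp add: inv_into_f_f[OF inj])
      next
        case False
        then show ?thesis using PiE_arb[OF g False] by simp
      qed
    qed
    have "g (inv_into D f e) \<in> {..<m}" if "e \<in> E" for e
      using that im by (intro PiE_mem[OF g] inv_into_into) simp
    then show "restrict (\<lambda>e. g (inv_into D f e)) E \<in> E \<rightarrow>\<^sub>E {..<m}" by simp
  qed
qed

lemma Tr_insert:
  assumes k: "k \<notin> D" "finite D" and M: "\<And>k. M k \<in> carrier_mat m m"
  shows "Tr m (insert k D) \<tau> M = (\<Sum>g\<in>D \<rightarrow>\<^sub>E {..<m}. \<Sum>y<m.
    M k $$ (y, (g(k := y)) (\<tau> k)) * (\<Prod>j\<in>D. M j $$ (g j, (g(k := y)) (\<tau> j))))"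
proof -
  have "Tr m (insert k D) \<tau> M = (\<Sum>(y, g)\<in>{..<m} \<times> (D \<rightarrow>\<^sub>E {..<m}).
    \<Prod>j\<in>insert k D. M j $$ ((g(k := y)) j, (g(k := y)) (\<tau> j)))"
    unfolding Tr_def PiE_insert_eq
    by (subst sum.reindex[OF inj_combinator[OF k(1)]]) (auto simp: case_prod_unfold intro!: sum.cong)
  also have "\<dots> = (\<Sum>y<m. \<Sum>g\<in>D \<rightarrow>\<^sub>E {..<m}. \<Prod>j\<in>insert k D. M j $$ ((g(k := y)) j, (g(k := y)) (\<tau> j)))"
    by (rule sum.cartesian_product[symmetric])
  also have "\<dots> = (\<Sum>g\<in>D \<rightarrow>\<^sub>E {..<m}. \<Sum>y<m. \<Prod>j\<in>insert k D. M j $$ ((g(k := y)) j, (g(k := y)) (\<tau> j)))"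
    by (rule sum.swap)
  also have "\<dots> = (\<Sum>g\<in>D \<rightarrow>\<^sub>E {..<m}. \<Sum>y<m.
    M k $$ (y, (g(k := y)) (\<tau> k)) * (\<Prod>j\<in>D. M j $$ (g j, (g(k := y)) (\<tau> j))))"
  proof (intro sum.cong refl)
    fix g y
    have "(\<Prod>j\<in>D. M j $$ ((g(k := y)) j, (g(k := y)) (\<tau> j))) = (\<Prod>j\<in>D. M j $$ (g j, (g(k := y)) (\<tau> j)))"
      by (intro prod.cong refl) (use k in auto)
    then show "(\<Prod>j\<in>insert k D. M j $$ ((g(k := y)) j, (g(k := y)) (\<tau> j))) =
      M k $$ (y, (g(k := y)) (\<tau> k)) * (\<Prod>j\<in>D. M j $$ (g j, (g(k := y)) (\<tau> j)))"
      using k by simp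
  qed
  finally show ?thesis .
qed

lemma Tr_fixed:
  assumes k: "k \<notin> D" "finite D" and M: "\<And>k. M k \<in> carrier_mat m m"
    and \<tau>: "\<tau> permutes D"
  shows "Tr m (insert k D) \<tau> M = (\<Sum>y<m. M k $$ (y, y)) * Tr m D \<tau> M"
proof -
  have \<tau>k: "\<tau> k = k" using \<tau> k by (simp add: permutes_not_in)
  have "Tr m (insert k D) \<tau> M = (\<Sum>g\<in>D \<rightarrow>\<^sub>E {..<m}. \<Sum>y<m.
    M k $$ (y, (g(k := y)) (\<tau> k)) * (\<Prod>j\<in>D. M j $$ (g j, (g(k := y)) (\<tau> j))))"
    by (rule Tr_insert[OF k M])
  also have "\<dots> = (\<Sum>g\<in>D \<rightarrow>\<^sub>E {..<m}. \<Sum>y<m. M k $$ (y, y) * (\<Prod>j\<in>D. M j $$ (g j, g (\<tau> j))))"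
  proof (intro sum.cong refl arg_cong2[where f = "(*)"] prod.cong)
    fix g :: "nat \<Rightarrow> nat" and y j assume "j \<in> D"
    then have "\<tau> j \<noteq> k" using permutes_in_image[OF \<tau>, of j] k by auto
    then show "M j $$ (g j, (g(k := y)) (\<tau> j)) = M j $$ (g j, g (\<tau> j))" by simp
  qed (simp add: \<tau>k)
  also have "\<dots> = (\<Sum>y<m. M k $$ (y, y)) * Tr m D \<tau> M"
    unfolding Tr_def sum_product by (rule sum.swap)
  finally show ?thesis .
qed

text \<open>Taking \<open>k\<close> out of its cycle: the predecessor \<open>l\<close> inherits the
  successor of \<open>k\<close> and carries the product of both matrices.\<close>

lemma Tr_contract:
  assumes k: "k \<notin> D" "finite D" and M: "\<And>k. M k \<in> carrier_mat m m"
    and \<tau>: "\<tau> permutes insert k D" and \<tau>k: "\<tau> k \<noteq> k" and l: "\<tau> l = k"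
  shows "Tr m (insert k D) \<tau> M = Tr m D (transpose k (\<tau> k) \<circ> \<tau>) (M(l := M l * M k))"
proof -
  have lD: "l \<in> D" using permutes_in_image[OF \<tau>, of l] l \<tau>k by auto
  have inj: "\<tau> j = k \<longleftrightarrow> j = l" for j using l permutes_inj[OF \<tau>] by (auto simp: inj_def)
  have \<tau>kD: "\<tau> k \<in> D" using permutes_in_image[OF \<tau>, of k] \<tau>k by auto
  have dims: "dim_row (M k) = m" "dim_col (M k) = m" for k using M[of k] by auto
  have "Tr m (insert k D) \<tau> M = (\<Sum>g\<in>D \<rightarrow>\<^sub>E {..<m}. \<Sum>y<m.
    M k $$ (y, (g(k := y)) (\<tau> k)) * (\<Prod>j\<in>D. M j $$ (g j, (g(k := y)) (\<tau> j))))"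
    by (rule Tr_insert[OF k M])
  also have "\<dots> = Tr m D (transpose k (\<tau> k) \<circ> \<tau>) (M(l := M l * M k))"
    unfolding Tr_def
  proof (rule sum.cong[OF refl])
    fix g assume g: "g \<in> D \<rightarrow>\<^sub>E {..<m}"
    let ?\<tau> = "transpose k (\<tau> k) \<circ> \<tau>"
    have \<tau>': "?\<tau> j = (if j = l then \<tau> k else \<tau> j)" if "j \<in> D" for j
    proof (cases "j = l")
      case False
      then have "\<tau> j \<noteq> k" using inj by simp
      moreover have "\<tau> j \<noteq> \<tau> k" using that k injD[OF permutes_inj[OF \<tau>]] by metis
      ultimately show ?thesis using False by simp
    qed (simp add: l)
    have gm: "g j < m" if "j \<in> D" for j using g that by auto
    have rest: "(\<Prod>j\<in>D - {l}. M j $$ (g j, (g(k := y)) (\<tau> j))) = (\<Prod>j\<in>D - {l}. M j $$ (g j, g (\<tau> j)))" for y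
      by (intro prod.cong refl) (use inj in auto)
    have "(\<Sum>y<m. M k $$ (y, (g(k := y)) (\<tau> k)) * (\<Prod>j\<in>D. M j $$ (g j, (g(k := y)) (\<tau> j)))) =
      (\<Sum>y<m. (M l $$ (g l, y) * M k $$ (y, g (\<tau> k))) * (\<Prod>j\<in>D - {l}. M j $$ (g j, g (\<tau> j))))"
    proof (rule sum.cong[OF refl])
      fix y
      have "(\<Prod>j\<in>D. M j $$ (g j, (g(k := y)) (\<tau> j))) = M l $$ (g l, y) * (\<Prod>j\<in>D - {l}. M j $$ (g j, g (\<tau> j)))"
        by (subst prod.remove[OF k(2) lD]) (simp only: rest l fun_upd_same)
      then show "M k $$ (y, (g(k := y)) (\<tau> k)) * (\<Prod>j\<in>D. M j $$ (g j, (g(k := y)) (\<tau> j))) =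
        (M l $$ (g l, y) * M k $$ (y, g (\<tau> k))) * (\<Prod>j\<in>D - {l}. M j $$ (g j, g (\<tau> j)))"
        by (simp only: fun_upd_other[OF \<tau>k] mult_ac)
    qed
    also have "\<dots> = (\<Sum>y<m. M l $$ (g l, y) * M k $$ (y, g (\<tau> k))) * (\<Prod>j\<in>D - {l}. M j $$ (g j, g (\<tau> j)))"
      by (rule sum_distrib_right[symmetric])
    also have "(\<Sum>y<m. M l $$ (g l, y) * M k $$ (y, g (\<tau> k))) = (M l * M k) $$ (g l, g (\<tau> k))"
      using gm[OF lD] gm[OF \<tau>kD] by (simp add: dims scalar_prod_def atLeast0LessThan)
    also have "(\<Prod>j\<in>D - {l}. M j $$ (g j, g (\<tau> j))) = (\<Prod>j\<in>D - {l}. (M(l := M l * M k)) j $$ (g j, g (?\<tau> j)))"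
    proof (intro prod.cong refl)
      fix j assume j: "j \<in> D - {l}"
      then have "?\<tau> j = \<tau> j" using \<tau>'[of j] by (simp only: Diff_iff singleton_iff if_False simp_thms)
      then show "M j $$ (g j, g (\<tau> j)) = (M(l := M l * M k)) j $$ (g j, g (?\<tau> j))"
        using j by (simp del: comp_apply)
    qed
    also have "(M l * M k) $$ (g l, g (\<tau> k)) = (M(l := M l * M k)) l $$ (g l, g (?\<tau> l))"
      using \<tau>'[OF lD] by (simp del: comp_apply)
    also have "(M(l := M l * M k)) l $$ (g l, g (?\<tau> l)) * (\<Prod>j\<in>D - {l}. (M(l := M l * M k)) j $$ (g j, g (?\<tau> j))) =
      (\<Prod>j\<in>D. (M(l := M l * M k)) j $$ (g j, g (?\<tau> j)))"
      by (rule prod.remove[OF k(2) lD, symmetric])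
    finally show "(\<Sum>y<m. M k $$ (y, (g(k := y)) (\<tau> k)) * (\<Prod>j\<in>D. M j $$ (g j, (g(k := y)) (\<tau> j)))) =
      (\<Prod>j\<in>D. (M(l := M l * M k)) j $$ (g j, g (?\<tau> j)))" .
  qed
  finally show ?thesis .
qed

lemma contract_permutes:
  assumes \<tau>: "\<tau> permutes insert k D" and k: "k \<notin> D"
  shows "transpose k (\<tau> k) \<circ> \<tau> permutes D"
proof -
  have "transpose k (\<tau> k) permutes insert k D"
    using permutes_in_image[OF \<tau>, of k] by (intro permutes_swap_id) auto
  from permutes_compose[OF \<tau> this] have "transpose k (\<tau> k) \<circ> \<tau> permutes insert k D" .
  then show ?thesis by (rule permutes_superset) (use k in auto)
qed

section \<open>Polarization\<close>

definition Pol :: "nat \<Rightarrow> nat set \<Rightarrow> (nat \<Rightarrow> 'r::comm_ring_1 mat) \<Rightarrow> 'r" where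
  "Pol m I M = (\<Sum>p | p permutes I. signof p * Tr m I p M)"

lemma card_bijections:
  assumes "finite I" "finite J" "card I = card J"
  shows "card {f \<in> I \<rightarrow>\<^sub>E J. inj_on f I} = fact (card I)"
proof -
  have "card {f \<in> I \<rightarrow>\<^sub>E J. inj_on f I} = card J ^ (card I - card I) * prod ((-) (card J)) {0..<card I}"
    using assms by (intro card_inj_on_subset_funcset) auto
  then show ?thesis using assms(3) by (simp add: fact_prod_rev)
qed

text \<open>In \<open>Pol\<close> with equal matrices, index functions that are not injective cancel
  in pairs. An injective one yields the principal minor on its image, and every image arises from t!
  functions, t being the size of \<open>I\<close>.\<close>

lemma fact_sg:
  fixes B :: "'r::idom mat"
  assumes two: "(2 :: 'r) \<noteq> 0" and fin: "finite I" and B: "B \<in> carrier_mat m m"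
  shows "of_nat (fact (card I)) * sg (card I) B = Pol m I (\<lambda>_. B)"
proof -
  let ?F = "I \<rightarrow>\<^sub>E {..<m}"
  let ?Js = "{J. J \<subseteq> {0..<m} \<and> card J = card I}"
  let ?minor = "\<lambda>J. \<Sum>p | p permutes J. signof p * (\<Prod>s\<in>J. B $$ (s, p s))"
  have finF: "finite ?F" using fin by (intro finite_PiE) auto
  have "Pol m I (\<lambda>_. B) = (\<Sum>i\<in>?F. \<Sum>p | p permutes I. signof p * (\<Prod>r\<in>I. B $$ (i r, i (p r))))"
    unfolding Pol_def Tr_def by (simp add: sum_distrib_left) (rule sum.swap)
  also have "\<dots> = (\<Sum>i\<in>{i\<in>?F. inj_on i I}. \<Sum>p | p permutes I. signof p * (\<Prod>r\<in>I. B $$ (i r, i (p r))))"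
  proof (rule sum.mono_neutral_right[OF finF], blast, rule ballI)
    fix i assume "i \<in> ?F - {i\<in>?F. inj_on i I}"
    then obtain a b where ab: "a \<in> I" "b \<in> I" "a \<noteq> b" "i a = i b" by (auto simp: inj_on_def)
    have "i (transpose a b x) = i x" for x using ab(4) by (simp add: transpose_def)
    then show "(\<Sum>p | p permutes I. signof p * (\<Prod>r\<in>I. B $$ (i r, i (p r)))) = 0"
      by (intro sum_signed_cancel[OF two fin ab(1-3)]) simp
  qed
  also have "\<dots> = (\<Sum>i\<in>{i\<in>?F. inj_on i I}. ?minor (i ` I))"
  proof (rule sum.cong[OF refl])
    fix i assume "i \<in> {i\<in>?F. inj_on i I}"
    then have inj: "inj_on i I" and bij: "bij_betw i I (i ` I)" by (auto simp: bij_betw_def)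
    have "?minor (i ` I) = (\<Sum>p | p permutes I. signof (map_permutation I i p) * (\<Prod>s\<in>i ` I. B $$ (s, map_permutation I i p s)))"
      by (rule sum.reindex_bij_betw[OF bij_betw_map_permutation[OF bij], symmetric])
    also have "\<dots> = (\<Sum>p | p permutes I. signof p * (\<Prod>r\<in>I. B $$ (i r, i (p r))))"
    proof (rule sum.cong[OF refl])
      fix p assume "p \<in> {p. p permutes I}"
      then have p: "p permutes I" by simp
      have "(\<Prod>s\<in>i ` I. B $$ (s, map_permutation I i p s)) = (\<Prod>r\<in>I. B $$ (i r, i (p r)))"
        by (subst prod.reindex[OF inj]) (auto intro!: prod.cong simp: map_permutation_apply[OF inj])
      then show "signof (map_permutation I i p) * (\<Prod>s\<in>i ` I. B $$ (s, map_permutation I i p s)) = signof p * (\<Prod>r\<in>I. B $$ (i r, i (p r)))"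
        using sign_map_permutation[OF inj p fin] by simp
    qed
    finally show "(\<Sum>p | p permutes I. signof p * (\<Prod>r\<in>I. B $$ (i r, i (p r)))) = ?minor (i ` I)" by simp
  qed
  also have "\<dots> = (\<Sum>J\<in>?Js. \<Sum>i\<in>{i\<in>{i\<in>?F. inj_on i I}. i ` I = J}. ?minor (i ` I))"
  proof (rule sum.group[symmetric])
    show "finite {i\<in>?F. inj_on i I}" using finF by simp
    show "finite ?Js" by (rule finite_subsets_card)
    show "(\<lambda>i. i ` I) ` {i\<in>?F. inj_on i I} \<subseteq> ?Js" by (auto simp: card_image)
  qed
  also have "\<dots> = (\<Sum>J\<in>?Js. of_nat (fact (card I)) * ?minor J)"
  proof (rule sum.cong[OF refl])
    fix J assume J: "J \<in> ?Js"
    then have finJ: "finite J" using finite_subset by blast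
    have "{i\<in>{i\<in>?F. inj_on i I}. i ` I = J} = {f \<in> I \<rightarrow>\<^sub>E J. inj_on f I}"
    proof (intro equalityI subsetI)
      fix i assume "i \<in> {f \<in> I \<rightarrow>\<^sub>E J. inj_on f I}"
      then have i: "i \<in> I \<rightarrow>\<^sub>E J" "inj_on i I" by auto
      have "i ` I = J" using i J finJ by (intro card_subset_eq) (auto simp: card_image)
      then show "i \<in> {i\<in>{i\<in>?F. inj_on i I}. i ` I = J}" using i J by (auto simp: PiE_iff)
    qed (auto simp: PiE_iff)
    moreover have "card {f \<in> I \<rightarrow>\<^sub>E J. inj_on f I} = fact (card I)" using J fin finJ by (intro card_bijections) auto
    ultimately have "card {i\<in>{i\<in>?F. inj_on i I}. i ` I = J} = fact (card I)" by simp
    moreover have "(\<Sum>i\<in>{i\<in>{i\<in>?F. inj_on i I}. i ` I = J}. ?minor (i ` I)) = (\<Sum>i\<in>{i\<in>{i\<in>?F. inj_on i I}. i ` I = J}. ?minor J)"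
      by (rule sum.cong) auto
    ultimately show "(\<Sum>i\<in>{i\<in>{i\<in>?F. inj_on i I}. i ` I = J}. ?minor (i ` I)) = of_nat (fact (card I)) * ?minor J"
      by simp
  qed
  also have "\<dots> = of_nat (fact (card I)) * sg (card I) B"
    using B by (simp add: sg_def sum_distrib_left)
  finally show ?thesis by simp
qed

lemma Pol_reindex:
  assumes fin: "finite I" and f: "bij_betw f I I"
  shows "Pol m I (\<lambda>r. M (f r)) = Pol m I M"
proof -
  have "Pol m I M = (\<Sum>p | p permutes I. signof (map_permutation I f p) * Tr m I (map_permutation I f p) M)"
    unfolding Pol_def by (rule sum.reindex_bij_betw[OF bij_betw_map_permutation[OF f], symmetric])
  also have "\<dots> = (\<Sum>p | p permutes I. signof p * Tr m I p (\<lambda>r. M (f r)))"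
    using f fin by (intro sum.cong refl) (simp add: Tr_reindex sign_map_permutation bij_betw_def)
  finally show ?thesis by (simp add: Pol_def)
qed

definition msumset :: "nat \<Rightarrow> nat set \<Rightarrow> (nat \<Rightarrow> 'r::comm_ring_1 mat) \<Rightarrow> 'r mat" where
  "msumset m S M = mat m m (\<lambda>(i, j). \<Sum>k\<in>S. M k $$ (i, j))"

lemma msumset_carrier: "msumset m S M \<in> carrier_mat m m"
  by (simp add: msumset_def)

lemma Pol_msumset:
  assumes fin: "finite I" and S: "S \<subseteq> I"
  shows "Pol m I (\<lambda>_. msumset m S M) = (\<Sum>f\<in>I \<rightarrow>\<^sub>E S. Pol m I (\<lambda>r. M (f r)))"
proof -
  have finS: "finite S" using S fin by (rule finite_subset)
  have "Tr m I p (\<lambda>_. msumset m S M) = (\<Sum>f\<in>I \<rightarrow>\<^sub>E S. Tr m I p (\<lambda>r. M (f r)))" if p: "p permutes I" for p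
  proof -
    have "Tr m I p (\<lambda>_. msumset m S M) = (\<Sum>i\<in>I \<rightarrow>\<^sub>E {..<m}. \<Prod>k\<in>I. \<Sum>s\<in>S. M s $$ (i k, i (p k)))"
      unfolding Tr_def
    proof (intro sum.cong prod.cong refl)
      fix i k assume i: "i \<in> I \<rightarrow>\<^sub>E {..<m}" and k: "k \<in> I"
      have "p k \<in> I" using permutes_in_image[OF p, of k] k by simp
      then have "i k < m" "i (p k) < m" using i k by auto
      then show "msumset m S M $$ (i k, i (p k)) = (\<Sum>s\<in>S. M s $$ (i k, i (p k)))" by (simp add: msumset_def)
    qed
    also have "\<dots> = (\<Sum>i\<in>I \<rightarrow>\<^sub>E {..<m}. \<Sum>f\<in>I \<rightarrow>\<^sub>E S. \<Prod>k\<in>I. M (f k) $$ (i k, i (p k)))"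
      using fin finS by (intro sum.cong refl prod_sum_PiE) auto
    also have "\<dots> = (\<Sum>f\<in>I \<rightarrow>\<^sub>E S. Tr m I p (\<lambda>r. M (f r)))"
      unfolding Tr_def by (rule sum.swap)
    finally show ?thesis .
  qed
  then have "Pol m I (\<lambda>_. msumset m S M) = (\<Sum>p | p permutes I. \<Sum>f\<in>I \<rightarrow>\<^sub>E S. signof p * Tr m I p (\<lambda>r. M (f r)))"
    unfolding Pol_def by (intro sum.cong refl) (simp add: sum_distrib_left)
  also have "\<dots> = (\<Sum>f\<in>I \<rightarrow>\<^sub>E S. Pol m I (\<lambda>r. M (f r)))"
    unfolding Pol_def by (rule sum.swap)
  finally show ?thesis .
qed

lemma sum_signs_Pow: "finite S \<Longrightarrow> (\<Sum>T\<in>Pow S. (-1) ^ card (S - T)) = (if S = {} then 1 else (0 :: 'r::comm_ring_1))"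
proof -
  assume fin: "finite S"
  have "(\<Sum>T\<in>Pow S. (-1) ^ card (S - T)) = (\<Prod>x\<in>S. 1 + (-1 :: 'r))"
    by (subst prod_add[OF fin]) simp
  also have "\<dots> = 0 ^ card S" by simp
  also have "\<dots> = (if S = {} then 1 else 0)" using fin by (auto simp: zero_power card_gt_0_iff)
  finally show "(\<Sum>T\<in>Pow S. (-1) ^ card (S - T)) = (if S = {} then 1 else (0 :: 'r))" .
qed

text \<open>Inclusion and exclusion. By multilinearity, t! times the right side expands over maps f
  from \<open>I\<close> to \<open>I\<close>. The alternating sum over all \<open>S\<close> that
  contain the image of f is 0 unless f is surjective, and each of the t! bijections contributes
  \<open>Pol m I M\<close>; finally t! is cancelled.\<close>

lemma Pol_polarization:
  fixes M :: "nat \<Rightarrow> 'r::idom mat"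
  assumes two: "(2 :: 'r) \<noteq> 0" and nz: "of_nat (fact (card I)) \<noteq> (0 :: 'r)" and fin: "finite I"
  shows "Pol m I M = (\<Sum>S\<in>Pow I. (-1) ^ card (I - S) * sg (card I) (msumset m S M))"
proof -
  have finII: "finite (I \<rightarrow>\<^sub>E I)" using fin by (intro finite_PiE) auto
  have "of_nat (fact (card I)) * (\<Sum>S\<in>Pow I. (-1) ^ card (I - S) * sg (card I) (msumset m S M)) =
    (\<Sum>S\<in>Pow I. (-1) ^ card (I - S) * (of_nat (fact (card I)) * sg (card I) (msumset m S M)))"
    by (simp add: sum_distrib_left mult_ac)
  also have "\<dots> = (\<Sum>S\<in>Pow I. (-1) ^ card (I - S) * (\<Sum>f\<in>I \<rightarrow>\<^sub>E S. Pol m I (\<lambda>r. M (f r))))"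
    by (intro sum.cong refl) (simp add: fact_sg[OF two fin msumset_carrier] Pol_msumset[OF fin])
  also have "\<dots> = (\<Sum>S\<in>Pow I. \<Sum>f\<in>I \<rightarrow>\<^sub>E I. if f ` I \<subseteq> S then (-1) ^ card (I - S) * Pol m I (\<lambda>r. M (f r)) else 0)"
  proof (rule sum.cong[OF refl])
    fix S assume S: "S \<in> Pow I"
    have "I \<rightarrow>\<^sub>E S = {f \<in> I \<rightarrow>\<^sub>E I. f ` I \<subseteq> S}"
      using S by (auto simp: PiE_iff extensional_def image_subset_iff)
    then show "(-1) ^ card (I - S) * (\<Sum>f\<in>I \<rightarrow>\<^sub>E S. Pol m I (\<lambda>r. M (f r))) =
      (\<Sum>f\<in>I \<rightarrow>\<^sub>E I. if f ` I \<subseteq> S then (-1) ^ card (I - S) * Pol m I (\<lambda>r. M (f r)) else 0)"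
      using finII by (simp add: sum_distrib_left sum.inter_filter) (auto intro!: sum.cong)
  qed
  also have "\<dots> = (\<Sum>f\<in>I \<rightarrow>\<^sub>E I. \<Sum>S\<in>Pow I. if f ` I \<subseteq> S then (-1) ^ card (I - S) * Pol m I (\<lambda>r. M (f r)) else 0)"
    by (rule sum.swap)
  also have "\<dots> = (\<Sum>f\<in>I \<rightarrow>\<^sub>E I. if inj_on f I then Pol m I M else 0)"
  proof (rule sum.cong[OF refl])
    fix f assume f: "f \<in> I \<rightarrow>\<^sub>E I"
    then have fI: "f ` I \<subseteq> I" by auto
    have "(\<Sum>S\<in>Pow I. if f ` I \<subseteq> S then (-1) ^ card (I - S) * Pol m I (\<lambda>r. M (f r)) else 0) =
      (\<Sum>S\<in>{S \<in> Pow I. f ` I \<subseteq> S}. (-1) ^ card (I - S) * Pol m I (\<lambda>r. M (f r)))"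
      by (rule sum.inter_filter[symmetric]) (use fin in simp)
    also have "\<dots> = (\<Sum>T\<in>Pow (I - f ` I). (-1) ^ card (I - f ` I - T) * Pol m I (\<lambda>r. M (f r)))"
      by (rule sum.reindex_bij_witness[where i = "\<lambda>T. T \<union> f ` I" and j = "\<lambda>S. S - f ` I"])
         (use fI in \<open>auto intro!: arg_cong2[where f = "(*)"] arg_cong[where f = "\<lambda>S. (-1) ^ card S"]\<close>)
    also have "\<dots> = (if I - f ` I = {} then 1 else 0) * Pol m I (\<lambda>r. M (f r))"
      using fin by (simp add: sum_distrib_right[symmetric] sum_signs_Pow)
    also have "\<dots> = (if inj_on f I then Pol m I M else 0)"
    proof (cases "inj_on f I")
      case True
      then have im: "f ` I = I" using fI fin by (intro card_subset_eq) (auto simp: card_image)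
      then have "bij_betw f I I" using True by (simp add: bij_betw_def)
      then show ?thesis using True im Pol_reindex[OF fin, of f m M] by simp
    next
      case False
      then have "I - f ` I \<noteq> {}" using fin finite_surj_inj[of I f] by blast
      then show ?thesis using False by simp
    qed
    finally show "(\<Sum>S\<in>Pow I. if f ` I \<subseteq> S then (-1) ^ card (I - S) * Pol m I (\<lambda>r. M (f r)) else 0) =
      (if inj_on f I then Pol m I M else 0)" .
  qed
  also have "\<dots> = (\<Sum>f\<in>{f \<in> I \<rightarrow>\<^sub>E I. inj_on f I}. Pol m I M)"
    by (simp only: sum.inter_filter[OF finII])
  also have "\<dots> = of_nat (fact (card I)) * Pol m I M"
    by (simp add: card_bijections[OF fin fin])
  finally show ?thesis using nz by (simp add: mult_left_cancel)
qed

subsection \<open>Straightening\<close>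

definition lexless :: "nat \<Rightarrow> (nat \<Rightarrow> nat) \<Rightarrow> (nat \<Rightarrow> nat) \<Rightarrow> bool" where
  "lexless d \<tau> \<sigma> \<longleftrightarrow> (\<exists>k<d. (\<forall>j<k. \<tau> j = \<sigma> j) \<and> \<tau> k < \<sigma> k)"

lemma lexless_irrefl: "\<not> lexless d \<tau> \<tau>"
  by (simp add: lexless_def)

lemma lexless_trans:
  assumes "lexless d \<rho> \<tau>" "lexless d \<tau> \<sigma>"
  shows "lexless d \<rho> \<sigma>"
proof -
  obtain k where k: "k < d" "\<forall>j<k. \<rho> j = \<tau> j" "\<rho> k < \<tau> k" using assms(1) by (auto simp: lexless_def)
  obtain l where l: "l < d" "\<forall>j<l. \<tau> j = \<sigma> j" "\<tau> l < \<sigma> l" using assms(2) by (auto simp: lexless_def)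
  consider "k < l" | "k = l" | "l < k" by linarith
  then show ?thesis
  proof cases
    case 1
    then show ?thesis using k l unfolding lexless_def by (intro exI[of _ k]) auto
  next
    case 2
    then show ?thesis using k l unfolding lexless_def by (intro exI[of _ k]) auto
  next
    case 3
    then show ?thesis using k l unfolding lexless_def by (intro exI[of _ l]) auto
  qed
qed

text \<open>Turns induction along \<open>lexless\<close> into induction on natural numbers.\<close>

definition lexrank :: "nat \<Rightarrow> (nat \<Rightarrow> nat) \<Rightarrow> nat" where
  "lexrank d \<sigma> = card {\<tau>. \<tau> permutes {..<d} \<and> lexless d \<tau> \<sigma>}"

lemma lexrank_mono:
  assumes "lexless d \<tau> \<sigma>" "\<tau> permutes {..<d}"
  shows "lexrank d \<tau> < lexrank d \<sigma>"
  unfolding lexrank_def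
proof (rule psubset_card_mono)
  show "finite {\<tau>. \<tau> permutes {..<d} \<and> lexless d \<tau> \<sigma>}"
    by (rule finite_subset[OF _ finite_permutations[of "{..<d}"]]) auto
  have "\<tau> \<in> {\<tau>. \<tau> permutes {..<d} \<and> lexless d \<tau> \<sigma>}" using assms by simp
  moreover have "\<tau> \<notin> {\<tau>'. \<tau>' permutes {..<d} \<and> lexless d \<tau>' \<tau>}" by (simp add: lexless_irrefl)
  moreover have "{\<tau>'. \<tau>' permutes {..<d} \<and> lexless d \<tau>' \<tau>} \<subseteq> {\<tau>. \<tau> permutes {..<d} \<and> lexless d \<tau> \<sigma>}"
    using lexless_trans[OF _ assms(1)] by auto
  ultimately show "{\<tau>'. \<tau>' permutes {..<d} \<and> lexless d \<tau>' \<tau>} \<subset> {\<tau>. \<tau> permutes {..<d} \<and> lexless d \<tau> \<sigma>}" by blast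
qed

definition decreasing_on :: "(nat \<Rightarrow> nat) \<Rightarrow> nat set \<Rightarrow> bool" where
  "decreasing_on \<sigma> P \<longleftrightarrow> (\<forall>k\<in>P. \<forall>l\<in>P. k < l \<longrightarrow> \<sigma> l < \<sigma> k)"

text \<open>Colour a position by the length of the longest decreasing subsequence that ends there.\<close>

lemma increasing_colouring:
  assumes \<sigma>: "\<sigma> permutes {..<d}"
    and no: "\<And>P. P \<subseteq> {..<d} \<Longrightarrow> decreasing_on \<sigma> P \<Longrightarrow> card P \<noteq> Suc n"
  shows "\<exists>c. (\<forall>k<d. c k < n) \<and> (\<forall>k<d. \<forall>l<d. k < l \<longrightarrow> c k = c l \<longrightarrow> \<sigma> k < \<sigma> l)"
proof -
  define Q where "Q k = {P. P \<subseteq> {..k} \<and> k \<in> P \<and> decreasing_on \<sigma> P}" for k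
  define c where "c k = Max (card ` Q k) - 1" for k
  have finQ: "finite (card ` Q k)" for k
    by (intro finite_imageI finite_subset[of "Q k" "Pow {..k}"]) (auto simp: Q_def)
  have neQ: "card ` Q k \<noteq> {}" for k
  proof -
    have "{k} \<in> Q k" by (auto simp: Q_def decreasing_on_def)
    then show ?thesis by blast
  qed
  have ge1: "card P \<ge> 1" if "P \<in> Q k" for P k
  proof -
    have "finite P" "P \<noteq> {}" using that finite_subset[of P "{..k}"] by (auto simp: Q_def)
    then show ?thesis by (simp add: Suc_le_eq card_gt_0_iff)
  qed
  have maxP: "\<exists>P\<in>Q k. card P = Suc (c k)" for k
  proof -
    from Max_in[OF finQ neQ] obtain P where P: "P \<in> Q k" "card P = Max (card ` Q k)" by (metis imageE)
    then show ?thesis using ge1[OF P(1)] by (intro bexI[of _ P]) (auto simp: c_def)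
  qed
  have le: "card P \<le> Suc (c k)" if "P \<in> Q k" for P k
    using Max_ge[OF finQ, of "card P" k] that ge1[OF that] by (auto simp: c_def)
  have "c k < n" if k: "k < d" for k
  proof (rule ccontr)
    assume "\<not> c k < n"
    obtain P where P: "P \<in> Q k" "card P = Suc (c k)" using maxP by blast
    then obtain P' where P': "P' \<subseteq> P" "card P' = Suc n"
      using \<open>\<not> c k < n\<close> obtain_subset_with_card_n[of "Suc n" P] by (metis Suc_le_mono not_less)
    then have "P' \<subseteq> {..<d}" using P k by (auto simp: Q_def)
    moreover have "decreasing_on \<sigma> P'" using P P' by (auto simp: Q_def decreasing_on_def)
    ultimately show False using no P' by blast
  qed
  moreover have "\<sigma> k < \<sigma> l" if "k < l" "c k = c l" for k l
  proof (rule ccontr)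
    assume "\<not> \<sigma> k < \<sigma> l"
    moreover have "\<sigma> k \<noteq> \<sigma> l" using that injD[OF permutes_inj[OF \<sigma>], of k l] by auto
    ultimately have lt: "\<sigma> l < \<sigma> k" by simp
    obtain P where P: "P \<in> Q k" "card P = Suc (c k)" using maxP by blast
    have nl: "l \<notin> P" using P that by (auto simp: Q_def)
    have "insert l P \<in> Q l"
    proof -
      have "\<sigma> l < \<sigma> j" if "j \<in> P" for j
      proof (cases "j = k")
        case False
        then have "j < k" using that P by (auto simp: Q_def le_less)
        then have "\<sigma> k < \<sigma> j" using P that by (auto simp: Q_def decreasing_on_def)
        then show ?thesis using lt by simp
      qed (use lt in simp)
      moreover have jl: "j < l" if "j \<in> P" for j using that P \<open>k < l\<close> by (auto simp: Q_def)
      ultimately have "decreasing_on \<sigma> (insert l P)"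
        using P(1) unfolding Q_def decreasing_on_def by (auto dest: jl)
      moreover have "insert l P \<subseteq> {..l}" using jl by (auto intro: less_imp_le)
      ultimately show ?thesis by (simp add: Q_def)
    qed
    from le[OF this] have "card (insert l P) \<le> Suc (c l)" .
    moreover have "finite P" using P finite_subset[of P "{..k}"] by (auto simp: Q_def)
    ultimately show False using nl P(2) that(2) by simp
  qed
  ultimately show ?thesis by blast
qed

text \<open>At the first place k where \<tau> differs from \<sigma>, the value \<tau> k is \<sigma>
  l for some l > k of the same colour, because the values of \<sigma> before k are used up. As
  \<sigma> increases within a colour, \<sigma> k < \<tau> k. So \<sigma> is the smallest of all
  permutations with its colour pattern.\<close>

lemma lexless_same_colours:
  assumes \<sigma>: "\<sigma> permutes {..<d}" and \<tau>: "\<tau> permutes {..<d}" and ne: "\<tau> \<noteq> \<sigma>"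
    and inc: "\<forall>k<d. \<forall>l<d. k < l \<longrightarrow> c k = c l \<longrightarrow> \<sigma> k < \<sigma> l"
    and same: "\<And>k. k < d \<Longrightarrow> c (inv_into UNIV \<sigma> (\<tau> k)) = c k"
  shows "lexless d \<sigma> \<tau>"
proof -
  have "\<exists>k. \<tau> k \<noteq> \<sigma> k" using ne by auto
  define k where "k = (LEAST k. \<tau> k \<noteq> \<sigma> k)"
  have k: "\<tau> k \<noteq> \<sigma> k" unfolding k_def using \<open>\<exists>k. \<tau> k \<noteq> \<sigma> k\<close> by (rule LeastI_ex)
  have lt: "\<tau> j = \<sigma> j" if "j < k" for j using not_less_Least[of j "\<lambda>k. \<tau> k \<noteq> \<sigma> k"] that by (auto simp: k_def)
  have kd: "k < d"
  proof (rule ccontr)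
    assume "\<not> k < d"
    then show False using k permutes_not_in[OF \<sigma>, of k] permutes_not_in[OF \<tau>, of k] by simp
  qed
  define l where "l = inv_into UNIV \<sigma> (\<tau> k)"
  have sl: "\<sigma> l = \<tau> k" unfolding l_def by (rule permutes_inverses(1)[OF \<sigma>])
  have ld: "l < d" using permutes_in_image[OF \<sigma>, of l] permutes_in_image[OF \<tau>, of k] kd sl by simp
  have cl: "c l = c k" unfolding l_def by (rule same[OF kd])
  have "\<not> l < k"
  proof
    assume "l < k"
    then have "\<tau> l = \<tau> k" using lt sl by simp
    then show False using \<open>l < k\<close> injD[OF permutes_inj[OF \<tau>]] by blast
  qed
  moreover have "l \<noteq> k" using k sl by auto
  ultimately have "k < l" by simp
  then have "\<sigma> k < \<tau> k" using inc kd ld cl sl by metis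
  then show ?thesis unfolding lexless_def using kd lt by (intro exI[of _ k]) auto
qed

text \<open>The opposite extreme: on a decreasing subsequence \<sigma> is the largest of all
  rearrangements of its values, since the first changed value can only be replaced by one from a
  later position.\<close>

lemma lexless_rearrangement:
  assumes \<sigma>: "\<sigma> permutes {..<d}" and P: "P \<subseteq> {..<d}" and dec: "decreasing_on \<sigma> P"
    and p: "p permutes \<sigma> ` P" and ne: "p \<noteq> id"
  shows "lexless d (p \<circ> \<sigma>) \<sigma>"
proof -
  have inj: "inj \<sigma>" by (rule permutes_inj[OF \<sigma>])
  obtain x where x: "p x \<noteq> x" using ne by (auto simp: fun_eq_iff)
  then have "x \<in> \<sigma> ` P" using p by (meson permutes_not_in)
  then have ex: "\<exists>k. k \<in> P \<and> p (\<sigma> k) \<noteq> \<sigma> k" using x by auto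
  define k where "k = (LEAST k. k \<in> P \<and> p (\<sigma> k) \<noteq> \<sigma> k)"
  have k: "k \<in> P" "p (\<sigma> k) \<noteq> \<sigma> k" using LeastI_ex[OF ex] by (auto simp: k_def)
  have lt: "p (\<sigma> j) = \<sigma> j" if "j < k" for j
  proof (cases "j \<in> P")
    case True
    then show ?thesis using not_less_Least[of j "\<lambda>k. k \<in> P \<and> p (\<sigma> k) \<noteq> \<sigma> k"] that by (auto simp: k_def)
  next
    case False
    then have "\<sigma> j \<notin> \<sigma> ` P" using inj by (auto simp: inj_def)
    then show ?thesis by (rule permutes_not_in[OF p])
  qed
  have "p (\<sigma> k) \<in> \<sigma> ` P" using permutes_in_image[OF p, of "\<sigma> k"] k(1) by simp
  then obtain l where l: "l \<in> P" "p (\<sigma> k) = \<sigma> l" by auto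
  have "\<not> l < k"
  proof
    assume "l < k"
    then have "p (\<sigma> l) = p (\<sigma> k)" using lt l by simp
    then have "l = k" using injD[OF permutes_inj[OF p]] injD[OF inj] by blast
    then show False using \<open>l < k\<close> by simp
  qed
  moreover have "l \<noteq> k" using k l by auto
  ultimately have "k < l" by simp
  then have "\<sigma> l < \<sigma> k" using dec k l by (auto simp: decreasing_on_def)
  then show ?thesis unfolding lexless_def using k P lt l by (intro exI[of _ k]) auto
qed

lemma straighten:
  fixes T :: "(nat \<Rightarrow> nat) \<Rightarrow> ('v, 'f::field) mpoly" and b :: "(nat \<Rightarrow> nat) \<Rightarrow> 'f"
  assumes two: "(2 :: 'f) \<noteq> 0"
    and anti: "\<And>\<sigma> I. \<sigma> permutes {..<d} \<Longrightarrow> I \<subseteq> {..<d} \<Longrightarrow> card I = Suc n \<Longrightarrow>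
      (\<Sum>p | p permutes I. Const (signof p) * T (p \<circ> \<sigma>)) \<in> ideal_gen G"
    and van: "\<And>i j. (\<forall>k<d. i k < n) \<Longrightarrow>
      (\<Sum>\<tau> | \<tau> permutes {..<d} \<and> (\<forall>k<d. i (\<tau> k) = (j k :: nat)). b \<tau>) = 0"
  shows "(\<Sum>\<tau> | \<tau> permutes {..<d}. Const (b \<tau>) * T \<tau>) \<in> ideal_gen G"
proof -
  let ?P = "{\<tau>. \<tau> permutes {..<d}}"
  let ?S = "\<lambda>i j. {\<tau>. \<tau> permutes {..<d} \<and> (\<forall>k<d. i (\<tau> k) = (j k :: nat))}"
  have finP: "finite ?P" by (rule finite_permutations) simp
  have finS: "finite (?S i j)" for i j by (rule finite_subset[OF _ finP]) auto
  interpret C: comm_ring_hom "Const :: 'f \<Rightarrow> ('v, 'f) mpoly" by (rule comm_ring_hom_Const)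
  have "(\<forall>i j. (\<forall>k<d. i k < n) \<longrightarrow> (\<Sum>\<tau>\<in>?S i j. b \<tau>) = 0) \<Longrightarrow>
    (\<forall>\<tau>\<in>?P. b \<tau> \<noteq> 0 \<longrightarrow> lexrank d \<tau> < r) \<Longrightarrow> (\<Sum>\<tau>\<in>?P. Const (b \<tau>) * T \<tau>) \<in> ideal_gen G" for r and b :: "(nat \<Rightarrow> nat) \<Rightarrow> 'f"
  proof (induction r arbitrary: b)
    case 0
    then have "(\<Sum>\<tau>\<in>?P. Const (b \<tau>) * T \<tau>) = 0" by (intro sum.neutral) auto
    then show ?case by (simp add: ideal_gen_zero)
  next
    case (Suc r)
    define top where "top b = {\<tau>\<in>?P. b \<tau> \<noteq> 0 \<and> lexrank d \<tau> = r}" for b :: "(nat \<Rightarrow> nat) \<Rightarrow> 'f"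
    have fintop: "finite (top b)" for b using finP by (simp add: top_def)
    show ?case using Suc.prems
    proof (induction "card (top b)" arbitrary: b)
      case 0
      then have "top b = {}" using fintop by simp
      then have "\<forall>\<tau>\<in>?P. b \<tau> \<noteq> 0 \<longrightarrow> lexrank d \<tau> < r" using 0(3) by (auto simp: top_def less_Suc_eq)
      with 0(2) show ?case by (rule Suc.IH)
    next
      case (Suc m)
      then obtain \<sigma> where s: "\<sigma> \<in> top b" by (metis card.empty equals0I nat.distinct(1))
      then have \<sigma>: "\<sigma> permutes {..<d}" and bs: "b \<sigma> \<noteq> 0" and rs: "lexrank d \<sigma> = r" by (auto simp: top_def)
      show ?case
      proof (cases "\<exists>P. P \<subseteq> {..<d} \<and> decreasing_on \<sigma> P \<and> card P = Suc n")
        case False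
        then obtain c where c: "\<forall>k<d. c k < n" and inc: "\<forall>k<d. \<forall>l<d. k < l \<longrightarrow> c k = c l \<longrightarrow> \<sigma> k < \<sigma> l"
          using increasing_colouring[OF \<sigma>, of n] by blast
        \<comment> \<open>A value gets the colour of the position at which \<sigma> takes it. Then
          \<sigma> is the smallest permutation in this relation, so all others have rank above
          \<open>r\<close> and coefficient 0, against \<open>b \<sigma> \<noteq> 0\<close>.\<close>
        let ?i = "\<lambda>k. c (inv_into UNIV \<sigma> k)"
        have "inv_into UNIV \<sigma> k < d" if "k < d" for k
          using permutes_in_image[OF permutes_inv[OF \<sigma>], of k] that by simp
        then have "\<forall>k<d. ?i k < n" using c by simp
        then have z: "(\<Sum>\<tau>\<in>?S ?i c. b \<tau>) = 0" by (rule mp[OF spec[OF spec[OF Suc.prems(1)]]])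
        have "\<sigma> \<in> ?S ?i c" using \<sigma> by (simp add: permutes_inverses(2)[OF \<sigma>])
        have others: "b \<tau> = 0" if \<tau>: "\<tau> \<in> ?S ?i c - {\<sigma>}" for \<tau>
        proof (rule ccontr)
          assume nz: "b \<tau> \<noteq> 0"
          have p: "\<tau> permutes {..<d}" using \<tau> by simp
          have "lexless d \<sigma> \<tau>" by (rule lexless_same_colours[OF \<sigma> p _ inc]) (use \<tau> in auto)
          from lexrank_mono[OF this \<sigma>] have "r < lexrank d \<tau>" using rs by simp
          moreover have "lexrank d \<tau> < Suc r" using Suc.prems(2) p nz by simp
          ultimately show False by simp
        qed
        have "(\<Sum>\<tau>\<in>?S ?i c. b \<tau>) = b \<sigma> + (\<Sum>\<tau>\<in>?S ?i c - {\<sigma>}. b \<tau>)"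
          by (rule sum.remove[OF finS \<open>\<sigma> \<in> ?S ?i c\<close>])
        also have "(\<Sum>\<tau>\<in>?S ?i c - {\<sigma>}. b \<tau>) = 0" by (rule sum.neutral) (use others in blast)
        finally show ?thesis using z bs by simp
      next
        case True
        then obtain P where P: "P \<subseteq> {..<d}" "decreasing_on \<sigma> P" "card P = Suc n" by blast
        define I where "I = \<sigma> ` P"
        have inj: "inj \<sigma>" by (rule permutes_inj[OF \<sigma>])
        have Id: "I \<subseteq> {..<d}" using P(1) permutes_image[OF \<sigma>] by (auto simp: I_def)
        have cI: "card I = Suc n" using P(3) inj by (simp add: I_def card_image inj_on_subset)
        have finI: "finite I" using Id by (rule finite_subset) simp
        have pP: "p \<circ> \<sigma> \<in> ?P" if "p permutes I" for p
          using permutes_compose[OF \<sigma> permutes_subset[OF that Id]] by simp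
        \<comment> \<open>The coefficients of the antisymmetrized trace; its leading term is
          \<sigma> with coefficient 1, because \<sigma> is decreasing on \<open>P\<close>.\<close>
        define \<alpha> :: "(nat \<Rightarrow> nat) \<Rightarrow> 'f" where "\<alpha> \<tau> = (\<Sum>p | p permutes I. if p \<circ> \<sigma> = \<tau> then signof p else 0)" for \<tau>
        define b' where "b' \<tau> = b \<tau> - b \<sigma> * \<alpha> \<tau>" for \<tau>
        have finpI: "finite {p. p permutes I}" by (rule finite_permutations[OF finI])
        have id_iff: "p \<circ> \<sigma> = \<sigma> \<longleftrightarrow> p = id" for p
        proof
          assume "p \<circ> \<sigma> = \<sigma>"
          then have "p (\<sigma> (inv_into UNIV \<sigma> x)) = \<sigma> (inv_into UNIV \<sigma> x)" for x by (metis comp_apply)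
          then show "p = id" by (simp add: fun_eq_iff permutes_inverses(1)[OF \<sigma>])
        qed simp
        have "\<alpha> \<sigma> = (\<Sum>p | p permutes I. if p = id then signof p else 0)"
          unfolding \<alpha>_def id_iff ..
        also have "\<dots> = 1" using finpI by (simp add: permutes_id)
        finally have \<alpha>\<sigma>: "\<alpha> \<sigma> = 1" .
        have \<alpha>low: "lexrank d \<tau> < r" if nz: "\<alpha> \<tau> \<noteq> 0" and ne: "\<tau> \<noteq> \<sigma>" for \<tau>
        proof -
          have "\<exists>p. p permutes I \<and> p \<circ> \<sigma> = \<tau>"
          proof (rule ccontr)
            assume "\<nexists>p. p permutes I \<and> p \<circ> \<sigma> = \<tau>"
            then have "\<alpha> \<tau> = 0" unfolding \<alpha>_def by (intro sum.neutral) auto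
            with nz show False by simp
          qed
          then obtain p where p: "p permutes I" "p \<circ> \<sigma> = \<tau>" by (elim exE conjE)
          then have "p \<noteq> id" using ne by auto
          have "lexless d (p \<circ> \<sigma>) \<sigma>" using lexless_rearrangement[OF \<sigma> P(1,2) p(1)[unfolded I_def] \<open>p \<noteq> id\<close>] .
          then show ?thesis using lexrank_mono[of d \<tau> \<sigma>] p pP[OF p(1)] rs by simp
        qed
        have "b' \<sigma> = 0" by (simp add: b'_def \<alpha>\<sigma>)
        have same: "b' \<tau> = b \<tau>" if "lexrank d \<tau> = r" "\<tau> \<noteq> \<sigma>" for \<tau>
          using \<alpha>low[of \<tau>] that by (auto simp: b'_def)
        have "\<tau> \<in> top b' \<longleftrightarrow> \<tau> \<in> top b - {\<sigma>}" for \<tau>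
          using same[of \<tau>] \<open>b' \<sigma> = 0\<close> by (cases "\<tau> = \<sigma>"; cases "lexrank d \<tau> = r") (simp_all add: top_def)
        then have "top b' = top b - {\<sigma>}" by blast
        then have cm: "m = card (top b')" using Suc.hyps(2) s fintop by simp
        have "\<forall>\<tau>\<in>?P. b' \<tau> \<noteq> 0 \<longrightarrow> lexrank d \<tau> < Suc r"
        proof (intro ballI impI)
          fix \<tau> assume \<tau>: "\<tau> \<in> ?P" "b' \<tau> \<noteq> 0"
          show "lexrank d \<tau> < Suc r"
          proof (cases "b \<tau> = 0")
            case True
            then have "\<alpha> \<tau> \<noteq> 0" "\<tau> \<noteq> \<sigma>" using \<tau> bs by (auto simp: b'_def)
            then show ?thesis using \<alpha>low[of \<tau>] by simp
          next
            case False
            then show ?thesis using Suc.prems(2) \<tau> by simp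
          qed
        qed
        moreover have "\<forall>i j. (\<forall>k<d. i k < n) \<longrightarrow> (\<Sum>\<tau>\<in>?S i j. b' \<tau>) = 0"
        proof (intro allI impI)
          fix i j :: "nat \<Rightarrow> nat" assume i: "\<forall>k<d. i k < n"
          \<comment> \<open>The new coefficients must satisfy \<open>van\<close> again. Two of the n
            + 1 values in \<open>I\<close> share one of the n colours, and exchanging them cancels
            the antisymmetrized part of the sum.\<close>
          have "\<not> inj_on i I"
          proof
            assume "inj_on i I"
            moreover have "i ` I \<subseteq> {..<n}" using i Id by auto
            ultimately have "card I \<le> card {..<n}" by (intro card_inj_on_le[of i]) auto
            then show False using cI by simp
          qed
          then obtain a a' where a: "a \<in> I" "a' \<in> I" "a \<noteq> a'" "i a = i a'" by (auto simp: inj_on_def)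
          have it: "i (transpose a a' x) = i x" for x using a(4) by (simp add: transpose_def)
          have "(\<Sum>\<tau>\<in>?S i j. \<alpha> \<tau>) = (\<Sum>p | p permutes I. \<Sum>\<tau>\<in>?S i j. if p \<circ> \<sigma> = \<tau> then signof p else 0)"
            unfolding \<alpha>_def by (rule sum.swap)
          also have "\<dots> = (\<Sum>p | p permutes I. signof p * (if p \<circ> \<sigma> \<in> ?S i j then 1 else 0))"
            by (intro sum.cong refl, subst sum.delta'[OF finS]) auto
          also have "\<dots> = (\<Sum>p | p permutes I. signof p * (if \<forall>k<d. i (p (\<sigma> k)) = j k then 1 else 0))"
            using pP by (intro sum.cong refl arg_cong2[where f = "(*)"]) auto
          also have "\<dots> = 0"
            by (rule sum_signed_cancel[OF two finI a(1-3)]) (simp add: it)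
          finally show "(\<Sum>\<tau>\<in>?S i j. b' \<tau>) = 0"
            using Suc.prems(1) i by (simp add: b'_def sum_subtractf flip: sum_distrib_left)
        qed
        ultimately have IH: "(\<Sum>\<tau>\<in>?P. Const (b' \<tau>) * T \<tau>) \<in> ideal_gen G" by (intro Suc.hyps(1)[OF cm])
        have "(\<Sum>\<tau>\<in>?P. Const (\<alpha> \<tau>) * T \<tau>) = (\<Sum>\<tau>\<in>?P. \<Sum>p | p permutes I. if p \<circ> \<sigma> = \<tau> then Const (signof p) * T \<tau> else 0)"
          unfolding \<alpha>_def C.hom_sum sum_distrib_right by (intro sum.cong refl) auto
        also have "\<dots> = (\<Sum>p | p permutes I. \<Sum>\<tau>\<in>?P. if p \<circ> \<sigma> = \<tau> then Const (signof p) * T \<tau> else 0)"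
          by (rule sum.swap)
        also have "\<dots> = (\<Sum>p | p permutes I. Const (signof p) * T (p \<circ> \<sigma>))"
          using pP by (intro sum.cong refl, subst sum.delta'[OF finP]) simp
        also have "\<dots> \<in> ideal_gen G" by (rule anti[OF \<sigma> Id cI])
        finally have "(\<Sum>\<tau>\<in>?P. Const (\<alpha> \<tau>) * T \<tau>) \<in> ideal_gen G" .
        from ideal_gen_add[OF IH ideal_gen_mult[OF this, of "Const (b \<sigma>)"]]
        have "(\<Sum>\<tau>\<in>?P. Const (b' \<tau>) * T \<tau>) + Const (b \<sigma>) * (\<Sum>\<tau>\<in>?P. Const (\<alpha> \<tau>) * T \<tau>) \<in> ideal_gen G" .
        also have "(\<Sum>\<tau>\<in>?P. Const (b' \<tau>) * T \<tau>) + Const (b \<sigma>) * (\<Sum>\<tau>\<in>?P. Const (\<alpha> \<tau>) * T \<tau>) = (\<Sum>\<tau>\<in>?P. Const (b \<tau>) * T \<tau>)"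
          by (simp add: b'_def C.hom_minus C.hom_mult sum_distrib_left flip: sum.distrib) (simp add: algebra_simps)
        finally show ?thesis .
      qed
    qed
  qed
  moreover have "\<forall>\<tau>\<in>?P. b \<tau> \<noteq> 0 \<longrightarrow> lexrank d \<tau> < Suc (Max (insert 0 (lexrank d ` ?P)))"
  proof (intro ballI impI)
    fix \<tau> assume "\<tau> \<in> ?P"
    then have "lexrank d \<tau> \<le> Max (insert 0 (lexrank d ` ?P))" using finP by (intro Max_ge) auto
    then show "lexrank d \<tau> < Suc (Max (insert 0 (lexrank d ` ?P)))" by simp
  qed
  ultimately show ?thesis using van by simp
qed

subsection \<open>Invariants as sums of traces\<close>

lemma Tr_empty [simp]: "Tr m {} \<tau> M = 1"
  by (simp add: Tr_def)

lemma Tr_singleton: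
  assumes "\<And>k. M k \<in> carrier_mat m m"
  shows "Tr m {a} id M = (\<Sum>y<m. M a $$ (y, y))"
  using Tr_fixed[of a "{}" M m id] assms by (simp add: permutes_id)

lemma Tr_union:
  assumes disj: "D \<inter> D' = {}" and fin: "finite D" "finite D'"
    and \<tau>: "\<tau> permutes D" and \<tau>': "\<tau>' permutes D'"
  shows "Tr m (D \<union> D') (\<tau> \<circ> \<tau>') M = Tr m D \<tau> M * Tr m D' \<tau>' M"
proof -
  have a: "(\<tau> \<circ> \<tau>') k = \<tau> k" "\<tau> k \<in> D" if "k \<in> D" for k
  proof -
    have "k \<notin> D'" using that disj by blast
    then show "(\<tau> \<circ> \<tau>') k = \<tau> k" by (simp add: permutes_not_in[OF \<tau>'])
    show "\<tau> k \<in> D" using that by (simp only: permutes_in_image[OF \<tau>])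
  qed
  have a': "(\<tau> \<circ> \<tau>') k = \<tau>' k" "\<tau>' k \<in> D'" if "k \<in> D'" for k
  proof -
    show "\<tau>' k \<in> D'" using that by (simp only: permutes_in_image[OF \<tau>'])
    then have "\<tau>' k \<notin> D" using disj by blast
    then show "(\<tau> \<circ> \<tau>') k = \<tau>' k" by (simp add: permutes_not_in[OF \<tau>])
  qed
  have "Tr m D \<tau> M * Tr m D' \<tau>' M = (\<Sum>(g, g')\<in>(D \<rightarrow>\<^sub>E {..<m}) \<times> (D' \<rightarrow>\<^sub>E {..<m}).
      (\<Prod>k\<in>D. M k $$ (g k, g (\<tau> k))) * (\<Prod>k\<in>D'. M k $$ (g' k, g' (\<tau>' k))))"
    unfolding Tr_def sum_product sum.cartesian_product ..
  also have "\<dots> = Tr m (D \<union> D') (\<tau> \<circ> \<tau>') M"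
    unfolding Tr_def
  proof (rule sum.reindex_bij_witness[where j = "\<lambda>(g, g') x. if x \<in> D then g x else g' x" and i = "\<lambda>f. (restrict f D, restrict f D')"])
    fix f assume f: "f \<in> D \<union> D' \<rightarrow>\<^sub>E {..<m}"
    have "(if x \<in> D then restrict f D x else restrict f D' x) = f x" for x
      using PiE_arb[OF f, of x] by auto
    then show "(case (restrict f D, restrict f D') of (g, g') \<Rightarrow> \<lambda>x. if x \<in> D then g x else g' x) = f" by (simp add: fun_eq_iff)
    show "(restrict f D, restrict f D') \<in> (D \<rightarrow>\<^sub>E {..<m}) \<times> (D' \<rightarrow>\<^sub>E {..<m})" using f by auto
  next
    fix z assume "z \<in> (D \<rightarrow>\<^sub>E {..<m}) \<times> (D' \<rightarrow>\<^sub>E {..<m})"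
    then obtain g g' where z: "z = (g, g')" and g: "g \<in> D \<rightarrow>\<^sub>E {..<m}" and g': "g' \<in> D' \<rightarrow>\<^sub>E {..<m}" by auto
    let ?f = "\<lambda>x. if x \<in> D then g x else g' x"
    have "restrict ?f D = g"
    proof
      fix x show "restrict ?f D x = g x" using PiE_arb[OF g, of x] by auto
    qed
    moreover have "restrict ?f D' = g'"
    proof
      fix x show "restrict ?f D' x = g' x" using PiE_arb[OF g', of x] disj by auto
    qed
    ultimately show "(restrict (case z of (g, g') \<Rightarrow> \<lambda>x. if x \<in> D then g x else g' x) D, restrict (case z of (g, g') \<Rightarrow> \<lambda>x. if x \<in> D then g x else g' x) D') = z"
      using z by simp
    have "?f x = undefined" if "x \<notin> D \<union> D'" for x using PiE_arb[OF g', of x] that by auto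
    moreover have "?f x \<in> {..<m}" if "x \<in> D \<union> D'" for x using that PiE_mem[OF g, of x] PiE_mem[OF g', of x] by auto
    ultimately show "(case z of (g, g') \<Rightarrow> \<lambda>x. if x \<in> D then g x else g' x) \<in> D \<union> D' \<rightarrow>\<^sub>E {..<m}"
      using z by (simp add: PiE_iff extensional_def)
    have "(\<Prod>k\<in>D \<union> D'. M k $$ (?f k, ?f ((\<tau> \<circ> \<tau>') k))) =
      (\<Prod>k\<in>D. M k $$ (?f k, ?f ((\<tau> \<circ> \<tau>') k))) * (\<Prod>k\<in>D'. M k $$ (?f k, ?f ((\<tau> \<circ> \<tau>') k)))"
      by (rule prod.union_disjoint[OF fin disj])
    also have "(\<Prod>k\<in>D. M k $$ (?f k, ?f ((\<tau> \<circ> \<tau>') k))) = (\<Prod>k\<in>D. M k $$ (g k, g (\<tau> k)))"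
      by (intro prod.cong refl) (simp only: a if_True)
    also have "(\<Prod>k\<in>D'. M k $$ (?f k, ?f ((\<tau> \<circ> \<tau>') k))) = (\<Prod>k\<in>D'. M k $$ (g' k, g' (\<tau>' k)))"
    proof (intro prod.cong refl)
      fix k assume k: "k \<in> D'"
      then have "k \<notin> D" "\<tau>' k \<notin> D" using disj a'(2)[OF k] by auto
      then show "M k $$ (?f k, ?f ((\<tau> \<circ> \<tau>') k)) = M k $$ (g' k, g' (\<tau>' k))" unfolding a'(1)[OF k] by simp
    qed
    finally show "(\<Prod>k\<in>D \<union> D'. M k $$ ((case z of (g, g') \<Rightarrow> \<lambda>x. if x \<in> D then g x else g' x) k,
        (case z of (g, g') \<Rightarrow> \<lambda>x. if x \<in> D then g x else g' x) ((\<tau> \<circ> \<tau>') k))) =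
      (case z of (g, g') \<Rightarrow> (\<Prod>k\<in>D. M k $$ (g k, g (\<tau> k))) * (\<Prod>k\<in>D'. M k $$ (g' k, g' (\<tau>' k))))"
      by (simp only: z prod.case)
  qed
  finally show ?thesis by simp
qed

text \<open>Positions are removed one at a time: a fixed point contributes a trace as a factor, any
  other position merges its word into that of its predecessor. \<open>Q\<close> is left open because
  the same argument serves both \<open>represented\<close> and \<open>spanned\<close>.\<close>

lemma Tr_words_induct:
  fixes Q :: "(nat \<Rightarrow> (nat \<Rightarrow> 'r::comm_ring_1 mat) \<Rightarrow> 'r) \<Rightarrow> bool"
  assumes cong: "\<And>F G. Q F \<Longrightarrow> (\<And>m A. mat_family m A \<Longrightarrow> G m A = F m A) \<Longrightarrow> Q G"
    and one: "Q (\<lambda>m A. 1)" and mult: "\<And>F G. Q F \<Longrightarrow> Q G \<Longrightarrow> Q (\<lambda>m A. F m A * G m A)"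
    and tr: "\<And>w. w \<noteq> 0 \<Longrightarrow> Q (\<lambda>m A. \<Sum>y<m. wmat m A w $$ (y, y))"
    and fin: "finite D" and perm: "\<tau> permutes D" and v: "\<And>k. v k \<noteq> 0"
  shows "Q (\<lambda>m A. Tr m D \<tau> (\<lambda>k. wmat m A (v k)))"
  using fin perm v
proof (induction D arbitrary: \<tau> v rule: finite_induct)
  case empty
  then show ?case using one by simp
next
  case (insert k D)
  show ?case
  proof (cases "\<tau> k = k")
    case True
    then have \<tau>: "\<tau> permutes D" using insert.prems(1) by (intro permutes_superset[OF insert.prems(1)]) auto
    have "Q (\<lambda>m A. (\<Sum>y<m. wmat m A (v k) $$ (y, y)) * Tr m D \<tau> (\<lambda>k. wmat m A (v k)))"
      by (intro mult tr insert.IH \<tau> insert.prems(2))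
    then show ?thesis
    proof (rule cong)
      fix m and A :: "nat \<Rightarrow> 'r mat" assume "mat_family m A"
      then interpret mat_family m A .
      show "Tr m (insert k D) \<tau> (\<lambda>k. wmat m A (v k)) = (\<Sum>y<m. wmat m A (v k) $$ (y, y)) * Tr m D \<tau> (\<lambda>k. wmat m A (v k))"
        by (rule Tr_fixed[OF insert.hyps(2,1) wmat_carrier \<tau>])
    qed
  next
    case False
    define l where "l = inv_into UNIV \<tau> k"
    have l: "\<tau> l = k" unfolding l_def by (rule permutes_inverses(1)[OF insert.prems(1)])
    define v' where "v' = v(l := v l + v k)"
    have "v' j \<noteq> 0" for j using insert.prems(2) by (simp add: v'_def)
    then have "Q (\<lambda>m A. Tr m D (transpose k (\<tau> k) \<circ> \<tau>) (\<lambda>k. wmat m A (v' k)))"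
      by (intro insert.IH contract_permutes insert.prems(1) insert.hyps(2))
    then show ?thesis
    proof (rule cong)
      fix m and A :: "nat \<Rightarrow> 'r mat" assume "mat_family m A"
      then interpret mat_family m A .
      have "(\<lambda>k. wmat m A (v k))(l := wmat m A (v l) * wmat m A (v k)) = (\<lambda>k. wmat m A (v' k))"
        by (auto simp: v'_def wmat_plus)
      then show "Tr m (insert k D) \<tau> (\<lambda>k. wmat m A (v k)) = Tr m D (transpose k (\<tau> k) \<circ> \<tau>) (\<lambda>k. wmat m A (v' k))"
        using Tr_contract[OF insert.hyps(2,1) wmat_carrier insert.prems(1) False l, of v] by simp
    qed
  qed
qed

text \<open>A term consists of a coefficient, a permutation and a list with a single letter for each
  position, so that longer words are encoded in the cycles. This form, multilinear in the positions,
  is the one on which straightening acts.\<close>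

definition trsum :: "nat \<Rightarrow> (nat \<Rightarrow> 'f::field alg_closure mat) \<Rightarrow> ('f \<times> (nat \<Rightarrow> nat) \<times> nat list) list \<Rightarrow> 'f alg_closure" where
  "trsum m A L = (\<Sum>(q, \<tau>, w)\<leftarrow>L. to_ac q * Tr m {..<length w} \<tau> (\<lambda>k. A (w ! k)))"

definition trace_terms :: "('f \<times> (nat \<Rightarrow> nat) \<times> nat list) list \<Rightarrow> bool" where
  "trace_terms L \<longleftrightarrow> (\<forall>(q, \<tau>, w)\<in>set L. \<tau> permutes {..<length w})"

definition spanned :: "(nat \<Rightarrow> (nat \<Rightarrow> 'f::field alg_closure mat) \<Rightarrow> 'f alg_closure) \<Rightarrow> bool" where
  "spanned F \<longleftrightarrow> (\<exists>L. trace_terms L \<and> (\<forall>m A. mat_family m A \<longrightarrow> F m A = trsum m A L))"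

lemma spannedI: "trace_terms L \<Longrightarrow> (\<And>m A. mat_family m A \<Longrightarrow> F m A = trsum m A L) \<Longrightarrow> spanned F"
  by (auto simp: spanned_def)

lemma spanned_cong: "spanned F \<Longrightarrow> (\<And>m A. mat_family m A \<Longrightarrow> G m A = F m A) \<Longrightarrow> spanned G"
  by (auto simp: spanned_def)

lemma spanned_const: "spanned (\<lambda>m A. to_ac a)"
  by (rule spannedI[where L = "[(a, id, [])]"]) (auto simp: trace_terms_def trsum_def permutes_id)

lemma spanned_0: "spanned (\<lambda>m A. 0)" and spanned_1: "spanned (\<lambda>m A. 1)"
  using spanned_const[of 0] spanned_const[of 1] by simp_all

lemma spanned_add:
  assumes "spanned F" "spanned G"
  shows "spanned (\<lambda>m A. F m A + G m A)"
proof -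
  obtain L L' where L: "trace_terms L" "\<And>m A. mat_family m A \<Longrightarrow> F m A = trsum m A L"
    and L': "trace_terms L'" "\<And>m A. mat_family m A \<Longrightarrow> G m A = trsum m A L'"
    using assms by (auto simp: spanned_def)
  show ?thesis by (rule spannedI[where L = "L @ L'"]) (use L L' in \<open>auto simp: trace_terms_def trsum_def\<close>)
qed

lemma spanned_sum: "(\<And>x. x \<in> S \<Longrightarrow> spanned (F x)) \<Longrightarrow> spanned (\<lambda>m A. \<Sum>x\<in>S. F x m A)"
  by (induction S rule: infinite_finite_induct) (auto intro: spanned_add spanned_0)

text \<open>The lists are concatenated, and the second permutation acts on the shifted
  positions.\<close>

lemma spanned_term_mult:
  assumes \<tau>: "\<tau> permutes {..<length w}" and \<tau>': "\<tau>' permutes {..<length w'}"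
  shows "spanned (\<lambda>m A. (to_ac q * Tr m {..<length w} \<tau> (\<lambda>k. A (w ! k))) * (to_ac q' * Tr m {..<length w'} \<tau>' (\<lambda>k. A (w' ! k))))"
proof -
  let ?d = "length w" and ?d' = "length w'"
  let ?f = "\<lambda>k. k + ?d"
  have bij: "bij_betw ?f {..<?d'} {?d..<?d + ?d'}"
    by (rule bij_betwI[where g = "\<lambda>k. k - ?d"]) auto
  define \<rho> where "\<rho> = map_permutation {..<?d'} ?f \<tau>'"
  have \<rho>: "\<rho> permutes {?d..<?d + ?d'}" unfolding \<rho>_def by (rule map_permutation_permutes[OF bij \<tau>'])
  have un: "{..<?d} \<union> {?d..<?d + ?d'} = {..<length (w @ w')}" by auto
  have perm: "\<tau> \<circ> \<rho> permutes {..<length (w @ w')}"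
    by (rule permutes_compose[OF permutes_subset[OF \<rho>] permutes_subset[OF \<tau>]]) auto
  show ?thesis
  proof (rule spannedI[where L = "[(q * q', \<tau> \<circ> \<rho>, w @ w')]"])
    show "trace_terms [(q * q', \<tau> \<circ> \<rho>, w @ w')]" using perm by (simp add: trace_terms_def)
    fix m and A :: "nat \<Rightarrow> 'a alg_closure mat" assume "mat_family m A"
    have "Tr m {..<length (w @ w')} (\<tau> \<circ> \<rho>) (\<lambda>k. A ((w @ w') ! k)) =
      Tr m {..<?d} \<tau> (\<lambda>k. A ((w @ w') ! k)) * Tr m {?d..<?d + ?d'} \<rho> (\<lambda>k. A ((w @ w') ! k))"
      unfolding un[symmetric] by (rule Tr_union[OF _ _ _ \<tau> \<rho>]) auto
    also have "Tr m {..<?d} \<tau> (\<lambda>k. A ((w @ w') ! k)) = Tr m {..<?d} \<tau> (\<lambda>k. A (w ! k))"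
      by (rule Tr_cong) (auto simp: nth_append)
    also have "Tr m {?d..<?d + ?d'} \<rho> (\<lambda>k. A ((w @ w') ! k)) = Tr m {..<?d'} \<tau>' (\<lambda>k. A ((w @ w') ! (k + ?d)))"
      unfolding \<rho>_def by (rule Tr_reindex[OF bij \<tau>'])
    also have "\<dots> = Tr m {..<?d'} \<tau>' (\<lambda>k. A (w' ! k))" by (rule Tr_cong) (auto simp: nth_append)
    finally show "(to_ac q * Tr m {..<?d} \<tau> (\<lambda>k. A (w ! k))) * (to_ac q' * Tr m {..<?d'} \<tau>' (\<lambda>k. A (w' ! k))) =
      trsum m A [(q * q', \<tau> \<circ> \<rho>, w @ w')]"
      by (simp only: trsum_def list.map prod.case sum_list.Cons sum_list.Nil add_0_right to_ac_mult mult_ac)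
  qed
qed

lemma spanned_mult:
  assumes "spanned F" "spanned G"
  shows "spanned (\<lambda>m A. F m A * G m A)"
proof -
  obtain L L' where L: "trace_terms L" "\<And>m A. mat_family m A \<Longrightarrow> F m A = trsum m A L"
    and L': "trace_terms L'" "\<And>m A. mat_family m A \<Longrightarrow> G m A = trsum m A L'"
    using assms by (auto simp: spanned_def)
  have "spanned (\<lambda>m A. (to_ac q * Tr m {..<length w} \<tau> (\<lambda>k. A (w ! k))) * trsum m A L')"
    if "\<tau> permutes {..<length w}" for q \<tau> w
    using L'(1)
  proof (induction L')
    case (Cons x L')
    obtain q' \<tau>' w' where x: "x = (q', \<tau>', w')" by (cases x)
    have "spanned (\<lambda>m A. (to_ac q * Tr m {..<length w} \<tau> (\<lambda>k. A (w ! k))) * (to_ac q' * Tr m {..<length w'} \<tau>' (\<lambda>k. A (w' ! k)))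
       + (to_ac q * Tr m {..<length w} \<tau> (\<lambda>k. A (w ! k))) * trsum m A L')"
      using Cons x by (intro spanned_add spanned_term_mult that) (auto simp: trace_terms_def)
    then show ?case by (rule spanned_cong) (simp add: x trsum_def distrib_left)
  qed (rule spanned_cong[OF spanned_0], simp add: trsum_def)
  note step = this
  have "spanned (\<lambda>m A. trsum m A L * trsum m A L')"
    using L(1)
  proof (induction L)
    case (Cons x L)
    obtain q \<tau> w where x: "x = (q, \<tau>, w)" by (cases x)
    have "spanned (\<lambda>m A. (to_ac q * Tr m {..<length w} \<tau> (\<lambda>k. A (w ! k))) * trsum m A L' + trsum m A L * trsum m A L')"
      using Cons x by (intro spanned_add step) (auto simp: trace_terms_def)
    then show ?case by (rule spanned_cong) (simp add: x trsum_def distrib_right)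
  qed (rule spanned_cong[OF spanned_0], simp add: trsum_def)
  then show ?thesis by (rule spanned_cong) (simp add: L L')
qed

text \<open>The converse of contraction: the word at the last position is spread over new positions,
  its first letter staying behind and the rest moving on to the next place of the same
  cycle.\<close>

lemma spanned_Tr_word:
  assumes "w \<noteq> 0" "\<tau> permutes {..<Suc d}" "length c = d"
  shows "spanned (\<lambda>m A. Tr m {..<Suc d} \<tau> (\<lambda>k. if k = d then wmat m A w else A (c ! k)))"
  using assms
proof (induction w arbitrary: \<tau> d c rule: word_induct)
  case (Cons x ks)
  show ?case
  proof (cases "ks = []")
    case True
    show ?thesis
    proof (rule spannedI[where L = "[(1, \<tau>, c @ [x])]"])
      show "trace_terms [(1, \<tau>, c @ [x])]" using Cons.prems by (simp add: trace_terms_def)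
      fix m and A :: "nat \<Rightarrow> 'a alg_closure mat" assume "mat_family m A"
      then interpret mat_family m A .
      show "Tr m {..<Suc d} \<tau> (\<lambda>k. if k = d then wmat m A (Word (x # ks)) else A (c ! k)) = trsum m A [(1, \<tau>, c @ [x])]"
      proof -
        have "wmat m A (Word [x]) = A x" by (rule wmat_letter)
        then have "Tr m {..<Suc d} \<tau> (\<lambda>k. if k = d then wmat m A (Word (x # ks)) else A (c ! k)) = Tr m {..<Suc d} \<tau> (\<lambda>k. A ((c @ [x]) ! k))"
          using Cons.prems True by (intro Tr_cong) (auto simp: nth_append less_Suc_eq)
        then show ?thesis using Cons.prems by (simp add: trsum_def)
      qed
    qed
  next
    case False
    \<comment> \<open>Inserts the position d + 1 between \<open>d\<close> and its successor
      \<open>\<tau> d\<close>.\<close>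
    define \<tau>2 where "\<tau>2 = transpose (Suc d) (\<tau> d) \<circ> \<tau>"
    have d: "\<tau> d < Suc d" using permutes_in_image[OF Cons.prems(2), of d] by simp
    have fixK: "\<tau> (Suc d) = Suc d" by (rule permutes_not_in[OF Cons.prems(2)]) simp
    have ins: "insert (Suc d) {..<Suc d} = {..<Suc (Suc d)}" by auto
    have "transpose (Suc d) (\<tau> d) permutes {..<Suc (Suc d)}" using d by (intro permutes_swap_id) auto
    then have p2: "\<tau>2 permutes {..<Suc (Suc d)}" unfolding \<tau>2_def
      by (intro permutes_compose[OF permutes_subset[OF Cons.prems(2)]]) auto
    have K: "\<tau>2 (Suc d) = \<tau> d" "\<tau>2 d = Suc d" by (simp_all add: \<tau>2_def fixK)
    have contr: "transpose (Suc d) (\<tau>2 (Suc d)) \<circ> \<tau>2 = \<tau>" unfolding K(1) by (simp add: \<tau>2_def fun_eq_iff)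
    have ne: "Word ks \<noteq> 0" using False by (simp add: zero_word_def)
    have "spanned (\<lambda>m (A :: nat \<Rightarrow> 'a alg_closure mat). Tr m {..<Suc (Suc d)} \<tau>2 (\<lambda>k. if k = Suc d then wmat m A (Word ks) else A ((c @ [x]) ! k)))"
      by (rule Cons.IH[OF ne p2]) (simp add: Cons.prems)
    then show ?thesis
    proof (rule spanned_cong)
      fix m and A :: "nat \<Rightarrow> 'a alg_closure mat" assume "mat_family m A"
      then interpret mat_family m A .
      let ?M = "\<lambda>k. if k = Suc d then wmat m A (Word ks) else A ((c @ [x]) ! k)"
      have "Tr m (insert (Suc d) {..<Suc d}) \<tau>2 ?M = Tr m {..<Suc d} (transpose (Suc d) (\<tau>2 (Suc d)) \<circ> \<tau>2) (?M(d := ?M d * ?M (Suc d)))"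
        by (rule Tr_contract) (use p2 K d in \<open>auto simp: ins\<close>)
      then have "Tr m {..<Suc (Suc d)} \<tau>2 ?M = Tr m {..<Suc d} \<tau> (?M(d := ?M d * ?M (Suc d)))"
        unfolding contr ins .
      also have "\<dots> = Tr m {..<Suc d} \<tau> (\<lambda>k. if k = d then wmat m A (Word (x # ks)) else A (c ! k))"
        by (rule Tr_cong) (use Cons.prems in \<open>auto simp: wmat_Cons nth_append\<close>)
      finally show "Tr m {..<Suc d} \<tau> (\<lambda>k. if k = d then wmat m A (Word (x # ks)) else A (c ! k)) = Tr m {..<Suc (Suc d)} \<tau>2 ?M" by simp
    qed
  qed
qed simp

lemma spanned_tr: "w \<noteq> 0 \<Longrightarrow> spanned (\<lambda>m A. \<Sum>y<m. wmat m A w $$ (y, y))"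
proof -
  assume w: "w \<noteq> 0"
  have "spanned (\<lambda>m (A :: nat \<Rightarrow> 'a alg_closure mat). Tr m {..<Suc 0} id (\<lambda>k. if k = 0 then wmat m A w else A ([] ! k)))"
    by (rule spanned_Tr_word[OF w]) (auto simp: permutes_id)
  then show ?thesis
  proof (rule spanned_cong)
    fix m and A :: "nat \<Rightarrow> 'a alg_closure mat" assume "mat_family m A"
    then interpret mat_family m A .
    have "{..<Suc 0} = {0}" by auto
    then show "(\<Sum>y<m. wmat m A w $$ (y, y)) = Tr m {..<Suc 0} id (\<lambda>k. if k = 0 then wmat m A w else A ([] ! k))"
      by (simp only:) (subst Tr_singleton, auto)
  qed
qed

section \<open>Passage between \<sigma>_t and traces in characteristic 0\<close>

lemma of_nat_ac_eq_0_iff: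
  assumes "CHAR('f::field) = 0"
  shows "(of_nat k :: 'f alg_closure) = 0 \<longleftrightarrow> k = 0" and "(of_nat k :: 'f) = 0 \<longleftrightarrow> k = 0"
proof -
  show a: "(of_nat k :: 'f) = 0 \<longleftrightarrow> k = 0" using assms by (simp add: of_nat_eq_0_iff_char_dvd)
  have "(of_nat k :: 'f alg_closure) = 0 \<longleftrightarrow> to_ac (of_nat k :: 'f) = to_ac 0" by (simp only: to_ac_of_nat to_ac_0)
  then show "(of_nat k :: 'f alg_closure) = 0 \<longleftrightarrow> k = 0" unfolding to_ac_eq_iff a .
qed

lemma two_ac_neq_0: "CHAR('f::field) = 0 \<Longrightarrow> (2 :: 'f alg_closure) \<noteq> 0" "CHAR('f::field) = 0 \<Longrightarrow> (2 :: 'f) \<noteq> 0"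
  using of_nat_ac_eq_0_iff[where 'f = 'f, of 2] by simp_all

lemma to_ac_signof: "to_ac (signof p) = signof p"
  by (simp add: sign_def)

text \<open>Dividing \<open>fact_sg\<close> by t!, which is possible in characteristic 0, expresses
  \<sigma>_t through traces along permutations.\<close>

lemma spanned_sg:
  assumes char: "CHAR('f::field) = 0" and w: "w \<noteq> 0"
  shows "spanned (\<lambda>m (A :: nat \<Rightarrow> 'f alg_closure mat). sg t (wmat m A w))"
proof -
  have "spanned (\<lambda>m (A :: nat \<Rightarrow> 'f alg_closure mat). to_ac (1 / of_nat (fact t)) *
    (\<Sum>p | p permutes {..<t}. to_ac (signof p) * Tr m {..<t} p (\<lambda>k. wmat m A w)))"
  proof (intro spanned_mult spanned_const spanned_sum)
    fix p assume p: "p \<in> {p. p permutes {..<t}}"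
    show "spanned (\<lambda>m (A :: nat \<Rightarrow> 'f alg_closure mat). Tr m {..<t} p (\<lambda>k. wmat m A w))"
      by (rule Tr_words_induct[where Q = spanned, OF spanned_cong spanned_1 spanned_mult spanned_tr])
         (use p w in auto)
  qed
  then show ?thesis
  proof (rule spanned_cong)
    fix m and A :: "nat \<Rightarrow> 'f alg_closure mat" assume "mat_family m A"
    then interpret mat_family m A .
    have "of_nat (fact (card {..<t})) * sg (card {..<t}) (wmat m A w) = Pol m {..<t} (\<lambda>_. wmat m A w)"
      by (rule fact_sg[OF two_ac_neq_0(1)[OF char]]) auto
    moreover have "(of_nat (fact t) :: 'f alg_closure) \<noteq> 0" unfolding of_nat_ac_eq_0_iff(1)[OF char] by simp
    ultimately have "sg t (wmat m A w) = 1 / of_nat (fact t) * Pol m {..<t} (\<lambda>_. wmat m A w)"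
      by (simp add: field_simps)
    then show "sg t (wmat m A w) = to_ac (1 / of_nat (fact t)) *
        (\<Sum>p | p permutes {..<t}. to_ac (signof p) * Tr m {..<t} p (\<lambda>k. wmat m A w))"
      by (simp only: Pol_def to_ac_signof to_ac_divide to_ac_1 to_ac_of_nat)
  qed
qed

lemma spanned_ev:
  fixes f :: "'f::field sXt"
  assumes char: "CHAR('f) = 0"
  shows "spanned (\<lambda>m A. ev m A f)"
proof (induction f rule: mpoly_induct)
  case (Const a)
  show ?case by (rule spanned_cong[OF spanned_const[of a]]) simp
next
  case (Var g)
  obtain t e where g: "t > 0" "e \<in> Xtilde" "g = Abs_tgen (t, e)" by (rule tgen_cases)
  have "e \<noteq> 0" using g(2) by (simp add: Xtilde_def)
  show ?case
    by (rule spanned_cong[OF spanned_sg[OF char \<open>e \<noteq> 0\<close>, of t]])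
       (use ev_sigma_t[OF g(1,2)] in \<open>simp add: g(3) sigma_t_def\<close>)
next
  case (add f g)
  then show ?case by (rule spanned_cong[OF spanned_add]) (simp add: ev.hom_add)
next
  case (mult f g)
  then show ?case by (rule spanned_cong[OF spanned_mult]) (simp add: ev.hom_mult)
qed

text \<open>The trace is \<sigma>_1, by \<open>fact_sg\<close> with one position.\<close>

lemma represented_tr:
  assumes inf: "infinite (UNIV :: 'f::field set)" and char: "CHAR('f) = 0" and w: "w \<noteq> 0"
  shows "represented (\<lambda>m (A :: nat \<Rightarrow> 'f alg_closure mat). \<Sum>y<m. wmat m A w $$ (y, y))"
proof (rule represented_cong[OF represented_sg_word[OF inf w, of 1]])
  fix m and A :: "nat \<Rightarrow> 'f alg_closure mat" assume "mat_family m A"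
  then interpret mat_family m A .
  have "of_nat (fact (card {0::nat})) * sg (card {0::nat}) (wmat m A w) = Pol m {0} (\<lambda>_. wmat m A w)"
    by (rule fact_sg[OF two_ac_neq_0(1)[OF char]]) auto
  moreover have "Tr m {0} id (\<lambda>_. wmat m A w) = (\<Sum>y<m. wmat m A w $$ (y, y))"
    by (rule Tr_singleton) simp
  ultimately show "(\<Sum>y<m. wmat m A w $$ (y, y)) = sg 1 (wmat m A w)"
    by (simp add: Pol_def)
qed

lemma represented_Tr:
  assumes inf: "infinite (UNIV :: 'f::field set)" and char: "CHAR('f) = 0"
    and "finite D" "\<tau> permutes D" "\<And>k. v k \<noteq> 0"
  shows "represented (\<lambda>m (A :: nat \<Rightarrow> 'f alg_closure mat). Tr m D \<tau> (\<lambda>k. wmat m A (v k)))"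
  by (rule Tr_words_induct[where Q = represented, OF represented_cong represented_1 represented_mult represented_tr[OF inf char]])
     (use assms in auto)

lemma fmat_sum_mon:
  fixes A :: "nat \<Rightarrow> 'f::field alg_closure mat"
  assumes mf: "mat_family m A" and S: "finite S"
  shows "fmat to_ac m A (\<Sum>k\<in>S. mon (v k)) = msumset m S (\<lambda>k. wmat m A (v k))"
proof -
  interpret mat_family_hom m A "to_ac :: 'f \<Rightarrow> _" by (rule fam_hom[OF mf])
  have dims: "dim_row (wmat m A w) = m" "dim_col (wmat m A w) = m" for w using wmat_carrier[of w] by auto
  show ?thesis using S
  proof (induction S rule: finite_induct)
    case empty
    show ?case by (auto simp: fmat_zero msumset_def)
  next
    case (insert k S)
    then show ?case
      by (intro eq_matI) (auto simp: fmat_add fmat_mon msumset_def dims)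
  qed
qed

text \<open>Positions outside \<open>I\<close> are removed as in \<open>Tr_words_induct\<close>;
  this commutes with antisymmetrization because every \<open>p\<close> fixes them. When only
  \<open>I\<close> is left, the sum is, up to the sign of \<sigma>, the full polarization of
  \<sigma>_{n+1}, a combination of its values at sums of words.\<close>

lemma antisymmetrized_trace_in_ideal:
  fixes v :: "nat \<Rightarrow> word"
  assumes inf: "infinite (UNIV :: 'f::field set)" and char: "CHAR('f) = 0"
    and D: "finite D" "D \<inter> I = {}" and I: "card I = Suc n"
    and \<sigma>: "\<sigma> permutes D \<union> I" and v: "\<And>k. v k \<noteq> 0"
  shows "\<exists>g\<in>ideal_gen {pi_t (sigma (Suc n) a) | a. a \<in> (FX :: (word \<Rightarrow>\<^sub>0 'f) set)}.
    represents g (\<lambda>m A. \<Sum>p | p permutes I. signof p * Tr m (D \<union> I) (p \<circ> \<sigma>) (\<lambda>k. wmat m A (v k)))"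
  using D \<sigma> v
proof (induction D arbitrary: \<sigma> v rule: finite_induct)
  case empty
  let ?J = "{pi_t (sigma (Suc n) a) | a. a \<in> (FX :: (word \<Rightarrow>\<^sub>0 'f) set)}"
  have finI: "finite I" using I by (simp add: card_ge_0_finite)
  \<comment> \<open>The polarization formula with \<open>sg\<close> replaced by generators of the
    ideal; the sign of \<sigma> comes from passing from \<open>p\<close> to
    \<open>p \<circ> \<sigma>\<close>.\<close>
  define g :: "'f sXt" where "g = (\<Sum>S\<in>Pow I. Const (signof \<sigma> * (-1) ^ card (I - S)) * pi_t (sigma (Suc n) (\<Sum>k\<in>S. mon (v k))))"
  have FX: "(\<Sum>k\<in>S. mon (v k)) \<in> (FX :: (word \<Rightarrow>\<^sub>0 'f) set)" for S
    by (intro FX_sum FX_mon empty.prems)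
  have "g \<in> ideal_gen ?J"
    unfolding g_def using FX by (intro ideal_gen_sum ideal_gen_mult ideal_gen_base) auto
  moreover have "represents g (\<lambda>m A. \<Sum>p | p permutes I. signof p * Tr m I (p \<circ> \<sigma>) (\<lambda>k. wmat m A (v k)))"
    unfolding represents_def
  proof (intro allI impI)
    fix m and A :: "nat \<Rightarrow> 'f alg_closure mat" assume mf: "mat_family m A"
    let ?M = "\<lambda>k. wmat m A (v k)"
    have \<sigma>: "\<sigma> permutes I" using empty.prems by simp
    have sgn: "signof p = (signof \<sigma> * signof (p \<circ> \<sigma>) :: 'f alg_closure)" if "p permutes I" for p
    proof -
      have "sign (p \<circ> \<sigma>) = sign p * sign \<sigma>"
        using that \<sigma> finI by (intro sign_compose) (auto simp: permutation_permutes)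
      moreover have "sign \<sigma> * sign \<sigma> = 1" by (simp add: sign_def)
      ultimately have "sign p = sign \<sigma> * sign (p \<circ> \<sigma>)" by (simp add: mult_ac)
      then show ?thesis by simp
    qed
    have "(\<Sum>p | p permutes I. signof p * Tr m I (p \<circ> \<sigma>) ?M) =
      signof \<sigma> * (\<Sum>p | p permutes I. signof (p \<circ> \<sigma>) * Tr m I (p \<circ> \<sigma>) ?M)"
      unfolding sum_distrib_left by (intro sum.cong refl) (simp only: mem_Collect_eq sgn mult.assoc)
    also have "(\<Sum>p | p permutes I. signof (p \<circ> \<sigma>) * Tr m I (p \<circ> \<sigma>) ?M) = Pol m I ?M"
      unfolding Pol_def by (rule sum_permutations_compose_right[OF \<sigma>, symmetric])
    also have "Pol m I ?M = (\<Sum>S\<in>Pow I. (-1) ^ card (I - S) * sg (card I) (msumset m S ?M))"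
      by (rule Pol_polarization[OF two_ac_neq_0(1)[OF char] _ finI]) (simp only: of_nat_ac_eq_0_iff(1)[OF char] fact_nonzero simp_thms)
    also have "signof \<sigma> * \<dots> = (\<Sum>S\<in>Pow I. to_ac (signof \<sigma> * (-1) ^ card (I - S)) * sg (Suc n) (msumset m S ?M))"
      unfolding sum_distrib_left I by (intro sum.cong refl) (simp add: to_ac_signof mult_ac)
    also have "\<dots> = ev m A g"
      unfolding g_def ev.hom_sum ev.hom_mult ev_Const ev_pi_t_sigma[OF inf mf FX]
      by (intro sum.cong refl arg_cong2[where f = "(*)"]) (use finI in \<open>simp add: fmat_sum_mon[OF mf] finite_subset\<close>)
    finally show "ev m A g = (\<Sum>p | p permutes I. signof p * Tr m I (p \<circ> \<sigma>) ?M)" ..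
  qed
  ultimately show ?case unfolding Un_empty_left by (rule bexI[rotated])
next
  case (insert k D)
  have k: "k \<notin> D \<union> I" "finite (D \<union> I)" and ins: "insert k D \<union> I = insert k (D \<union> I)" and disj: "D \<inter> I = {}"
    using insert.hyps insert.prems(1) I by (auto intro: card_ge_0_finite)
  have \<sigma>: "\<sigma> permutes insert k (D \<union> I)" using insert.prems(2) unfolding ins .
  have pk: "p k = k" if "p permutes I" for p using that k by (intro permutes_not_in) auto
  have p\<sigma>: "p \<circ> \<sigma> permutes insert k (D \<union> I)" if "p permutes I" for p
    by (rule permutes_compose[OF \<sigma> permutes_subset[OF that]]) auto
  show ?case
  proof (cases "\<sigma> k = k")
    case True
    have s: "\<tau> permutes D \<union> I" if "\<tau> permutes insert k (D \<union> I)" "\<tau> k = k" for \<tau>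
      by (rule permutes_superset[OF that(1)]) (use that in auto)
    obtain g where g: "g \<in> ideal_gen {pi_t (sigma (Suc n) a) | a. a \<in> (FX :: (word \<Rightarrow>\<^sub>0 'f) set)}"
      "represents g (\<lambda>m A. \<Sum>p | p permutes I. signof p * Tr m (D \<union> I) (p \<circ> \<sigma>) (\<lambda>k. wmat m A (v k)))"
      using insert.IH[of \<sigma> v, OF disj s[OF \<sigma> True] insert.prems(3)] by (elim bexE)
    obtain t :: "'f sXt" where t: "represents t (\<lambda>m A. \<Sum>y<m. wmat m A (v k) $$ (y, y))"
      using represented_tr[OF inf char insert.prems(3), of k] unfolding represented_def by (elim exE)
    show ?thesis
    proof (rule bexI[OF _ ideal_gen_mult[OF g(1), of t]], unfold represents_def, intro allI impI)
      fix m and A :: "nat \<Rightarrow> 'f alg_closure mat" assume mf: "mat_family m A"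
      then interpret mat_family m A .
      have "(\<Sum>p | p permutes I. signof p * Tr m (insert k D \<union> I) (p \<circ> \<sigma>) (\<lambda>k. wmat m A (v k))) =
        (\<Sum>p | p permutes I. signof p * ((\<Sum>y<m. wmat m A (v k) $$ (y, y)) * Tr m (D \<union> I) (p \<circ> \<sigma>) (\<lambda>k. wmat m A (v k))))"
        unfolding ins
      proof (intro sum.cong refl arg_cong2[where f = "(*)"] Tr_fixed k wmat_carrier s)
        fix p assume "p \<in> {p. p permutes I}"
        then show "p \<circ> \<sigma> permutes insert k (D \<union> I)" "(p \<circ> \<sigma>) k = k"
          using p\<sigma> pk True by simp_all
      qed
      also have "\<dots> = ev m A t * ev m A g"
        using t g(2) mf by (simp add: represents_def sum_distrib_left mult_ac)
      finally show "ev m A (t * g) = (\<Sum>p | p permutes I. signof p * Tr m (insert k D \<union> I) (p \<circ> \<sigma>) (\<lambda>k. wmat m A (v k)))"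
        by (simp add: ev.hom_mult)
    qed
  next
    case False
    define l where "l = inv_into UNIV \<sigma> k"
    have l: "\<sigma> l = k" unfolding l_def by (rule permutes_inverses(1)[OF \<sigma>])
    define v' where "v' = v(l := v l + v k)"
    have v': "v' j \<noteq> 0" for j using insert.prems(3) by (simp add: v'_def)
    let ?\<sigma> = "transpose k (\<sigma> k) \<circ> \<sigma>"
    obtain g where g: "g \<in> ideal_gen {pi_t (sigma (Suc n) a) | a. a \<in> (FX :: (word \<Rightarrow>\<^sub>0 'f) set)}"
      "represents g (\<lambda>m A. \<Sum>p | p permutes I. signof p * Tr m (D \<union> I) (p \<circ> ?\<sigma>) (\<lambda>k. wmat m A (v' k)))"
      using insert.IH[of ?\<sigma> v', OF disj contract_permutes[OF \<sigma> k(1)] v'] by (elim bexE)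
    show ?thesis
    proof (rule bexI[OF _ g(1)], unfold represents_def, intro allI impI)
      fix m and A :: "nat \<Rightarrow> 'f alg_closure mat" assume mf: "mat_family m A"
      then interpret mat_family m A .
      have M: "(\<lambda>k. wmat m A (v k))(l := wmat m A (v l) * wmat m A (v k)) = (\<lambda>k. wmat m A (v' k))"
        by (auto simp: v'_def wmat_plus)
      have "Tr m (insert k (D \<union> I)) (p \<circ> \<sigma>) (\<lambda>k. wmat m A (v k)) = Tr m (D \<union> I) (p \<circ> ?\<sigma>) (\<lambda>k. wmat m A (v' k))"
        if p: "p permutes I" for p
      proof -
        have inj: "p x = p y \<longleftrightarrow> x = y" for x y using permutes_inj[OF p] by (auto simp: inj_def)
        have pk': "p x = k \<longleftrightarrow> x = k" for x using inj[of x k] pk[OF p] by simp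
        \<comment> \<open>As \<open>p\<close> is injective and fixes \<open>k\<close>, contraction
          at \<open>k\<close> and composition with \<open>p\<close> may be interchanged.\<close>
        have tr: "transpose k ((p \<circ> \<sigma>) k) \<circ> (p \<circ> \<sigma>) = p \<circ> ?\<sigma>"
        proof
          fix x show "(transpose k ((p \<circ> \<sigma>) k) \<circ> (p \<circ> \<sigma>)) x = (p \<circ> ?\<sigma>) x"
            by (simp add: transpose_def inj pk' pk[OF p])
        qed
        have "(p \<circ> \<sigma>) k \<noteq> k" "(p \<circ> \<sigma>) l = k" using False pk' pk[OF p] l by simp_all
        from Tr_contract[OF k wmat_carrier p\<sigma>[OF p] this, of v]
        show ?thesis unfolding tr M .
      qed
      then have "(\<Sum>p | p permutes I. signof p * Tr m (insert k D \<union> I) (p \<circ> \<sigma>) (\<lambda>k. wmat m A (v k))) =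
        (\<Sum>p | p permutes I. signof p * Tr m (D \<union> I) (p \<circ> ?\<sigma>) (\<lambda>k. wmat m A (v' k)))"
        unfolding ins by (intro sum.cong refl) simp
      then show "ev m A g = (\<Sum>p | p permutes I. signof p * Tr m (insert k D \<union> I) (p \<circ> \<sigma>) (\<lambda>k. wmat m A (v k)))"
        using g(2) mf by (simp add: represents_def)
    qed
  qed
qed

subsection \<open>Characteristic zero\<close>

lemma prod_if:
  fixes g :: "'a \<Rightarrow> 'r::comm_semiring_1"
  assumes "finite S"
  shows "(\<Prod>k\<in>S. if P k then g k else 0) = (if \<forall>k\<in>S. P k then prod g S else 0)"
  using assms by (induction S rule: finite_induct) auto

text \<open>Letter \<open>k\<close> becomes a sum of weighted matrix units, one for each position of
  \<open>w\<close> that carries it. The weights \<open>s r\<close> mark the positions, so that the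
  part linear in each of them can be extracted.\<close>

definition test_mat :: "nat \<Rightarrow> nat list \<Rightarrow> (nat \<Rightarrow> nat) \<Rightarrow> (nat \<Rightarrow> nat) \<Rightarrow> (nat \<Rightarrow> 'r::comm_ring_1) \<Rightarrow> nat \<Rightarrow> 'r mat" where
  "test_mat n w i j s k = mat n n (\<lambda>(x, y). \<Sum>r<length w. if w ! r = k \<and> i r = x \<and> j r = y then s r else 0)"

text \<open>A map \<rho> picks a matrix unit for every position of the trace. The row indices then
  force the index function to be \<open>i \<circ> \<rho>\<close>, and the column indices become the
  condition on \<open>j\<close>.\<close>

lemma Tr_test_mat:
  assumes \<tau>: "\<tau> permutes {..<e}" and i: "\<And>r. r < length w \<Longrightarrow> i r < n"
  shows "Tr n {..<e} \<tau> (\<lambda>k. test_mat n w i j s (v ! k)) =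
    (\<Sum>\<rho>\<in>{..<e} \<rightarrow>\<^sub>E {..<length w}. if \<forall>k<e. w ! \<rho> k = v ! k \<and> i (\<rho> (\<tau> k)) = j (\<rho> k) then \<Prod>k<e. s (\<rho> k) else 0)"
proof -
  let ?d = "length w"
  let ?P = "\<lambda>g k r. w ! r = v ! k \<and> i r = g k \<and> j r = g (\<tau> k)"
  have \<tau>e: "\<tau> k < e" if "k < e" for k using permutes_in_image[OF \<tau>, of k] that by simp
  have "Tr n {..<e} \<tau> (\<lambda>k. test_mat n w i j s (v ! k)) =
    (\<Sum>g\<in>{..<e} \<rightarrow>\<^sub>E {..<n}. \<Prod>k<e. \<Sum>r<?d. if ?P g k r then s r else 0)"
    unfolding Tr_def
  proof (intro sum.cong prod.cong refl)
    fix g k assume g: "g \<in> {..<e} \<rightarrow>\<^sub>E {..<n}" and k: "k \<in> {..<e}"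
    have "g k < n" "g (\<tau> k) < n" using PiE_mem[OF g, of k] PiE_mem[OF g, of "\<tau> k"] k \<tau>e by auto
    then show "test_mat n w i j s (v ! k) $$ (g k, g (\<tau> k)) = (\<Sum>r<?d. if ?P g k r then s r else 0)"
      by (simp add: test_mat_def)
  qed
  also have "\<dots> = (\<Sum>g\<in>{..<e} \<rightarrow>\<^sub>E {..<n}. \<Sum>\<rho>\<in>{..<e} \<rightarrow>\<^sub>E {..<?d}. \<Prod>k<e. if ?P g k (\<rho> k) then s (\<rho> k) else 0)"
    by (intro sum.cong refl prod_sum_PiE) auto
  also have "\<dots> = (\<Sum>\<rho>\<in>{..<e} \<rightarrow>\<^sub>E {..<?d}. \<Sum>g\<in>{..<e} \<rightarrow>\<^sub>E {..<n}. \<Prod>k<e. if ?P g k (\<rho> k) then s (\<rho> k) else 0)"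
    by (rule sum.swap)
  also have "\<dots> = (\<Sum>\<rho>\<in>{..<e} \<rightarrow>\<^sub>E {..<?d}. if \<forall>k<e. w ! \<rho> k = v ! k \<and> i (\<rho> (\<tau> k)) = j (\<rho> k) then \<Prod>k<e. s (\<rho> k) else 0)"
  proof (rule sum.cong[OF refl])
    fix \<rho> assume \<rho>: "\<rho> \<in> {..<e} \<rightarrow>\<^sub>E {..<?d}"
    let ?g = "restrict (\<lambda>k. i (\<rho> k)) {..<e}"
    have fin: "finite ({..<e} \<rightarrow>\<^sub>E {..<n})" by (intro finite_PiE) auto
    have \<rho>d: "\<rho> k < ?d" if "k < e" for k using PiE_mem[OF \<rho>, of k] that by simp
    have g: "?g \<in> {..<e} \<rightarrow>\<^sub>E {..<n}" using i \<rho>d by auto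
    have "(\<Sum>g\<in>{..<e} \<rightarrow>\<^sub>E {..<n}. \<Prod>k<e. if ?P g k (\<rho> k) then s (\<rho> k) else 0) =
      (\<Sum>g\<in>{?g}. \<Prod>k<e. if ?P g k (\<rho> k) then s (\<rho> k) else 0)"
    proof (rule sum.mono_neutral_right[OF fin])
      show "{?g} \<subseteq> {..<e} \<rightarrow>\<^sub>E {..<n}" using g by simp
      show "\<forall>g\<in>({..<e} \<rightarrow>\<^sub>E {..<n}) - {?g}. (\<Prod>k<e. if ?P g k (\<rho> k) then s (\<rho> k) else 0) = 0"
      proof
        fix g assume g': "g \<in> ({..<e} \<rightarrow>\<^sub>E {..<n}) - {?g}"
        have "\<not> (\<forall>k\<in>{..<e}. ?P g k (\<rho> k))"
        proof
          assume a: "\<forall>k\<in>{..<e}. ?P g k (\<rho> k)"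
          have "g = ?g"
          proof (rule PiE_ext[of _ "{..<e}" "\<lambda>_. {..<n}"])
            show "g \<in> {..<e} \<rightarrow>\<^sub>E {..<n}" using g' by blast
            show "?g \<in> {..<e} \<rightarrow>\<^sub>E {..<n}" by (rule g)
            show "g k = ?g k" if "k \<in> {..<e}" for k using a that by simp
          qed
          with g' show False by simp
        qed
        then show "(\<Prod>k<e. if ?P g k (\<rho> k) then s (\<rho> k) else 0) = 0" unfolding prod_if[OF finite_lessThan] by (rule if_not_P)
      qed
    qed
    also have "\<dots> = (if \<forall>k\<in>{..<e}. ?P ?g k (\<rho> k) then \<Prod>k<e. s (\<rho> k) else 0)"
      by (simp only: sum.insert[OF finite.emptyI empty_iff[THEN iffD1, THEN notI]] sum.empty add_0_right prod_if[OF finite_lessThan])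
    also have "(\<forall>k\<in>{..<e}. ?P ?g k (\<rho> k)) \<longleftrightarrow> (\<forall>k<e. w ! \<rho> k = v ! k \<and> i (\<rho> (\<tau> k)) = j (\<rho> k))"
      using \<tau>e by auto
    finally show "(\<Sum>g\<in>{..<e} \<rightarrow>\<^sub>E {..<n}. \<Prod>k<e. if ?P g k (\<rho> k) then s (\<rho> k) else 0) =
      (if \<forall>k<e. w ! \<rho> k = v ! k \<and> i (\<rho> (\<tau> k)) = j (\<rho> k) then \<Prod>k<e. s (\<rho> k) else 0)" .
  qed
  finally show ?thesis .
qed

text \<open>The monomial collected along \<rho> contains every mark exactly once just when \<rho> is
  a bijection; this singles out the coefficient to be extracted.\<close>

lemma sum_single_eq_iff:
  fixes e d :: nat
  assumes \<rho>: "\<rho> \<in> {..<e} \<rightarrow>\<^sub>E {..<d}"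
  shows "(\<Sum>k<e. Poly_Mapping.single (\<rho> k) (1::nat)) = (\<Sum>r<d. Poly_Mapping.single r 1) \<longleftrightarrow> bij_betw \<rho> {..<e} {..<d}"
proof
  assume "bij_betw \<rho> {..<e} {..<d}"
  then show "(\<Sum>k<e. Poly_Mapping.single (\<rho> k) (1::nat)) = (\<Sum>r<d. Poly_Mapping.single r 1)"
    by (rule sum.reindex_bij_betw)
next
  assume eq: "(\<Sum>k<e. Poly_Mapping.single (\<rho> k) (1::nat)) = (\<Sum>r<d. Poly_Mapping.single r 1)"
  have c: "card {k\<in>{..<e}. \<rho> k = r} = 1" if "r < d" for r
  proof -
    have "Poly_Mapping.lookup (\<Sum>k<e. Poly_Mapping.single (\<rho> k) (1::nat)) r = (\<Sum>k<e. if \<rho> k = r then 1 else 0)"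
      by (simp add: lookup_sum lookup_single when_def del: One_nat_def)
    also have "\<dots> = (\<Sum>k\<in>{k\<in>{..<e}. \<rho> k = r}. 1)" by (rule sum.inter_filter[symmetric]) simp
    finally have "Poly_Mapping.lookup (\<Sum>k<e. Poly_Mapping.single (\<rho> k) (1::nat)) r = card {k\<in>{..<e}. \<rho> k = r}"
      by simp
    moreover have "Poly_Mapping.lookup (\<Sum>r<d. Poly_Mapping.single r (1::nat)) r = 1"
      using that by (simp add: lookup_sum lookup_single when_def sum.If_cases)
    ultimately show ?thesis using eq by simp
  qed
  have \<rho>d: "\<rho> k < d" if "k < e" for k using PiE_mem[OF \<rho>, of k] that by simp
  have "inj_on \<rho> {..<e}"
  proof (rule inj_onI)
    fix k l assume kl: "k \<in> {..<e}" "l \<in> {..<e}" "\<rho> k = \<rho> l"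
    have "l < e" using kl(2) by simp
    obtain y where "{k\<in>{..<e}. \<rho> k = \<rho> l} = {y}" by (rule card_1_singletonE[OF c[OF \<rho>d[OF \<open>l < e\<close>]]])
    then have "k \<in> {y}" "l \<in> {y}" using kl by auto
    then show "k = l" by simp
  qed
  moreover have "\<rho> ` {..<e} = {..<d}"
  proof (intro equalityI subsetI)
    fix r assume "r \<in> {..<d}"
    then have "{k\<in>{..<e}. \<rho> k = r} \<noteq> {}" using c[of r] by (metis card.empty lessThan_iff zero_neq_one)
    then show "r \<in> \<rho> ` {..<e}" by auto
  qed (use \<rho>d in auto)
  ultimately show "bij_betw \<rho> {..<e} {..<d}" by (simp add: bij_betw_def)
qed

lemma sum_bijections_eq_sum_permutations:
  fixes d :: nat
  assumes F: "\<And>\<rho> h. (\<And>k. k < d \<Longrightarrow> \<rho> k = h k) \<Longrightarrow> F \<rho> = F h"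
  shows "(\<Sum>\<rho> | \<rho> \<in> {..<d} \<rightarrow>\<^sub>E {..<d} \<and> bij_betw \<rho> {..<d} {..<d}. F \<rho>) = (\<Sum>h | h permutes {..<d}. F h)"
proof (rule sum.reindex_bij_witness[where i = "\<lambda>h. restrict h {..<d}" and j = "\<lambda>\<rho> k. if k < d then \<rho> k else k"])
  fix \<rho> assume \<rho>: "\<rho> \<in> {\<rho>. \<rho> \<in> {..<d} \<rightarrow>\<^sub>E {..<d} \<and> bij_betw \<rho> {..<d} {..<d}}"
  then show "restrict (\<lambda>k. if k < d then \<rho> k else k) {..<d} = \<rho>"
    using PiE_arb[of \<rho>] by (auto simp: fun_eq_iff restrict_def)
  have "bij_betw (\<lambda>k. if k < d then \<rho> k else k) {..<d} {..<d} \<longleftrightarrow> bij_betw \<rho> {..<d} {..<d}"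
    by (rule bij_betw_cong) simp
  then have "(\<lambda>k. if k < d then \<rho> k else k) permutes {..<d}" using \<rho> by (intro bij_imp_permutes) auto
  then show "(\<lambda>k. if k < d then \<rho> k else k) \<in> {h. h permutes {..<d}}" by simp
  show "F (\<lambda>k. if k < d then \<rho> k else k) = F \<rho>" by (rule F) simp
next
  fix h assume h: "h \<in> {h. h permutes {..<d}}"
  then show "(\<lambda>k. if k < d then restrict h {..<d} k else k) = h" by (auto simp: fun_eq_iff permutes_not_in)
  have "bij_betw (restrict h {..<d}) {..<d} {..<d} \<longleftrightarrow> bij_betw h {..<d} {..<d}"
    by (rule bij_betw_cong) simp
  then have "bij_betw (restrict h {..<d}) {..<d} {..<d}" using h by (simp add: permutes_imp_bij)
  moreover have "h k < d" if "k < d" for k using h that permutes_in_image[of h "{..<d}" k] by simp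
  ultimately show "restrict h {..<d} \<in> {\<rho>. \<rho> \<in> {..<d} \<rightarrow>\<^sub>E {..<d} \<and> bij_betw \<rho> {..<d} {..<d}}" by auto
qed

text \<open>The contribution of one term to that coefficient: \<open>h\<close> matches its positions
  with positions of \<open>w\<close> that carry the same letters, and \<open>P\<close> says that the
  matrix units at neighbours in a cycle fit together.\<close>

definition symm :: "nat list \<Rightarrow> (nat \<Rightarrow> nat \<Rightarrow> bool) \<Rightarrow> 'f \<times> (nat \<Rightarrow> nat) \<times> nat list \<Rightarrow> 'f::comm_ring_1" where
  "symm w P x = (case x of (q, \<tau>, v) \<Rightarrow> if length v = length w then
     \<Sum>h | h permutes {..<length w}. if \<forall>k<length w. w ! h k = v ! k \<and> P (h k) (h (\<tau> k)) then q else 0 else 0)"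

text \<open>The value of \<open>L\<close> at the test matrices is a polynomial in the marks that
  vanishes identically; compare the coefficients of the product of all marks.\<close>

lemma sum_symm_eq_0:
  fixes L :: "('f::field \<times> (nat \<Rightarrow> nat) \<times> nat list) list"
  assumes inf: "infinite (UNIV :: 'f set)" and L: "trace_terms L"
    and van: "\<And>A. mat_family n A \<Longrightarrow> trsum n A L = 0"
    and i: "\<And>r. r < length w \<Longrightarrow> i r < n"
  shows "(\<Sum>x\<leftarrow>L. symm w (\<lambda>k l. i l = j k) x) = 0"
proof -
  let ?d = "length w"
  let ?C = "\<lambda>\<tau> v \<rho>. \<forall>k<length v. w ! \<rho> k = v ! k \<and> i (\<rho> (\<tau> k)) = j (\<rho> k)"
  define trace_poly :: "'f \<times> (nat \<Rightarrow> nat) \<times> nat list \<Rightarrow> (nat, 'f) mpoly" where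
    "trace_poly x = (case x of (q, \<tau>, v) \<Rightarrow> \<Sum>\<rho>\<in>{..<length v} \<rightarrow>\<^sub>E {..<?d}.
       if ?C \<tau> v \<rho> then Const q * (\<Prod>k<length v. Var (\<rho> k)) else 0)" for x
  have ev: "meval to_ac s (trace_poly (q, \<tau>, v)) = to_ac q * Tr n {..<length v} \<tau> (\<lambda>k. test_mat n w i j s (v ! k))"
    if "\<tau> permutes {..<length v}" for q \<tau> v and s :: "nat \<Rightarrow> 'f alg_closure"
  proof -
    interpret e: comm_ring_hom "meval to_ac s :: (nat, 'f) mpoly \<Rightarrow> _" by (rule comm_ring_hom_meval[OF comm_ring_hom_to_ac])
    have e: "meval to_ac s (if P then Const q * (\<Prod>k<length v. Var (\<rho> k)) else 0) = to_ac q * (if P then \<Prod>k<length v. s (\<rho> k) else 0)" for P \<rho>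
      by (cases P) (simp_all add: e.hom_mult e.hom_prod meval_Const[OF comm_ring_hom_to_ac] meval_Var[OF comm_ring_hom_to_ac])
    have "to_ac q * Tr n {..<length v} \<tau> (\<lambda>k. test_mat n w i j s (v ! k)) =
      (\<Sum>\<rho>\<in>{..<length v} \<rightarrow>\<^sub>E {..<?d}. to_ac q * (if ?C \<tau> v \<rho> then \<Prod>k<length v. s (\<rho> k) else 0))"
    proof -
      have "Tr n {..<length v} \<tau> (\<lambda>k. test_mat n w i j s (v ! k)) =
        (\<Sum>\<rho>\<in>{..<length v} \<rightarrow>\<^sub>E {..<?d}. if ?C \<tau> v \<rho> then \<Prod>k<length v. s (\<rho> k) else 0)"
        by (rule Tr_test_mat[OF that]) (rule i)
      then show ?thesis by (simp only: sum_distrib_left)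
    qed
    then show ?thesis unfolding trace_poly_def prod.case e.hom_sum e by (rule sym)
  qed
  have "meval to_ac s (\<Sum>x\<leftarrow>L. trace_poly x) = trsum n (test_mat n w i j s) L" for s :: "nat \<Rightarrow> 'f alg_closure"
  proof -
    interpret e: comm_ring_hom "meval to_ac s :: (nat, 'f) mpoly \<Rightarrow> _" by (rule comm_ring_hom_meval[OF comm_ring_hom_to_ac])
    show ?thesis using L
    proof (induction L)
      case (Cons x L)
      obtain q \<tau> v where x: "x = (q, \<tau>, v)" by (cases x)
      have "\<tau> permutes {..<length v}" "trace_terms L" using Cons.prems by (auto simp: trace_terms_def x)
      then show ?case using Cons.IH by (simp add: x e.hom_add ev trsum_def)
    qed (simp add: trsum_def)
  qed
  moreover have "mat_family n (test_mat n w i j s)" for s :: "nat \<Rightarrow> 'f alg_closure"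
    by (rule mat_family.intro) (simp add: test_mat_def)
  ultimately have "meval to_ac s (\<Sum>x\<leftarrow>L. trace_poly x) = 0" for s :: "nat \<Rightarrow> 'f alg_closure" using van by simp
  then have z: "(\<Sum>x\<leftarrow>L. trace_poly x) = 0"
    by (rule mpoly_zero_if_vanishing[OF comm_ring_hom_to_ac inj_to_ac infinite_alg_closure[OF inf]])
  define \<mu> :: "nat \<Rightarrow>\<^sub>0 nat" where "\<mu> = (\<Sum>r<?d. Poly_Mapping.single r 1)"
  have VarProd: "(\<Prod>k<e. Var (\<rho> k)) = (Poly_Mapping.single (\<Sum>k<e. Poly_Mapping.single (\<rho> k) 1) 1 :: (nat, 'f) mpoly)" for \<rho> :: "nat \<Rightarrow> nat" and e
    by (induction e) (simp_all add: Var_def mult_single)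
  have "Poly_Mapping.lookup (trace_poly x) \<mu> = symm w (\<lambda>k l. i l = j k) x" if "x \<in> set L" for x
  proof -
    obtain q \<tau> v where x: "x = (q, \<tau>, v)" by (cases x)
    have \<tau>: "\<tau> permutes {..<length v}" using L that by (auto simp: trace_terms_def x)
    let ?e = "length v"
    have fin: "finite ({..<?e} \<rightarrow>\<^sub>E {..<?d})" by (intro finite_PiE) auto
    have gen: "Poly_Mapping.lookup (if Q then a else 0) \<mu> = (if B then if Q then q else 0 else 0)"
      if "Poly_Mapping.lookup a \<mu> = (if B then q else 0)" for Q B and a :: "(nat, 'f) mpoly"
      using that by simp
    have "Poly_Mapping.lookup (trace_poly x) \<mu> = (\<Sum>\<rho>\<in>{..<?e} \<rightarrow>\<^sub>E {..<?d}. if bij_betw \<rho> {..<?e} {..<?d} then (if ?C \<tau> v \<rho> then q else 0) else 0)"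
      unfolding x trace_poly_def prod.case lookup_sum
    proof (rule sum.cong[OF refl])
      fix \<rho> assume \<rho>: "\<rho> \<in> {..<?e} \<rightarrow>\<^sub>E {..<?d}"
      have "Poly_Mapping.lookup (Const q * (\<Prod>k<?e. Var (\<rho> k))) \<mu> = (if (\<Sum>k<?e. Poly_Mapping.single (\<rho> k) 1) = \<mu> then q else 0)"
        unfolding VarProd by (simp add: Const_def mult_single lookup_single when_def)
      also have "((\<Sum>k<?e. Poly_Mapping.single (\<rho> k) 1) = \<mu>) \<longleftrightarrow> bij_betw \<rho> {..<?e} {..<?d}"
        unfolding \<mu>_def by (rule sum_single_eq_iff[OF \<rho>])
      finally have "Poly_Mapping.lookup (Const q * (\<Prod>k<?e. Var (\<rho> k))) \<mu> = (if bij_betw \<rho> {..<?e} {..<?d} then q else 0)" .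
      then show "Poly_Mapping.lookup (if ?C \<tau> v \<rho> then Const q * (\<Prod>k<?e. Var (\<rho> k)) else 0) \<mu> =
        (if bij_betw \<rho> {..<?e} {..<?d} then (if ?C \<tau> v \<rho> then q else 0) else 0)"
        by (rule gen)
    qed
    also have "\<dots> = (\<Sum>\<rho> | \<rho> \<in> {..<?e} \<rightarrow>\<^sub>E {..<?d} \<and> bij_betw \<rho> {..<?e} {..<?d}. if ?C \<tau> v \<rho> then q else 0)"
      using fin by (rule sum.inter_filter[symmetric])
    also have "\<dots> = symm w (\<lambda>k l. i l = j k) x"
    proof (cases "?e = ?d")
      case True
      have \<tau>d: "\<tau> k < ?d" if "k < ?d" for k using permutes_in_image[OF \<tau>, of k] that True by simp
      have c: "?C \<tau> v \<rho> = ?C \<tau> v h" if "\<And>k. k < ?d \<Longrightarrow> \<rho> k = h k" for \<rho> h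
        unfolding True using that \<tau>d by auto
      have "(\<Sum>\<rho> | \<rho> \<in> {..<?d} \<rightarrow>\<^sub>E {..<?d} \<and> bij_betw \<rho> {..<?d} {..<?d}. if ?C \<tau> v \<rho> then q else 0) = (\<Sum>h | h permutes {..<?d}. if ?C \<tau> v h then q else 0)"
      proof (rule sum_bijections_eq_sum_permutations)
        fix \<rho> h :: "nat \<Rightarrow> nat" assume "\<And>k. k < ?d \<Longrightarrow> \<rho> k = h k"
        from arg_cong[where f = "\<lambda>P. if P then q else 0", OF c[OF this]]
        show "(if ?C \<tau> v \<rho> then q else 0) = (if ?C \<tau> v h then q else 0)" .
      qed
      then show ?thesis by (simp add: symm_def x True)
    next
      case False
      have "\<not> bij_betw \<rho> {..<?e} {..<?d}" for \<rho> using bij_betw_same_card[of \<rho> "{..<?e}" "{..<?d}"] False by auto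
      then show ?thesis using False by (simp add: symm_def x)
    qed
    finally show ?thesis .
  qed
  then have "(\<Sum>x\<leftarrow>L. symm w (\<lambda>k l. i l = j k) x) = (\<Sum>x\<leftarrow>L. Poly_Mapping.lookup (trace_poly x) \<mu>)"
    by (intro arg_cong[where f = sum_list] map_cong refl) simp
  also have "\<dots> = Poly_Mapping.lookup (\<Sum>x\<leftarrow>L. trace_poly x) \<mu>"
    by (induction L) (simp_all add: lookup_add)
  finally show ?thesis by (simp add: z)
qed

lemma sum_sum_list: "(\<Sum>x\<in>S. \<Sum>y\<leftarrow>L. f x y) = (\<Sum>y\<leftarrow>L. \<Sum>x\<in>S. f x y)"
  for f :: "'a \<Rightarrow> 'b \<Rightarrow> 'c::comm_monoid_add"
  by (induction L) (simp_all add: sum.distrib)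

text \<open>The matchings \<open>h\<close> are collected according to \<open>c h\<close>, in the
  applications the conjugate of \<tau> by \<open>h\<close>. The ring is general because both the
  field and its closure occur.\<close>

lemma sum_symm_delta:
  assumes S: "finite S" and \<tau>: "\<tau> permutes {..<length v}"
    and img: "\<And>h. h permutes {..<length w} \<Longrightarrow> length v = length w \<Longrightarrow> c h \<in> S"
  shows "(\<Sum>\<rho>\<in>S. (if length v = length w then \<Sum>h | h permutes {..<length w}.
      if (\<forall>k<length w. w ! h k = v ! k) \<and> c h = \<rho> then q else 0 else 0) * g \<rho>) =
    (if length v = length w then \<Sum>h | h permutes {..<length w}.
      if \<forall>k<length w. w ! h k = v ! k then q * g (c h) else (0::'r::comm_ring_1) else 0)"
proof (cases "length v = length w")
  case True
  have "(\<Sum>\<rho>\<in>S. (\<Sum>h | h permutes {..<length w}. if (\<forall>k<length w. w ! h k = v ! k) \<and> c h = \<rho> then q else 0) * g \<rho>) =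
    (\<Sum>\<rho>\<in>S. \<Sum>h | h permutes {..<length w}. if c h = \<rho> then (if \<forall>k<length w. w ! h k = v ! k then q else 0) * g \<rho> else 0)"
    unfolding sum_distrib_right by (intro sum.cong refl) (simp add: if_distrib[of "\<lambda>x. x * _"] cong: if_cong)
  also have "\<dots> = (\<Sum>h | h permutes {..<length w}. \<Sum>\<rho>\<in>S. if c h = \<rho> then (if \<forall>k<length w. w ! h k = v ! k then q else 0) * g \<rho> else 0)"
    by (rule sum.swap)
  also have "\<dots> = (\<Sum>h | h permutes {..<length w}. if \<forall>k<length w. w ! h k = v ! k then q * g (c h) else 0)"
    by (intro sum.cong refl, subst sum.delta'[OF S]) (use img True in auto)
  finally show ?thesis using True by simp
qed simp

text \<open>Renumbering the positions of a term does not change its value, so the coefficients in a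
  trace expansion are not determined by \<open>f\<close>. They are therefore averaged over all
  renumberings, and straightening is applied for each list of letters \<open>w\<close>
  separately.\<close>

lemma K_t_subset_ideal:
  assumes inf: "infinite (UNIV :: 'f::field set)" and char: "CHAR('f) = 0" and f: "f \<in> K_t n"
  shows "f \<in> ideal_gen {pi_t (sigma (n + 1) a) | a. a \<in> (FX :: (word \<Rightarrow>\<^sub>0 'f) set)}"
proof -
  let ?J = "{pi_t (sigma (Suc n) a) | a. a \<in> (FX :: (word \<Rightarrow>\<^sub>0 'f) set)}"
  let ?c = "\<lambda>w \<tau> h. map_permutation {..<length w} h \<tau>"
  let ?Pm = "\<lambda>w :: nat list. {\<tau>. \<tau> permutes {..<length w}}"
  obtain L where L: "trace_terms L" and evL: "\<And>m A. mat_family m A \<Longrightarrow> ev m A f = trsum m A L"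
    using spanned_ev[OF char, of f] unfolding spanned_def by (elim exE conjE) simp
  have van: "trsum n A L = 0" if "mat_family n A" for A
    using f that evL[OF that] unfolding K_t_iff[OF inf] by simp
  \<comment> \<open>The part of the term \<open>x\<close> that lands on the list \<open>w\<close>
    and the permutation \<rho> when positions are renumbered by \<open>h\<close>; renumbering
    conjugates \<tau>.\<close>
  define b :: "nat list \<Rightarrow> 'f \<times> (nat \<Rightarrow> nat) \<times> nat list \<Rightarrow> (nat \<Rightarrow> nat) \<Rightarrow> 'f" where
    "b w x \<rho> = (case x of (q, \<tau>, v) \<Rightarrow> if length v = length w then \<Sum>h | h permutes {..<length w}.
       if (\<forall>k<length w. w ! h k = v ! k) \<and> ?c w \<tau> h = \<rho> then q else 0 else 0)" for w x \<rho>
  define B where "B w \<rho> = (\<Sum>x\<leftarrow>L. b w x \<rho>)" for w \<rho>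
  have finP: "finite (?Pm w)" for w by (rule finite_permutations) simp
  have cP: "?c w \<tau> h permutes {..<length w}" if "\<tau> permutes {..<length w}" "h permutes {..<length w}" for w \<tau> h
    by (rule map_permutation_permutes[OF permutes_imp_bij[OF that(2)] that(1)])
  \<comment> \<open>Written in terms of conjugates, the relation obtained from the test matrices is
    the hypothesis \<open>van\<close> of \<open>straighten\<close>.\<close>
  have vanB: "(\<Sum>\<rho> | \<rho> permutes {..<length w} \<and> (\<forall>k<length w. i (\<rho> k) = j k). B w \<rho>) = 0"
    if i: "\<forall>k<length w. i k < n" for w and i j :: "nat \<Rightarrow> nat"
  proof -
    let ?P = "\<lambda>\<rho>. \<forall>k<length w. i (\<rho> k) = j k"
    have "(\<Sum>\<rho>\<in>?Pm w. b w x \<rho> * (if ?P \<rho> then 1 else 0)) = symm w (\<lambda>k l. i l = j k) x" if x: "x \<in> set L" for x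
    proof -
      obtain q \<tau> v where x': "x = (q, \<tau>, v)" by (cases x)
      have \<tau>: "\<tau> permutes {..<length v}" using L x by (auto simp: trace_terms_def x')
      have "(\<Sum>\<rho>\<in>?Pm w. b w x \<rho> * (if ?P \<rho> then 1 else 0)) = (if length v = length w then \<Sum>h | h permutes {..<length w}.
          if \<forall>k<length w. w ! h k = v ! k then q * (if ?P (?c w \<tau> h) then 1 else 0) else 0 else 0)"
        unfolding b_def x' prod.case by (rule sum_symm_delta[OF finP \<tau>]) (use \<tau> cP in auto)
      also have "\<dots> = symm w (\<lambda>k l. i l = j k) x"
      proof (cases "length v = length w")
        case True
        have "?P (?c w \<tau> h) \<longleftrightarrow> (\<forall>k<length w. i (h (\<tau> k)) = j (h k))" if h: "h permutes {..<length w}" for h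
        proof -
          have "?P (?c w \<tau> h) \<longleftrightarrow> (\<forall>k\<in>h ` {..<length w}. i (?c w \<tau> h k) = j k)"
            unfolding permutes_image[OF h] by auto
          also have "\<dots> \<longleftrightarrow> (\<forall>k<length w. i (h (\<tau> k)) = j (h k))"
          proof -
            have "?c w \<tau> h (h k) = h (\<tau> k)" if "k < length w" for k
              by (rule map_permutation_apply) (use that inj_on_subset[OF permutes_inj[OF h] subset_UNIV] in auto)
            then show ?thesis by auto
          qed
          finally show ?thesis .
        qed
        then show ?thesis unfolding symm_def x' prod.case using True
          by (auto intro!: sum.cong)
      qed (simp add: symm_def x')
      finally show ?thesis .
    qed
    then have "(\<Sum>x\<leftarrow>L. \<Sum>\<rho>\<in>?Pm w. b w x \<rho> * (if ?P \<rho> then 1 else 0)) = (\<Sum>x\<leftarrow>L. symm w (\<lambda>k l. i l = j k) x)"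
      by (intro arg_cong[where f = sum_list] map_cong refl) simp
    also have "\<dots> = 0" by (rule sum_symm_eq_0[OF inf L van]) (use i in simp_all)
    finally have z: "(\<Sum>x\<leftarrow>L. \<Sum>\<rho>\<in>?Pm w. b w x \<rho> * (if ?P \<rho> then 1 else 0)) = 0" .
    have "(\<Sum>\<rho> | \<rho> permutes {..<length w} \<and> ?P \<rho>. B w \<rho>) = (\<Sum>\<rho>\<in>{\<rho>\<in>?Pm w. ?P \<rho>}. B w \<rho>)" by simp
    also have "\<dots> = (\<Sum>\<rho>\<in>?Pm w. B w \<rho> * (if ?P \<rho> then 1 else 0))"
      unfolding sum.inter_filter[OF finP] by (intro sum.cong refl) auto
    also have "\<dots> = (\<Sum>x\<leftarrow>L. \<Sum>\<rho>\<in>?Pm w. b w x \<rho> * (if ?P \<rho> then 1 else 0))"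
      unfolding B_def sum_list_mult_const[symmetric] by (rule sum_sum_list)
    finally show ?thesis using z by simp
  qed
  \<comment> \<open>Positions beyond the length carry a dummy letter, so that all words are
    nonempty.\<close>
  define v where "v w k = Word [if k < length w then w ! k else 0]" for w :: "nat list" and k
  have v: "v w k \<noteq> 0" for w k by (simp add: v_def zero_word_def)
  define T :: "nat list \<Rightarrow> (nat \<Rightarrow> nat) \<Rightarrow> 'f sXt" where
    "T w \<tau> = (SOME T. represents T (\<lambda>m A. Tr m {..<length w} \<tau> (\<lambda>k. wmat m A (v w k))))" for w \<tau>
  have T: "represents (T w \<tau>) (\<lambda>m A. Tr m {..<length w} \<tau> (\<lambda>k. wmat m A (v w k)))"
    if \<tau>: "\<tau> permutes {..<length w}" for w \<tau>
    unfolding T_def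
    by (rule someI_ex[OF represented_Tr[of "{..<length w}" \<tau> "v w", OF inf char finite_lessThan \<tau> v, unfolded represented_def]])
  have evT: "ev m A (T w \<tau>) = Tr m {..<length w} \<tau> (\<lambda>k. A (w ! k))"
    if \<tau>: "\<tau> permutes {..<length w}" and mf: "mat_family m A" for w \<tau> m A
  proof -
    interpret mat_family m A by (rule mf)
    have "ev m A (T w \<tau>) = Tr m {..<length w} \<tau> (\<lambda>k. wmat m A (v w k))"
      using T[OF \<tau>] mf by (simp add: represents_def)
    also have "\<dots> = Tr m {..<length w} \<tau> (\<lambda>k. A (w ! k))"
    proof (rule Tr_cong[OF _ refl])
      fix k assume "k \<in> {..<length w}"
      then show "wmat m A (v w k) = A (w ! k)" using wmat_letter[of "w ! k"] by (simp add: v_def)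
    qed
    finally show ?thesis .
  qed
  have anti: "(\<Sum>p | p permutes I. Const (signof p) * T w (p \<circ> \<sigma>)) \<in> ideal_gen ?J"
    if \<sigma>: "\<sigma> permutes {..<length w}" and I: "I \<subseteq> {..<length w}" "card I = Suc n" for w \<sigma> I
  proof -
    have un: "({..<length w} - I) \<union> I = {..<length w}" using I by blast
    obtain g where g: "g \<in> ideal_gen ?J"
      "represents g (\<lambda>m A. \<Sum>p | p permutes I. signof p * Tr m (({..<length w} - I) \<union> I) (p \<circ> \<sigma>) (\<lambda>k. wmat m A (v w k)))"
      using antisymmetrized_trace_in_ideal[OF inf char _ _ I(2), of "{..<length w} - I" \<sigma> "v w"] \<sigma> v unfolding un by auto
    have "(\<Sum>p | p permutes I. Const (signof p) * T w (p \<circ> \<sigma>)) = g"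
    proof (rule sXt_eqI'[OF inf])
      fix m and A :: "nat \<Rightarrow> 'f alg_closure mat" assume mf: "mat_family m A"
      have "represents (T w (p \<circ> \<sigma>)) (\<lambda>m A. Tr m {..<length w} (p \<circ> \<sigma>) (\<lambda>k. wmat m A (v w k)))" if "p permutes I" for p
        by (rule T[OF permutes_compose[OF \<sigma> permutes_subset[OF that I(1)]]])
      then show "ev m A (\<Sum>p | p permutes I. Const (signof p) * T w (p \<circ> \<sigma>)) = ev m A g"
        using g(2) mf unfolding represents_def un ev.hom_sum ev.hom_mult ev_Const to_ac_signof by simp
    qed
    with g(1) show ?thesis by simp
  qed
  define N where "N = Max (insert 0 ((\<lambda>(q, \<tau>, v). length v) ` set L))"
  define V where "V = (\<Union>(q, \<tau>, v)\<in>set L. set v)"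
  \<comment> \<open>A finite set that contains all rearrangements of the lists of letters in
    \<open>L\<close>.\<close>
  define W where "W = {w. set w \<subseteq> V \<and> length w \<le> N}"
  have finW: "finite W" unfolding W_def V_def by (rule finite_lists_length_le) auto
  \<comment> \<open>Each of the d! renumberings \<open>h\<close> of a term belongs to exactly one
    list \<open>w\<close> and leaves the trace unchanged, so division by d! restores the
    term.\<close>
  have per_term: "(\<Sum>w\<in>W. to_ac (1 / of_nat (fact (length w))) * (\<Sum>\<rho>\<in>?Pm w. to_ac (b w x \<rho>) * Tr m {..<length w} \<rho> (\<lambda>k. A (w ! k)))) =
    (case x of (q, \<tau>, v) \<Rightarrow> to_ac q * Tr m {..<length v} \<tau> (\<lambda>k. A (v ! k)))"
    if x: "x \<in> set L" for x m and A :: "nat \<Rightarrow> 'f alg_closure mat"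
  proof -
    obtain q \<tau> u where x': "x = (q, \<tau>, u)" by (cases x)
    have \<tau>: "\<tau> permutes {..<length u}" using L x by (auto simp: trace_terms_def x')
    let ?d = "length u"
    let ?q = "to_ac q * Tr m {..<?d} \<tau> (\<lambda>k. A (u ! k))"
    let ?F = "1 / of_nat (fact ?d) :: 'f alg_closure"
    have uN: "?d \<le> N" unfolding N_def by (rule Max_ge) (use x x' in force)+
    have uV: "set u \<subseteq> V" unfolding V_def using x x' by force
    have tb: "to_ac (b w x \<rho>) = (if length u = length w then \<Sum>h | h permutes {..<length w}.
       if (\<forall>k<length w. w ! h k = u ! k) \<and> ?c w \<tau> h = \<rho> then to_ac q else 0 else 0)" for w \<rho>
    proof -
      interpret a: comm_ring_hom "to_ac :: 'f \<Rightarrow> _" by (rule comm_ring_hom_to_ac)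
      show ?thesis unfolding b_def x' prod.case by (simp add: a.hom_sum if_distrib[of to_ac] cong: if_cong)
    qed
    have inner: "(\<Sum>\<rho>\<in>?Pm w. to_ac (b w x \<rho>) * Tr m {..<length w} \<rho> (\<lambda>k. A (w ! k))) =
      (if length u = length w then \<Sum>h | h permutes {..<?d}. if \<forall>k<?d. w ! h k = u ! k then ?q else 0 else 0)" for w
    proof -
      have "(\<Sum>\<rho>\<in>?Pm w. to_ac (b w x \<rho>) * Tr m {..<length w} \<rho> (\<lambda>k. A (w ! k))) =
        (if length u = length w then \<Sum>h | h permutes {..<length w}.
          if \<forall>k<length w. w ! h k = u ! k then to_ac q * Tr m {..<length w} (?c w \<tau> h) (\<lambda>k. A (w ! k)) else 0 else 0)"
        unfolding tb by (rule sum_symm_delta[OF finP \<tau>]) (use \<tau> cP in auto)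
      also have "\<dots> = (if length u = length w then \<Sum>h | h permutes {..<?d}. if \<forall>k<?d. w ! h k = u ! k then ?q else 0 else 0)"
      proof (intro if_cong refl)
        assume len: "length u = length w"
        show "(\<Sum>h | h permutes {..<length w}.
          if \<forall>k<length w. w ! h k = u ! k then to_ac q * Tr m {..<length w} (?c w \<tau> h) (\<lambda>k. A (w ! k)) else 0) =
          (\<Sum>h | h permutes {..<?d}. if \<forall>k<?d. w ! h k = u ! k then ?q else 0)"
          unfolding len[symmetric]
        proof (intro sum.cong refl if_cong arg_cong2[where f = "(*)"])
          fix h assume h: "h \<in> {h. h permutes {..<?d}}" and e: "\<forall>k<?d. w ! h k = u ! k"
          have "Tr m {..<?d} (map_permutation {..<?d} h \<tau>) (\<lambda>k. A (w ! k)) = Tr m {..<?d} \<tau> (\<lambda>k. A (w ! h k))"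
            by (rule Tr_reindex[OF _ \<tau>]) (use h in \<open>simp add: permutes_imp_bij\<close>)
          also have "\<dots> = Tr m {..<?d} \<tau> (\<lambda>k. A (u ! k))" by (rule Tr_cong) (use e in auto)
          finally show "Tr m {..<?d} (map_permutation {..<?d} h \<tau>) (\<lambda>k. A (w ! k)) = Tr m {..<?d} \<tau> (\<lambda>k. A (u ! k))" .
        qed
      qed
      finally show ?thesis .
    qed
    have one: "(\<Sum>w\<in>{w\<in>W. length u = length w}. if \<forall>k<?d. w ! h k = u ! k then ?F * ?q else 0) = ?F * ?q"
      if h: "h permutes {..<?d}" for h
    proof -
      \<comment> \<open>The only list that \<open>h\<close> matches with \<open>u\<close>.\<close>
      define w0 where "w0 = map (\<lambda>k. u ! inv_into UNIV h k) [0..<?d]"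
      have invd: "inv_into UNIV h k < ?d" if "k < ?d" for k
        using permutes_in_image[OF permutes_inv[OF h], of k] that by simp
      have hd: "h k < ?d" if "k < ?d" for k using permutes_in_image[OF h, of k] that by simp
      have "set w0 \<subseteq> set u" unfolding w0_def using invd by auto
      then have w0: "w0 \<in> {w\<in>W. length u = length w}" using uV uN by (auto simp: W_def w0_def)
      have eq: "(\<forall>k<?d. w ! h k = u ! k) \<longleftrightarrow> w0 = w" if "length u = length w" for w
      proof
        assume a: "\<forall>k<?d. w ! h k = u ! k"
        show "w0 = w"
        proof (rule nth_equalityI)
          fix k assume "k < length w0"
          then have k: "k < ?d" by (simp add: w0_def)
          then have "w0 ! k = u ! inv_into UNIV h k" by (simp add: w0_def)
          also have "\<dots> = w ! h (inv_into UNIV h k)" using a invd[OF k] by simp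
          finally show "w0 ! k = w ! k" by (simp add: permutes_inverses(1)[OF h])
        qed (use that in \<open>simp add: w0_def\<close>)
      next
        assume "w0 = w"
        then show "\<forall>k<?d. w ! h k = u ! k" by (auto simp: w0_def hd permutes_inverses(2)[OF h])
      qed
      have "(\<Sum>w\<in>{w\<in>W. length u = length w}. if \<forall>k<?d. w ! h k = u ! k then ?F * ?q else 0) =
        (\<Sum>w\<in>{w\<in>W. length u = length w}. if w0 = w then ?F * ?q else 0)"
        by (intro sum.cong refl if_cong) (use eq in auto)
      also have "\<dots> = ?F * ?q" using w0 finW by (subst sum.delta') auto
      finally show ?thesis .
    qed
    have "(\<Sum>w\<in>W. to_ac (1 / of_nat (fact (length w))) * (\<Sum>\<rho>\<in>?Pm w. to_ac (b w x \<rho>) * Tr m {..<length w} \<rho> (\<lambda>k. A (w ! k)))) =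
      (\<Sum>w\<in>W. if length u = length w then \<Sum>h | h permutes {..<?d}. if \<forall>k<?d. w ! h k = u ! k then ?F * ?q else 0 else 0)"
      unfolding inner
      by (intro sum.cong refl) (simp add: sum_distrib_left if_distrib[of "\<lambda>x. _ * x"] cong: if_cong)
    also have "\<dots> = (\<Sum>w\<in>{w\<in>W. length u = length w}. \<Sum>h | h permutes {..<?d}. if \<forall>k<?d. w ! h k = u ! k then ?F * ?q else 0)"
      by (rule sum.inter_filter[OF finW, symmetric])
    also have "\<dots> = (\<Sum>h | h permutes {..<?d}. \<Sum>w\<in>{w\<in>W. length u = length w}. if \<forall>k<?d. w ! h k = u ! k then ?F * ?q else 0)"
      by (rule sum.swap)
    also have "\<dots> = (\<Sum>h | h permutes {..<?d}. ?F * ?q)" by (intro sum.cong refl) (simp only: mem_Collect_eq one)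
    also have "\<dots> = of_nat (fact ?d) * (?F * ?q)" by (simp add: card_permutations)
    also have "\<dots> = ?q"
    proof -
      have "(of_nat (fact ?d) :: 'f alg_closure) \<noteq> 0" unfolding of_nat_ac_eq_0_iff(1)[OF char] by simp
      then show ?thesis by simp
    qed
    finally show ?thesis by (simp add: x')
  qed
  have "f = (\<Sum>w\<in>W. Const (1 / of_nat (fact (length w))) * (\<Sum>\<rho>\<in>?Pm w. Const (B w \<rho>) * T w \<rho>))"
  proof (rule sXt_eqI'[OF inf])
    fix m and A :: "nat \<Rightarrow> 'f alg_closure mat" assume mf: "mat_family m A"
    let ?t = "\<lambda>w \<rho>. Tr m {..<length w} \<rho> (\<lambda>k. A (w ! k))"
    interpret a: comm_ring_hom "to_ac :: 'f \<Rightarrow> _" by (rule comm_ring_hom_to_ac)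
    have tB: "to_ac (B w \<rho>) = (\<Sum>x\<leftarrow>L. to_ac (b w x \<rho>))" for w \<rho>
      unfolding B_def by (induction L) (simp_all add: a.hom_add)
    have "ev m A f = (\<Sum>x\<leftarrow>L. case x of (q, \<tau>, v) \<Rightarrow> to_ac q * Tr m {..<length v} \<tau> (\<lambda>k. A (v ! k)))"
      unfolding evL[OF mf] trsum_def ..
    also have "\<dots> = (\<Sum>x\<leftarrow>L. \<Sum>w\<in>W. to_ac (1 / of_nat (fact (length w))) * (\<Sum>\<rho>\<in>?Pm w. to_ac (b w x \<rho>) * ?t w \<rho>))"
      by (intro arg_cong[where f = sum_list] map_cong refl) (simp only: per_term)
    also have "\<dots> = (\<Sum>w\<in>W. \<Sum>x\<leftarrow>L. to_ac (1 / of_nat (fact (length w))) * (\<Sum>\<rho>\<in>?Pm w. to_ac (b w x \<rho>) * ?t w \<rho>))"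
      by (rule sum_sum_list[symmetric])
    also have "\<dots> = (\<Sum>w\<in>W. to_ac (1 / of_nat (fact (length w))) * (\<Sum>\<rho>\<in>?Pm w. to_ac (B w \<rho>) * ?t w \<rho>))"
      unfolding tB sum_list_mult_const[symmetric] sum_list_const_mult sum_sum_list ..
    also have "\<dots> = ev m A (\<Sum>w\<in>W. Const (1 / of_nat (fact (length w))) * (\<Sum>\<rho>\<in>?Pm w. Const (B w \<rho>) * T w \<rho>))"
      unfolding ev.hom_sum ev.hom_mult ev_Const
      by (intro sum.cong refl arg_cong2[where f = "(*)"]) (use mf in \<open>simp add: evT\<close>)
    finally show "ev m A f = ev m A (\<Sum>w\<in>W. Const (1 / of_nat (fact (length w))) * (\<Sum>\<rho>\<in>?Pm w. Const (B w \<rho>) * T w \<rho>))" .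
  qed
  also have "\<dots> \<in> ideal_gen ?J"
  proof (rule ideal_gen_sum, rule ideal_gen_mult)
    fix w
    show "(\<Sum>\<rho>\<in>?Pm w. Const (B w \<rho>) * T w \<rho>) \<in> ideal_gen ?J"
    proof (rule straighten[OF two_ac_neq_0(2)[OF char] anti])
      show "(\<Sum>\<rho> | \<rho> permutes {..<length w} \<and> (\<forall>k<length w. i (\<rho> k) = j k). B w \<rho>) = 0"
        if "\<forall>k<length w. i k < n" for i j :: "nat \<Rightarrow> nat"
        by (rule vanB[OF that])
    qed
  qed
  finally show ?thesis by simp
qed

lemma K_t_eq_ideal:
  assumes inf: "infinite (UNIV :: 'f::field set)" and char: "CHAR('f) = 0"
  shows "K_t n = ideal_gen {pi_t (sigma (n + 1) a) | a. a \<in> (FX :: (word \<Rightarrow>\<^sub>0 'f) set)}"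
proof (intro equalityI subsetI)
  fix f :: "'f sXt" assume f: "f \<in> ideal_gen {pi_t (sigma (n + 1) a) | a. a \<in> FX}"
  show "f \<in> K_t n"
    unfolding K_t_iff[OF inf]
  proof (intro allI impI)
    fix A :: "nat \<Rightarrow> 'f alg_closure mat" assume mf: "mat_family n A"
    interpret mat_family_hom n A "to_ac :: 'f \<Rightarrow> _" by (rule fam_hom[OF mf])
    show "ev n A f = 0"
    proof (rule ideal_gen_subset_kernel[OF ev.comm_ring_hom_axioms _ f])
      fix x assume "x \<in> {pi_t (sigma (n + 1) a) | a. a \<in> (FX :: (word \<Rightarrow>\<^sub>0 'f) set)}"
      then obtain a where a: "x = pi_t (sigma (n + 1) a)" "a \<in> (FX :: (word \<Rightarrow>\<^sub>0 'f) set)" by (elim CollectE exE conjE)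
      show "ev n A x = 0"
        unfolding a(1) ev_pi_t_sigma[OF inf mf a(2)] by (rule sg_gt) (simp add: fmat_def)
    qed
  qed
qed (rule K_t_subset_ideal[OF inf char])

text \<open>The single element \<sigma>_{n+1}(x_1) is a basis: a substitution may send x_1 to any
  \<open>a\<close>, so its images are exactly the \<sigma>_{n+1}(a).\<close>

lemma K_t_finitely_based:
  assumes inf: "infinite (UNIV :: 'f::field set)" and char: "CHAR('f) = 0"
  shows "finitely_based (K_t n :: 'f sXt set)"
proof -
  let ?x = "mon (Word [0]) :: word \<Rightarrow>\<^sub>0 'f"
  let ?J = "{pi_t (sigma (n + 1) a) | a. a \<in> (FX :: (word \<Rightarrow>\<^sub>0 'f) set)}"
  have x: "?x \<in> FX" by (rule FX_mon) (simp add: zero_word_def)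
  have "{\<phi> f | \<phi> f. subst_endo \<phi> \<and> f \<in> {pi_t (sigma (n + 1) ?x)}} = ?J"
  proof (intro equalityI subsetI)
    fix y assume "y \<in> {\<phi> f | \<phi> f. subst_endo \<phi> \<and> f \<in> {pi_t (sigma (n + 1) ?x)}}"
    then obtain \<phi> where \<phi>: "subst_endo \<phi>" and y: "y = \<phi> (pi_t (sigma (n + 1) ?x))" by blast
    obtain s where s: "\<And>k. s k \<in> (FX :: (word \<Rightarrow>\<^sub>0 'f) set)"
      "\<forall>t>0. \<forall>a\<in>FX. \<phi> (pi_t (sigma t a)) = pi_t (sigma t (FX_subst s a))"
      using \<phi> unfolding subst_endo_def by blast
    have "y = pi_t (sigma (n + 1) (FX_subst s ?x))" using s(2) x y by simp
    moreover have "FX_subst s ?x \<in> FX" by (rule FX_FX_subst[OF x]) (rule s(1))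
    ultimately show "y \<in> ?J" by blast
  next
    fix y assume "y \<in> ?J"
    then obtain a where y: "y = pi_t (sigma (n + 1) a)" and a: "a \<in> (FX :: (word \<Rightarrow>\<^sub>0 'f) set)" by blast
    obtain \<phi> where \<phi>: "alg_hom \<phi>" "\<forall>t>0. \<forall>b\<in>FX. \<phi> (pi_t (sigma t b)) = pi_t (sigma t (FX_subst (\<lambda>_. a) b))"
      using ex_subst_endo[OF inf, of "\<lambda>_. a", OF a] by (elim exE conjE)
    have "subst_endo \<phi>" unfolding subst_endo_def using \<phi> a by (intro conjI exI[of _ "\<lambda>_. a"]) simp_all
    moreover have "y = \<phi> (pi_t (sigma (n + 1) ?x))"
      using \<phi>(2) x by (simp add: y FX_subst_mon word_subst_def)
    ultimately show "y \<in> {\<phi> f | \<phi> f. subst_endo \<phi> \<and> f \<in> {pi_t (sigma (n + 1) ?x)}}" by blast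
  qed
  then have "K_t n = ideal_gen {\<phi> f | \<phi> f. subst_endo \<phi> \<and> f \<in> {pi_t (sigma (n + 1) ?x)}}"
    unfolding K_t_eq_ideal[OF inf char] by simp
  then show ?thesis unfolding finitely_based_def by (intro exI[of _ "{pi_t (sigma (n + 1) ?x)}"]) simp
qed

theorem lemma3p12:
  fixes n :: nat
  assumes "infinite (UNIV :: 'f::field set)"
    and "n > 1"
  shows "(CHAR('f) = 0 \<longrightarrow>
            K_t n = ideal_gen {pi_t (sigma (n + 1) a) | a. a \<in> (FX :: (word \<Rightarrow>\<^sub>0 'f) set)} \<and>
            finitely_based (K_t n :: 'f sXt set)) \<and>
         (CHAR('f) > 0 \<longrightarrow> \<not> finitely_based (K_t n :: 'f sXt set))"
  using K_t_eq_ideal[OF assms(1)] K_t_finitely_based[OF assms(1)] K_t_not_finitely_based[OF assms(1)]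
  by simp

end
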